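(* Let $n,d\ge1$, let $\Omega\subset\mathbb{R}^n$ be a bounded Lipschitz domain, and let $\boldsymbol{\mathcal{F}}[\mathbf{u}]=\int_\Omega F(x,\mathbf{u},\nabla\mathbf{u})\,dx$ for $\mathbf{u}:\Omega\to\mathbb{R}^d$, where $F:\Omega\times\mathbb{R}^d\times\mathbb{R}^{n\times d}\to[0,\infty)$ is measurable with respect to the first variable and continuous with respect to the second and the third variable. Let $M:\Omega\times\mathbb{R}^{n\times d}\to[0,\infty)$ be a weak $N$-function that is continuous with respect to both variables, such that $M\in\Delta_2$ and $$M(x,\boldsymbol{\xi})=\sum_{i=1}^dM_i(x,\boldsymbol{\xi}^i),\qquad\boldsymbol{\xi}=(\boldsymbol{\xi}^1,\dots,\boldsymbol{\xi}^d)\in\mathbb{R}^{n\times d},\ \boldsymbol{\xi}^i\in\mathbb{R}^n,$$ for some weak $N$-functions $M_i:\Omega\times\mathbb{R}^n\to[0,\infty)$. Suppose there exist constants $0<\nu,\beta<1<L$ such that $$\nu M(x,\beta\boldsymbol{\xi})\le F(x,\mathbf{z},\boldsymbol{\xi})\le L\,(M(x,\boldsymbol{\xi})+1)\qquad\text{for all }x\in\Omega,\ \mathbf{z}\in\mathbb{R}^d,\ \boldsymbol{\xi}\in\mathbb{R}^{n\times d}.$$ Then the following hold. (i) If $\gamma=0$, $\mathbf{u}_0\in V^1L_M(\Omega)$, and $M$ satisfies condition $\mathsf{(B^{gen}_\gamma)}$ (with $\gamma=0$), then $$\inf_{\mathbf{u}\in\mathbf{u}_0+V^1_0L_M(\Omega)}\boldsymbol{\mathcal{F}}[\mathbf{u}]=\inf_{\mathbf{u}\in\mathbf{u}_0+C_c^\infty(\Omega)}\boldsymbol{\mathcal{F}}[\mathbf{u}].$$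 (ii) If $\gamma\in(0,1)$, $\mathbf{u}_0\in V^1L_M(\Omega)\cap C^{0,\gamma}(\Omega)$, and $M$ satisfies condition $\mathsf{(B^{gen}_\gamma)}$, then $$\inf_{\mathbf{u}\in\mathbf{u}_0+(V^1_0L_M(\Omega)\cap C^{0,\gamma}(\Omega))}\boldsymbol{\mathcal{F}}[\mathbf{u}]=\inf_{\mathbf{u}\in\mathbf{u}_0+C_c^\infty(\Omega)}\boldsymbol{\mathcal{F}}[\mathbf{u}].$$ (iii) If $\mathbf{u}_0\in V^1L_M(\Omega)\cap C^{0,1}(\Omega)$, then $$\inf_{\mathbf{u}\in\mathbf{u}_0+(V^1_0L_M(\Omega)\cap C^{0,1}(\Omega))}\boldsymbol{\mathcal{F}}[\mathbf{u}]=\inf_{\mathbf{u}\in\mathbf{u}_0+C_c^\infty(\Omega)}\boldsymbol{\mathcal{F}}[\mathbf{u}].$$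
   Context: Weak $N$-functions. For $\ell\ge1$, a function $N:\Omega\times\mathbb{R}^\ell\to[0,\infty)$ is a weak $N$-function if: (1) it is Carathéodory (measurable in $x$, continuous in $\xi$); (2) $N(x,0)=0$ and $\xi\mapsto N(x,\xi)$ is convex for a.a. $x\in\Omega$; (3) $N(x,\xi)=N(x,-\xi)$ for a.a. $x\in\Omega$ and all $\xi$; (4) there exist convex functions $m_1,m_2:[0,\infty)\to[0,\infty)$ with $m_1(0)=0$, $m_1(s)>0$ for $s>0$, such that $m_1(|\xi|)\le N(x,\xi)\le m_2(|\xi|)$ for a.a. $x\in\Omega$ and all $\xi$. Here $\mathbb{R}^{n\times d}$ is identified with $\mathbb{R}^{nd}$. $M\in\Delta_2$ means: there exist constants $c,C>0$ and a nonnegative integrable $h:\Omega\to\mathbb{R}$ such that for a.e. $x\in\Omega$, $M(x,2\boldsymbol{\xi})\le cM(x,\boldsymbol{\xi})+h(x)$ for all $\boldsymbol{\xi}$ with $|\boldsymbol{\xi}|>C$. For a ball $B\subset\mathbb{R}^n$ and a weak $N$-function $N$: $N_B^-(\xi)=\operatorname{ess\,inf}_{y\in B\cap\Omega}N(y,\xi)$ and $N_B^+(\xi)=\operatorname{ess\,sup}_{y\in B\cap\Omega}N(y,\xi)$. Condition $\mathsf{(B^{gen}_\gamma)}$ for $M$ on $\Omega\times\mathbb{R}^{n\times d}$: $M(x,\boldsymbol{\xi})=\sum_{j=1}^{K}N_j(x,\xi_j)$ for some $K\ge1$, where $\boldsymbol{\xi}=(\xi_1,\dots,\xi_K)$ with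 $\xi_j\in\mathbb{R}^{\ell_j}$, $\mathbb{R}^{\ell_1}\times\dots\times\mathbb{R}^{\ell_K}=\mathbb{R}^{n\times d}$, and $N_j:\Omega\times\mathbb{R}^{\ell_j}\to[0,\infty)$ are weak $N$-functions; and there exist constants $c^\Diamond,C^\Diamond>1$ such that for every ball $B$ with radius $r\le1$, all $j$, and all $\xi_j\in\mathbb{R}^{\ell_j}$ satisfying $(N_j)_B^-(C^\Diamond\xi_j)\le\sup_{|\eta_j|=1}(N_j)_B^-(\eta_jc^\Diamond r^{\gamma-1})$, there holds $(N_j)_B^+(\xi_j)\le(N_j)_B^-(C^\Diamond\xi_j)+1$. Function spaces (of $\mathbb{R}^d$-valued maps; $\nabla\mathbf{u}=(\nabla u^1,\dots,\nabla u^d)$ for $\mathbf{u}=(u^1,\dots,u^d)$). $L_M(\Omega;\mathbb{R}^{n\times d})$ is the smallest linear space containing all measurable $\boldsymbol{\xi}:\Omega\to\mathbb{R}^{n\times d}$ with $\int_\Omega M(x,\boldsymbol{\xi}(x))\,dx<\infty$. $V^1L_M(\Omega)=\{\mathbf{f}\in W^{1,1}(\Omega;\mathbb{R}^d):\nabla\mathbf{f}\in L_M(\Omega;\mathbb{R}^{n\times d})\}$ and $V^1_0L_M(\Omega)=\{\mathbf{f}\in W^{1,1}_0(\Omega;\mathbb{R}^d):\nabla\mathbf{f}\in L_M(\Omega;\mathbb{R}^{n\times d})\}$. $C_c^\infty(\Omega)$ and $C^{0,\gamma}(\Omega)$ denote the corresponding spaces of $\mathbb{R}^d$-valued maps, where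 for $\gamma\in(0,1]$, $\mathbf{h}\in C^{0,\gamma}(\Omega)$ means $\sup_{x\ne y\in\Omega}|\mathbf{h}(x)-\mathbf{h}(y)|/|x-y|^\gamma<\infty$. *)

theory Defs
  imports "HOL-Probability.Essential_Supremum"
begin

text \<open>
  Vectors in the \<open>n\<close>-dimensional space have type \<open>real ^ 'n\<close>.  A matrix
  \<open>\<xi> :: real ^ 'n ^ 'd\<close> consists of the \<open>d\<close> vectors \<open>\<xi> $ i\<close> of \<open>real ^ 'n\<close>, and its norm is
  the Euclidean norm of all \<open>n * d\<close> entries.  Functions on \<open>\<Omega>\<close> are represented by
  total functions of which only the values on \<open>\<Omega>\<close> are relevant.
\<close>

section \<open>Domains\<close>

text \<open>Around each boundary point, \<open>\<Omega>\<close> is the strict epigraph of a Lipschitz function \<open>g\<close>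
  over the hyperplane orthogonal to some unit vector \<open>e\<close>.\<close>

definition lipschitz_boundary :: "'a::euclidean_space set \<Rightarrow> bool" where
  "lipschitz_boundary \<Omega> \<longleftrightarrow>
     (\<forall>p\<in>frontier \<Omega>. \<exists>e r K. \<exists>g :: 'a \<Rightarrow> real. norm e = 1 \<and> r > 0 \<and>
        K-lipschitz_on {y. y \<bullet> e = 0} g \<and>
        (\<forall>x\<in>ball p r. x \<in> \<Omega> \<longleftrightarrow> g (x - (x \<bullet> e) *\<^sub>R e) < x \<bullet> e))"

definition bounded_lipschitz_domain :: "'a::euclidean_space set \<Rightarrow> bool" where
  "bounded_lipschitz_domain \<Omega> \<longleftrightarrow>
     open \<Omega> \<and> connected \<Omega> \<and> \<Omega> \<noteq> {} \<and> bounded \<Omega> \<and> lipschitz_boundary \<Omega>"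


section \<open>Smooth, Hoelder and Sobolev functions\<close>

fun C_k :: "nat \<Rightarrow> ('a::euclidean_space \<Rightarrow> 'b::real_normed_vector) \<Rightarrow> bool" where
  "C_k 0 f \<longleftrightarrow> continuous_on UNIV f"
| "C_k (Suc k) f \<longleftrightarrow> (\<forall>x. f differentiable (at x)) \<and>
     (\<forall>b\<in>Basis. C_k k (\<lambda>x. frechet_derivative f (at x) b))"

definition Cc_infty :: "'a::euclidean_space set \<Rightarrow> ('a \<Rightarrow> 'b::real_normed_vector) set" where
  "Cc_infty \<Omega> = {\<phi>. (\<forall>k. C_k k \<phi>) \<and> compact (closure {x. \<phi> x \<noteq> 0}) \<and>
                     closure {x. \<phi> x \<noteq> 0} \<subseteq> \<Omega>}"

definition Hoelder :: "'a::euclidean_space set \<Rightarrow> real \<Rightarrow> ('a \<Rightarrow> 'b::real_normed_vector) set" where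
  "Hoelder \<Omega> \<gamma> =
     {h. \<exists>H. \<forall>x\<in>\<Omega>. \<forall>y\<in>\<Omega>. x \<noteq> y \<longrightarrow> norm (h x - h y) / norm (x - y) powr \<gamma> \<le> H}"

definition locally_integrable ::
    "'a::euclidean_space set \<Rightarrow> ('a \<Rightarrow> 'b::euclidean_space) \<Rightarrow> bool" where
  "locally_integrable \<Omega> f \<longleftrightarrow> (\<forall>K. compact K \<and> K \<subseteq> \<Omega> \<longrightarrow> integrable (lebesgue_on K) f)"

definition has_weak_grad ::
    "(real ^ 'n) set \<Rightarrow> (real ^ 'n \<Rightarrow> real ^ 'd) \<Rightarrow> (real ^ 'n \<Rightarrow> real ^ 'n ^ 'd) \<Rightarrow> bool" where
  "has_weak_grad \<Omega> u G \<longleftrightarrow> locally_integrable \<Omega> u \<and> locally_integrable \<Omega> G \<and>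
     (\<forall>\<phi> \<in> Cc_infty \<Omega>. \<forall>i j.
        (LINT x|lebesgue_on \<Omega>. u x $ i * frechet_derivative \<phi> (at x) (axis j 1)) =
        - (LINT x|lebesgue_on \<Omega>. G x $ i $ j * (\<phi> x :: real)))"

text \<open>A weak gradient is unique up to null sets; \<open>weak_grad\<close> picks one representative.\<close>

definition weak_grad ::
    "(real ^ 'n) set \<Rightarrow> (real ^ 'n \<Rightarrow> real ^ 'd) \<Rightarrow> real ^ 'n \<Rightarrow> real ^ 'n ^ 'd" where
  "weak_grad \<Omega> u = (SOME G. has_weak_grad \<Omega> u G)"

definition W11 :: "(real ^ 'n) set \<Rightarrow> (real ^ 'n \<Rightarrow> real ^ 'd) set" where
  "W11 \<Omega> = {u. integrable (lebesgue_on \<Omega>) u \<and>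
                 (\<exists>G. has_weak_grad \<Omega> u G \<and> integrable (lebesgue_on \<Omega>) G)}"

definition W11_norm :: "(real ^ 'n) set \<Rightarrow> (real ^ 'n \<Rightarrow> real ^ 'd) \<Rightarrow> real" where
  "W11_norm \<Omega> u =
     (LINT x|lebesgue_on \<Omega>. norm (u x)) + (LINT x|lebesgue_on \<Omega>. norm (weak_grad \<Omega> u x))"

definition W11_0 :: "(real ^ 'n) set \<Rightarrow> (real ^ 'n \<Rightarrow> real ^ 'd) set" where
  "W11_0 \<Omega> = {u \<in> W11 \<Omega>. \<exists>\<phi> :: nat \<Rightarrow> _. (\<forall>k. \<phi> k \<in> Cc_infty \<Omega>) \<and>
                 (\<lambda>k. W11_norm \<Omega> (\<lambda>x. \<phi> k x - u x)) \<longlonglongrightarrow> 0}"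


section \<open>Weak N-functions\<close>

text \<open>The second argument ranges over a linear subspace \<open>V\<close> of a Euclidean space, which plays
  the role of the finite-dimensional space on which the function lives.\<close>

definition weak_N_function ::
    "'a::euclidean_space set \<Rightarrow> 'b::euclidean_space set \<Rightarrow> ('a \<Rightarrow> 'b \<Rightarrow> real) \<Rightarrow> bool" where
  "weak_N_function \<Omega> V N \<longleftrightarrow>
     (\<forall>x\<in>\<Omega>. \<forall>\<xi>\<in>V. 0 \<le> N x \<xi>) \<and>
     (\<forall>\<xi>\<in>V. (\<lambda>x. N x \<xi>) \<in> borel_measurable (lebesgue_on \<Omega>)) \<and>
     (\<forall>x\<in>\<Omega>. continuous_on V (N x)) \<and>
     (AE x in lebesgue_on \<Omega>. N x 0 = 0 \<and> convex_on V (N x)) \<and>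
     (AE x in lebesgue_on \<Omega>. \<forall>\<xi>\<in>V. N x \<xi> = N x (- \<xi>)) \<and>
     (\<exists>m1 m2 :: real \<Rightarrow> real.
        convex_on {0..} m1 \<and> convex_on {0..} m2 \<and>
        (\<forall>s\<ge>0. 0 \<le> m1 s \<and> 0 \<le> m2 s) \<and> m1 0 = 0 \<and> (\<forall>s>0. 0 < m1 s) \<and>
        (AE x in lebesgue_on \<Omega>. \<forall>\<xi>\<in>V. m1 (norm \<xi>) \<le> N x \<xi> \<and> N x \<xi> \<le> m2 (norm \<xi>)))"

definition Delta2 ::
    "'a::euclidean_space set \<Rightarrow> ('a \<Rightarrow> 'b::euclidean_space \<Rightarrow> real) \<Rightarrow> bool" where
  "Delta2 \<Omega> M \<longleftrightarrow> (\<exists>c>0. \<exists>C>0. \<exists>h. integrable (lebesgue_on \<Omega>) h \<and> (\<forall>x\<in>\<Omega>. 0 \<le> h x) \<and>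
     (AE x in lebesgue_on \<Omega>. \<forall>\<xi>. norm \<xi> > C \<longrightarrow> M x (2 *\<^sub>R \<xi>) \<le> c * M x \<xi> + h x))"

text \<open>Essential extrema over \<open>B \<inter> \<Omega>\<close>, with extended real values: if \<open>B \<inter> \<Omega>\<close> is a null set,
  the infimum is \<open>\<infinity>\<close> and the supremum is \<open>-\<infinity>\<close>.\<close>

definition N_sup ::
    "'a::euclidean_space set \<Rightarrow> ('a \<Rightarrow> 'b \<Rightarrow> real) \<Rightarrow> 'a set \<Rightarrow> 'b \<Rightarrow> ereal" where
  "N_sup \<Omega> N B \<xi> = esssup (lebesgue_on (B \<inter> \<Omega>)) (\<lambda>y. ereal (N y \<xi>))"

definition N_inf ::
    "'a::euclidean_space set \<Rightarrow> ('a \<Rightarrow> 'b \<Rightarrow> real) \<Rightarrow> 'a set \<Rightarrow> 'b \<Rightarrow> ereal" where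
  "N_inf \<Omega> N B \<xi> = - esssup (lebesgue_on (B \<inter> \<Omega>)) (\<lambda>y. - ereal (N y \<xi>))"

text \<open>A splitting of the matrix space into a product of \<open>K\<close> lower-dimensional spaces is given
  by distributing the entries over \<open>K\<close> nonempty blocks: \<open>b i k < K\<close> is the block of the
  entry \<open>\<xi> $ i $ k\<close>.  The \<open>j\<close>-th factor is identified with the coordinate subspace
  \<open>block_space b j\<close>, isometrically.\<close>

definition block_space :: "('d \<Rightarrow> 'n \<Rightarrow> nat) \<Rightarrow> nat \<Rightarrow> (real ^ 'n ^ 'd) set" where
  "block_space b j = {\<xi>. \<forall>i k. b i k \<noteq> j \<longrightarrow> \<xi> $ i $ k = 0}"

definition block_part :: "('d \<Rightarrow> 'n \<Rightarrow> nat) \<Rightarrow> nat \<Rightarrow> real ^ 'n ^ 'd \<Rightarrow> real ^ 'n ^ 'd" where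
  "block_part b j \<xi> = (\<chi> i k. if b i k = j then \<xi> $ i $ k else 0)"

definition B_gen ::
    "real \<Rightarrow> (real ^ 'n) set \<Rightarrow> (real ^ 'n \<Rightarrow> real ^ 'n ^ 'd \<Rightarrow> real) \<Rightarrow> bool" where
  "B_gen \<gamma> \<Omega> M \<longleftrightarrow>
     (\<exists>(K::nat) b (N :: nat \<Rightarrow> real ^ 'n \<Rightarrow> real ^ 'n ^ 'd \<Rightarrow> real).
        K \<ge> 1 \<and> {b i k | i k. True} = {..<K} \<and>
        (\<forall>j<K. weak_N_function \<Omega> (block_space b j) (N j)) \<and>
        (\<forall>x\<in>\<Omega>. \<forall>\<xi>. M x \<xi> = (\<Sum>j<K. N j x (block_part b j \<xi>))) \<and>
        (\<exists>c>1. \<exists>C>1. \<forall>p r. 0 < r \<and> r \<le> 1 \<longrightarrow>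
           (\<forall>j<K. \<forall>\<xi>\<in>block_space b j.
              N_inf \<Omega> (N j) (ball p r) (C *\<^sub>R \<xi>)
                \<le> (SUP \<eta>\<in>{\<eta> \<in> block_space b j. norm \<eta> = 1}.
                     N_inf \<Omega> (N j) (ball p r) ((c * r powr (\<gamma> - 1)) *\<^sub>R \<eta>))
              \<longrightarrow> N_sup \<Omega> (N j) (ball p r) \<xi> \<le> N_inf \<Omega> (N j) (ball p r) (C *\<^sub>R \<xi>) + 1)))"


section \<open>Musielak--Orlicz spaces and the functional\<close>

definition linear_fun_space :: "('a \<Rightarrow> 'b::real_vector) set \<Rightarrow> bool" where
  "linear_fun_space S \<longleftrightarrow> (\<lambda>x. 0) \<in> S \<and> (\<forall>f\<in>S. \<forall>g\<in>S. (\<lambda>x. f x + g x) \<in> S) \<and>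
     (\<forall>c. \<forall>f\<in>S. (\<lambda>x. c *\<^sub>R f x) \<in> S)"

definition L_M ::
    "'a::euclidean_space set \<Rightarrow> ('a \<Rightarrow> 'b::euclidean_space \<Rightarrow> real) \<Rightarrow> ('a \<Rightarrow> 'b) set" where
  "L_M \<Omega> M = linear_fun_space hull
     {f \<in> borel_measurable (lebesgue_on \<Omega>). (\<integral>\<^sup>+x. ennreal (M x (f x)) \<partial>lebesgue_on \<Omega>) < \<infinity>}"

definition V1L ::
    "(real ^ 'n) set \<Rightarrow> (real ^ 'n \<Rightarrow> real ^ 'n ^ 'd \<Rightarrow> real) \<Rightarrow> (real ^ 'n \<Rightarrow> real ^ 'd) set" where
  "V1L \<Omega> M = {f \<in> W11 \<Omega>. weak_grad \<Omega> f \<in> L_M \<Omega> M}"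

definition V1L_0 ::
    "(real ^ 'n) set \<Rightarrow> (real ^ 'n \<Rightarrow> real ^ 'n ^ 'd \<Rightarrow> real) \<Rightarrow> (real ^ 'n \<Rightarrow> real ^ 'd) set" where
  "V1L_0 \<Omega> M = {f \<in> W11_0 \<Omega>. weak_grad \<Omega> f \<in> L_M \<Omega> M}"

definition energy ::
    "(real ^ 'n) set \<Rightarrow> (real ^ 'n \<Rightarrow> real ^ 'd \<Rightarrow> real ^ 'n ^ 'd \<Rightarrow> real) \<Rightarrow>
     (real ^ 'n \<Rightarrow> real ^ 'd) \<Rightarrow> ennreal" where
  "energy \<Omega> F u = (\<integral>\<^sup>+x. ennreal (F x (u x) (weak_grad \<Omega> u x)) \<partial>lebesgue_on \<Omega>)"

definition translate ::
    "('a \<Rightarrow> 'b::real_vector) \<Rightarrow> ('a \<Rightarrow> 'b) set \<Rightarrow> ('a \<Rightarrow> 'b) set" where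
  "translate u0 S = {(\<lambda>x. u0 x + v x) | v. v \<in> S}"

end

theory Submission imports Defs begin

text \<open>
  Test functions belong to each of the larger classes of competitors, so one inequality between the
  two infima is monotonicity.  For the other one it suffices to approximate a competitor \<open>u0 + v\<close> by
  \<open>u0 + \<phi>\<close> with test functions \<open>\<phi>\<close> in such a way that the energies converge.  If \<open>\<phi>\<close> tends to \<open>v\<close>
  in \<open>W\<^sup>1\<^sup>,\<^sup>1\<close> and the modular \<open>\<integral> M(x, \<nabla>\<phi> - \<nabla>v)\<close> tends to zero, a subsequence of the functions
  \<open>M(x, \<nabla>\<phi> - \<nabla>v)\<close> has an integrable majorant; by convexity, the doubling condition and the growth
  \<open>F \<le> L(M + 1)\<close> so have the integrands of the energies, and dominated convergence applies
  (\<open>energy_infimum_le\<close>).  The theorem is therefore a statement on density in the sense of the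
  modular, \<open>approximable\<close> below.

  A function of zero trace, extended by zero, is a limit in \<open>W\<^sup>1\<^sup>,\<^sup>1\<close> of smooth functions on the whole
  space, and truncating its components only deletes rows of the gradient.  As \<open>M\<close> is a sum over the
  rows, such truncations converge in the modular.  Truncating at large heights reduces the case
  \<open>\<gamma> = 0\<close> to bounded functions (\<open>admissible_approximable\<close>).  For \<open>\<gamma> > 0\<close> the small values are cut off
  instead; since a Hoelder continuous function of zero trace vanishes at the boundary of a Lipschitz
  domain (\<open>compact_superlevel\<close>), the support becomes compact (\<open>hoelder_approximable\<close>).  What remains
  is mollified.  A bounded function is first split by cutoff functions into pieces that can be moved
  into the domain along a direction transversal to the boundary.

  The mollified gradient on the scale \<open>\<epsilon>\<close> is of order \<open>\<epsilon>\<^sup>\<gamma>\<^sup>-\<^sup>1\<close>, by boundedness or by Hoelder continuity.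
  In this range the balance condition compares the values of \<open>M\<close> at the points of a ball of radius
  proportional to \<open>\<epsilon>\<close>.  The infimum of \<open>M\<close> over such a ball need not be convex, so Jensen's inequality
  cannot be applied to it.  Instead, a tangent plane of \<open>M x\<close> at a single point \<open>x\<close> is used:
  by the balance condition in the admissible range, and by convexity along rays beyond it, the plane
  lies below a fixed multiple of \<open>M z (C \<xi>)\<close>, up to an additive constant, for all \<open>z\<close> in the ball
  (\<open>affine_minorant\<close>), and affine functions commute with averaging (\<open>averaged_minorant\<close>).  This bounds
  \<open>M\<close> at a fixed fraction of the mollified gradient by the mollification of an integrable function (\<open>mollified_bound\<close>),
  and such mollifications have integrable majorants along suitable sequences of radii
  (\<open>moll_approximable\<close>).  For \<open>\<gamma> = 1\<close> the mollified gradients are bounded, hence \<open>M\<close> is bounded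
  along them.

  Continuity of \<open>M\<close> in the space variable turns properties that hold almost everywhere into
  properties at every point, and essential extrema over balls into extrema.
\<close>

section \<open>Smooth functions\<close>

definition smooth :: "('a::euclidean_space \<Rightarrow> 'b::real_normed_vector) \<Rightarrow> bool" where
  "smooth f \<longleftrightarrow> (\<forall>k. C_k k f)"

lemma smoothD:
  assumes "smooth f"
  shows "f differentiable (at x)" "b \<in> Basis \<Longrightarrow> smooth (\<lambda>x. frechet_derivative f (at x) b)"
  using assms unfolding smooth_def by (metis C_k.simps(2))+

lemma smooth_continuous: "smooth f \<Longrightarrow> continuous_on UNIV f"
  unfolding smooth_def by (metis C_k.simps(1))

text \<open>Closure of \<open>S\<close> under partial derivatives keeps an induction on \<open>k\<close> within \<open>S\<close>.  In this way a whole
  family of functions is seen to be smooth from its first derivatives alone.\<close>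

lemma C_k_coinduct:
  assumes "\<And>f. f \<in> S \<Longrightarrow> (\<forall>x. f differentiable (at x)) \<and>
      (\<forall>b\<in>Basis. (\<lambda>x. frechet_derivative f (at x) b) \<in> S)"
    and "f \<in> S"
  shows "C_k k f"
  using assms(2)
proof (induction k arbitrary: f)
  case 0
  then show ?case
    using assms(1) by (auto intro!: continuous_at_imp_continuous_on differentiable_imp_continuous_within)
next
  case (Suc k)
  then show ?case using assms(1) by auto
qed

lemma smooth_coinduct:
  assumes "\<And>f. f \<in> S \<Longrightarrow> (\<forall>x. f differentiable (at x)) \<and>
      (\<forall>b\<in>Basis. (\<lambda>x. frechet_derivative f (at x) b) \<in> S)"
    and "f \<in> S"
  shows "smooth f"
  using C_k_coinduct[OF assms] by (simp add: smooth_def)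

lemma frechet_derivativeI: "(f has_derivative f') (at x) \<Longrightarrow> frechet_derivative f (at x) = f'"
  using frechet_derivative_at by metis

lemma frechet_works: "f differentiable (at x) \<Longrightarrow> (f has_derivative frechet_derivative f (at x)) (at x)"
  by (simp add: frechet_derivative_works)

lemma C_k_add: "C_k k f \<Longrightarrow> C_k k g \<Longrightarrow> C_k k (\<lambda>x. f x + g x)"
proof (induction k arbitrary: f g)
  case 0
  then show ?case by (auto intro: continuous_on_add)
next
  case (Suc k)
  have d: "((\<lambda>x. f x + g x) has_derivative
      (\<lambda>h. frechet_derivative f (at x) h + frechet_derivative g (at x) h)) (at x)" for x
    using Suc.prems by (intro has_derivative_add frechet_works) simp_all
  show ?case
    using Suc d by (auto simp: frechet_derivativeI[OF d] differentiable_def)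
qed

lemma C_k_bounded_linear: "bounded_linear h \<Longrightarrow> C_k k f \<Longrightarrow> C_k k (\<lambda>x. h (f x))"
proof (induction k arbitrary: f)
  case 0
  then show ?case using bounded_linear.continuous_on[OF 0(1), of UNIV f] by simp
next
  case (Suc k)
  have d: "((\<lambda>x. h (f x)) has_derivative
      (\<lambda>v. h (frechet_derivative f (at x) v))) (at x)" for x
    using Suc.prems by (intro bounded_linear.has_derivative[OF Suc.prems(1)] frechet_works) simp
  show ?case
    using Suc d by (auto simp: frechet_derivativeI[OF d] differentiable_def)
qed

lemma smooth_add: "smooth f \<Longrightarrow> smooth g \<Longrightarrow> smooth (\<lambda>x. f x + g x)"
  by (simp add: smooth_def C_k_add)

lemma smooth_bounded_linear: "bounded_linear h \<Longrightarrow> smooth f \<Longrightarrow> smooth (\<lambda>x. h (f x))"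
  by (simp add: smooth_def C_k_bounded_linear)

lemma smooth_zero: "smooth (\<lambda>x. 0)"
  by (rule smooth_coinduct[of "{\<lambda>x. 0}"]) (auto simp: frechet_derivative_const)

lemma C_k_affine: "C_k k f \<Longrightarrow> C_k k (\<lambda>x. f (a + c *\<^sub>R x))"
proof (induction k arbitrary: f)
  case 0
  then show ?case by (auto intro!: continuous_on_compose2[of UNIV f] continuous_intros)
next
  case (Suc k)
  have d: "((\<lambda>x. f (a + c *\<^sub>R x)) has_derivative
      (\<lambda>v. c *\<^sub>R frechet_derivative f (at (a + c *\<^sub>R x)) v)) (at x)" for x
  proof -
    have 1: "(f has_derivative frechet_derivative f (at (a + c *\<^sub>R x))) (at (a + c *\<^sub>R x))"
      using Suc.prems by (auto intro!: frechet_works)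
    have 2: "((\<lambda>x. a + c *\<^sub>R x) has_derivative (\<lambda>v. c *\<^sub>R v)) (at x)"
      by (auto intro!: derivative_eq_intros)
    show ?thesis
      using has_derivative_compose[OF 2 1]
      by (simp add: linear_simps bounded_linear.linear has_derivative_bounded_linear[OF 1])
  qed
  have "C_k k (\<lambda>x. c *\<^sub>R frechet_derivative f (at (a + c *\<^sub>R x)) b)" if "b \<in> Basis" for b
    using that Suc.prems Suc.IH[of "\<lambda>x. frechet_derivative f (at x) b"]
    by (intro C_k_bounded_linear[OF bounded_linear_scaleR_right]) auto
  then show ?case
    using d by (auto simp: frechet_derivativeI[OF d] differentiable_def)
qed

lemma smooth_affine: "smooth f \<Longrightarrow> smooth (\<lambda>x. f (a + c *\<^sub>R x))"
  by (simp add: smooth_def C_k_affine)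

subsection \<open>A smooth bump function\<close>

text \<open>The derivatives of \<open>exp (- 1 / t)\<close> are linear combinations of these functions, which are continued
  by \<open>0\<close> to \<open>t \<le> 0\<close>.\<close>

definition expi :: "nat \<Rightarrow> real \<Rightarrow> real" where
  "expi k t = (if t > 0 then exp (- 1 / t) / t ^ k else 0)"

lemma expi_tendsto_0: "(expi k \<longlongrightarrow> 0) (at_right 0)"
proof -
  have "((\<lambda>t::real. (inverse t) ^ k / exp (inverse t)) \<longlongrightarrow> 0) (at_right 0)"
    using filterlim_compose[OF tendsto_power_div_exp_0 filterlim_inverse_at_top_right] .
  then show ?thesis
  proof (rule Lim_transform_eventually)
    show "\<forall>\<^sub>F t in at_right 0. (inverse t) ^ k / exp (inverse t) = expi k t"
      by (auto simp: eventually_at_right_field expi_def exp_minus field_simps intro!: exI[of _ 1])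
  qed
qed

lemma expi_deriv: "(expi k has_real_derivative (expi (k + 2) t - k * expi (k + 1) t)) (at t)"
proof (cases t "0::real" rule: linorder_cases)
  case greater
  have "((\<lambda>t. exp (- 1 / t) / t ^ k) has_real_derivative (expi (k + 2) t - k * expi (k + 1) t)) (at t)"
  proof -
    have "((\<lambda>t. exp (- 1 / t)) has_real_derivative exp (- 1 / t) * (1 / t\<^sup>2)) (at t)"
      using greater by (auto intro!: derivative_eq_intros simp: field_simps power2_eq_square)
    moreover have "((\<lambda>t. t ^ k) has_real_derivative k * t ^ (k - 1)) (at t)"
      using DERIV_pow[of k t] by simp
    ultimately have "((\<lambda>t. exp (- 1 / t) / t ^ k) has_real_derivative
        (exp (- 1 / t) * (1 / t\<^sup>2) * t ^ k - exp (- 1 / t) * (k * t ^ (k - 1))) / (t ^ k * t ^ k)) (at t)"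
      using greater by (intro DERIV_divide) auto
    also have "(exp (- 1 / t) * (1 / t\<^sup>2) * t ^ k - exp (- 1 / t) * (k * t ^ (k - 1))) / (t ^ k * t ^ k)
        = expi (k + 2) t - k * expi (k + 1) t"
      using greater by (cases k) (simp_all add: expi_def divide_simps power2_eq_square algebra_simps)
    finally show ?thesis .
  qed
  then show ?thesis
    by (rule has_field_derivative_transform_within_open[of _ _ _ "{0<..}"])
      (use greater in \<open>auto simp: expi_def\<close>)
next
  case less
  have "((\<lambda>_. 0) has_real_derivative (expi (k + 2) t - k * expi (k + 1) t)) (at t)"
    using less by (simp add: expi_def)
  then show ?thesis
    by (rule has_field_derivative_transform_within_open[of _ _ _ "{..<0}"])
      (use less in \<open>auto simp: expi_def\<close>)
next
  case equal
  have "((\<lambda>h. (expi k (0 + h) - expi k 0) / h) \<longlongrightarrow> 0) (at_right 0)"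
    by (rule Lim_transform_eventually[OF expi_tendsto_0[of "Suc k"]])
      (auto simp: eventually_at_right_field expi_def intro!: exI[of _ 1])
  moreover have "((\<lambda>h. (expi k (0 + h) - expi k 0) / h) \<longlongrightarrow> 0) (at_left 0)"
    by (rule Lim_transform_eventually[OF tendsto_const])
      (auto simp: eventually_at_left_field expi_def intro!: exI[of _ "-1"])
  ultimately have "((\<lambda>h. (expi k (0 + h) - expi k 0) / h) \<longlongrightarrow> 0) (at 0)"
    using filterlim_split_at by blast
  then show ?thesis using equal by (simp add: DERIV_def expi_def)
qed

text \<open>An algebra of functions that contains the bump function and is closed under partial derivatives,
  as \<open>smooth_coinduct\<close> requires.\<close>

inductive_set bump_algebra :: "('a::euclidean_space \<Rightarrow> real) set" where
  const: "(\<lambda>x. c) \<in> bump_algebra"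
| coord: "(\<lambda>x. x \<bullet> b) \<in> bump_algebra"
| expi: "(\<lambda>x. expi k (1 - x \<bullet> x)) \<in> bump_algebra"
| add: "f \<in> bump_algebra \<Longrightarrow> g \<in> bump_algebra \<Longrightarrow> (\<lambda>x. f x + g x) \<in> bump_algebra"
| mult: "f \<in> bump_algebra \<Longrightarrow> g \<in> bump_algebra \<Longrightarrow> (\<lambda>x. f x * g x) \<in> bump_algebra"

lemma bump_algebra_smooth: "f \<in> bump_algebra \<Longrightarrow> smooth f"
proof (rule smooth_coinduct[of bump_algebra])
  fix f :: "'a \<Rightarrow> real" assume "f \<in> bump_algebra"
  then have "\<exists>D. (\<forall>x. (f has_derivative D x) (at x)) \<and> (\<forall>b\<in>Basis. (\<lambda>x. D x b) \<in> bump_algebra)"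
  proof (induction)
    case (const c)
    then show ?case by (intro exI[of _ "\<lambda>x h. 0"]) (auto intro: bump_algebra.const)
  next
    case (coord b)
    then show ?case
      by (intro exI[of _ "\<lambda>x h. h \<bullet> b"]) (auto intro: bump_algebra.const intro!: derivative_eq_intros)
  next
    case (expi k)
    define e where "e x = expi (k + 2) (1 - x \<bullet> x) - k * expi (k + 1) (1 - x \<bullet> x)" for x :: 'a
    have "((\<lambda>x. expi k (1 - x \<bullet> x)) has_derivative (\<lambda>h. e x * (- 2) * (x \<bullet> h))) (at x)" for x :: 'a
    proof -
      have 1: "((\<lambda>x. 1 - x \<bullet> x) has_derivative (\<lambda>h. - 2 * (x \<bullet> h))) (at x)"
        by (auto intro!: derivative_eq_intros simp: inner_commute)
      have 2: "(expi k has_derivative (\<lambda>h. h * e x)) (at (1 - x \<bullet> x))"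
        using expi_deriv[of k "1 - x \<bullet> x"] unfolding e_def has_field_derivative_def by (simp add: mult_commute_abs)
      show ?thesis using has_derivative_compose[OF 1 2] by (simp add: mult_ac)
    qed
    moreover have "(\<lambda>x. e x * (- 2) * (x \<bullet> b)) \<in> bump_algebra" for b
    proof -
      have "(\<lambda>x. ((expi (k + 2) (1 - x \<bullet> x) + (- real k) * expi (k + 1) (1 - x \<bullet> x)) * (- 2)) * (x \<bullet> b)) \<in> bump_algebra"
        by (intro bump_algebra.intros)
      then show ?thesis by (simp add: e_def)
    qed
    ultimately show ?case
      by (intro exI[of _ "\<lambda>x h. e x * (- 2) * (x \<bullet> h)"]) auto
  next
    case (add f g)
    then obtain D E where "\<forall>x. (f has_derivative D x) (at x)" "\<forall>b\<in>Basis. (\<lambda>x. D x b) \<in> bump_algebra"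
      "\<forall>x. (g has_derivative E x) (at x)" "\<forall>b\<in>Basis. (\<lambda>x. E x b) \<in> bump_algebra" by blast
    then show ?case
      by (intro exI[of _ "\<lambda>x h. D x h + E x h"]) (auto intro!: has_derivative_add bump_algebra.add)
  next
    case (mult f g)
    then obtain D E where "\<forall>x. (f has_derivative D x) (at x)" "\<forall>b\<in>Basis. (\<lambda>x. D x b) \<in> bump_algebra"
      "\<forall>x. (g has_derivative E x) (at x)" "\<forall>b\<in>Basis. (\<lambda>x. E x b) \<in> bump_algebra" by blast
    then show ?case using mult
      by (intro exI[of _ "\<lambda>x h. f x * E x h + D x h * g x"])
        (auto intro!: has_derivative_mult bump_algebra.add bump_algebra.mult)
  qed
  then obtain D where D: "\<And>x. (f has_derivative D x) (at x)" "\<forall>b\<in>Basis. (\<lambda>x. D x b) \<in> bump_algebra"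
    by blast
  have "frechet_derivative f (at x) = D x" for x
    by (rule frechet_derivativeI[OF D(1)])
  then show "(\<forall>x. f differentiable (at x)) \<and> (\<forall>b\<in>Basis. (\<lambda>x. frechet_derivative f (at x) b) \<in> bump_algebra)"
    using D by (auto simp: differentiable_def)
qed

definition bump :: "'a::euclidean_space \<Rightarrow> real" where
  "bump x = expi 0 (1 - x \<bullet> x)"

lemma smooth_bump: "smooth bump"
  using bump_algebra_smooth[OF bump_algebra.expi[of 0]] by (simp add: bump_def[abs_def])

lemma bump_nonneg: "bump x \<ge> 0" and bump_pos: "norm x < 1 \<Longrightarrow> bump x > 0"
  and bump_outside: "norm x \<ge> 1 \<Longrightarrow> bump x = 0"
  by (auto simp: bump_def expi_def power2_norm_eq_inner[symmetric] abs_square_less_1 not_less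
      dest: power_less_one_iff)

subsection \<open>Continuously differentiable functions of compact support\<close>

text \<open>The gradient is carried along as an argument.  This allows to treat pairs of a function and its
  gradient as elements of one space and to pass to limits in both components.\<close>

definition C1c :: "('a::euclidean_space \<Rightarrow> real) \<Rightarrow> ('a \<Rightarrow> 'a) \<Rightarrow> bool" where
  "C1c \<phi> d\<phi> \<longleftrightarrow> (\<forall>x. (\<phi> has_derivative (\<lambda>h. d\<phi> x \<bullet> h)) (at x)) \<and> continuous_on UNIV d\<phi> \<and>
     (\<exists>R. \<forall>x. norm x \<ge> R \<longrightarrow> \<phi> x = 0 \<and> d\<phi> x = 0)"

definition gr :: "('a::euclidean_space \<Rightarrow> real) \<Rightarrow> 'a \<Rightarrow> 'a" where
  "gr \<phi> x = (\<Sum>b\<in>Basis. frechet_derivative \<phi> (at x) b *\<^sub>R b)"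

lemma gr_eq: "\<phi> differentiable (at x) \<Longrightarrow> frechet_derivative \<phi> (at x) h = gr \<phi> x \<bullet> h"
proof -
  assume "\<phi> differentiable (at x)"
  then have l: "linear (frechet_derivative \<phi> (at x))"
    using linear_frechet_derivative by blast
  have "frechet_derivative \<phi> (at x) h = frechet_derivative \<phi> (at x) (\<Sum>b\<in>Basis. (h \<bullet> b) *\<^sub>R b)"
    by (simp add: euclidean_representation)
  also have "\<dots> = (\<Sum>b\<in>Basis. (h \<bullet> b) * frechet_derivative \<phi> (at x) b)"
    by (simp add: linear_sum[OF l] linear_scale[OF l])
  also have "\<dots> = gr \<phi> x \<bullet> h"
    by (simp add: gr_def inner_sum_left mult.commute inner_commute[of h])
  finally show ?thesis .
qed

lemma gr_inner: "b \<in> Basis \<Longrightarrow> gr \<phi> x \<bullet> b = frechet_derivative \<phi> (at x) b"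
  by (simp add: gr_def inner_sum_left inner_Basis if_distrib cong: if_cong)

lemma C1c_derivD: "C1c \<phi> d\<phi> \<Longrightarrow> (\<phi> has_derivative (\<lambda>h. d\<phi> x \<bullet> h)) (at x)"
  by (simp add: C1c_def)

lemma C1c_continuous: "C1c \<phi> d\<phi> \<Longrightarrow> continuous_on UNIV \<phi>" "C1c \<phi> d\<phi> \<Longrightarrow> continuous_on UNIV d\<phi>"
  using has_derivative_continuous[OF C1c_derivD]
  by (blast intro: continuous_at_imp_continuous_on, simp add: C1c_def)

lemma frechet_derivative_zero_outside:
  assumes "\<And>y. y \<in> U \<Longrightarrow> f y = 0" "open U" "x \<in> U"
  shows "frechet_derivative f (at x) h = 0"
proof -
  have "(f has_derivative (\<lambda>h. 0)) (at x)"
    by (rule has_derivative_transform_within_open[of "\<lambda>_. 0"]) (use assms in auto)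
  then show ?thesis using frechet_derivativeI by metis
qed

lemma compact_support_bound:
  fixes f :: "'a::euclidean_space \<Rightarrow> 'b::real_normed_vector"
  assumes "continuous_on UNIV f" "\<And>x. norm x \<ge> R \<Longrightarrow> f x = 0"
  obtains B where "B > 0" "\<And>x. norm (f x) \<le> B"
proof -
  have "compact (f ` cball 0 R)"
    using assms by (intro compact_continuous_image) (auto intro: continuous_on_subset)
  then obtain B where B: "B > 0" "\<forall>y\<in>f ` cball 0 R. norm y \<le> B"
    using compact_imp_bounded bounded_pos by blast
  have "norm (f x) \<le> B" for x
    using B assms(2)[of x] by (cases "norm x \<ge> R") auto
  then show ?thesis using that B by blast
qed

lemma compact_support_uniform:
  fixes f :: "'a::euclidean_space \<Rightarrow> 'b::real_normed_vector"
  assumes "continuous_on UNIV f" "\<And>x. norm x \<ge> R \<Longrightarrow> f x = 0" "e > 0"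
  obtains d where "d > 0" "\<And>x y. norm (x - y) < d \<Longrightarrow> norm (f x - f y) < e"
proof -
  have "uniformly_continuous_on (cball 0 (R + 1)) f"
    using assms by (intro compact_uniformly_continuous) (auto intro: continuous_on_subset)
  then obtain d where d: "d > 0" "\<And>x y. x \<in> cball 0 (R+1) \<Longrightarrow> y \<in> cball 0 (R+1) \<Longrightarrow> dist y x < d \<Longrightarrow> dist (f y) (f x) < e"
    unfolding uniformly_continuous_on_def using \<open>e > 0\<close> by metis
  have "norm (f x - f y) < e" if "norm (x - y) < min d 1" for x y
  proof (cases "norm x \<le> R + 1 \<and> norm y \<le> R + 1")
    case True
    then show ?thesis using d(2)[of y x] that by (auto simp: dist_norm)
  next
    case False
    then have "norm x \<ge> R \<and> norm y \<ge> R"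
      using that norm_triangle_ineq2[of x y] norm_triangle_ineq2[of y x] norm_minus_commute[of x y]
      by auto
    then show ?thesis using assms by auto
  qed
  then show ?thesis using that[of "min d 1"] d by auto
qed

lemma smooth_C1c:
  assumes "smooth \<phi>" "\<And>x. norm x \<ge> R \<Longrightarrow> \<phi> x = 0"
  shows "C1c \<phi> (gr \<phi>)"
  unfolding C1c_def
proof (intro conjI allI exI[of _ "R + 1"] impI)
  fix x
  show "(\<phi> has_derivative (\<bullet>) (gr \<phi> x)) (at x)"
    by (rule has_derivative_eq_rhs[OF frechet_works[OF smoothD(1)[OF assms(1)]]])
      (auto simp: fun_eq_iff gr_eq[OF smoothD(1)[OF assms(1)]])
  show "continuous_on UNIV (gr \<phi>)"
    unfolding gr_def[abs_def]
    by (intro continuous_intros smooth_continuous smoothD assms) auto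
  assume "R + 1 \<le> norm x"
  then show "\<phi> x = 0" using assms by simp
  have "frechet_derivative \<phi> (at x) b = 0" for b
  proof (rule frechet_derivative_zero_outside)
    show "open (- cball (0::'a) R)" "x \<in> - cball 0 R" using \<open>R + 1 \<le> norm x\<close> by auto
  qed (use assms in auto)
  then show "gr \<phi> x = 0" by (simp add: gr_def)
qed

lemma C1c_mult:
  assumes "C1c f df" "C1c g dg"
  shows "C1c (\<lambda>x. f x * g x) (\<lambda>x. f x *\<^sub>R dg x + g x *\<^sub>R df x)"
  unfolding C1c_def
proof (intro conjI allI)
  fix x
  show "((\<lambda>x. f x * g x) has_derivative (\<bullet>) (f x *\<^sub>R dg x + g x *\<^sub>R df x)) (at x)"
    by (rule has_derivative_eq_rhs[OF has_derivative_mult[OF C1c_derivD[OF assms(1)] C1c_derivD[OF assms(2)]]])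
      (auto simp: fun_eq_iff inner_add_left mult_ac)
  show "continuous_on UNIV (\<lambda>x. f x *\<^sub>R dg x + g x *\<^sub>R df x)"
    by (intro continuous_intros C1c_continuous[OF assms(1)] C1c_continuous[OF assms(2)])
  obtain R where "\<forall>x. norm x \<ge> R \<longrightarrow> f x = 0 \<and> df x = 0" using assms by (auto simp: C1c_def)
  then show "\<exists>R. \<forall>x. R \<le> norm x \<longrightarrow> f x * g x = 0 \<and> f x *\<^sub>R dg x + g x *\<^sub>R df x = 0"
    by (intro exI[of _ R]) auto
qed

lemma C1c_compose:
  assumes "C1c f df" and T: "\<And>s. (T has_real_derivative T' s) (at s)" "continuous_on UNIV T'" "T 0 = 0"
  shows "C1c (\<lambda>x. T (f x)) (\<lambda>x. T' (f x) *\<^sub>R df x)"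
  unfolding C1c_def
proof (intro conjI allI)
  fix x
  have "(T has_derivative (\<lambda>h. h * T' (f x))) (at (f x))"
    using T(1)[of "f x"] by (simp add: has_field_derivative_def mult_commute_abs)
  then show "((\<lambda>x. T (f x)) has_derivative (\<bullet>) (T' (f x) *\<^sub>R df x)) (at x)"
    by (rule has_derivative_eq_rhs[OF has_derivative_compose[OF C1c_derivD[OF assms(1)]]])
      (auto simp: fun_eq_iff mult_ac)
  show "continuous_on UNIV (\<lambda>x. T' (f x) *\<^sub>R df x)"
    by (intro continuous_intros C1c_continuous[OF assms(1)] continuous_on_compose2[OF T(2)]) auto
  obtain R where "\<forall>x. norm x \<ge> R \<longrightarrow> f x = 0 \<and> df x = 0" using assms by (auto simp: C1c_def)
  then show "\<exists>R. \<forall>x. R \<le> norm x \<longrightarrow> T (f x) = 0 \<and> T' (f x) *\<^sub>R df x = 0"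
    using T(3) by (intro exI[of _ R]) auto
qed

lemma C1c_reflect:
  assumes "C1c f df"
  shows "C1c (\<lambda>y. f (x - y)) (\<lambda>y. - df (x - y))"
  unfolding C1c_def
proof (intro conjI allI)
  fix y
  have "((\<lambda>y. x - y) has_derivative (\<lambda>h. - h)) (at y)" by (auto intro!: derivative_eq_intros)
  then show "((\<lambda>y. f (x - y)) has_derivative (\<bullet>) (- df (x - y))) (at y)"
    by (rule has_derivative_eq_rhs[OF has_derivative_compose[OF _ C1c_derivD[OF assms(1)]]])
      (auto simp: fun_eq_iff)
  show "continuous_on UNIV (\<lambda>y. - df (x - y))"
    by (intro continuous_intros continuous_on_compose2[OF C1c_continuous(2)[OF assms]]) auto
  obtain R where R: "\<forall>x. norm x \<ge> R \<longrightarrow> f x = 0 \<and> df x = 0" using assms by (auto simp: C1c_def)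
  have "R \<le> norm (x - y)" if "R + norm x \<le> norm y" for y
    using that norm_triangle_ineq2[of y x] by (simp add: norm_minus_commute)
  then show "\<exists>R. \<forall>y. R \<le> norm y \<longrightarrow> f (x - y) = 0 \<and> - df (x - y) = 0"
    using R by (intro exI[of _ "R + norm x"]) auto
qed

lemma C1c_uminus: "C1c f df \<Longrightarrow> C1c (\<lambda>x. - f x) (\<lambda>x. - df x)"
  using C1c_compose[of f df uminus "\<lambda>_. -1", OF _ DERIV_minus[OF DERIV_ident]] by simp

lemma C1c_add:
  assumes "C1c f df" "C1c g dg"
  shows "C1c (\<lambda>x. f x + g x) (\<lambda>x. df x + dg x)"
  unfolding C1c_def
proof (intro conjI allI)
  fix x
  show "((\<lambda>x. f x + g x) has_derivative (\<bullet>) (df x + dg x)) (at x)"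
    by (rule has_derivative_eq_rhs[OF has_derivative_add[OF C1c_derivD[OF assms(1)] C1c_derivD[OF assms(2)]]])
      (auto simp: fun_eq_iff inner_add_left)
  show "continuous_on UNIV (\<lambda>x. df x + dg x)"
    by (intro continuous_intros C1c_continuous[OF assms(1)] C1c_continuous[OF assms(2)])
  obtain R S where "\<forall>x. norm x \<ge> R \<longrightarrow> f x = 0 \<and> df x = 0" "\<forall>x. norm x \<ge> S \<longrightarrow> g x = 0 \<and> dg x = 0"
    using assms by (auto simp: C1c_def)
  then show "\<exists>R. \<forall>x. R \<le> norm x \<longrightarrow> f x + g x = 0 \<and> df x + dg x = 0"
    by (intro exI[of _ "max R S"]) auto
qed

section \<open>Integration over the whole space\<close>

lemma ennreal_add_strict_mono:
  fixes a b c d :: ennreal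
  shows "a < c \<Longrightarrow> b < d \<Longrightarrow> a + b < c + d"
  by (cases a; cases b; cases c; cases d)
     (auto simp: ennreal_less_iff ennreal_less_top simp flip: ennreal_plus)

text \<open>The sum of all \<open>f k\<close> is integrable, so it is a common majorant, and its terms tend to zero wherever
  it is finite.  Small integrals are used in this form throughout: it feeds dominated convergence.\<close>

lemma fast_convergence:
  fixes f :: "nat \<Rightarrow> 'a \<Rightarrow> real"
  assumes [measurable]: "\<And>k. f k \<in> borel_measurable M" and "\<And>k x. 0 \<le> f k x"
    and small: "\<And>k. (\<integral>\<^sup>+x. f k x \<partial>M) \<le> ennreal ((1/2) ^ k)"
  obtains S where "S \<in> borel_measurable M" "\<And>x. 0 \<le> S x" "(\<integral>\<^sup>+x. ennreal (S x) \<partial>M) < \<infinity>"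
    "AE x in M. (\<forall>k. f k x \<le> S x) \<and> (\<lambda>k. f k x) \<longlonglongrightarrow> 0"
proof -
  define S where "S x = enn2real (\<Sum>k. ennreal (f k x))" for x
  have "(\<integral>\<^sup>+x. (\<Sum>k. ennreal (f k x)) \<partial>M) = (\<Sum>k. \<integral>\<^sup>+x. ennreal (f k x) \<partial>M)"
    by (intro nn_integral_suminf) auto
  also have "\<dots> \<le> (\<Sum>k. ennreal ((1/2) ^ k))"
    by (intro suminf_le small) auto
  also have "\<dots> = ennreal (\<Sum>k. (1/2) ^ k)"
    by (intro suminf_ennreal2) (auto intro: summable_geometric)
  finally have fin: "(\<integral>\<^sup>+x. (\<Sum>k. ennreal (f k x)) \<partial>M) < \<infinity>"
    using order_le_less_trans by force
  then have ae: "AE x in M. (\<Sum>k. ennreal (f k x)) \<noteq> \<infinity>"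
    by (intro nn_integral_PInf_AE) auto
  have "(\<integral>\<^sup>+x. ennreal (S x) \<partial>M) = (\<integral>\<^sup>+x. (\<Sum>k. ennreal (f k x)) \<partial>M)"
    using ae by (intro nn_integral_cong_AE) (auto simp: S_def less_top)
  moreover have "AE x in M. (\<forall>k. f k x \<le> S x) \<and> (\<lambda>k. f k x) \<longlonglongrightarrow> 0"
    using ae
  proof eventually_elim
    case (elim x)
    then have sm: "summable (\<lambda>k. f k x)"
      using assms(2) by (intro summable_suminf_not_top) auto
    then have "S x = (\<Sum>k. f k x)"
      unfolding S_def using assms(2) by (simp add: suminf_ennreal2 suminf_nonneg)
    then show ?case
      using sm assms(2) sum_le_suminf[OF sm, of "{k}" for k] by (auto intro: summable_LIMSEQ_zero)
  qed
  moreover have "S \<in> borel_measurable M" unfolding S_def by measurable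
  ultimately show ?thesis using that[of S] fin by (auto simp: S_def)
qed

lemma nn_integral_affine:
  fixes f :: "'a::euclidean_space \<Rightarrow> ennreal"
  assumes [measurable]: "f \<in> borel_measurable borel" and "c \<noteq> 0"
  shows "(\<integral>\<^sup>+x. f x \<partial>lborel) = ennreal (\<bar>c\<bar> ^ DIM('a)) * (\<integral>\<^sup>+x. f (t + c *\<^sub>R x) \<partial>lborel)"
  by (subst lborel_affine[OF \<open>c \<noteq> 0\<close>, of t])
     (simp add: nn_integral_density nn_integral_distr nn_integral_cmult)

lemma integral_affine:
  fixes f :: "'a::euclidean_space \<Rightarrow> 'b::{banach, second_countable_topology}"
  assumes [measurable]: "f \<in> borel_measurable borel" and "c \<noteq> 0"
  shows "(\<integral>x. f x \<partial>lborel) = \<bar>c\<bar> ^ DIM('a) *\<^sub>R (\<integral>x. f (t + c *\<^sub>R x) \<partial>lborel)"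
  by (subst lborel_affine[OF \<open>c \<noteq> 0\<close>, of t])
     (simp add: integral_density integral_distr)

lemma integrable_affine:
  fixes f :: "'a::euclidean_space \<Rightarrow> 'b::{banach, second_countable_topology}"
  assumes f: "integrable lborel f" and "c \<noteq> 0"
  shows "integrable lborel (\<lambda>x. f (t + c *\<^sub>R x))"
proof -
  have [measurable]: "f \<in> borel_measurable borel" using f by auto
  have "(\<integral>\<^sup>+x. ennreal (norm (f x)) \<partial>lborel) = ennreal (\<bar>c\<bar> ^ DIM('a)) * (\<integral>\<^sup>+x. norm (f (t + c *\<^sub>R x)) \<partial>lborel)"
    by (rule nn_integral_affine) (use \<open>c \<noteq> 0\<close> in auto)
  moreover have "(\<integral>\<^sup>+x. ennreal (norm (f x)) \<partial>lborel) < \<infinity>"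
    using f by (simp add: integrable_iff_bounded)
  ultimately show ?thesis
    using \<open>c \<noteq> 0\<close> by (auto simp: integrable_iff_bounded ennreal_mult_less_top)
qed

lemma integrable_reflect:
  fixes f :: "'a::euclidean_space \<Rightarrow> 'b::{banach, second_countable_topology}"
  shows "integrable lborel f \<Longrightarrow> integrable lborel (\<lambda>y. f (x - y))"
  using integrable_affine[of f "-1" x] by simp

lemma integral_reflect:
  fixes f :: "'a::euclidean_space \<Rightarrow> 'b::{banach, second_countable_topology}"
  assumes "f \<in> borel_measurable borel"
  shows "(\<integral>y. f (x - y) \<partial>lborel) = (\<integral>y. f y \<partial>lborel)"
  using integral_affine[OF assms, of "-1" x] by simp

lemma integral_translate:
  fixes f :: "'a::euclidean_space \<Rightarrow> 'b::{banach, second_countable_topology}"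
  assumes "f \<in> borel_measurable borel"
  shows "(\<integral>y. f (a + y) \<partial>lborel) = (\<integral>y. f y \<partial>lborel)"
  using integral_affine[OF assms, of "1" a] by simp

lemma nn_integral_translate:
  fixes f :: "'a::euclidean_space \<Rightarrow> ennreal"
  assumes "f \<in> borel_measurable borel"
  shows "(\<integral>\<^sup>+y. f (a + y) \<partial>lborel) = (\<integral>\<^sup>+y. f y \<partial>lborel)"
    "(\<integral>\<^sup>+y. f (y - a) \<partial>lborel) = (\<integral>\<^sup>+y. f y \<partial>lborel)"
  using nn_integral_affine[OF assms, of "1" a] nn_integral_affine[OF assms, of "1" "- a"] by simp_all

lemma integrable_scaleR_bounded:
  fixes f :: "'a \<Rightarrow> 'b::{banach, second_countable_topology}"
  assumes f: "integrable M f" and g[measurable]: "g \<in> borel_measurable M" and B: "\<And>x. \<bar>g x\<bar> \<le> B"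
  shows "integrable M (\<lambda>x. g x *\<^sub>R f x)"
proof (rule Bochner_Integration.integrable_bound[of _ "\<lambda>x. B *\<^sub>R norm (f x)"])
  show "integrable M (\<lambda>x. B *\<^sub>R norm (f x))" using f by auto
  have "f \<in> borel_measurable M" using f by auto
  then show "(\<lambda>x. g x *\<^sub>R f x) \<in> borel_measurable M" by measurable
  have "B \<ge> 0" using B[of undefined] abs_ge_zero order_trans by blast
  then show "AE x in M. norm (g x *\<^sub>R f x) \<le> norm (B *\<^sub>R norm (f x))"
    using B by (auto intro!: mult_right_mono)
qed

lemma integrable_compact_support:
  fixes f :: "'a::euclidean_space \<Rightarrow> 'b::{banach, second_countable_topology}"
  assumes "continuous_on UNIV f" "\<And>x. norm x \<ge> R \<Longrightarrow> f x = 0"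
  shows "integrable lborel f"
proof -
  have "integrable lborel (\<lambda>x. indicator (cball 0 R) x *\<^sub>R f x)"
    by (rule borel_integrable_compact) (use assms in \<open>auto intro: continuous_on_subset\<close>)
  moreover have "(\<lambda>x. indicator (cball 0 R) x *\<^sub>R f x) = f"
    using assms by (auto simp: fun_eq_iff indicator_def)
  ultimately show ?thesis by simp
qed

subsection \<open>Continuity of translations in the mean\<close>

text \<open>Continuity of translations in \<open>L\<^sup>1\<close>.  The nonnegative integral frees the closure properties below
  from integrability side conditions.\<close>

definition translation_continuous :: "('a::euclidean_space \<Rightarrow> 'b::real_normed_vector) \<Rightarrow> bool" where
  "translation_continuous f \<longleftrightarrow>
     (\<forall>e>0. \<exists>d>0. \<forall>y. norm y < d \<longrightarrow> (\<integral>\<^sup>+x. ennreal (norm (f (x - y) - f x)) \<partial>lborel) < ennreal e)"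

text \<open>A translation is an isometry, so an approximation \<open>g\<close> of \<open>f\<close> is as close to \<open>f\<close> after translation
  as before.\<close>

lemma translation_continuous_approx:
  fixes f :: "'a::euclidean_space \<Rightarrow> 'b::{banach, second_countable_topology}"
  assumes [measurable]: "f \<in> borel_measurable borel"
    and appr: "\<And>e. e > 0 \<Longrightarrow> \<exists>g. g \<in> borel_measurable borel \<and> translation_continuous g \<and>
      (\<integral>\<^sup>+x. ennreal (norm (g x - f x)) \<partial>lborel) < ennreal e"
  shows "translation_continuous f"
  unfolding translation_continuous_def
proof (intro allI impI)
  fix e :: real assume "e > 0"
  then obtain g where [measurable]: "g \<in> borel_measurable borel" and g: "translation_continuous g"
    "(\<integral>\<^sup>+x. ennreal (norm (g x - f x)) \<partial>lborel) < ennreal (e/3)"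
    using appr[of "e/3"] by auto
  have "e/3 > 0" using \<open>e > 0\<close> by simp
  obtain d where d: "d > 0"
    "\<And>y. norm y < d \<Longrightarrow> (\<integral>\<^sup>+x. ennreal (norm (g (x - y) - g x)) \<partial>lborel) < ennreal (e/3)"
    using g(1)[unfolded translation_continuous_def, rule_format, OF \<open>e/3 > 0\<close>] by blast
  have "(\<integral>\<^sup>+x. ennreal (norm (f (x - y) - f x)) \<partial>lborel) < ennreal e" if "norm y < d" for y
  proof -
    have "(\<integral>\<^sup>+x. ennreal (norm (f (x - y) - f x)) \<partial>lborel) \<le>
       (\<integral>\<^sup>+x. (ennreal (norm (g (x - y) - f (x - y))) + ennreal (norm (g (x - y) - g x))) + ennreal (norm (g x - f x)) \<partial>lborel)"
      by (intro nn_integral_mono) (simp flip: ennreal_plus, norm)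
    also have "\<dots> = (\<integral>\<^sup>+x. ennreal (norm (g (x - y) - f (x - y))) \<partial>lborel) +
        (\<integral>\<^sup>+x. ennreal (norm (g (x - y) - g x)) \<partial>lborel) + (\<integral>\<^sup>+x. ennreal (norm (g x - f x)) \<partial>lborel)"
      by (simp add: nn_integral_add)
    also have "(\<integral>\<^sup>+x. ennreal (norm (g (x - y) - f (x - y))) \<partial>lborel) = (\<integral>\<^sup>+x. ennreal (norm (g x - f x)) \<partial>lborel)"
      by (rule nn_integral_translate(2)[of "\<lambda>x. ennreal (norm (g x - f x))" y]) measurable
    also have "(\<integral>\<^sup>+x. ennreal (norm (g x - f x)) \<partial>lborel) + (\<integral>\<^sup>+x. ennreal (norm (g (x - y) - g x)) \<partial>lborel)
         + (\<integral>\<^sup>+x. ennreal (norm (g x - f x)) \<partial>lborel) < ennreal (e/3) + ennreal (e/3) + ennreal (e/3)"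
      by (intro ennreal_add_strict_mono g d that)
    also have "\<dots> = ennreal e" using \<open>e > 0\<close> by (simp flip: ennreal_plus)
    finally show ?thesis .
  qed
  then show "\<exists>d>0. \<forall>y. norm y < d \<longrightarrow> (\<integral>\<^sup>+x. ennreal (norm (f (x - y) - f x)) \<partial>lborel) < ennreal e"
    using d(1) by blast
qed

lemma translation_continuous_add:
  fixes f g :: "'a::euclidean_space \<Rightarrow> 'b::{banach, second_countable_topology}"
  assumes [measurable]: "f \<in> borel_measurable borel" "g \<in> borel_measurable borel"
    and tc: "translation_continuous f" "translation_continuous g"
  shows "translation_continuous (\<lambda>x. f x + g x)"
  unfolding translation_continuous_def
proof (intro allI impI)
  fix e :: real assume "e > 0"
  then have "e/2 > 0" by simp
  obtain d where d1: "d > 0"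
    "\<And>y. norm y < d \<Longrightarrow> (\<integral>\<^sup>+x. ennreal (norm (f (x - y) - f x)) \<partial>lborel) < ennreal (e/2)"
    using tc(1)[unfolded translation_continuous_def, rule_format, OF \<open>e/2 > 0\<close>] by blast
  obtain d' where d2: "d' > 0"
    "\<And>y. norm y < d' \<Longrightarrow> (\<integral>\<^sup>+x. ennreal (norm (g (x - y) - g x)) \<partial>lborel) < ennreal (e/2)"
    using tc(2)[unfolded translation_continuous_def, rule_format, OF \<open>e/2 > 0\<close>] by blast
  note d = d1(1) d2(1) d1(2) d2(2)
  have "(\<integral>\<^sup>+x. ennreal (norm (f (x - y) + g (x - y) - (f x + g x))) \<partial>lborel) < ennreal e"
    if "norm y < min d d'" for y
  proof -
    have "(\<integral>\<^sup>+x. ennreal (norm (f (x - y) + g (x - y) - (f x + g x))) \<partial>lborel) \<le>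
      (\<integral>\<^sup>+x. ennreal (norm (f (x - y) - f x)) + ennreal (norm (g (x - y) - g x)) \<partial>lborel)"
      by (intro nn_integral_mono) (simp flip: ennreal_plus, norm)
    also have "\<dots> = (\<integral>\<^sup>+x. ennreal (norm (f (x - y) - f x)) \<partial>lborel) + (\<integral>\<^sup>+x. ennreal (norm (g (x - y) - g x)) \<partial>lborel)"
      by (simp add: nn_integral_add)
    also have "\<dots> < ennreal (e/2) + ennreal (e/2)"
      using that by (intro ennreal_add_strict_mono d) auto
    also have "\<dots> = ennreal e" using \<open>e > 0\<close> by (simp flip: ennreal_plus)
    finally show ?thesis .
  qed
  then show "\<exists>d>0. \<forall>y. norm y < d \<longrightarrow> (\<integral>\<^sup>+x. ennreal (norm (f (x - y) + g (x - y) - (f x + g x))) \<partial>lborel) < ennreal e"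
    using d(1,2) by (intro exI[of _ "min d d'"]) auto
qed

text \<open>A point of an open set stays in the set under small translations.  Dominated convergence makes
  the part of \<open>U\<close> that leaves \<open>U\<close> small, and the part that enters \<open>U\<close> is a translate of what leaves \<open>U\<close>
  under the opposite translation.\<close>

lemma translation_continuous_open:
  fixes U :: "'a::euclidean_space set" and c :: "'b::real_normed_vector"
  assumes "open U" "emeasure lborel U < \<infinity>"
  shows "translation_continuous (\<lambda>x. indicator U x *\<^sub>R c)"
proof -
  have [measurable]: "U \<in> sets borel" using assms by auto
  define q where "q y = (\<integral>\<^sup>+x. indicator U x * (1 - indicator U (x - y)) \<partial>lborel :: ennreal)" for y
  have q: "\<exists>d>0. \<forall>y. norm y < d \<longrightarrow> q y < ennreal e" if "e > 0" for e
  proof (rule ccontr)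
    assume "\<not> ?thesis"
    then have neg: "\<And>d. d > 0 \<Longrightarrow> \<exists>y. norm y < d \<and> q y \<ge> ennreal e"
      using linorder_not_less by blast
    have "\<exists>y. norm y < 1 / Suc n \<and> q y \<ge> ennreal e" for n
      by (rule neg) simp
    then obtain y where y: "\<And>n. norm (y n) < 1 / Suc n" "\<And>n. q (y n) \<ge> ennreal e" by metis
    have y0: "y \<longlonglongrightarrow> 0"
    proof (rule Lim_null_comparison)
      show "(\<lambda>n. 1 / real (Suc n)) \<longlonglongrightarrow> 0" by (rule LIMSEQ_Suc[OF lim_1_over_n])
      show "\<forall>\<^sub>F n in sequentially. norm (y n) \<le> 1 / real (Suc n)"
        by (intro always_eventually allI less_imp_le y(1))
    qed
    have "(\<lambda>n. q (y n)) \<longlonglongrightarrow> (\<integral>\<^sup>+x. 0 \<partial>(lborel :: 'a measure))"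
      unfolding q_def
    proof (rule nn_integral_dominated_convergence[where w="indicator U"])
      show "AE x in lborel. (\<lambda>n. indicator U x * (1 - indicator U (x - y n))) \<longlonglongrightarrow> (0::ennreal)"
      proof (rule AE_I2)
        fix x :: 'a
        show "(\<lambda>n. indicator U x * (1 - indicator U (x - y n))) \<longlonglongrightarrow> (0::ennreal)"
        proof (cases "x \<in> U")
          case True
          have "(\<lambda>n. x - y n) \<longlonglongrightarrow> x" using tendsto_diff[OF tendsto_const y0, of x] by simp
          then have "\<forall>\<^sub>F n in sequentially. x - y n \<in> U"
            using True assms(1) topological_tendstoD by blast
          then show ?thesis by (auto intro!: tendsto_eventually elim!: eventually_mono)
        qed auto
      qed
      show "(\<integral>\<^sup>+x. indicator U x \<partial>(lborel :: 'a measure)) < \<infinity>" using assms(2) by simp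
      show "AE x in lborel. indicator U x * (1 - indicator U (x - y j)) \<le> (indicator U x :: ennreal)" for j
        by (auto simp: indicator_def)
    qed measurable
    then have "(\<lambda>n. q (y n)) \<longlonglongrightarrow> 0" by simp
    then have "\<forall>\<^sub>F n in sequentially. q (y n) < ennreal e"
      using that by (intro order_tendstoD(2)) auto
    then show False using y(2) by (auto simp: not_less[symmetric] eventually_sequentially)
  qed
  have int: "(\<integral>\<^sup>+x. ennreal (norm (indicator U (x - y) *\<^sub>R c - indicator U x *\<^sub>R c)) \<partial>lborel) \<le> ennreal (norm c) * (q y + q (- y))" for y
  proof -
    have "(\<integral>\<^sup>+x. ennreal (norm (indicator U (x - y) *\<^sub>R c - indicator U x *\<^sub>R c)) \<partial>lborel)
       \<le> (\<integral>\<^sup>+x. ennreal (norm c) * (indicator U x * (1 - indicator U (x - y))) +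
            ennreal (norm c) * (indicator U (x - y) * (1 - indicator U x)) \<partial>lborel)"
      by (intro nn_integral_mono) (auto simp: indicator_def)
    also have "\<dots> = (\<integral>\<^sup>+x. ennreal (norm c) * (indicator U x * (1 - indicator U (x - y))) \<partial>lborel) +
            (\<integral>\<^sup>+x. ennreal (norm c) * (indicator U (x - y) * (1 - indicator U x)) \<partial>lborel)"
      by (rule nn_integral_add) measurable
    also have "\<dots> = ennreal (norm c) * q y + ennreal (norm c) * (\<integral>\<^sup>+x. indicator U (x - y) * (1 - indicator U x) \<partial>lborel)"
      by (simp add: q_def nn_integral_cmult)
    also have "(\<integral>\<^sup>+x. indicator U (x - y) * (1 - indicator U x) \<partial>lborel) = q (- y)"
      unfolding q_def
      using nn_integral_translate(2)[of "\<lambda>x. indicator U x * (1 - indicator U (x - - y))" y] by simp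
    finally show ?thesis by (simp add: distrib_left)
  qed
  show ?thesis
    unfolding translation_continuous_def
  proof (intro allI impI)
    fix e :: real assume "e > 0"
    define e' where "e' = e / (2 * (norm c + 1))"
    have "e' > 0" using \<open>e > 0\<close> by (auto simp: e'_def intro!: divide_pos_pos add_nonneg_pos)
    obtain d where d: "d > 0" "\<And>y. norm y < d \<Longrightarrow> q y < ennreal e'" using q[OF \<open>e' > 0\<close>] by blast
    have "(\<integral>\<^sup>+x. ennreal (norm (indicator U (x - y) *\<^sub>R c - indicator U x *\<^sub>R c)) \<partial>lborel) < ennreal e"
      if "norm y < d" for y
    proof -
      have "ennreal (norm c) * (q y + q (- y)) \<le> ennreal (norm c) * (ennreal e' + ennreal e')"
        using d(2)[of y] d(2)[of "-y"] that by (intro mult_left_mono add_mono) auto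
      also have "\<dots> = ennreal (norm c * (e' + e'))" using \<open>e' > 0\<close> by (simp flip: ennreal_plus ennreal_mult)
      also have "\<dots> < ennreal e"
      proof (rule ennreal_lessI[OF \<open>e > 0\<close>])
        have "norm c + 1 > 0" by (smt (verit) norm_ge_zero)
        have halves: "e / (2 * k) + e / (2 * k) = e / k" for k :: real
          by (cases "k = 0") (auto simp: field_simps)
        have "norm c * (e' + e') = e * (norm c / (norm c + 1))"
          unfolding e'_def halves by simp
        also have "\<dots> < e * 1" using \<open>e > 0\<close> \<open>norm c + 1 > 0\<close> by (intro mult_strict_left_mono) auto
        finally show "norm c * (e' + e') < e" by simp
      qed
      finally show ?thesis using int[of y] by (rule order_le_less_trans[rotated])
    qed
    then show "\<exists>d>0. \<forall>y. norm y < d \<longrightarrow> (\<integral>\<^sup>+x. ennreal (norm (indicator U (x - y) *\<^sub>R c - indicator U x *\<^sub>R c)) \<partial>lborel) < ennreal e"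
      using d(1) by blast
  qed
qed

text \<open>Outer regularity approximates measurable sets by open ones, and integrable functions are limits
  of simple functions.\<close>

lemma integrable_translation_continuous:
  fixes f :: "'a::euclidean_space \<Rightarrow> 'b::{banach, second_countable_topology}"
  assumes "integrable lborel f"
  shows "translation_continuous f"
  using assms
proof (induction rule: integrable_induct)
  case (base A c)
  then have A[measurable]: "A \<in> sets borel" by simp
  show ?case
  proof (rule translation_continuous_approx)
    show "(\<lambda>x. indicator A x *\<^sub>R c) \<in> borel_measurable borel" by measurable
    fix e :: real assume "e > 0"
    define e' where "e' = e / (norm c + 1)"
    have c1: "norm c + 1 > 0" by (smt (verit) norm_ge_zero)
    then have "e' > 0" using \<open>e > 0\<close> by (auto simp: e'_def)
    obtain U where U: "open U" "A \<subseteq> U" "emeasure lborel (U - A) < ennreal e'"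
      using outer_regular_lborel[OF A \<open>e' > 0\<close>] by metis
    have [measurable]: "U \<in> sets borel" using U by auto
    have "emeasure lborel U = emeasure lborel A + emeasure lborel (U - A)"
      using U by (subst plus_emeasure) (auto intro!: arg_cong[of _ _ "emeasure lborel"])
    then have fin: "emeasure lborel U < \<infinity>" using base U by (auto simp: less_top[symmetric] top_unique)
    have "(\<integral>\<^sup>+x. ennreal (norm (indicator U x *\<^sub>R c - indicator A x *\<^sub>R c)) \<partial>lborel) =
        (\<integral>\<^sup>+x. ennreal (norm c) * indicator (U - A) x \<partial>lborel)"
      using U(2) by (intro nn_integral_cong) (auto simp: indicator_def)
    also have "\<dots> = ennreal (norm c) * emeasure lborel (U - A)"
      by (simp add: nn_integral_cmult_indicator)
    also have "\<dots> \<le> ennreal (norm c) * ennreal e'" using U by (intro mult_left_mono) auto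
    also have "\<dots> = ennreal (norm c * e')" using \<open>e' > 0\<close> by (simp flip: ennreal_mult)
    also have "\<dots> < ennreal e"
    proof (rule ennreal_lessI[OF \<open>e > 0\<close>])
      have "norm c * e' = e * (norm c / (norm c + 1))" by (simp add: e'_def)
      also have "\<dots> < e * 1" using \<open>e > 0\<close> c1 by (intro mult_strict_left_mono) auto
      finally show "norm c * e' < e" by simp
    qed
    finally show "\<exists>g. g \<in> borel_measurable borel \<and> translation_continuous g \<and>
      (\<integral>\<^sup>+x. ennreal (norm (g x - indicator A x *\<^sub>R c)) \<partial>lborel) < ennreal e"
      using translation_continuous_open[OF U(1) fin, of c]
      by (intro exI[of _ "\<lambda>x. indicator U x *\<^sub>R c"]) auto
  qed
next
  case (add f g)
  then show ?case by (intro translation_continuous_add) auto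
next
  case (lim f s)
  have [measurable]: "f \<in> borel_measurable borel" using lim by auto
  show ?case
  proof (rule translation_continuous_approx)
    fix e :: real assume "e > 0"
    have [measurable]: "\<And>i. s i \<in> borel_measurable borel" using lim by auto
    have "(\<lambda>i. (\<integral>\<^sup>+x. norm (f x - s i x) \<partial>lborel)) \<longlonglongrightarrow> 0"
    proof (rule nn_integral_dominated_convergence_norm[where w="\<lambda>x. 2 * norm (f x)"])
      show "(\<integral>\<^sup>+x. ennreal (2 * norm (f x)) \<partial>lborel) < \<infinity>"
        using lim by (auto simp: integrable_iff_bounded ennreal_mult nn_integral_cmult ennreal_mult_less_top)
    qed (use lim in auto)
    then have "\<forall>\<^sub>F i in sequentially. (\<integral>\<^sup>+x. norm (f x - s i x) \<partial>lborel) < ennreal e"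
      using \<open>e > 0\<close> by (intro order_tendstoD(2)) auto
    then obtain i where "(\<integral>\<^sup>+x. norm (f x - s i x) \<partial>lborel) < ennreal e"
      by (auto simp: eventually_sequentially)
    then show "\<exists>g. g \<in> borel_measurable borel \<and> translation_continuous g \<and>
      (\<integral>\<^sup>+x. ennreal (norm (g x - f x)) \<partial>lborel) < ennreal e"
      using lim by (intro exI[of _ "s i"]) (auto simp: norm_minus_commute)
  qed measurable
qed

section \<open>Mollification\<close>

lemma C1c_integrable:
  fixes \<phi> :: "'a::euclidean_space \<Rightarrow> real"
  assumes "C1c \<phi> d\<phi>"
  shows "integrable lborel \<phi>" "integrable lborel d\<phi>"
proof -
  obtain R where "\<forall>x. norm x \<ge> R \<longrightarrow> \<phi> x = 0 \<and> d\<phi> x = 0" using assms by (auto simp: C1c_def)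
  then show "integrable lborel \<phi>" "integrable lborel d\<phi>"
    using integrable_compact_support[OF C1c_continuous(1)[OF assms], of R]
      integrable_compact_support[OF C1c_continuous(2)[OF assms], of R] by auto
qed

lemma C1c_bounded:
  fixes \<phi> :: "'a::euclidean_space \<Rightarrow> real"
  assumes "C1c \<phi> d\<phi>"
  obtains B where "B > 0" "\<And>x. \<bar>\<phi> x\<bar> \<le> B" "\<And>x. norm (d\<phi> x) \<le> B"
proof -
  obtain R where R: "\<forall>x. norm x \<ge> R \<longrightarrow> \<phi> x = 0 \<and> d\<phi> x = 0" using assms by (auto simp: C1c_def)
  obtain B where B: "B > 0" "\<And>x. norm (\<phi> x) \<le> B"
    using R compact_support_bound[OF C1c_continuous(1)[OF assms], of R] by auto
  obtain C where C: "C > 0" "\<And>x. norm (d\<phi> x) \<le> C"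
    using R compact_support_bound[OF C1c_continuous(2)[OF assms], of R] by auto
  show ?thesis
    using B C by (intro that[of "max B C"]) (auto simp: max.coboundedI1 max.coboundedI2)
qed

text \<open>The gradient is uniformly continuous, which makes the error of the linear approximation
  uniform in \<open>x\<close>.\<close>

lemma C1c_linearization:
  fixes \<phi> :: "'a::euclidean_space \<Rightarrow> real"
  assumes "C1c \<phi> d\<phi>" "e > 0"
  obtains d where "d > 0"
    "\<And>x h. norm h < d \<Longrightarrow> \<bar>\<phi> (x + h) - \<phi> x - d\<phi> x \<bullet> h\<bar> \<le> e * norm h"
proof -
  obtain R where R: "\<forall>x. norm x \<ge> R \<longrightarrow> \<phi> x = 0 \<and> d\<phi> x = 0" using assms by (auto simp: C1c_def)
  obtain d where d: "d > 0" "\<And>x y. norm (x - y) < d \<Longrightarrow> norm (d\<phi> x - d\<phi> y) < e"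
    using R compact_support_uniform[OF C1c_continuous(2)[OF assms(1)], of R e] \<open>e > 0\<close> by blast
  have "\<bar>\<phi> (x + h) - \<phi> x - d\<phi> x \<bullet> h\<bar> \<le> e * norm h" if "norm h < d" for x h
  proof -
    have D: "((\<lambda>s. \<phi> (x + s *\<^sub>R h)) has_derivative (\<lambda>t. d\<phi> (x + s *\<^sub>R h) \<bullet> (t *\<^sub>R h))) (at s within {0..1})" for s
    proof -
      have "((\<lambda>s. x + s *\<^sub>R h) has_derivative (\<lambda>t. t *\<^sub>R h)) (at s within {0..1})"
        by (auto intro!: derivative_eq_intros)
      then show ?thesis by (rule has_derivative_compose) (rule C1c_derivD[OF assms(1)])
    qed
    obtain s where s: "s \<in> {0..1}" "\<phi> (x + 1 *\<^sub>R h) - \<phi> (x + 0 *\<^sub>R h) = d\<phi> (x + s *\<^sub>R h) \<bullet> ((1 - 0) *\<^sub>R h)"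
      using mvt_very_simple[of 0 1 "\<lambda>s. \<phi> (x + s *\<^sub>R h)", OF _ D] by auto
    then have "\<phi> (x + h) - \<phi> x - d\<phi> x \<bullet> h = (d\<phi> (x + s *\<^sub>R h) - d\<phi> x) \<bullet> h"
      by (simp add: inner_diff_left)
    also have "\<bar>\<dots>\<bar> \<le> norm (d\<phi> (x + s *\<^sub>R h) - d\<phi> x) * norm h"
      by (rule Cauchy_Schwarz_ineq2)
    also have "\<dots> \<le> e * norm h"
    proof (rule mult_right_mono[OF less_imp_le[OF d(2)]])
      have "s * norm h \<le> 1 * norm h" using s by (intro mult_right_mono) auto
      moreover have "norm (x + s *\<^sub>R h - x) = s * norm h" using s by simp
      ultimately show "norm (x + s *\<^sub>R h - x) < d" using that by linarith
    qed simp
    finally show ?thesis .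
  qed
  then show ?thesis using that d by blast
qed

text \<open>The difference quotients of \<open>\<phi>\<close> have integral zero by translation invariance and converge
  uniformly to the derivative on a fixed ball.  Applied to a product this is integration by parts.\<close>

lemma C1c_integral_deriv:
  fixes \<phi> :: "'a::euclidean_space \<Rightarrow> real"
  assumes C1: "C1c \<phi> d\<phi>"
  shows "(\<integral>x. d\<phi> x \<bullet> b \<partial>lborel) = 0"
proof (cases "b = 0")
  case False
  have m[measurable]: "\<phi> \<in> borel_measurable borel" "d\<phi> \<in> borel_measurable borel"
    using C1c_continuous[OF C1] borel_measurable_continuous_onI by auto
  obtain R where R: "\<forall>x. norm x \<ge> R \<longrightarrow> \<phi> x = 0 \<and> d\<phi> x = 0" using C1 by (auto simp: C1c_def)
  define V where "V = measure lborel (cball (0::'a) (R + norm b))"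
  have "\<bar>\<integral>x. d\<phi> x \<bullet> b \<partial>lborel\<bar> \<le> e * (norm b * V)" if e0: "e > 0" for e
  proof -
    obtain d where d: "d > 0" "\<And>x h. norm h < d \<Longrightarrow> \<bar>\<phi> (x + h) - \<phi> x - d\<phi> x \<bullet> h\<bar> \<le> e * norm h"
      using C1c_linearization[OF C1 e0] by blast
    define s where "s = min 1 (d / (2 * norm b))"
    have s: "0 < s" "s \<le> 1" using d False by (auto simp: s_def)
    have "norm (s *\<^sub>R b) \<le> d / 2" using False s by (simp add: s_def min_def field_simps)
    then have sd: "norm (s *\<^sub>R b) < d" using d by simp
    define q where "q x = \<phi> (s *\<^sub>R b + x) - \<phi> x - s *\<^sub>R (d\<phi> x \<bullet> b)" for x
    have i: "integrable lborel \<phi>" "integrable lborel (\<lambda>x. \<phi> (s *\<^sub>R b + x))" "integrable lborel (\<lambda>x. d\<phi> x \<bullet> b)"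
      using C1c_integrable[OF C1] integrable_affine[of \<phi> 1 "s *\<^sub>R b"] by auto
    have "(\<integral>x. q x \<partial>lborel) = - s * (\<integral>x. d\<phi> x \<bullet> b \<partial>lborel)"
      unfolding q_def using i by (simp add: integral_translate)
    then have "s * \<bar>\<integral>x. d\<phi> x \<bullet> b \<partial>lborel\<bar> = \<bar>\<integral>x. q x \<partial>lborel\<bar>"
      using s by (simp add: abs_mult)
    also have "\<dots> \<le> (\<integral>x. \<bar>q x\<bar> \<partial>lborel)" by (rule integral_abs_bound)
    also have "\<dots> \<le> (\<integral>x. (e * norm (s *\<^sub>R b)) * indicator (cball (0::'a) (R + norm b)) x \<partial>lborel)"
    proof (rule Bochner_Integration.integral_mono)
      show "integrable lborel (\<lambda>x. \<bar>q x\<bar>)" unfolding q_def using i by auto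
      fix x
      show "\<bar>q x\<bar> \<le> e * norm (s *\<^sub>R b) * indicator (cball 0 (R + norm b)) x"
      proof (cases "norm x \<le> R + norm b")
        case True
        then show ?thesis using d(2)[OF sd, of x] by (simp add: q_def add.commute)
      next
        case False
        have "norm (s *\<^sub>R b) \<le> 1 * norm b" using s by (simp only: norm_scaleR) (intro mult_right_mono, auto)
        then have "norm (s *\<^sub>R b + x) \<ge> R"
          using False norm_diff_ineq[of x "s *\<^sub>R b"] by (simp add: add.commute)
        moreover have "norm x \<ge> R" using False norm_ge_zero[of b] by linarith
        ultimately show ?thesis using R False by (simp add: q_def)
      qed
      show "integrable lborel (\<lambda>x. e * norm (s *\<^sub>R b) * indicator (cball (0::'a) (R + norm b)) x)"
        using emeasure_bounded_finite[OF bounded_cball, of "0::'a" "R + norm b"]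
        by (intro integrable_mult_right integrable_real_indicator) auto
    qed
    also have "\<dots> = e * norm (s *\<^sub>R b) * V"
      by (simp add: V_def)
    also have "\<dots> = s * (e * (norm b * V))" using s by simp
    finally show ?thesis using s by simp
  qed
  then have "\<bar>\<integral>x. d\<phi> x \<bullet> b \<partial>lborel\<bar> \<le> 0 + e" if "e > 0" for e
  proof -
    define k where "k = norm b * V + 1"
    have "k > 0" "norm b * V \<le> k" unfolding k_def V_def by (auto intro!: add_nonneg_pos)
    then have "\<bar>\<integral>x. d\<phi> x \<bullet> b \<partial>lborel\<bar> \<le> (e / k) * (norm b * V)"
      using \<open>\<And>e. e > 0 \<Longrightarrow> \<bar>\<integral>x. d\<phi> x \<bullet> b \<partial>lborel\<bar> \<le> e * (norm b * V)\<close>[of "e / k"] that by simp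
    also have "\<dots> \<le> (e / k) * k" using that \<open>k > 0\<close> \<open>norm b * V \<le> k\<close> by (intro mult_left_mono) auto
    finally show ?thesis using \<open>k > 0\<close> by simp
  qed
  then have "\<bar>\<integral>x. d\<phi> x \<bullet> b \<partial>lborel\<bar> \<le> 0" by (rule field_le_epsilon)
  then show ?thesis by simp
qed simp

definition conv :: "('a::euclidean_space \<Rightarrow> real) \<Rightarrow> ('a \<Rightarrow> 'b::euclidean_space) \<Rightarrow> 'a \<Rightarrow> 'b" where
  "conv \<rho> f x = (\<integral>y. \<rho> (x - y) *\<^sub>R f y \<partial>lborel)"

lemma conv_integrable:
  fixes f :: "'a::euclidean_space \<Rightarrow> 'b::euclidean_space"
  assumes "integrable lborel f" "\<rho> \<in> borel_measurable borel" "\<And>x. \<bar>\<rho> x\<bar> \<le> B"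
  shows "integrable lborel (\<lambda>y. \<rho> (x - y) *\<^sub>R f y)"
proof (rule integrable_scaleR_bounded[OF assms(1)])
  show "(\<lambda>y. \<rho> (x - y)) \<in> borel_measurable lborel" using assms(2) by measurable
qed (use assms(3) in auto)

lemma C1c_measurable:
  assumes "C1c \<phi> d\<phi>"
  shows "\<phi> \<in> borel_measurable borel" "d\<phi> \<in> borel_measurable borel"
  using C1c_continuous[OF assms] borel_measurable_continuous_onI by auto

text \<open>Differentiation falls on the kernel, whose linearization error is uniform; hence integrability
  of \<open>f\<close> suffices.\<close>

lemma conv_has_derivative:
  fixes f :: "'a::euclidean_space \<Rightarrow> 'b::euclidean_space"
  assumes C1: "C1c \<rho> d\<rho>" and f: "integrable lborel f"
  shows "(conv \<rho> f has_derivative (\<lambda>h. conv (\<lambda>z. d\<rho> z \<bullet> h) f x)) (at x)"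
proof -
  note m[measurable] = C1c_measurable[OF C1]
  obtain B where B: "B > 0" "\<And>x. \<bar>\<rho> x\<bar> \<le> B" "\<And>x. norm (d\<rho> x) \<le> B" using C1c_bounded[OF C1] by blast
  have i1: "integrable lborel (\<lambda>y. \<rho> (x - y) *\<^sub>R f y)" for x
    by (rule conv_integrable[OF f _ B(2)]) measurable
  have bd: "\<bar>d\<rho> z \<bullet> h\<bar> \<le> B * norm h" for z h
    using Cauchy_Schwarz_ineq2[of "d\<rho> z" h] mult_right_mono[OF B(3)[of z] norm_ge_zero[of h]] by linarith
  have i2: "integrable lborel (\<lambda>y. (d\<rho> (x - y) \<bullet> h) *\<^sub>R f y)" for x h
    using conv_integrable[where \<rho>="\<lambda>z. d\<rho> z \<bullet> h" and x=x, OF f _ bd] by simp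
  define I where "I = (\<integral>y. norm (f y) \<partial>lborel)"
  have "I \<ge> 0" by (simp add: I_def)
  show ?thesis
    unfolding has_derivative_at
  proof (intro conjI)
    show "bounded_linear (\<lambda>h. conv (\<lambda>z. d\<rho> z \<bullet> h) f x)"
    proof (rule bounded_linear_intro[where K="B * I"])
      fix h h' r
      show "conv (\<lambda>z. d\<rho> z \<bullet> (h + h')) f x = conv (\<lambda>z. d\<rho> z \<bullet> h) f x + conv (\<lambda>z. d\<rho> z \<bullet> h') f x"
        using i2 by (simp add: conv_def inner_add_right scaleR_add_left)
      show "conv (\<lambda>z. d\<rho> z \<bullet> (r *\<^sub>R h)) f x = r *\<^sub>R conv (\<lambda>z. d\<rho> z \<bullet> h) f x"
        by (simp add: conv_def flip: scaleR_scaleR)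
      have "norm (conv (\<lambda>z. d\<rho> z \<bullet> h) f x) \<le> (\<integral>y. norm ((d\<rho> (x - y) \<bullet> h) *\<^sub>R f y) \<partial>lborel)"
        unfolding conv_def by (rule integral_norm_bound)
      also have "\<dots> \<le> (\<integral>y. (B * norm h) * norm (f y) \<partial>lborel)"
        using integrable_norm[OF i2[of x h]] f bd
        by (intro Bochner_Integration.integral_mono) (auto intro!: mult_right_mono)
      also have "\<dots> = norm h * (B * I)" by (simp add: I_def)
      finally show "norm (conv (\<lambda>z. d\<rho> z \<bullet> h) f x) \<le> norm h * (B * I)" .
    qed
    show "(\<lambda>h. norm (conv \<rho> f (x + h) - conv \<rho> f x - conv (\<lambda>z. d\<rho> z \<bullet> h) f x) / norm h) \<midarrow>0\<rightarrow> 0"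
    proof (rule LIM_I)
      fix e :: real assume "e > 0"
      define e' where "e' = e / (I + 1)"
      have "e' > 0" using \<open>e > 0\<close> \<open>I \<ge> 0\<close> by (simp add: e'_def)
      obtain d where d: "d > 0" "\<And>x h. norm h < d \<Longrightarrow> \<bar>\<rho> (x + h) - \<rho> x - d\<rho> x \<bullet> h\<bar> \<le> e' * norm h"
        using C1c_linearization[OF C1 \<open>e' > 0\<close>] by blast
      show "\<exists>s>0. \<forall>h. h \<noteq> 0 \<and> norm (h - 0) < s \<longrightarrow>
        norm (norm (conv \<rho> f (x + h) - conv \<rho> f x - conv (\<lambda>z. d\<rho> z \<bullet> h) f x) / norm h - 0) < e"
      proof (intro exI[of _ d] conjI allI impI d(1))
        fix h :: 'a assume h: "h \<noteq> 0 \<and> norm (h - 0) < d"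
        have "conv \<rho> f (x + h) - conv \<rho> f x - conv (\<lambda>z. d\<rho> z \<bullet> h) f x
          = (\<integral>y. (\<rho> (x + h - y) - \<rho> (x - y) - d\<rho> (x - y) \<bullet> h) *\<^sub>R f y \<partial>lborel)"
          using i1 i2 by (simp add: conv_def scaleR_diff_left)
        also have "norm \<dots> \<le> (\<integral>y. norm ((\<rho> (x + h - y) - \<rho> (x - y) - d\<rho> (x - y) \<bullet> h) *\<^sub>R f y) \<partial>lborel)"
          by (rule integral_norm_bound)
        also have "\<dots> \<le> (\<integral>y. (e' * norm h) * norm (f y) \<partial>lborel)"
        proof (rule Bochner_Integration.integral_mono)
          show "integrable lborel (\<lambda>y. norm ((\<rho> (x + h - y) - \<rho> (x - y) - d\<rho> (x - y) \<bullet> h) *\<^sub>R f y))"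
            using i1 i2 by (auto simp: scaleR_diff_left)
          fix y
          have "\<bar>\<rho> (x + h - y) - \<rho> (x - y) - d\<rho> (x - y) \<bullet> h\<bar> \<le> e' * norm h"
            using d(2)[of h "x - y"] h by (simp add: algebra_simps)
          then show "norm ((\<rho> (x + h - y) - \<rho> (x - y) - d\<rho> (x - y) \<bullet> h) *\<^sub>R f y) \<le> e' * norm h * norm (f y)"
            by (auto intro!: mult_right_mono)
        qed (use f in auto)
        also have "\<dots> = norm h * (e' * I)" by (simp add: I_def)
        finally have X: "norm (conv \<rho> f (x + h) - conv \<rho> f x - conv (\<lambda>z. d\<rho> z \<bullet> h) f x) \<le> norm h * (e' * I)" .
        have "norm X / norm h \<le> e' * I" if "norm X \<le> norm h * (e' * I)" for X :: 'b
          using that h by (simp add: field_simps)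
        from this[OF X]
        have "norm (conv \<rho> f (x + h) - conv \<rho> f x - conv (\<lambda>z. d\<rho> z \<bullet> h) f x) / norm h \<le> e' * I" .
        also have "\<dots> < e" using \<open>e > 0\<close> \<open>I \<ge> 0\<close> by (simp add: e'_def field_simps)
        finally show "norm (norm (conv \<rho> f (x + h) - conv \<rho> f x - conv (\<lambda>z. d\<rho> z \<bullet> h) f x) / norm h - 0) < e" by simp
      qed
    qed
  qed
qed

text \<open>The convolutions of \<open>f\<close> with all smooth kernels of compact support form a family that is closed
  under partial derivatives.\<close>

lemma conv_smooth:
  fixes f :: "'a::euclidean_space \<Rightarrow> 'b::euclidean_space"
  assumes "smooth \<rho>" "\<And>x. norm x \<ge> R \<Longrightarrow> \<rho> x = 0" and f: "integrable lborel f"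
  shows "smooth (conv \<rho> f)"
proof (rule smooth_coinduct)
  define S where "S = {conv \<rho> f | \<rho>. smooth \<rho> \<and> (\<exists>R. \<forall>x. norm x \<ge> R \<longrightarrow> \<rho> x = 0)}"
  show "conv \<rho> f \<in> S" using assms by (auto simp: S_def)
  fix g assume "g \<in> S"
  then obtain \<rho> R where \<rho>: "g = conv \<rho> f" "smooth \<rho>" "\<And>x. norm x \<ge> R \<Longrightarrow> \<rho> x = 0" by (auto simp: S_def)
  have C1: "C1c \<rho> (gr \<rho>)" by (rule smooth_C1c) (use \<rho> in auto)
  have d: "(g has_derivative (\<lambda>h. conv (\<lambda>z. gr \<rho> z \<bullet> h) f x)) (at x)" for x
    using conv_has_derivative[OF C1 f] \<rho>(1) by simp
  have "conv (\<lambda>z. gr \<rho> z \<bullet> b) f \<in> S" if "b \<in> Basis" for b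
  proof -
    have "smooth (\<lambda>z. gr \<rho> z \<bullet> b)" using smoothD(2)[OF \<rho>(2) that] by (simp add: gr_inner[OF that])
    moreover have "\<exists>R. \<forall>x. norm x \<ge> R \<longrightarrow> gr \<rho> x \<bullet> b = 0" using C1 by (auto simp: C1c_def) (metis inner_zero_left)
    ultimately show ?thesis by (auto simp: S_def)
  qed
  then show "(\<forall>x. g differentiable (at x)) \<and> (\<forall>b\<in>Basis. (\<lambda>x. frechet_derivative g (at x) b) \<in> S)"
    using d by (auto simp: frechet_derivativeI[OF d] differentiable_def)
qed

subsection \<open>The standard mollifier\<close>

lemma bump_integral_pos: "integrable lborel (bump :: 'a::euclidean_space \<Rightarrow> real)"
  "0 < (\<integral>x. bump x \<partial>(lborel :: 'a measure))"
proof -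
  show i: "integrable lborel (bump :: 'a \<Rightarrow> real)"
    using smooth_continuous[OF smooth_bump] bump_outside by (rule integrable_compact_support)
  have "(\<integral>x. bump x \<partial>(lborel :: 'a measure)) \<noteq> 0"
  proof
    assume "(\<integral>x. bump x \<partial>(lborel :: 'a measure)) = 0"
    then have "AE x in lborel. bump (x::'a) = 0"
      using i by (subst (asm) integral_nonneg_eq_0_iff_AE) (auto simp: bump_nonneg)
    then have "AE x in lborel. x \<notin> ball (0::'a) 1"
      by eventually_elim (use bump_pos in force)
    then have "ball (0::'a) 1 \<in> null_sets lborel"
      by (intro iffD2[OF AE_iff_null_sets]) auto
    then have "negligible (ball (0::'a) 1)"
      by (simp add: negligible_iff_null_sets null_sets_completionI)
    then show False using open_not_negligible[of "ball (0::'a) 1"] by simp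
  qed
  then show "0 < (\<integral>x. bump x \<partial>(lborel :: 'a measure))"
    using Bochner_Integration.integral_nonneg[of "lborel :: 'a measure" bump, OF bump_nonneg] by (simp add: less_le)
qed

definition rho :: "real \<Rightarrow> 'a::euclidean_space \<Rightarrow> real" where
  "rho \<epsilon> x = bump (x /\<^sub>R \<epsilon>) / (\<epsilon> ^ DIM('a) * (\<integral>x. bump x \<partial>(lborel :: 'a measure)))"

context
  fixes \<epsilon> :: real assumes \<epsilon>: "\<epsilon> > 0"
begin

lemma rho_nonneg: "rho \<epsilon> (x::'a::euclidean_space) \<ge> 0"
  unfolding rho_def using \<epsilon> bump_integral_pos(2)[where 'a='a]
  by (intro divide_nonneg_nonneg mult_nonneg_nonneg bump_nonneg) auto

lemma rho_outside: "norm x \<ge> \<epsilon> \<Longrightarrow> rho \<epsilon> x = 0"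
  using \<epsilon> by (auto simp: rho_def field_simps intro!: bump_outside)

lemma smooth_rho: "smooth (rho \<epsilon> :: 'a::euclidean_space \<Rightarrow> real)"
proof -
  have "smooth (\<lambda>x::'a. (1 / (\<epsilon> ^ DIM('a) * (\<integral>x. bump x \<partial>(lborel :: 'a measure)))) *\<^sub>R bump (0 + (1/\<epsilon>) *\<^sub>R x))"
    by (intro smooth_bounded_linear[OF bounded_linear_scaleR_right] smooth_affine smooth_bump)
  then show ?thesis by (simp add: rho_def[abs_def] divide_inverse mult_ac)
qed

lemma rho_C1c: "C1c (rho \<epsilon> :: 'a::euclidean_space \<Rightarrow> real) (gr (rho \<epsilon>))"
  using smooth_rho rho_outside by (rule smooth_C1c)

lemma rho_integral: "(\<integral>x. rho \<epsilon> x \<partial>(lborel :: 'a::euclidean_space measure)) = 1"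
proof -
  have [measurable]: "(bump :: 'a \<Rightarrow> real) \<in> borel_measurable borel"
    using bump_integral_pos(1) by auto

  have "(\<integral>x. bump (x /\<^sub>R \<epsilon>) \<partial>(lborel :: 'a measure)) = \<epsilon> ^ DIM('a) * (\<integral>x. bump x \<partial>(lborel :: 'a measure))"
    using \<epsilon> integral_affine[of "\<lambda>x::'a. bump (x /\<^sub>R \<epsilon>)" \<epsilon> 0] by simp
  then show ?thesis
    unfolding rho_def using \<epsilon> bump_integral_pos(2)[where 'a='a] by simp
qed

text \<open>Substitution: the gradient scales with \<open>\<epsilon>\<close> to the power \<open>- 1 - DIM('a)\<close>, the volume with \<open>DIM('a)\<close>.\<close>

lemma rho_grad_integral:
  "(\<integral>x. norm (gr (rho \<epsilon>) x) \<partial>(lborel :: 'a::euclidean_space measure))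
   = (\<integral>x. norm (gr (rho 1) x) \<partial>(lborel :: 'a measure)) / \<epsilon>"
proof -
  have [measurable]: "gr (rho \<epsilon> :: 'a \<Rightarrow> real) \<in> borel_measurable borel"
    using C1c_measurable[OF rho_C1c] by auto
  have eq: "(rho 1 :: 'a \<Rightarrow> real) = (\<lambda>x. \<epsilon> ^ DIM('a) * rho \<epsilon> (\<epsilon> *\<^sub>R x))"
    using \<epsilon> by (auto simp: rho_def fun_eq_iff)
  have "gr (rho 1) x = \<epsilon> ^ DIM('a) *\<^sub>R (\<epsilon> *\<^sub>R gr (rho \<epsilon>) (\<epsilon> *\<^sub>R x))" for x :: 'a
  proof -
    have "((\<lambda>x. \<epsilon> *\<^sub>R x) has_derivative (\<lambda>h. \<epsilon> *\<^sub>R h)) (at x)"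
      by (auto intro!: derivative_eq_intros)
    from has_derivative_mult_right[OF has_derivative_compose[OF this C1c_derivD[OF rho_C1c]], of "\<epsilon> ^ DIM('a)"]
    have "(rho 1 has_derivative (\<lambda>h. \<epsilon> ^ DIM('a) * (gr (rho \<epsilon>) (\<epsilon> *\<^sub>R x) \<bullet> (\<epsilon> *\<^sub>R h)))) (at x)"
      by (subst eq)
    then have "frechet_derivative (rho 1) (at x) = (\<lambda>h. \<epsilon> ^ DIM('a) * (gr (rho \<epsilon>) (\<epsilon> *\<^sub>R x) \<bullet> (\<epsilon> *\<^sub>R h)))"
      by (rule frechet_derivativeI)
    then have "gr (rho 1) x = (\<Sum>b\<in>Basis. (\<epsilon> ^ DIM('a) * (gr (rho \<epsilon>) (\<epsilon> *\<^sub>R x) \<bullet> (\<epsilon> *\<^sub>R b))) *\<^sub>R b)"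
      by (simp add: gr_def)
    also have "\<dots> = (\<Sum>b\<in>Basis. ((\<epsilon> ^ DIM('a) *\<^sub>R (\<epsilon> *\<^sub>R gr (rho \<epsilon>) (\<epsilon> *\<^sub>R x))) \<bullet> b) *\<^sub>R b)"
      by (intro sum.cong) (auto simp: mult_ac)
    finally show ?thesis by (simp only: euclidean_representation)
  qed
  then have "(\<integral>x. norm (gr (rho 1) x) \<partial>(lborel :: 'a measure))
     = \<epsilon> * (\<epsilon> ^ DIM('a) * (\<integral>x. norm (gr (rho \<epsilon>) (\<epsilon> *\<^sub>R x)) \<partial>(lborel :: 'a measure)))"
    using \<epsilon> by (simp add: mult_ac)
  also have "\<epsilon> ^ DIM('a) * (\<integral>x. norm (gr (rho \<epsilon>) (\<epsilon> *\<^sub>R x)) \<partial>(lborel :: 'a measure)) =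
    (\<integral>x. norm (gr (rho \<epsilon>) x) \<partial>(lborel :: 'a measure))"
    using \<epsilon> integral_affine[of "\<lambda>x::'a. norm (gr (rho \<epsilon>) x)" \<epsilon> 0] by simp
  finally show ?thesis using \<epsilon> by simp
qed

end

lemma conv_translate:
  fixes f :: "'a::euclidean_space \<Rightarrow> 'b::euclidean_space"
  assumes [measurable]: "f \<in> borel_measurable borel" "\<rho> \<in> borel_measurable borel"
  shows "conv \<rho> f x = (\<integral>z. \<rho> z *\<^sub>R f (x - z) \<partial>lborel)"
  unfolding conv_def using integral_reflect[of "\<lambda>y. \<rho> (x - y) *\<^sub>R f y" x] by simp

lemma conv_measurable:
  fixes f :: "'a::euclidean_space \<Rightarrow> 'b::euclidean_space"
  assumes [measurable]: "f \<in> borel_measurable borel" "\<rho> \<in> borel_measurable borel"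
  shows "conv \<rho> f \<in> borel_measurable borel"
  unfolding conv_def[abs_def] by measurable

text \<open>The mollification is an average of translates of \<open>f\<close>, each of which is close to \<open>f\<close> in the mean.
  The additional shift \<open>a\<close> is there for functions that are moved away from the boundary before they
  are mollified.\<close>

lemma conv_converges:
  fixes f :: "'a::euclidean_space \<Rightarrow> 'b::euclidean_space"
  assumes f: "integrable lborel f" and "e > 0"
  obtains d where "d > 0" "\<And>\<epsilon> a. 0 < \<epsilon> \<Longrightarrow> \<epsilon> + norm a < d \<Longrightarrow>
    (\<integral>\<^sup>+x. ennreal (norm (conv (rho \<epsilon>) f (x - a) - f x)) \<partial>lborel) \<le> ennreal e"
proof -
  have [measurable]: "f \<in> borel_measurable borel" using f by auto
  obtain d where d: "d > 0"
    "\<And>y. norm y < d \<Longrightarrow> (\<integral>\<^sup>+x. ennreal (norm (f (x - y) - f x)) \<partial>lborel) < ennreal e"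
    using integrable_translation_continuous[OF f] \<open>e > 0\<close> unfolding translation_continuous_def by blast
  have "(\<integral>\<^sup>+x. ennreal (norm (conv (rho \<epsilon>) f (x - a) - f x)) \<partial>lborel) \<le> ennreal e"
    if \<epsilon>: "0 < \<epsilon>" "\<epsilon> + norm a < d" for \<epsilon> a
  proof -
    have [measurable]: "(rho \<epsilon> :: 'a \<Rightarrow> real) \<in> borel_measurable borel"
      using C1c_measurable[OF rho_C1c] \<epsilon> by auto
    obtain B where B: "\<And>x::'a. \<bar>rho \<epsilon> x\<bar> \<le> B" using C1c_bounded[OF rho_C1c[OF \<epsilon>(1)]] by metis
    have int: "integrable lborel (rho \<epsilon> :: 'a \<Rightarrow> real)" using C1c_integrable[OF rho_C1c[OF \<epsilon>(1)]] by auto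
    have one: "(\<integral>\<^sup>+z. ennreal (rho \<epsilon> (z::'a)) \<partial>lborel) = 1"
      using nn_integral_eq_integral[OF int AE_I2[OF rho_nonneg[OF \<epsilon>(1)]]] rho_integral[OF \<epsilon>(1), where 'a='a] by simp
    have pt: "ennreal (norm (conv (rho \<epsilon>) f (x - a) - f x)) \<le> (\<integral>\<^sup>+z. ennreal (rho \<epsilon> z * norm (f (x - (a + z)) - f x)) \<partial>lborel)" for x
    proof -
      have i: "integrable lborel (\<lambda>z. rho \<epsilon> z *\<^sub>R f (x - (a + z)))"
        using integrable_scaleR_bounded[OF integrable_reflect[OF f, of "x - a"] _ B] by (simp add: algebra_simps)
      have "conv (rho \<epsilon>) f (x - a) = (\<integral>z. rho \<epsilon> z *\<^sub>R f (x - (a + z)) \<partial>lborel)"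
        by (subst conv_translate) (auto simp: algebra_simps)
      moreover have "f x = (\<integral>z. rho \<epsilon> (z::'a) *\<^sub>R f x \<partial>lborel)"
        using int rho_integral[OF \<epsilon>(1), where 'a='a] by (subst integral_scaleR_left) simp_all
      ultimately have "conv (rho \<epsilon>) f (x - a) - f x = (\<integral>z. rho \<epsilon> z *\<^sub>R f (x - (a + z)) \<partial>lborel) - (\<integral>z. rho \<epsilon> (z::'a) *\<^sub>R f x \<partial>lborel)"
        by simp
      also have "\<dots> = (\<integral>z. rho \<epsilon> z *\<^sub>R f (x - (a + z)) - rho \<epsilon> z *\<^sub>R f x \<partial>lborel)"
        using i int by (intro Bochner_Integration.integral_diff[symmetric]) auto
      also have "ennreal (norm \<dots>) \<le> (\<integral>\<^sup>+z. ennreal (norm (rho \<epsilon> z *\<^sub>R f (x - (a + z)) - rho \<epsilon> z *\<^sub>R f x)) \<partial>lborel)"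
        using i int by (intro integral_norm_bound_ennreal Bochner_Integration.integrable_diff) auto
      also have "\<dots> = (\<integral>\<^sup>+z. ennreal (rho \<epsilon> z * norm (f (x - (a + z)) - f x)) \<partial>lborel)"
        by (intro nn_integral_cong) (simp add: rho_nonneg[OF \<epsilon>(1)] flip: scaleR_diff_right)
      finally show ?thesis .
    qed
    have "(\<integral>\<^sup>+x. ennreal (norm (conv (rho \<epsilon>) f (x - a) - f x)) \<partial>lborel) \<le>
       (\<integral>\<^sup>+x. (\<integral>\<^sup>+z. ennreal (rho \<epsilon> z * norm (f (x - (a + z)) - f x)) \<partial>lborel) \<partial>lborel)"
      by (intro nn_integral_mono pt)
    also have "\<dots> = (\<integral>\<^sup>+z. (\<integral>\<^sup>+x. ennreal (rho \<epsilon> z * norm (f (x - (a + z)) - f x)) \<partial>lborel) \<partial>lborel)"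
      by (rule lborel_pair.Fubini') measurable
    also have "\<dots> = (\<integral>\<^sup>+z. ennreal (rho \<epsilon> z) * (\<integral>\<^sup>+x. ennreal (norm (f (x - (a + z)) - f x)) \<partial>lborel) \<partial>lborel)"
      by (intro nn_integral_cong) (simp add: rho_nonneg[OF \<epsilon>(1)] ennreal_mult nn_integral_cmult)
    also have "\<dots> \<le> (\<integral>\<^sup>+z. ennreal (rho \<epsilon> (z::'a)) * ennreal e \<partial>lborel)"
    proof (rule nn_integral_mono)
      fix z :: 'a
      show "ennreal (rho \<epsilon> z) * (\<integral>\<^sup>+x. ennreal (norm (f (x - (a + z)) - f x)) \<partial>lborel) \<le> ennreal (rho \<epsilon> z) * ennreal e"
      proof (cases "norm z < \<epsilon>")
        case True
        then have "norm (a + z) < d" using \<epsilon> norm_triangle_ineq[of a z] by simp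
        then show ?thesis by (intro mult_left_mono less_imp_le[OF d(2)]) auto
      qed (simp add: rho_outside[OF \<epsilon>(1)])
    qed
    also have "\<dots> = ennreal e" by (simp add: nn_integral_multc one)
    finally show ?thesis .
  qed
  then show ?thesis using that d(1) by blast
qed

text \<open>The gradient of the kernel has integral zero, so the constant \<open>c\<close> may be subtracted from \<open>f\<close>.
  There remains the oscillation \<open>\<delta>\<close> times the \<open>L\<^sup>1\<close> norm of the gradient of the kernel.\<close>

lemma conv_grad_bound:
  fixes f :: "'a::euclidean_space \<Rightarrow> real"
  assumes f: "integrable lborel f" and \<epsilon>: "\<epsilon> > 0" and b: "norm b \<le> 1"
    and osc: "\<And>y. norm (x - y) < \<epsilon> \<Longrightarrow> \<bar>f y - c\<bar> \<le> \<delta>"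
  shows "\<bar>conv (\<lambda>z. gr (rho \<epsilon>) z \<bullet> b) f x\<bar> \<le> (\<integral>x. norm (gr (rho 1) x) \<partial>(lborel :: 'a measure)) * \<delta> / \<epsilon>"
proof -
  note m[measurable] = C1c_measurable[OF rho_C1c[OF \<epsilon>]]
  have "\<delta> \<ge> 0" using osc[of x] \<epsilon> by auto
  have gi: "integrable lborel (gr (rho \<epsilon>) :: 'a \<Rightarrow> 'a)" using C1c_integrable[OF rho_C1c[OF \<epsilon>]] by auto
  obtain B where B: "\<And>x. norm (gr (rho \<epsilon>) (x::'a)) \<le> B" using C1c_bounded[OF rho_C1c[OF \<epsilon>]] by metis
  have bb: "\<bar>gr (rho \<epsilon>) (z::'a) \<bullet> b\<bar> \<le> norm (gr (rho \<epsilon>) z)" for z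
    using Cauchy_Schwarz_ineq2[of "gr (rho \<epsilon>) z" b] mult_left_mono[OF b norm_ge_zero[of "gr (rho \<epsilon>) z"]] by simp
  have out: "rho \<epsilon> y = 0" if "y \<in> - cball 0 \<epsilon>" for y :: 'a
    using that by (intro rho_outside[OF \<epsilon>]) auto
  have g0: "gr (rho \<epsilon>) z = 0" if "norm z \<ge> \<epsilon>" for z :: 'a
  proof (cases "norm z = \<epsilon>")
    case False
    have "frechet_derivative (rho \<epsilon>) (at z) h = 0" for h
      by (rule frechet_derivative_zero_outside[of "- cball (0::'a) \<epsilon>", OF out])
        (use that False in auto)
    then show ?thesis by (simp add: gr_def)
  next
    case True
    \<comment> \<open>on the sphere the gradient vanishes as a limit of values outside the ball\<close>
    have "isCont (gr (rho \<epsilon>)) z"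
      using C1c_continuous(2)[OF rho_C1c[OF \<epsilon>]] continuous_on_eq_continuous_at by blast
    moreover have "((\<lambda>t::real. t *\<^sub>R z) \<longlongrightarrow> 1 *\<^sub>R z) (at_right 1)"
      by (intro tendsto_intros)
    ultimately have "((\<lambda>t::real. gr (rho \<epsilon>) (t *\<^sub>R z)) \<longlongrightarrow> gr (rho \<epsilon>) z) (at_right 1)"
      using isCont_tendsto_compose[of z "gr (rho \<epsilon>)"] by simp
    moreover have "gr (rho \<epsilon>) (t *\<^sub>R z) = 0" if "t > 1" for t
    proof -
      have "frechet_derivative (rho \<epsilon>) (at (t *\<^sub>R z)) h = 0" for h
        by (rule frechet_derivative_zero_outside[of "- cball (0::'a) \<epsilon>", OF out])
          (use that True \<epsilon> in auto)
      then show ?thesis by (simp add: gr_def)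
    qed
    then have "((\<lambda>t::real. gr (rho \<epsilon>) (t *\<^sub>R z)) \<longlongrightarrow> 0) (at_right 1)"
      by (intro tendsto_eventually) (auto simp: eventually_at_right_field intro!: exI[of _ 2])
    ultimately show ?thesis using tendsto_unique[OF trivial_limit_at_right_real] by blast
  qed
  have i1: "integrable lborel (\<lambda>y. (gr (rho \<epsilon>) (x - y) \<bullet> b) *\<^sub>R f y)"
    using conv_integrable[OF f, of "\<lambda>z. gr (rho \<epsilon>) z \<bullet> b" B x] bb B order_trans by fastforce
  have i2: "integrable lborel (\<lambda>y. (gr (rho \<epsilon>) (x - y) \<bullet> b))"
    using integrable_reflect[OF gi, of x] by auto
  have "(\<integral>y. (gr (rho \<epsilon>) (x - y) \<bullet> b) \<partial>lborel) = 0"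
    using C1c_integral_deriv[OF rho_C1c[OF \<epsilon>], of b] integral_reflect[of "\<lambda>y. gr (rho \<epsilon>) y \<bullet> b" x] by simp
  then have "conv (\<lambda>z. gr (rho \<epsilon>) z \<bullet> b) f x = (\<integral>y. (gr (rho \<epsilon>) (x - y) \<bullet> b) * (f y - c) \<partial>lborel)"
    using i1 i2 by (simp add: conv_def right_diff_distrib)
  also have "\<bar>\<dots>\<bar> \<le> (\<integral>y. \<bar>(gr (rho \<epsilon>) (x - y) \<bullet> b) * (f y - c)\<bar> \<partial>lborel)"
    by (rule integral_abs_bound)
  also have "\<dots> \<le> (\<integral>y. \<delta> * norm (gr (rho \<epsilon>) (x - y)) \<partial>lborel)"
  proof (rule Bochner_Integration.integral_mono)
    show "integrable lborel (\<lambda>y. \<bar>(gr (rho \<epsilon>) (x - y) \<bullet> b) * (f y - c)\<bar>)"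
      using i1 i2 by (auto simp: right_diff_distrib)
    show "integrable lborel (\<lambda>y. \<delta> * norm (gr (rho \<epsilon>) (x - y)))"
      using integrable_reflect[OF gi, of x] by auto
    fix y
    show "\<bar>(gr (rho \<epsilon>) (x - y) \<bullet> b) * (f y - c)\<bar> \<le> \<delta> * norm (gr (rho \<epsilon>) (x - y))"
      using mult_mono[OF bb[of "x - y"] osc[of y]] g0[of "x - y"]
      by (cases "norm (x - y) < \<epsilon>") (auto simp: abs_mult mult_ac)
  qed
  also have "\<dots> = \<delta> * (\<integral>y. norm (gr (rho \<epsilon>) y) \<partial>(lborel :: 'a measure))"
    using integral_reflect[of "\<lambda>y. norm (gr (rho \<epsilon>) y)" x] by simp
  finally show ?thesis using rho_grad_integral[OF \<epsilon>, where 'a='a] by (simp add: mult_ac)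
qed

section \<open>Strong Sobolev functions\<close>

definition sdist :: "('a::euclidean_space \<Rightarrow> real) \<Rightarrow> ('a \<Rightarrow> 'a) \<Rightarrow> ('a \<Rightarrow> real) \<Rightarrow> ('a \<Rightarrow> 'a) \<Rightarrow> ennreal" where
  "sdist f g f' g' = (\<integral>\<^sup>+x. ennreal (\<bar>f x - f' x\<bar> + norm (g x - g' x)) \<partial>lborel)"

text \<open>\<open>g\<close> is the gradient of \<open>f\<close> in the strong sense: the pair is a limit of continuously differentiable
  functions of compact support in the whole space, with distances measured in \<open>W\<^sup>1\<^sup>,\<^sup>1\<close>.  Properties of
  such limits follow from those of smooth functions, and no boundary terms occur.\<close>

definition sob :: "('a::euclidean_space \<Rightarrow> real) \<Rightarrow> ('a \<Rightarrow> 'a) \<Rightarrow> bool" where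
  "sob f g \<longleftrightarrow> integrable lborel f \<and> integrable lborel g \<and>
     (\<forall>e>0. \<exists>\<phi> d\<phi>. C1c \<phi> d\<phi> \<and> sdist \<phi> d\<phi> f g < ennreal e)"

lemma sobD:
  assumes "sob f g"
  shows "integrable lborel f" "integrable lborel g" "f \<in> borel_measurable borel" "g \<in> borel_measurable borel"
  using assms by (auto simp: sob_def)

lemma sob_approx:
  assumes "sob f g" "e > 0"
  obtains \<phi> d\<phi> where "C1c \<phi> d\<phi>" "sdist \<phi> d\<phi> f g < ennreal e"
  using assms unfolding sob_def by blast

lemma sdist_triangle:
  assumes [measurable]: "f \<in> borel_measurable borel" "g \<in> borel_measurable borel"
    "f' \<in> borel_measurable borel" "g' \<in> borel_measurable borel"
    "f'' \<in> borel_measurable borel" "g'' \<in> borel_measurable borel"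
  shows "sdist f g f'' g'' \<le> sdist f g f' g' + sdist f' g' f'' g''"
proof -
  have "sdist f g f'' g'' \<le> (\<integral>\<^sup>+x. ennreal (\<bar>f x - f' x\<bar> + norm (g x - g' x))
      + ennreal (\<bar>f' x - f'' x\<bar> + norm (g' x - g'' x)) \<partial>lborel)"
    unfolding sdist_def by (intro nn_integral_mono) (simp flip: ennreal_plus, norm)
  also have "\<dots> = sdist f g f' g' + sdist f' g' f'' g''"
    unfolding sdist_def by (rule nn_integral_add) measurable
  finally show ?thesis .
qed

lemma sob_limit:
  assumes i: "integrable lborel f" "integrable lborel g"
    and appr: "\<And>e. e > 0 \<Longrightarrow> \<exists>f' g'. sob f' g' \<and> sdist f' g' f g < ennreal e"
  shows "sob f g"
  unfolding sob_def
proof (intro conjI i allI impI)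
  fix e :: real assume "e > 0"
  then have "e/2 > 0" by simp
  obtain f' g' where 1: "sob f' g'" "sdist f' g' f g < ennreal (e/2)" using appr[OF \<open>e/2 > 0\<close>] by blast
  obtain \<phi> d\<phi> where 2: "C1c \<phi> d\<phi>" "sdist \<phi> d\<phi> f' g' < ennreal (e/2)" using sob_approx[OF 1(1) \<open>e/2 > 0\<close>] by blast
  have "sdist \<phi> d\<phi> f g \<le> sdist \<phi> d\<phi> f' g' + sdist f' g' f g"
    using i sobD[OF 1(1)] C1c_measurable[OF 2(1)] by (intro sdist_triangle) auto
  also have "\<dots> < ennreal (e/2) + ennreal (e/2)" by (intro ennreal_add_strict_mono 1 2)
  also have "\<dots> = ennreal e" using \<open>e > 0\<close> by (simp flip: ennreal_plus)
  finally show "\<exists>\<phi> d\<phi>. C1c \<phi> d\<phi> \<and> sdist \<phi> d\<phi> f g < ennreal e" using 2 by blast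
qed

lemma C1c_sob:
  assumes "C1c \<phi> d\<phi>"
  shows "sob \<phi> d\<phi>"
  unfolding sob_def
proof (intro conjI allI impI C1c_integrable[OF assms])
  fix e :: real assume "e > 0"
  then show "\<exists>\<psi> d\<psi>. C1c \<psi> d\<psi> \<and> sdist \<psi> d\<psi> \<phi> d\<phi> < ennreal e"
    by (intro exI[of _ \<phi>] exI[of _ d\<phi>]) (simp add: assms sdist_def)
qed

lemma sob_add:
  assumes "sob f g" "sob f' g'"
  shows "sob (\<lambda>x. f x + f' x) (\<lambda>x. g x + g' x)"
  unfolding sob_def
proof (intro conjI allI impI)
  note m[measurable] = sobD(3,4)[OF assms(1)] sobD(3,4)[OF assms(2)]
  fix e :: real assume "e > 0"
  then have "e/2 > 0" by simp
  obtain \<phi> d\<phi> where 1: "C1c \<phi> d\<phi>" "sdist \<phi> d\<phi> f g < ennreal (e/2)" using sob_approx[OF assms(1) \<open>e/2 > 0\<close>] by blast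
  obtain \<psi> d\<psi> where 2: "C1c \<psi> d\<psi>" "sdist \<psi> d\<psi> f' g' < ennreal (e/2)" using sob_approx[OF assms(2) \<open>e/2 > 0\<close>] by blast
  note [measurable] = C1c_measurable[OF 1(1)] C1c_measurable[OF 2(1)]
  have "sdist (\<lambda>x. \<phi> x + \<psi> x) (\<lambda>x. d\<phi> x + d\<psi> x) (\<lambda>x. f x + f' x) (\<lambda>x. g x + g' x) \<le>
      (\<integral>\<^sup>+x. ennreal (\<bar>\<phi> x - f x\<bar> + norm (d\<phi> x - g x)) + ennreal (\<bar>\<psi> x - f' x\<bar> + norm (d\<psi> x - g' x)) \<partial>lborel)"
    unfolding sdist_def by (intro nn_integral_mono) (simp flip: ennreal_plus, norm)
  also have "\<dots> = sdist \<phi> d\<phi> f g + sdist \<psi> d\<psi> f' g'"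
    unfolding sdist_def by (rule nn_integral_add) measurable
  also have "\<dots> < ennreal (e/2) + ennreal (e/2)" by (intro ennreal_add_strict_mono 1 2)
  also have "\<dots> = ennreal e" using \<open>e > 0\<close> by (simp flip: ennreal_plus)
  finally show "\<exists>\<phi> d\<phi>. C1c \<phi> d\<phi> \<and> sdist \<phi> d\<phi> (\<lambda>x. f x + f' x) (\<lambda>x. g x + g' x) < ennreal e"
    using C1c_add[OF 1(1) 2(1)] by blast
qed (use sobD[OF assms(1)] sobD[OF assms(2)] in auto)

lemma sob_uminus:
  assumes "sob f g"
  shows "sob (\<lambda>x. - f x) (\<lambda>x. - g x)"
  unfolding sob_def
proof (intro conjI allI impI)
  fix e :: real assume "e > 0"
  obtain \<phi> d\<phi> where 1: "C1c \<phi> d\<phi>" "sdist \<phi> d\<phi> f g < ennreal e" using sob_approx[OF assms(1) \<open>e > 0\<close>] by blast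
  have eq: "\<bar>- \<phi> x - - f x\<bar> = \<bar>\<phi> x - f x\<bar>" "norm (- d\<phi> x - - g x) = norm (d\<phi> x - g x)" for x
    by (auto simp: norm_minus_commute)
  have "sdist (\<lambda>x. - \<phi> x) (\<lambda>x. - d\<phi> x) (\<lambda>x. - f x) (\<lambda>x. - g x) = sdist \<phi> d\<phi> f g"
    unfolding sdist_def eq ..
  then show "\<exists>\<phi> d\<phi>. C1c \<phi> d\<phi> \<and> sdist \<phi> d\<phi> (\<lambda>x. - f x) (\<lambda>x. - g x) < ennreal e"
    using C1c_uminus[OF 1(1)] 1(2) by metis
qed (use sobD[OF assms(1)] in auto)

lemma sob_diff:
  assumes "sob f g" "sob f' g'"
  shows "sob (\<lambda>x. f x - f' x) (\<lambda>x. g x - g' x)"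
  using sob_add[OF assms(1) sob_uminus[OF assms(2)]] by simp

text \<open>Along a rapidly converging sequence of approximations \<open>\<phi> k\<close>, the values \<open>T' (\<phi> k x)\<close> converge almost
  everywhere and the errors have an integrable majorant, so the chain rule survives the limit.\<close>

lemma sob_compose:
  assumes fg: "sob f g" and T: "\<And>s. (T has_real_derivative T' s) (at s)" "continuous_on UNIV T'" "T 0 = 0"
    "\<And>s. \<bar>T' s\<bar> \<le> 1"
  shows "sob (\<lambda>x. T (f x)) (\<lambda>x. T' (f x) *\<^sub>R g x)"
  unfolding sob_def
proof (intro conjI allI impI)
  note m[measurable] = sobD(3,4)[OF fg]
  have lip: "\<bar>T s - T t\<bar> \<le> \<bar>s - t\<bar>" for s t
  proof -
    have "norm (T s - T t) \<le> 1 * norm (s - t)"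
      by (rule field_differentiable_bound[of UNIV T T']) (use T in auto)
    then show ?thesis by simp
  qed
  have mT[measurable]: "T \<in> borel_measurable borel" "T' \<in> borel_measurable borel"
    using T by (auto intro!: borel_measurable_continuous_onI continuous_at_imp_continuous_on DERIV_isCont)
  show "integrable lborel (\<lambda>x. T' (f x) *\<^sub>R g x)"
    by (rule integrable_scaleR_bounded[OF sobD(2)[OF fg] _ T(4)]) measurable
  show "integrable lborel (\<lambda>x. T (f x))"
    by (rule Bochner_Integration.integrable_bound[OF sobD(1)[OF fg]]) (use lip[of _ 0] T(3) in auto)
  fix e :: real assume "e > 0"
  have "\<exists>\<phi> d\<phi>. C1c \<phi> d\<phi> \<and> sdist \<phi> d\<phi> f g < ennreal ((1/2) ^ k)" for k
    using sob_approx[OF fg, of "(1/2)^k"] by (metis zero_less_power half_gt_zero zero_less_one)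
  then obtain \<phi> d\<phi> where \<phi>: "\<And>k. C1c (\<phi> k) (d\<phi> k)" "\<And>k. sdist (\<phi> k) (d\<phi> k) f g < ennreal ((1/2) ^ k)"
    by metis
  note [measurable] = C1c_measurable[OF \<phi>(1)]
  define r where "r k x = \<bar>\<phi> k x - f x\<bar> + norm (d\<phi> k x - g x)" for k x
  obtain S where S[measurable]: "S \<in> borel_measurable lborel" and S0: "\<And>x. 0 \<le> S x"
    and Sfin: "(\<integral>\<^sup>+x. ennreal (S x) \<partial>lborel) < \<infinity>"
    and Sae: "AE x in lborel. (\<forall>k. r k x \<le> S x) \<and> (\<lambda>k. r k x) \<longlonglongrightarrow> 0"
  proof (rule fast_convergence[of r lborel])
    show "r k \<in> borel_measurable lborel" for k unfolding r_def by measurable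
    show "(\<integral>\<^sup>+x. ennreal (r k x) \<partial>lborel) \<le> ennreal ((1/2) ^ k)" for k
      using \<phi>(2)[of k] by (simp add: r_def sdist_def)
  qed (auto simp: r_def)
  have [measurable]: "r k \<in> borel_measurable borel" for k unfolding r_def by measurable
  define u where "u k x = 2 * r k x + \<bar>T' (\<phi> k x) - T' (f x)\<bar> * norm (g x)" for k x
  have "(\<lambda>k. \<integral>\<^sup>+x. ennreal (u k x) \<partial>lborel) \<longlonglongrightarrow> (\<integral>\<^sup>+x. ennreal 0 \<partial>(lborel :: 'a measure))"
  proof (rule nn_integral_dominated_convergence[where w="\<lambda>x. ennreal (2 * S x + 2 * norm (g x))"])
    show "(\<lambda>x. ennreal (u k x)) \<in> borel_measurable lborel" for k unfolding u_def by measurable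
    have "(\<integral>\<^sup>+x. ennreal (2 * S x + 2 * norm (g x)) \<partial>lborel) = 2 * (\<integral>\<^sup>+x. ennreal (S x) \<partial>lborel) + 2 * (\<integral>\<^sup>+x. ennreal (norm (g x)) \<partial>lborel)"
      using S0 by (simp add: ennreal_mult nn_integral_add nn_integral_cmult)
    then show "(\<integral>\<^sup>+x. ennreal (2 * S x + 2 * norm (g x)) \<partial>lborel) < \<infinity>"
      using Sfin sobD(2)[OF fg] by (simp add: integrable_iff_bounded ennreal_mult_less_top)
    show "AE x in lborel. ennreal (u k x) \<le> ennreal (2 * S x + 2 * norm (g x))" for k
      using Sae
    proof eventually_elim
      case (elim x)
      have "\<bar>T' (\<phi> k x) - T' (f x)\<bar> \<le> 2" using T(4)[of "\<phi> k x"] T(4)[of "f x"] by linarith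
      then have "u k x \<le> 2 * S x + 2 * norm (g x)"
        unfolding u_def using elim by (intro add_mono mult_right_mono mult_left_mono) auto
      then show ?case by (rule ennreal_leI)
    qed
    show "AE x in lborel. (\<lambda>k. ennreal (u k x)) \<longlonglongrightarrow> ennreal 0"
      using Sae
    proof eventually_elim
      case (elim x)
      have "(\<lambda>k. \<phi> k x - f x) \<longlonglongrightarrow> 0"
        by (rule Lim_null_comparison[of _ "\<lambda>k. r k x"]) (use elim in \<open>auto simp: r_def\<close>)
      then have "(\<lambda>k. \<phi> k x) \<longlonglongrightarrow> f x" by (simp add: LIM_zero_iff)
      moreover have "isCont T' (f x)" using T(2) by (simp add: continuous_on_eq_continuous_at)
      ultimately have "(\<lambda>k. T' (\<phi> k x)) \<longlonglongrightarrow> T' (f x)" by (rule isCont_tendsto_compose[rotated])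
      then have "(\<lambda>k. u k x) \<longlonglongrightarrow> 2 * 0 + \<bar>T' (f x) - T' (f x)\<bar> * norm (g x)"
        unfolding u_def using elim by (intro tendsto_intros) auto
      then show ?case by (intro tendsto_ennrealI) simp
    qed
  qed simp_all
  then have "(\<lambda>k. \<integral>\<^sup>+x. ennreal (u k x) \<partial>lborel) \<longlonglongrightarrow> 0" by simp
  then have "\<forall>\<^sub>F k in sequentially. (\<integral>\<^sup>+x. ennreal (u k x) \<partial>lborel) < ennreal e"
    using \<open>e > 0\<close> by (intro order_tendstoD(2)) auto
  then obtain k where k: "(\<integral>\<^sup>+x. ennreal (u k x) \<partial>lborel) < ennreal e" by (auto simp: eventually_sequentially)
  have "sdist (\<lambda>x. T (\<phi> k x)) (\<lambda>x. T' (\<phi> k x) *\<^sub>R d\<phi> k x) (\<lambda>x. T (f x)) (\<lambda>x. T' (f x) *\<^sub>R g x)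
    \<le> (\<integral>\<^sup>+x. ennreal (u k x) \<partial>lborel)"
    unfolding sdist_def
  proof (intro nn_integral_mono ennreal_leI)
    fix x
    have "T' (\<phi> k x) *\<^sub>R d\<phi> k x - T' (f x) *\<^sub>R g x =
       T' (\<phi> k x) *\<^sub>R (d\<phi> k x - g x) + (T' (\<phi> k x) - T' (f x)) *\<^sub>R g x"
      by (simp add: algebra_simps)
    then have "norm (T' (\<phi> k x) *\<^sub>R d\<phi> k x - T' (f x) *\<^sub>R g x) \<le>
       \<bar>T' (\<phi> k x)\<bar> * norm (d\<phi> k x - g x) + \<bar>T' (\<phi> k x) - T' (f x)\<bar> * norm (g x)"
      using norm_triangle_ineq by (metis norm_scaleR)
    moreover have "\<bar>T' (\<phi> k x)\<bar> * norm (d\<phi> k x - g x) \<le> 1 * norm (d\<phi> k x - g x)"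
      by (intro mult_right_mono T) auto
    ultimately show "\<bar>T (\<phi> k x) - T (f x)\<bar> + norm (T' (\<phi> k x) *\<^sub>R d\<phi> k x - T' (f x) *\<^sub>R g x) \<le> u k x"
      using lip[of "\<phi> k x" "f x"] norm_ge_zero[of "d\<phi> k x - g x"] abs_ge_zero[of "\<phi> k x - f x"]
      unfolding u_def r_def by argo
  qed
  then show "\<exists>\<phi> d\<phi>. C1c \<phi> d\<phi> \<and> sdist \<phi> d\<phi> (\<lambda>x. T (f x)) (\<lambda>x. T' (f x) *\<^sub>R g x) < ennreal e"
    using k C1c_compose[OF \<phi>(1) T(1-3)] order_le_less_trans by blast
qed

text \<open>A continuously differentiable approximation of the positive part whose derivative lies between
  \<open>0\<close> and \<open>1\<close>.\<close>

definition spos :: "real \<Rightarrow> real \<Rightarrow> real" where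
  "spos e u = (max 0 u)\<^sup>2 / (max 0 u + e)"

lemma spos_deriv:
  assumes "e > 0"
  shows "(spos e has_real_derivative (1 - e\<^sup>2 / (max 0 u + e)\<^sup>2)) (at u)"
proof (cases u "0::real" rule: linorder_cases)
  case less
  have "((\<lambda>_. 0) has_real_derivative (1 - e\<^sup>2 / (max 0 u + e)\<^sup>2)) (at u)"
    using less assms by simp
  then show ?thesis
    by (rule has_field_derivative_transform_within_open[of _ _ _ "{..<0}"])
      (use less in \<open>auto simp: spos_def\<close>)
next
  case greater
  have "((\<lambda>u. u\<^sup>2 / (u + e)) has_real_derivative ((2 * u) * (u + e) - u\<^sup>2 * 1) / ((u + e) * (u + e))) (at u)"
    using greater assms by (intro DERIV_divide) (auto intro!: derivative_eq_intros)
  also have "((2 * u) * (u + e) - u\<^sup>2 * 1) / ((u + e) * (u + e)) = 1 - e\<^sup>2 / (max 0 u + e)\<^sup>2"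
  proof -
    define k where "k = u + e"
    have k: "k > 0" "max 0 u + e = k" "u + e = k" using greater assms by (auto simp: k_def)
    have "2 * u * k - u\<^sup>2 * 1 = k\<^sup>2 - e\<^sup>2" by (simp add: k_def algebra_simps power2_eq_square)
    then show ?thesis using k by (simp add: diff_divide_distrib power2_eq_square)
  qed
  finally show ?thesis
    by (rule has_field_derivative_transform_within_open[of _ _ _ "{0<..}"])
      (use greater in \<open>auto simp: spos_def\<close>)
next
  case equal
  have "((\<lambda>h. (spos e (0 + h) - spos e 0) / h) \<longlongrightarrow> 0) (at 0)"
  proof (rule Lim_null_comparison)
    show "\<forall>\<^sub>F h in at 0. norm ((spos e (0 + h) - spos e 0) / h) \<le> \<bar>h\<bar> / e"
    proof (intro always_eventually allI)
      fix h :: real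
      show "norm ((spos e (0 + h) - spos e 0) / h) \<le> \<bar>h\<bar> / e"
      proof (cases "h > 0")
        case True
        then have "(spos e (0 + h) - spos e 0) / h = h / (h + e)"
          by (simp add: spos_def power2_eq_square)
        also have "\<bar>\<dots>\<bar> \<le> h / e" using True assms by (simp add: frac_le)
        finally show ?thesis using True by simp
      next
        case False
        then have "max 0 h = 0" by simp
        then have "spos e (0 + h) - spos e 0 = 0" by (simp add: spos_def)
        then show ?thesis using assms by (simp only: div_0 norm_zero) simp
      qed
    qed
    show "((\<lambda>h. \<bar>h\<bar> / e) \<longlongrightarrow> 0) (at (0::real))" using assms by (auto intro!: tendsto_eq_intros)
  qed
  then show ?thesis using equal assms by (simp add: DERIV_def)
qed

text \<open>The derivatives of the functions \<open>spos (\<epsilon> n)\<close> converge pointwise to the indicator function of the positive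
  half line, with value \<open>0\<close> at \<open>0\<close>; this determines the gradient on the level set \<open>f x = b\<close>.\<close>

lemma sob_pos_part:
  assumes fg: "sob f g" and "b \<ge> 0"
  shows "sob (\<lambda>x. max 0 (f x - b)) (\<lambda>x. if f x > b then g x else 0)"
proof (rule sob_limit)
  note m[measurable] = sobD(3,4)[OF fg]
  have c01: "\<bar>if f x > b then 1 else 0\<bar> \<le> (1::real)" for x by auto
  have "integrable lborel (\<lambda>x. (if f x > b then 1 else 0) *\<^sub>R g x)"
    by (rule integrable_scaleR_bounded[OF sobD(2)[OF fg] _ c01]) measurable
  then show "integrable lborel (\<lambda>x. if f x > b then g x else 0)"
    by (rule back_subst[of "integrable lborel"]) auto
  show "integrable lborel (\<lambda>x. max 0 (f x - b))"
    by (rule Bochner_Integration.integrable_bound[OF sobD(1)[OF fg]]) (use \<open>b \<ge> 0\<close> in auto)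
  fix e :: real assume "e > 0"
  define \<epsilon> where "\<epsilon> n = 1 / real (Suc n)" for n
  have \<epsilon>: "\<epsilon> n > 0" for n by (simp add: \<epsilon>_def)
  have \<epsilon>0: "\<epsilon> \<longlonglongrightarrow> 0" unfolding \<epsilon>_def by (rule LIMSEQ_Suc[OF lim_1_over_n])
  define T where "T n s = spos (\<epsilon> n) (s - b)" for n s
  define T' where "T' n s = 1 - (\<epsilon> n)\<^sup>2 / (max 0 (s - b) + \<epsilon> n)\<^sup>2" for n s
  have le1: "(\<epsilon> n)\<^sup>2 / (max 0 (s - b) + \<epsilon> n)\<^sup>2 \<le> 1" "0 \<le> (\<epsilon> n)\<^sup>2 / (max 0 (s - b) + \<epsilon> n)\<^sup>2" for n s
    using \<epsilon>[of n] by (auto simp: divide_le_eq_1 intro!: power_mono)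
  have sb: "sob (\<lambda>x. T n (f x)) (\<lambda>x. T' n (f x) *\<^sub>R g x)" for n
  proof (rule sob_compose[OF fg])
    show "(T n has_real_derivative T' n s) (at s)" for s
    proof -
      have "((\<lambda>s. s - b) has_real_derivative 1) (at s)" by (auto intro!: derivative_eq_intros)
      from DERIV_chain2[OF spos_deriv[OF \<epsilon>] this] show ?thesis by (simp add: T_def[abs_def] T'_def)
    qed
    have "max 0 (s - b) + \<epsilon> n \<noteq> 0" for s using \<epsilon>[of n] by (smt (verit))
    then show "continuous_on UNIV (T' n)" unfolding T'_def by (intro continuous_intros) auto
    show "T n 0 = 0" using \<open>b \<ge> 0\<close> by (simp add: T_def spos_def)
    show "\<bar>T' n s\<bar> \<le> 1" for s using le1[of n s] by (simp add: T'_def abs_le_iff)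
  qed
  define u where "u n x = \<bar>T n (f x) - max 0 (f x - b)\<bar> + norm (T' n (f x) *\<^sub>R g x - (if f x > b then g x else 0))" for n x
  have T1: "\<bar>T n s - max 0 (s - b)\<bar> \<le> \<epsilon> n" "\<bar>T n s - max 0 (s - b)\<bar> \<le> \<bar>s\<bar>" for n s
  proof -
    define m where "m = max 0 (s - b)"
    have m0: "m \<ge> 0" "m \<le> \<bar>s\<bar>" using \<open>b \<ge> 0\<close> by (auto simp: m_def)
    have "T n s - m = - (m * (\<epsilon> n / (m + \<epsilon> n)))"
      using \<epsilon>[of n] m0 by (simp add: T_def spos_def m_def[symmetric] field_simps power2_eq_square)
    then have eq: "\<bar>T n s - m\<bar> = m * (\<epsilon> n / (m + \<epsilon> n))" "m * (\<epsilon> n / (m + \<epsilon> n)) = \<epsilon> n * (m / (m + \<epsilon> n))"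
      using \<epsilon>[of n] m0 by (auto simp: abs_mult)
    have "m * (\<epsilon> n / (m + \<epsilon> n)) \<le> m * 1"
      using \<epsilon>[of n] m0 by (intro mult_left_mono) (auto simp: divide_le_eq_1)
    moreover have "\<epsilon> n * (m / (m + \<epsilon> n)) \<le> \<epsilon> n * 1"
      using \<epsilon>[of n] m0 by (intro mult_left_mono) (auto simp: divide_le_eq_1)
    ultimately show "\<bar>T n s - max 0 (s - b)\<bar> \<le> \<epsilon> n" "\<bar>T n s - max 0 (s - b)\<bar> \<le> \<bar>s\<bar>"
      using eq m0 unfolding m_def[symmetric] by linarith+
  qed
  have [measurable]: "(\<lambda>x. T n (f x)) \<in> borel_measurable borel" "(\<lambda>x. T' n (f x) *\<^sub>R g x) \<in> borel_measurable borel" for n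
    using sobD[OF sb] by auto
  have "(\<lambda>n. \<integral>\<^sup>+x. ennreal (u n x) \<partial>lborel) \<longlonglongrightarrow> (\<integral>\<^sup>+x. ennreal 0 \<partial>(lborel :: 'a measure))"
  proof (rule nn_integral_dominated_convergence[where w="\<lambda>x. ennreal (\<bar>f x\<bar> + norm (g x))"])
    show "(\<lambda>x. ennreal (u n x)) \<in> borel_measurable lborel" for n unfolding u_def by measurable
    have "(\<integral>\<^sup>+x. ennreal (\<bar>f x\<bar> + norm (g x)) \<partial>lborel) = (\<integral>\<^sup>+x. ennreal \<bar>f x\<bar> \<partial>lborel) + (\<integral>\<^sup>+x. ennreal (norm (g x)) \<partial>lborel)"
      by (simp add: nn_integral_add)
    then show "(\<integral>\<^sup>+x. ennreal (\<bar>f x\<bar> + norm (g x)) \<partial>lborel) < \<infinity>"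
      using sobD(1,2)[OF fg] by (simp add: integrable_iff_bounded)
    show "AE x in lborel. ennreal (u n x) \<le> ennreal (\<bar>f x\<bar> + norm (g x))" for n
    proof (intro AE_I2 ennreal_leI)
      fix x
      have "norm (T' n (f x) *\<^sub>R g x - (if f x > b then g x else 0)) \<le> 1 * norm (g x)"
      proof (cases "f x > b")
        case True
        then have "T' n (f x) *\<^sub>R g x - (if f x > b then g x else 0) = (T' n (f x) - 1) *\<^sub>R g x"
          by (simp add: algebra_simps)
        moreover have "\<bar>T' n (f x) - 1\<bar> \<le> 1" using le1[of n "f x"] by (simp add: T'_def abs_le_iff)
        ultimately show ?thesis by (simp only: norm_scaleR) (intro mult_right_mono, auto)
      next
        case False
        then show ?thesis using \<epsilon>[of n] by (simp add: T'_def)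
      qed
      then show "u n x \<le> \<bar>f x\<bar> + norm (g x)" using T1(2)[of n "f x"] by (simp add: u_def)
    qed
    show "AE x in lborel. (\<lambda>n. ennreal (u n x)) \<longlonglongrightarrow> ennreal 0"
    proof (intro AE_I2 tendsto_ennrealI)
      fix x
      have 1: "(\<lambda>n. \<bar>T n (f x) - max 0 (f x - b)\<bar>) \<longlonglongrightarrow> 0"
        by (rule Lim_null_comparison[OF _ \<epsilon>0]) (use T1(1) in auto)
      have 2: "(\<lambda>n. T' n (f x) *\<^sub>R g x) \<longlonglongrightarrow> (if f x > b then g x else 0)"
      proof (cases "f x > b")
        case True
        have "(\<lambda>n. (1 - (\<epsilon> n)\<^sup>2 / (max 0 (f x - b) + \<epsilon> n)\<^sup>2) *\<^sub>R g x) \<longlonglongrightarrow> (1 - 0\<^sup>2 / (max 0 (f x - b) + 0)\<^sup>2) *\<^sub>R g x"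
          using True by (intro tendsto_intros \<epsilon>0) auto
        then show ?thesis using True by (simp add: T'_def)
      next
        case False
        then show ?thesis using \<epsilon> by (simp add: T'_def less_imp_neq[symmetric])
      qed
      have "(\<lambda>n. u n x) \<longlonglongrightarrow> 0 + norm ((if f x > b then g x else 0) - (if f x > b then g x else 0))"
        unfolding u_def by (intro tendsto_add 1 tendsto_norm tendsto_diff 2 tendsto_const)
      then show "(\<lambda>n. u n x) \<longlonglongrightarrow> 0" by simp
    qed
  qed simp_all
  then have "(\<lambda>n. \<integral>\<^sup>+x. ennreal (u n x) \<partial>lborel) \<longlonglongrightarrow> 0" by simp
  then have "\<forall>\<^sub>F n in sequentially. (\<integral>\<^sup>+x. ennreal (u n x) \<partial>lborel) < ennreal e"
    using \<open>e > 0\<close> by (intro order_tendstoD(2)) auto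
  then obtain n where "(\<integral>\<^sup>+x. ennreal (u n x) \<partial>lborel) < ennreal e" by (auto simp: eventually_sequentially)
  then show "\<exists>f' g'. sob f' g' \<and> sdist f' g' (\<lambda>x. max 0 (f x - b)) (\<lambda>x. if f x > b then g x else 0) < ennreal e"
    using sb[of n] by (auto simp: u_def sdist_def)
qed

lemma sob_mult:
  assumes fg: "sob f g" and \<psi>: "C1c \<psi> d\<psi>"
  shows "sob (\<lambda>x. \<psi> x * f x) (\<lambda>x. \<psi> x *\<^sub>R g x + f x *\<^sub>R d\<psi> x)"
proof (rule sob_limit)
  note m[measurable] = sobD(3,4)[OF fg] C1c_measurable[OF \<psi>]
  obtain B where B: "B > 0" "\<And>x. \<bar>\<psi> x\<bar> \<le> B" "\<And>x. norm (d\<psi> x) \<le> B" using C1c_bounded[OF \<psi>] by blast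
  have 1: "integrable lborel (\<lambda>x. \<psi> x *\<^sub>R f x)" "integrable lborel (\<lambda>x. \<psi> x *\<^sub>R g x)"
    using integrable_scaleR_bounded[OF sobD(1)[OF fg] _ B(2)] integrable_scaleR_bounded[OF sobD(2)[OF fg] _ B(2)] by auto
  have 2: "integrable lborel (\<lambda>x. f x *\<^sub>R d\<psi> x)"
  proof (rule Bochner_Integration.integrable_bound[of _ "\<lambda>x. B * \<bar>f x\<bar>"])
    show "integrable lborel (\<lambda>x. B * \<bar>f x\<bar>)" using sobD(1)[OF fg] by auto
    show "AE x in lborel. norm (f x *\<^sub>R d\<psi> x) \<le> norm (B * \<bar>f x\<bar>)"
      using B(1) mult_left_mono[OF B(3) abs_ge_zero] by (intro AE_I2) (simp add: abs_mult mult.commute)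
  qed measurable
  show "integrable lborel (\<lambda>x. \<psi> x * f x)" "integrable lborel (\<lambda>x. \<psi> x *\<^sub>R g x + f x *\<^sub>R d\<psi> x)"
    using 1 2 by auto
  fix e :: real assume "e > 0"
  then have "e / (2 * B) > 0" using B by simp
  obtain \<phi> d\<phi> where \<phi>: "C1c \<phi> d\<phi>" "sdist \<phi> d\<phi> f g < ennreal (e / (2 * B))"
    using sob_approx[OF fg \<open>e / (2 * B) > 0\<close>] by blast
  note [measurable] = C1c_measurable[OF \<phi>(1)]
  have "sdist (\<lambda>x. \<psi> x * \<phi> x) (\<lambda>x. \<psi> x *\<^sub>R d\<phi> x + \<phi> x *\<^sub>R d\<psi> x) (\<lambda>x. \<psi> x * f x) (\<lambda>x. \<psi> x *\<^sub>R g x + f x *\<^sub>R d\<psi> x)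
     \<le> (\<integral>\<^sup>+x. ennreal (2 * B) * ennreal (\<bar>\<phi> x - f x\<bar> + norm (d\<phi> x - g x)) \<partial>lborel)"
    unfolding sdist_def
  proof (intro nn_integral_mono)
    fix x
    have "\<psi> x *\<^sub>R d\<phi> x + \<phi> x *\<^sub>R d\<psi> x - (\<psi> x *\<^sub>R g x + f x *\<^sub>R d\<psi> x) = \<psi> x *\<^sub>R (d\<phi> x - g x) + (\<phi> x - f x) *\<^sub>R d\<psi> x"
      by (simp add: algebra_simps)
    then have "norm (\<psi> x *\<^sub>R d\<phi> x + \<phi> x *\<^sub>R d\<psi> x - (\<psi> x *\<^sub>R g x + f x *\<^sub>R d\<psi> x)) \<le> \<bar>\<psi> x\<bar> * norm (d\<phi> x - g x) + \<bar>\<phi> x - f x\<bar> * norm (d\<psi> x)"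
      using norm_triangle_ineq by (metis norm_scaleR)
    also have "\<dots> \<le> B * norm (d\<phi> x - g x) + \<bar>\<phi> x - f x\<bar> * B"
      using B by (intro add_mono mult_left_mono mult_right_mono) auto
    finally have 3: "norm (\<psi> x *\<^sub>R d\<phi> x + \<phi> x *\<^sub>R d\<psi> x - (\<psi> x *\<^sub>R g x + f x *\<^sub>R d\<psi> x)) \<le> B * norm (d\<phi> x - g x) + \<bar>\<phi> x - f x\<bar> * B" .
    have "\<bar>\<psi> x * \<phi> x - \<psi> x * f x\<bar> = \<bar>\<psi> x\<bar> * \<bar>\<phi> x - f x\<bar>" by (simp flip: right_diff_distrib abs_mult)
    also have "\<dots> \<le> B * \<bar>\<phi> x - f x\<bar>" using B by (intro mult_right_mono) auto
    finally have "\<bar>\<psi> x * \<phi> x - \<psi> x * f x\<bar> + norm (\<psi> x *\<^sub>R d\<phi> x + \<phi> x *\<^sub>R d\<psi> x - (\<psi> x *\<^sub>R g x + f x *\<^sub>R d\<psi> x))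
       \<le> 2 * B * \<bar>\<phi> x - f x\<bar> + B * norm (d\<phi> x - g x)" using 3 by (simp add: mult.commute)
    also have "\<dots> \<le> (2 * B) * (\<bar>\<phi> x - f x\<bar> + norm (d\<phi> x - g x))"
      using B by (simp add: distrib_left mult_right_mono)
    finally show "ennreal (\<bar>\<psi> x * \<phi> x - \<psi> x * f x\<bar> + norm (\<psi> x *\<^sub>R d\<phi> x + \<phi> x *\<^sub>R d\<psi> x - (\<psi> x *\<^sub>R g x + f x *\<^sub>R d\<psi> x)))
      \<le> ennreal (2 * B) * ennreal (\<bar>\<phi> x - f x\<bar> + norm (d\<phi> x - g x))"
      using B by (simp add: ennreal_leI del: ennreal_plus flip: ennreal_mult)
  qed
  also have "\<dots> = ennreal (2 * B) * sdist \<phi> d\<phi> f g" unfolding sdist_def by (rule nn_integral_cmult) measurable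
  also have "\<dots> < ennreal (2 * B) * ennreal (e / (2 * B))"
    using \<phi>(2) B by (intro ennreal_mult_strict_left_mono) auto
  also have "\<dots> = ennreal e" using B by (simp flip: ennreal_mult')
  finally show "\<exists>f' g'. sob f' g' \<and> sdist f' g' (\<lambda>x. \<psi> x * f x) (\<lambda>x. \<psi> x *\<^sub>R g x + f x *\<^sub>R d\<psi> x) < ennreal e"
    using C1c_sob[OF C1c_mult[OF \<psi> \<phi>(1)]] by blast
qed

text \<open>For smooth \<open>f\<close> this is integration by parts.  Both sides are continuous with respect to the
  distance \<open>sdist\<close>.\<close>

lemma sob_conv:
  fixes f :: "'a::euclidean_space \<Rightarrow> real"
  assumes fg: "sob f g" and \<rho>: "C1c \<rho> d\<rho>"
  shows "conv (\<lambda>z. d\<rho> z \<bullet> h) f x = conv \<rho> g x \<bullet> h"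
proof -
  note m[measurable] = sobD(3,4)[OF fg] C1c_measurable[OF \<rho>]
  obtain B where B: "B > 0" "\<And>x. \<bar>\<rho> x\<bar> \<le> B" "\<And>x. norm (d\<rho> x) \<le> B" using C1c_bounded[OF \<rho>] by blast
  have bd: "\<bar>d\<rho> z \<bullet> h\<bar> \<le> B * norm h" for z
    using Cauchy_Schwarz_ineq2[of "d\<rho> z" h] mult_right_mono[OF B(3)[of z] norm_ge_zero[of h]] by linarith
  have i1: "integrable lborel (\<lambda>y. (d\<rho> (x - y) \<bullet> h) *\<^sub>R u y)" if "integrable lborel u" for u :: "'a \<Rightarrow> real"
    using conv_integrable[where \<rho>="\<lambda>z. d\<rho> z \<bullet> h" and x=x, OF that _ bd] by simp
  have i2: "integrable lborel (\<lambda>y. \<rho> (x - y) *\<^sub>R u y)" if "integrable lborel u" for u :: "'a \<Rightarrow> 'a"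
    using conv_integrable[where \<rho>=\<rho> and x=x, OF that _ B(2)] by simp
  define I where "I u v = conv (\<lambda>z. d\<rho> z \<bullet> h) u x - conv \<rho> v x \<bullet> h" for u :: "'a \<Rightarrow> real" and v
  have smooth0: "I \<phi> d\<phi> = 0" if \<phi>: "C1c \<phi> d\<phi>" for \<phi> d\<phi>
  proof -
    have "(\<integral>y. (\<rho> (x - y) *\<^sub>R d\<phi> y + \<phi> y *\<^sub>R - d\<rho> (x - y)) \<bullet> h \<partial>lborel) = 0"
      by (rule C1c_integral_deriv[OF C1c_mult[OF C1c_reflect[OF \<rho>] \<phi>]])
    moreover have "(\<integral>y. (\<rho> (x - y) *\<^sub>R d\<phi> y + \<phi> y *\<^sub>R - d\<rho> (x - y)) \<bullet> h \<partial>lborel)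
      = (\<integral>y. (\<rho> (x - y) *\<^sub>R d\<phi> y) \<bullet> h - (d\<rho> (x - y) \<bullet> h) *\<^sub>R \<phi> y \<partial>lborel)"
      by (intro Bochner_Integration.integral_cong) (auto simp: inner_add_left inner_diff_left)
    moreover have "\<dots> = (\<integral>y. (\<rho> (x - y) *\<^sub>R d\<phi> y) \<bullet> h \<partial>lborel) - (\<integral>y. (d\<rho> (x - y) \<bullet> h) *\<^sub>R \<phi> y \<partial>lborel)"
      using i1[OF C1c_integrable(1)[OF \<phi>]] i2[OF C1c_integrable(2)[OF \<phi>]]
      by (intro Bochner_Integration.integral_diff integrable_inner_left) auto
    moreover have "(\<integral>y. (\<rho> (x - y) *\<^sub>R d\<phi> y) \<bullet> h \<partial>lborel) = conv \<rho> d\<phi> x \<bullet> h"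
      unfolding conv_def using i2[OF C1c_integrable(2)[OF \<phi>]] by (rule integral_inner_left[rotated])
    ultimately show ?thesis by (simp add: I_def conv_def)
  qed
  have "\<bar>I f g\<bar> \<le> 0 + e" if "e > 0" for e
  proof -
    define e' where "e' = e / (B * norm h + 1)"
    have k: "B * norm h + 1 > 0" using B by (auto intro!: add_nonneg_pos)
    have "e' > 0" using that k by (simp add: e'_def)
    obtain \<phi> d\<phi> where \<phi>: "C1c \<phi> d\<phi>" "sdist \<phi> d\<phi> f g < ennreal e'" using sob_approx[OF fg \<open>e' > 0\<close>] by blast
    note [measurable] = C1c_measurable[OF \<phi>(1)]
    note ii = C1c_integrable[OF \<phi>(1)] sobD(1,2)[OF fg]
    have id: "integrable lborel (\<lambda>y. \<phi> y - f y)" "integrable lborel (\<lambda>y. d\<phi> y - g y)" using ii by auto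
    have "I f g = I f g - I \<phi> d\<phi>" using smooth0[OF \<phi>(1)] by simp
    also have "\<dots> = - I (\<lambda>y. \<phi> y - f y) (\<lambda>y. d\<phi> y - g y)"
      unfolding I_def conv_def using i1[OF ii(1)] i1[OF ii(3)] i2[OF ii(2)] i2[OF ii(4)]
      by (simp add: scaleR_diff_right right_diff_distrib inner_diff_left)
    finally have "\<bar>I f g\<bar> = \<bar>I (\<lambda>y. \<phi> y - f y) (\<lambda>y. d\<phi> y - g y)\<bar>" by simp
    also have "\<dots> \<le> \<bar>conv (\<lambda>z. d\<rho> z \<bullet> h) (\<lambda>y. \<phi> y - f y) x\<bar> + norm (conv \<rho> (\<lambda>y. d\<phi> y - g y) x) * norm h"
      unfolding I_def using Cauchy_Schwarz_ineq2[of "conv \<rho> (\<lambda>y. d\<phi> y - g y) x" h] by linarith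
    also have "\<dots> \<le> (\<integral>y. (B * norm h) * \<bar>\<phi> y - f y\<bar> \<partial>lborel) + (\<integral>y. B * norm (d\<phi> y - g y) \<partial>lborel) * norm h"
    proof (intro add_mono mult_right_mono norm_ge_zero)
      have "\<bar>conv (\<lambda>z. d\<rho> z \<bullet> h) (\<lambda>y. \<phi> y - f y) x\<bar> \<le> (\<integral>y. \<bar>(d\<rho> (x - y) \<bullet> h) *\<^sub>R (\<phi> y - f y)\<bar> \<partial>lborel)"
        unfolding conv_def by (rule integral_abs_bound)
      also have "\<dots> \<le> (\<integral>y. (B * norm h) * \<bar>\<phi> y - f y\<bar> \<partial>lborel)"
        using integrable_norm[OF i1[OF id(1)]] id(1) bd
        by (intro Bochner_Integration.integral_mono) (auto simp: abs_mult intro!: mult_right_mono)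
      finally show "\<bar>conv (\<lambda>z. d\<rho> z \<bullet> h) (\<lambda>y. \<phi> y - f y) x\<bar> \<le> (\<integral>y. (B * norm h) * \<bar>\<phi> y - f y\<bar> \<partial>lborel)" .
      have "norm (conv \<rho> (\<lambda>y. d\<phi> y - g y) x) \<le> (\<integral>y. norm (\<rho> (x - y) *\<^sub>R (d\<phi> y - g y)) \<partial>lborel)"
        unfolding conv_def by (rule integral_norm_bound)
      also have "\<dots> \<le> (\<integral>y. B * norm (d\<phi> y - g y) \<partial>lborel)"
        using integrable_norm[OF i2[OF id(2)]] id(2) B
        by (intro Bochner_Integration.integral_mono) (auto intro!: mult_right_mono)
      finally show "norm (conv \<rho> (\<lambda>y. d\<phi> y - g y) x) \<le> (\<integral>y. B * norm (d\<phi> y - g y) \<partial>lborel)" .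
    qed
    also have "\<dots> = (B * norm h) * (\<integral>y. \<bar>\<phi> y - f y\<bar> + norm (d\<phi> y - g y) \<partial>lborel)"
      using id by (simp add: algebra_simps)
    also have "\<dots> \<le> (B * norm h) * e'"
    proof (intro mult_left_mono)
      have "ennreal (\<integral>y. \<bar>\<phi> y - f y\<bar> + norm (d\<phi> y - g y) \<partial>lborel) = sdist \<phi> d\<phi> f g"
        unfolding sdist_def using id by (intro nn_integral_eq_integral[symmetric]) auto
      then have "ennreal (\<integral>y. \<bar>\<phi> y - f y\<bar> + norm (d\<phi> y - g y) \<partial>lborel) < ennreal e'" using \<phi>(2) by simp
      then show "(\<integral>y. \<bar>\<phi> y - f y\<bar> + norm (d\<phi> y - g y) \<partial>lborel) \<le> e'"
        using \<open>e' > 0\<close> by (subst (asm) ennreal_less_iff) (auto intro!: Bochner_Integration.integral_nonneg)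
    qed (use B in auto)
    also have "\<dots> \<le> (B * norm h + 1) * e'" using \<open>e' > 0\<close> by (intro mult_right_mono) auto
    also have "\<dots> = e" using k by (simp add: e'_def)
    finally show ?thesis by simp
  qed
  then have "\<bar>I f g\<bar> \<le> 0" by (rule field_le_epsilon)
  then show ?thesis by (simp add: I_def)
qed

text \<open>Radii are chosen for which the mean distances decrease geometrically.\<close>

lemma conv_AE_converges:
  fixes h :: "'a::euclidean_space \<Rightarrow> 'b::euclidean_space"
  assumes h: "integrable lborel h"
  obtains \<epsilon> :: "nat \<Rightarrow> real" where "\<And>k. 0 < \<epsilon> k" "\<epsilon> \<longlonglongrightarrow> 0"
    "AE x in lborel. (\<lambda>k. conv (rho (\<epsilon> k)) h x) \<longlonglongrightarrow> h x"
proof -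
  have "\<exists>\<epsilon>>0. \<epsilon> < 1 / real (Suc k) \<and> (\<integral>\<^sup>+x. ennreal (norm (conv (rho \<epsilon>) h x - h x)) \<partial>lborel) \<le> ennreal ((1/2) ^ k)" for k
  proof -
    obtain d where d: "d > 0" "\<And>\<epsilon> a. 0 < \<epsilon> \<Longrightarrow> \<epsilon> + norm a < d \<Longrightarrow>
      (\<integral>\<^sup>+x. ennreal (norm (conv (rho \<epsilon>) h (x - a) - h x)) \<partial>lborel) \<le> ennreal ((1/2) ^ k)"
      using conv_converges[OF h, of "(1/2) ^ k"] by auto
    show ?thesis
      using d(1) d(2)[of "min d (1 / real (Suc k)) / 2" 0]
      by (intro exI[of _ "min d (1 / real (Suc k)) / 2"]) (auto simp: min_def field_simps)
  qed
  then obtain \<epsilon> where \<epsilon>: "\<And>k. \<epsilon> k > 0" "\<And>k. \<epsilon> k < 1 / real (Suc k)"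
    "\<And>k. (\<integral>\<^sup>+x. ennreal (norm (conv (rho (\<epsilon> k)) h x - h x)) \<partial>lborel) \<le> ennreal ((1/2) ^ k)" by metis
  have m: "conv (rho (\<epsilon> k)) h \<in> borel_measurable borel" "h \<in> borel_measurable borel" for k
    using h C1c_measurable(1)[OF rho_C1c[OF \<epsilon>(1)]] by (auto intro!: conv_measurable)
  have "AE x in lborel. (\<lambda>k. norm (conv (rho (\<epsilon> k)) h x - h x)) \<longlonglongrightarrow> 0"
    by (rule fast_convergence[of "\<lambda>k x. norm (conv (rho (\<epsilon> k)) h x - h x)" lborel])
      (use \<epsilon>(3) m in \<open>auto elim!: eventually_mono\<close>)
  then have "AE x in lborel. (\<lambda>k. conv (rho (\<epsilon> k)) h x) \<longlonglongrightarrow> h x"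
    by eventually_elim (simp add: tendsto_norm_zero_iff LIM_zero_iff)
  moreover have "\<epsilon> \<longlonglongrightarrow> 0"
  proof (rule Lim_null_comparison)
    show "(\<lambda>n. 1 / real (Suc n)) \<longlonglongrightarrow> 0" by (rule LIMSEQ_Suc[OF lim_1_over_n])
    show "\<forall>\<^sub>F n in sequentially. norm (\<epsilon> n) \<le> 1 / real (Suc n)"
      using \<epsilon> by (intro always_eventually allI) (simp add: less_imp_le)
  qed
  ultimately show ?thesis using that \<epsilon>(1) by blast
qed

lemma conv_zero_AE:
  fixes h :: "'a::euclidean_space \<Rightarrow> 'b::euclidean_space"
  assumes h: "integrable lborel h"
    and zero: "\<And>x. x \<in> S \<Longrightarrow> \<exists>\<epsilon>0>0. \<forall>\<epsilon>. 0 < \<epsilon> \<and> \<epsilon> < \<epsilon>0 \<longrightarrow> conv (rho \<epsilon>) h x = 0"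
  shows "AE x in lborel. x \<in> S \<longrightarrow> h x = 0"
proof -
  obtain \<epsilon> :: "nat \<Rightarrow> real" where \<epsilon>: "\<And>k. 0 < \<epsilon> k" "\<epsilon> \<longlonglongrightarrow> 0"
    "AE x in lborel. (\<lambda>k. conv (rho (\<epsilon> k)) h x) \<longlonglongrightarrow> h x"
    using conv_AE_converges[OF h] by blast
  from \<epsilon>(3) show ?thesis
  proof eventually_elim
    case (elim x)
    show ?case
    proof
      assume "x \<in> S"
      then obtain \<epsilon>0 where \<epsilon>0: "\<epsilon>0 > 0" "\<forall>\<epsilon>. 0 < \<epsilon> \<and> \<epsilon> < \<epsilon>0 \<longrightarrow> conv (rho \<epsilon>) h x = 0" using zero by blast
      have "\<forall>\<^sub>F k in sequentially. \<epsilon> k < \<epsilon>0" using order_tendstoD(2)[OF \<epsilon>(2) \<epsilon>0(1)] .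
      then have "\<forall>\<^sub>F k in sequentially. conv (rho (\<epsilon> k)) h x = 0"
        by eventually_elim (use \<epsilon>(1) \<epsilon>0(2) in auto)
      then have "(\<lambda>k. conv (rho (\<epsilon> k)) h x) \<longlonglongrightarrow> 0" by (rule tendsto_eventually)
      then show "h x = 0" using elim LIMSEQ_unique by blast
    qed
  qed
qed

text \<open>The difference of two gradients is a gradient of the zero function, so all its mollifications
  vanish by \<open>sob_conv\<close>.\<close>

lemma sob_unique:
  assumes "sob f g" "sob f g'"
  shows "AE x in lborel. g x = g' x"
proof -
  have s: "sob (\<lambda>x. 0) (\<lambda>x. g x - g' x)" using sob_diff[OF assms] by simp
  have "conv (rho \<epsilon>) (\<lambda>x. g x - g' x) x = 0" if "\<epsilon> > 0" for \<epsilon> x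
  proof (rule euclidean_eqI)
    fix b :: 'a assume "b \<in> Basis"
    show "conv (rho \<epsilon>) (\<lambda>x. g x - g' x) x \<bullet> b = 0 \<bullet> b"
      using sob_conv[OF s rho_C1c[OF that], of b x] by (simp add: conv_def)
  qed
  then have "AE x in lborel. x \<in> UNIV \<longrightarrow> g x - g' x = 0"
    by (intro conv_zero_AE sobD(2)[OF s]) (auto intro!: exI[of _ 1])
  then show ?thesis by simp
qed

text \<open>Soft thresholding: the values in \<open>[-b, b]\<close> become zero, all others move by \<open>b\<close> towards zero.\<close>

definition soft :: "real \<Rightarrow> real \<Rightarrow> real" where
  "soft b s = max 0 (s - b) - max 0 (- s - b)"

lemma soft_zero: "\<bar>s\<bar> \<le> b \<Longrightarrow> soft b s = 0"
  and soft_close: "b \<ge> 0 \<Longrightarrow> \<bar>soft b s - s\<bar> \<le> b"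
  and soft_le: "b \<ge> 0 \<Longrightarrow> \<bar>soft b s - s\<bar> \<le> \<bar>s\<bar>"
  and soft_lipschitz: "b \<ge> 0 \<Longrightarrow> \<bar>soft b s - soft b t\<bar> \<le> \<bar>s - t\<bar>"
  by (auto simp: soft_def max_def)

lemma sob_soft:
  assumes "sob f g" "b \<ge> 0"
  shows "sob (\<lambda>x. soft b (f x)) (\<lambda>x. if \<bar>f x\<bar> > b then g x else 0)"
proof -
  have "sob (\<lambda>x. soft b (f x)) (\<lambda>x. (if f x > b then g x else 0) - (if - f x > b then - g x else 0))"
    unfolding soft_def by (intro sob_diff sob_pos_part assms sob_uminus)
  moreover have "(\<lambda>x. (if f x > b then g x else 0) - (if - f x > b then - g x else 0)) =
     (\<lambda>x. if \<bar>f x\<bar> > b then g x else 0)"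
    using \<open>b \<ge> 0\<close> by (auto simp: fun_eq_iff)
  ultimately show ?thesis by simp
qed

text \<open>The functions \<open>soft \<epsilon> \<circ> f\<close> converge to \<open>f\<close>, and their gradients to \<open>g\<close> off the zero set of \<open>f\<close> and to
  zero on it.  By uniqueness of the gradient, the limit is \<open>g\<close>.\<close>

lemma sob_zero_set:
  assumes fg: "sob f g"
  shows "AE x in lborel. f x = 0 \<longrightarrow> g x = 0"
proof -
  note m[measurable] = sobD(3,4)[OF fg]
  define \<epsilon> where "\<epsilon> n = 1 / real (Suc n)" for n
  have \<epsilon>: "\<epsilon> n > 0" for n by (simp add: \<epsilon>_def)
  have \<epsilon>0: "\<epsilon> \<longlonglongrightarrow> 0" unfolding \<epsilon>_def by (rule LIMSEQ_Suc[OF lim_1_over_n])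
  define g0 where "g0 x = (if f x \<noteq> 0 then g x else 0)" for x
  have [measurable]: "g0 \<in> borel_measurable borel" unfolding g0_def by measurable
  have "sob f g0"
  proof (rule sob_limit)
    show "integrable lborel f" by (rule sobD[OF fg])
    show "integrable lborel g0"
      by (rule Bochner_Integration.integrable_bound[OF sobD(2)[OF fg]]) (auto simp: g0_def)
    fix e :: real assume "e > 0"
    define u where "u n x = \<bar>soft (\<epsilon> n) (f x) - f x\<bar> + norm ((if \<bar>f x\<bar> > \<epsilon> n then g x else 0) - g0 x)" for n x
    have [measurable]: "(\<lambda>x. soft (\<epsilon> n) (f x)) \<in> borel_measurable borel" for n
      using sobD(3)[OF sob_soft[OF fg less_imp_le[OF \<epsilon>]]] .
    have "(\<lambda>n. \<integral>\<^sup>+x. ennreal (u n x) \<partial>lborel) \<longlonglongrightarrow> (\<integral>\<^sup>+x. ennreal 0 \<partial>(lborel :: 'a measure))"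
    proof (rule nn_integral_dominated_convergence[where w="\<lambda>x. ennreal (\<bar>f x\<bar> + norm (g x))"])
      show "(\<lambda>x. ennreal (u n x)) \<in> borel_measurable lborel" for n unfolding u_def by measurable
      have "(\<integral>\<^sup>+x. ennreal (\<bar>f x\<bar> + norm (g x)) \<partial>lborel) = (\<integral>\<^sup>+x. ennreal \<bar>f x\<bar> \<partial>lborel) + (\<integral>\<^sup>+x. ennreal (norm (g x)) \<partial>lborel)"
        by (simp add: nn_integral_add)
      then show "(\<integral>\<^sup>+x. ennreal (\<bar>f x\<bar> + norm (g x)) \<partial>lborel) < \<infinity>"
        using sobD(1,2)[OF fg] by (simp add: integrable_iff_bounded)
      show "AE x in lborel. ennreal (u n x) \<le> ennreal (\<bar>f x\<bar> + norm (g x))" for n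
        unfolding u_def
        by (intro AE_I2 ennreal_leI add_mono soft_le less_imp_le[OF \<epsilon>]) (use \<epsilon>[of n] in \<open>auto simp: g0_def\<close>)
      show "AE x in lborel. (\<lambda>n. ennreal (u n x)) \<longlonglongrightarrow> ennreal 0"
      proof (intro AE_I2 tendsto_ennrealI)
        fix x
        have 1: "(\<lambda>n. \<bar>soft (\<epsilon> n) (f x) - f x\<bar>) \<longlonglongrightarrow> 0"
          by (rule Lim_null_comparison[OF _ \<epsilon>0]) (use soft_close[OF less_imp_le[OF \<epsilon>]] in auto)
        have 2: "(\<lambda>n. norm ((if \<bar>f x\<bar> > \<epsilon> n then g x else 0) - g0 x)) \<longlonglongrightarrow> 0"
        proof (cases "f x = 0")
          case True
          then show ?thesis using less_imp_le[OF \<epsilon>] by (simp add: g0_def not_less[symmetric])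
        next
          case False
          then have "\<forall>\<^sub>F n in sequentially. \<epsilon> n < \<bar>f x\<bar>" using order_tendstoD(2)[OF \<epsilon>0, of "\<bar>f x\<bar>"] by simp
          then show ?thesis
            by (intro tendsto_eventually) (elim eventually_mono, use False in \<open>simp add: g0_def\<close>)
        qed
        show "(\<lambda>n. u n x) \<longlonglongrightarrow> 0" unfolding u_def using tendsto_add[OF 1 2] by simp
      qed
    qed simp_all
    then have "(\<lambda>n. \<integral>\<^sup>+x. ennreal (u n x) \<partial>lborel) \<longlonglongrightarrow> 0" by simp
    then have "\<forall>\<^sub>F n in sequentially. (\<integral>\<^sup>+x. ennreal (u n x) \<partial>lborel) < ennreal e"
      using \<open>e > 0\<close> by (intro order_tendstoD(2)) auto
    then obtain n where "(\<integral>\<^sup>+x. ennreal (u n x) \<partial>lborel) < ennreal e" by (auto simp: eventually_sequentially)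
    then show "\<exists>f' g'. sob f' g' \<and> sdist f' g' f g0 < ennreal e"
      using sob_soft[OF fg less_imp_le[OF \<epsilon>], of n] unfolding u_def sdist_def by blast
  qed
  from sob_unique[OF fg this] show ?thesis by eventually_elim (auto simp: g0_def)
qed

text \<open>The mollification of \<open>f\<close> has zero gradient in a slightly smaller ball, hence is constant there;
  at \<open>x1\<close> and \<open>x2\<close> it takes the values \<open>c1\<close> and \<open>c2\<close>.\<close>

lemma sob_locally_constant:
  fixes f :: "'a::euclidean_space \<Rightarrow> real"
  assumes fg: "sob f g" and g0: "\<And>x. x \<in> ball p r \<Longrightarrow> g x = 0"
    and 1: "ball x1 \<delta> \<subseteq> ball p r" "\<And>x. x \<in> ball x1 \<delta> \<Longrightarrow> f x = c1"
    and 2: "ball x2 \<delta> \<subseteq> ball p r" "\<And>x. x \<in> ball x2 \<delta> \<Longrightarrow> f x = c2"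
    and "\<delta> > 0"
  shows "c1 = c2"
proof -
  have x12: "dist p x1 < r" "dist p x2 < r" using 1(1) 2(1) \<open>\<delta> > 0\<close> by (auto simp: subset_iff)
  define \<epsilon> where "\<epsilon> = min \<delta> (min (r - dist p x1) (r - dist p x2)) / 2"
  have \<epsilon>: "\<epsilon> > 0" "\<epsilon> < \<delta>" "dist p x1 < r - \<epsilon>" "dist p x2 < r - \<epsilon>"
    using x12 \<open>\<delta> > 0\<close> by (auto simp: \<epsilon>_def min_def field_simps)
  define F where "F = conv (rho \<epsilon>) f"
  have z: "conv (\<lambda>z. gr (rho \<epsilon>) z \<bullet> h) f x = 0" if "x \<in> ball p (r - \<epsilon>)" for h x
  proof -
    have "rho \<epsilon> (x - y) *\<^sub>R g y = 0" for y
    proof (cases "norm (x - y) < \<epsilon>")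
      case True
      then have "y \<in> ball p r" using that dist_triangle[of p y x] by (simp add: dist_norm)
      then show ?thesis by (simp add: g0)
    qed (simp add: rho_outside[OF \<epsilon>(1)])
    then have "(\<lambda>y. rho \<epsilon> (x - y) *\<^sub>R g y) = (\<lambda>y. 0)" by (rule ext)
    then have "conv (rho \<epsilon>) g x = 0" unfolding conv_def by (simp only:) simp
    then show ?thesis using sob_conv[OF fg rho_C1c[OF \<epsilon>(1)], of h x] by simp
  qed
  have "\<exists>c. \<forall>x\<in>ball p (r - \<epsilon>). F x = c"
  proof (rule has_derivative_zero_constant)
    fix x assume "x \<in> ball p (r - \<epsilon>)"
    then show "(F has_derivative (\<lambda>h. 0)) (at x within ball p (r - \<epsilon>))"
      using conv_has_derivative[OF rho_C1c[OF \<epsilon>(1)] sobD(1)[OF fg], of x] z[of x]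
      by (simp add: F_def has_derivative_at_withinI)
  qed auto
  moreover have "F x = c" if "\<And>y. y \<in> ball x \<delta> \<Longrightarrow> f y = c" for x c
  proof -
    have "rho \<epsilon> (x - y) *\<^sub>R f y = rho \<epsilon> (x - y) *\<^sub>R c" for y
      using that[of y] rho_outside[OF \<epsilon>(1), of "x - y"] \<epsilon>(2)
      by (cases "norm (x - y) < \<epsilon>") (auto simp: dist_norm)
    then have "(\<lambda>y. rho \<epsilon> (x - y) *\<^sub>R f y) = (\<lambda>y. rho \<epsilon> (x - y) *\<^sub>R c)" by (rule ext)
    then have "F x = (\<integral>y. rho \<epsilon> (x - y) *\<^sub>R c \<partial>lborel)" unfolding F_def conv_def by (simp only:)
    also have "\<dots> = (\<integral>y. rho \<epsilon> (x - y) \<partial>lborel) * c" by simp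
    also have "(\<integral>y. rho \<epsilon> (x - y) \<partial>lborel) = (\<integral>y. rho \<epsilon> (y::'a) \<partial>lborel)"
      by (rule integral_reflect) (rule C1c_measurable[OF rho_C1c[OF \<epsilon>(1)]])
    finally show ?thesis using rho_integral[OF \<epsilon>(1), where 'a='a] by simp
  qed
  ultimately show ?thesis using 1(2) 2(2) \<epsilon>(3,4) by (metis mem_ball)
qed

section \<open>Weak gradients\<close>

text \<open>Translations and convolutions require Borel functions on the whole space, while the spaces of
  functions on \<open>\<Omega>\<close> refer to Lebesgue measurability; the passage is made coordinate by coordinate.\<close>

lemma borel_representative:
  fixes f :: "'a::euclidean_space \<Rightarrow> 'b::euclidean_space"
  assumes S[measurable]: "S \<in> sets borel" and f: "f \<in> borel_measurable (lebesgue_on S)"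
  obtains f' where "f' \<in> borel_measurable borel" "\<And>x. x \<notin> S \<Longrightarrow> f' x = 0" "AE x in lebesgue_on S. f' x = f x"
proof -
  have S': "S \<in> sets lebesgue" by simp
  have i: "(\<lambda>x. indicator S x *\<^sub>R f x) \<in> borel_measurable lebesgue"
    using f S' by (subst (asm) borel_measurable_restrict_space_iff) auto
  have "\<exists>h. h \<in> borel_measurable lborel \<and> (AE x in lborel. indicator S x * (f x \<bullet> b) = h x)" for b
  proof -
    have "(\<lambda>x. indicator S x * (f x \<bullet> b)) \<in> borel_measurable (completion lborel)"
      using borel_measurable_inner[OF i borel_measurable_const, of b] by simp
    from completion_ex_borel_measurable_real[OF this] show ?thesis by blast
  qed
  then obtain h where h: "\<And>b. h b \<in> borel_measurable lborel" "\<And>b. AE x in lborel. indicator S x * (f x \<bullet> b) = h b x"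
    by metis
  define f' where "f' x = indicator S x *\<^sub>R (\<Sum>b\<in>Basis. h b x *\<^sub>R b)" for x
  have [measurable]: "h b \<in> borel_measurable borel" for b using h(1)[of b] by simp
  have m: "f' \<in> borel_measurable borel" unfolding f'_def by measurable
  have ae: "AE x in lborel. f' x = indicator S x *\<^sub>R f x"
  proof -
    have "AE x in lborel. \<forall>b\<in>Basis. indicator S x * (f x \<bullet> b) = h b x"
      using h(2) by (intro AE_finite_allI) auto
    then show ?thesis
    proof eventually_elim
      case (elim x)
      have "f' x = indicator S x *\<^sub>R (\<Sum>b\<in>Basis. (indicator S x * (f x \<bullet> b)) *\<^sub>R b)"
        using elim by (simp add: f'_def)
      also have "\<dots> = indicator S x *\<^sub>R f x"
        by (cases "x \<in> S") (simp_all add: euclidean_representation)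
      finally show ?case .
    qed
  qed
  have "AE x in lebesgue_on S. f' x = f x"
    using AE_completion[OF ae] S' by (auto simp: AE_restrict_space_iff elim!: eventually_mono)
  then show ?thesis using that[of f'] m by (simp add: f'_def)
qed

lemma integrable_borel_representative:
  fixes f :: "'a::euclidean_space \<Rightarrow> 'b::euclidean_space"
  assumes S: "S \<in> sets borel" and f: "integrable (lebesgue_on S) f"
  obtains f' where "integrable lborel f'" "\<And>x. x \<notin> S \<Longrightarrow> f' x = 0" "AE x in lebesgue_on S. f' x = f x"
proof -
  obtain f' where f': "f' \<in> borel_measurable borel" "\<And>x. x \<notin> S \<Longrightarrow> f' x = 0" "AE x in lebesgue_on S. f' x = f x"
    using borel_representative[OF S borel_measurable_integrable[OF f]] by blast
  have S': "S \<in> sets lebesgue" using S by simp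
  have "integrable lebesgue f'"
  proof (rule integrable_cong_AE_imp)
    show "integrable lebesgue (\<lambda>x. indicator S x *\<^sub>R f x)" using f S' by (simp add: integrable_restrict_space)
    show "f' \<in> borel_measurable lebesgue" using f'(1) by (simp add: measurable_completion)
    have "AE x in lebesgue. x \<in> S \<longrightarrow> f' x = f x" using f'(3) S' by (simp add: AE_restrict_space_iff)
    then show "AE x in lebesgue. indicator S x *\<^sub>R f x = f' x"
      by eventually_elim (auto simp: indicator_def f'(2))
  qed
  then have "integrable lborel f'" using f'(1) by (simp add: integrable_completion)
  then show ?thesis using that f' by blast
qed

lemma integral_lebesgue_on_zero_extension:
  fixes f :: "'a::euclidean_space \<Rightarrow> 'b::euclidean_space"
  assumes "S \<in> sets borel"
  shows "(LINT x|lebesgue_on S. f x) = (LINT x|lebesgue. indicator S x *\<^sub>R f x)"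
  using assms by (intro integral_restrict_space) simp

lemma locally_integrable_inner:
  "locally_integrable \<Omega> f \<Longrightarrow> locally_integrable \<Omega> (\<lambda>x. f x \<bullet> b)"
  by (simp add: locally_integrable_def)

lemma integrable_test:
  fixes f :: "'a::euclidean_space \<Rightarrow> real"
  assumes "open \<Omega>" and f: "locally_integrable \<Omega> f"
    and \<psi>: "continuous_on UNIV \<psi>" "compact K" "K \<subseteq> \<Omega>" "\<And>x. x \<notin> K \<Longrightarrow> \<psi> x = 0"
  shows "integrable (lebesgue_on \<Omega>) (\<lambda>x. f x * \<psi> x)"
proof -
  have Kb: "K \<in> sets borel" "\<Omega> \<in> sets borel"
    using \<open>compact K\<close> \<open>open \<Omega>\<close> by (auto intro: borel_compact)
  then have K: "K \<in> sets lebesgue" "\<Omega> \<in> sets lebesgue" by simp_all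
  have "integrable (lebesgue_on K) f" using f \<psi> by (auto simp: locally_integrable_def)
  then have i: "integrable lebesgue (\<lambda>x. indicator K x *\<^sub>R f x)" using K by (simp add: integrable_restrict_space)
  have "compact (\<psi> ` K)" using \<psi> by (intro compact_continuous_image) (auto intro: continuous_on_subset)
  then obtain B where B: "\<forall>y\<in>\<psi> ` K. norm y \<le> B" using compact_imp_bounded bounded_iff by blast
  have "integrable lebesgue (\<lambda>x. \<psi> x *\<^sub>R (indicator K x *\<^sub>R f x))"
  proof (rule integrable_scaleR_bounded[OF i, of _ "max 0 B"])
    show "\<psi> \<in> borel_measurable lebesgue"
      using borel_measurable_continuous_onI[OF \<psi>(1)] by (simp add: measurable_completion)
    show "\<bar>\<psi> x\<bar> \<le> max 0 B" for x
      using B \<psi>(4)[of x] by (cases "x \<in> K") (auto simp: le_max_iff_disj)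
  qed
  moreover have "(\<lambda>x. \<psi> x *\<^sub>R (indicator K x *\<^sub>R f x)) = (\<lambda>x. indicator \<Omega> x *\<^sub>R (f x * \<psi> x))"
    using \<psi>(3,4) by (force simp: fun_eq_iff indicator_def)
  ultimately show ?thesis using K by (simp add: integrable_restrict_space)
qed

lemma Cc_inftyD:
  assumes "\<phi> \<in> Cc_infty \<Omega>"
  obtains K where "compact K" "K \<subseteq> \<Omega>" "\<And>x. x \<notin> K \<Longrightarrow> \<phi> x = 0"
    "\<And>x h. x \<notin> K \<Longrightarrow> frechet_derivative \<phi> (at x) h = 0" "smooth \<phi>"
proof -
  define K where "K = closure {x. \<phi> x \<noteq> 0}"
  have K: "compact K" "K \<subseteq> \<Omega>" "smooth \<phi>" using assms by (auto simp: Cc_infty_def smooth_def K_def)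
  have z: "\<phi> x = 0" if "x \<notin> K" for x
    using that closure_subset[of "{x. \<phi> x \<noteq> 0}"] unfolding K_def by auto
  have d: "frechet_derivative \<phi> (at x) h = 0" if "x \<notin> K" for x h
  proof (rule frechet_derivative_zero_outside[of "- K"])
    show "\<phi> y = 0" if "y \<in> - K" for y using z that by simp
    show "open (- K)" using K(1) by (simp add: compact_imp_closed open_Compl)
    show "x \<in> - K" using that by simp
  qed
  show ?thesis by (rule that[OF K(1,2) z d K(3)])
qed

lemma Cc_inftyI:
  assumes "smooth \<phi>" "compact K" "K \<subseteq> \<Omega>" "\<And>x. x \<notin> K \<Longrightarrow> \<phi> x = 0"
  shows "\<phi> \<in> Cc_infty \<Omega>"
proof -
  have "closure {x. \<phi> x \<noteq> 0} \<subseteq> K"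
    using assms by (intro closure_minimal) (auto simp: compact_imp_closed)
  moreover from this have "compact (closure {x. \<phi> x \<noteq> 0})"
    using bounded_subset[OF compact_imp_bounded[OF assms(2)]] by (simp add: compact_eq_bounded_closed)
  ultimately show ?thesis
    using assms(1,3) by (auto simp: Cc_infty_def smooth_def)
qed

lemma Cc_infty_C1c:
  fixes \<phi> :: "'a::euclidean_space \<Rightarrow> real"
  assumes "\<phi> \<in> Cc_infty \<Omega>"
  shows "C1c \<phi> (gr \<phi>)"
proof -
  obtain K where K: "compact K" "\<And>x. x \<notin> K \<Longrightarrow> \<phi> x = 0" "smooth \<phi>" using Cc_inftyD[OF assms] by metis
  obtain B where B: "\<forall>x\<in>K. norm x \<le> B" using compact_imp_bounded[OF K(1)] bounded_iff by blast
  show ?thesis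
    by (rule smooth_C1c[OF K(3), of "B + 1"]) (use K B in force)
qed

text \<open>The functions \<open>\<lambda>y. rho \<epsilon> (x - y)\<close> are test functions for small \<open>\<epsilon>\<close>, so the mollifications of \<open>H\<close> at
  \<open>x\<close> vanish, and \<open>H\<close> is almost everywhere their limit.  Countably many balls cover \<open>\<Omega>\<close>.\<close>

lemma fundamental_lemma:
  fixes H :: "'a::euclidean_space \<Rightarrow> real"
  assumes \<Omega>: "open \<Omega>" and H: "locally_integrable \<Omega> H"
    and zero: "\<And>\<phi>. \<phi> \<in> Cc_infty \<Omega> \<Longrightarrow> (LINT x|lebesgue_on \<Omega>. H x * \<phi> x) = 0"
  shows "AE x in lebesgue_on \<Omega>. H x = 0"
proof -
  have ball0: "AE x in lebesgue. x \<in> ball p r \<longrightarrow> H x = 0" if pr: "cball p r \<subseteq> \<Omega>" for p r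
  proof -
    have "integrable (lebesgue_on (cball p r)) H" using H pr by (auto simp: locally_integrable_def)
    then obtain h where h: "integrable lborel h" "\<And>x. x \<notin> cball p r \<Longrightarrow> h x = 0"
      "AE x in lebesgue_on (cball p r). h x = H x"
      using integrable_borel_representative[of "cball p r" H] by auto
    have [measurable]: "h \<in> borel_measurable borel" using h by auto
    have ae: "AE x in lebesgue. x \<in> cball p r \<longrightarrow> h x = H x"
      using h(3) by (simp add: AE_restrict_space_iff)
    have "AE x in lborel. x \<in> ball p r \<longrightarrow> h x = 0"
    proof (rule conv_zero_AE[OF h(1)])
      fix x assume x: "x \<in> ball p r"
      show "\<exists>\<epsilon>0>0. \<forall>\<epsilon>. 0 < \<epsilon> \<and> \<epsilon> < \<epsilon>0 \<longrightarrow> conv (rho \<epsilon>) h x = 0"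
      proof (intro exI[of _ "r - dist p x"] conjI allI impI)
        show "0 < r - dist p x" using x by simp
        fix \<epsilon> assume \<epsilon>: "0 < \<epsilon> \<and> \<epsilon> < r - dist p x"
        have K: "cball x \<epsilon> \<subseteq> cball p r" using \<epsilon> by (auto simp: subset_iff) (smt (verit) dist_triangle)
        define \<phi> where "\<phi> y = rho \<epsilon> (x - y)" for y
        have \<phi>0: "\<phi> y = 0" if "y \<notin> cball x \<epsilon>" for y
          using that \<epsilon> by (auto simp: \<phi>_def dist_norm intro!: rho_outside)
        have \<phi>C: "\<phi> \<in> Cc_infty \<Omega>"
        proof (rule Cc_inftyI[of _ "cball x \<epsilon>"])
          show "smooth \<phi>" using smooth_affine[OF smooth_rho[of \<epsilon>], of x "-1"] \<epsilon> by (simp add: \<phi>_def[abs_def])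
        qed (use K pr \<phi>0 in auto)
        have "\<phi> \<in> borel_measurable borel"
          using Cc_infty_C1c[OF \<phi>C] by (rule C1c_measurable)
        then have \<phi>h: "(\<lambda>y. \<phi> y *\<^sub>R h y) \<in> borel_measurable lborel" by measurable
        from zero[OF \<phi>C] have "0 = (LINT y|lebesgue. indicator \<Omega> y *\<^sub>R (H y * \<phi> y))"
          using \<Omega> by (subst (asm) integral_lebesgue_on_zero_extension) auto
        also have "\<dots> = (LINT y|lebesgue. \<phi> y *\<^sub>R h y)"
        proof (rule Bochner_Integration.integral_cong_AE)
          have "continuous_on UNIV \<phi>" using Cc_infty_C1c[OF \<phi>C] by (rule C1c_continuous)
          then have "integrable (lebesgue_on \<Omega>) (\<lambda>y. H y * \<phi> y)"
            using K pr \<phi>0 by (intro integrable_test[OF \<Omega> H _ compact_cball[of x \<epsilon>]]) auto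
          then have "integrable lebesgue (\<lambda>y. indicator \<Omega> y *\<^sub>R (H y * \<phi> y))"
            using \<Omega> by (simp add: integrable_restrict_space)
          then show "(\<lambda>y. indicator \<Omega> y *\<^sub>R (H y * \<phi> y)) \<in> borel_measurable lebesgue" by auto
          show "(\<lambda>y. \<phi> y *\<^sub>R h y) \<in> borel_measurable lebesgue" using \<phi>h by (rule measurable_completion)
          show "AE y in lebesgue. indicator \<Omega> y *\<^sub>R (H y * \<phi> y) = \<phi> y *\<^sub>R h y"
            using ae
          proof eventually_elim
            case (elim y)
            then show ?case using K pr \<phi>0[of y]
              by (cases "y \<in> cball x \<epsilon>") (auto simp: subset_iff simp del: mem_cball)
          qed
        qed
        also have "\<dots> = (LINT y|lborel. \<phi> y *\<^sub>R h y)"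
          by (rule integral_completion[OF \<phi>h])
        finally show "conv (rho \<epsilon>) h x = 0" by (simp add: conv_def \<phi>_def)
      qed
    qed
    then have "AE x in lebesgue. x \<in> ball p r \<longrightarrow> h x = 0" by (rule AE_completion)
    with ae show ?thesis by eventually_elim auto
  qed
  have "\<forall>p\<in>\<Omega>. \<exists>r>0. cball p r \<subseteq> \<Omega>" using \<Omega> open_contains_cball by blast
  then obtain r where r: "\<And>p. p \<in> \<Omega> \<Longrightarrow> r p > 0" "\<And>p. p \<in> \<Omega> \<Longrightarrow> cball p (r p) \<subseteq> \<Omega>" by metis
  obtain C where C: "C \<subseteq> (\<lambda>p. ball p (r p)) ` \<Omega>" "countable C" "\<Union>C = \<Union>((\<lambda>p. ball p (r p)) ` \<Omega>)"
    using Lindelof[of "(\<lambda>p. ball p (r p)) ` \<Omega>"] by auto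
  have "AE x in lebesgue. \<forall>U\<in>C. x \<in> U \<longrightarrow> H x = 0"
    using C ball0 r by (subst AE_ball_countable) auto
  moreover have "\<Omega> \<subseteq> \<Union>C" using C(3) r by force
  ultimately have "AE x in lebesgue. x \<in> \<Omega> \<longrightarrow> H x = 0" by (auto elim!: eventually_mono)
  then show ?thesis using \<Omega> by (simp add: AE_restrict_space_iff)
qed

definition mgrad :: "(real ^ 'n \<Rightarrow> real ^ 'd) \<Rightarrow> real ^ 'n \<Rightarrow> real ^ 'n ^ 'd" where
  "mgrad \<phi> x = (\<chi> i j. frechet_derivative \<phi> (at x) (axis j 1) $ i)"

lemma gr_nth:
  fixes f :: "real ^ 'n \<Rightarrow> real"
  shows "gr f x $ j = frechet_derivative f (at x) (axis j 1)"
proof -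
  have "axis j 1 \<in> (Basis :: (real ^ 'n) set)" by (auto simp: Basis_vec_def)
  from gr_inner[OF this, of f x] show ?thesis by (simp add: inner_axis)
qed

lemma frechet_component:
  assumes "smooth \<phi>"
  shows "frechet_derivative (\<lambda>x. \<phi> x $ i) (at x) h = frechet_derivative \<phi> (at x) h $ i"
  using frechet_derivativeI[OF bounded_linear.has_derivative[OF bounded_linear_vec_nth
      frechet_works[OF smoothD(1)[OF assms]], of i x]] by simp

lemma mgrad_row: "smooth \<phi> \<Longrightarrow> mgrad \<phi> x $ i = gr (\<lambda>x. \<phi> x $ i) x"
  by (simp add: vec_eq_iff mgrad_def gr_nth frechet_component)

lemma Cc_infty_component:
  assumes "\<phi> \<in> Cc_infty \<Omega>"
  shows "(\<lambda>x. \<phi> x $ i) \<in> Cc_infty \<Omega>"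
proof -
  obtain K where K: "compact K" "K \<subseteq> \<Omega>" "\<And>x. x \<notin> K \<Longrightarrow> \<phi> x = 0" "smooth \<phi>" using Cc_inftyD[OF assms] by metis
  show ?thesis
    by (rule Cc_inftyI[OF smooth_bounded_linear[OF bounded_linear_vec_nth K(4)] K(1,2)]) (simp add: K(3))
qed

lemma mgrad_outside:
  assumes "\<phi> \<in> Cc_infty \<Omega>" "x \<notin> \<Omega>"
  shows "\<phi> x = 0" "mgrad \<phi> x = 0"
proof -
  obtain K where K: "K \<subseteq> \<Omega>" "\<And>x. x \<notin> K \<Longrightarrow> \<phi> x = 0"
    "\<And>x h. x \<notin> K \<Longrightarrow> frechet_derivative \<phi> (at x) h = 0" using Cc_inftyD[OF assms(1)] by metis
  then have "x \<notin> K" using assms(2) by blast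
  then show "\<phi> x = 0" "mgrad \<phi> x = 0"
    using K(2,3) by (simp_all add: mgrad_def vec_eq_iff)
qed

lemma mgrad_continuous: "smooth \<phi> \<Longrightarrow> continuous_on UNIV (mgrad \<phi>)"
  unfolding mgrad_def[abs_def]
  by (intro continuous_intros smooth_continuous smoothD) (auto simp: Basis_vec_def)

lemma continuous_locally_integrable:
  fixes f :: "'a::euclidean_space \<Rightarrow> 'b::euclidean_space"
  assumes "continuous_on UNIV f"
  shows "locally_integrable \<Omega> f"
  unfolding locally_integrable_def
proof (intro allI impI)
  fix K assume K: "compact K \<and> K \<subseteq> \<Omega>"
  have "integrable lborel (\<lambda>x. indicator K x *\<^sub>R f x)"
    using K assms by (intro borel_integrable_compact) (auto intro: continuous_on_subset)
  then have "integrable lebesgue (\<lambda>x. indicator K x *\<^sub>R f x)"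
    by (subst integrable_completion) auto
  then show "integrable (lebesgue_on K) f"
    using K by (simp add: integrable_restrict_space borel_closed compact_imp_closed)
qed

lemma integral_lebesgue_on_borel:
  fixes f :: "'a::euclidean_space \<Rightarrow> 'b::euclidean_space"
  assumes "open \<Omega>" "f \<in> borel_measurable borel" "\<And>x. x \<notin> \<Omega> \<Longrightarrow> f x = 0"
  shows "(LINT x|lebesgue_on \<Omega>. f x) = (\<integral>x. f x \<partial>lborel)"
proof -
  have "(\<lambda>x. indicator \<Omega> x *\<^sub>R f x) = f" using assms(3) by (force simp: indicator_def)
  then show ?thesis
    using assms(1,2) by (simp add: integral_lebesgue_on_zero_extension integral_completion)
qed

lemma nn_integral_lebesgue_on_borel:
  assumes "open \<Omega>" "f \<in> borel_measurable borel" "\<And>x. x \<notin> \<Omega> \<Longrightarrow> f x = 0"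
  shows "(\<integral>\<^sup>+x. f x \<partial>lebesgue_on \<Omega>) = (\<integral>\<^sup>+x. f x \<partial>lborel)"
proof -
  have "(\<lambda>x. f x * indicator \<Omega> x) = f" using assms(3) by (force simp: indicator_def)
  then show ?thesis
    using assms(1,2) by (simp add: nn_integral_restrict_space nn_integral_completion)
qed

text \<open>Integration by parts, that is \<open>C1c_integral_deriv\<close> for the product of two test functions.\<close>

lemma Cc_infty_has_weak_grad:
  assumes "open \<Omega>" "\<phi> \<in> Cc_infty \<Omega>"
  shows "has_weak_grad \<Omega> \<phi> (mgrad \<phi>)"
proof -
  obtain K where K: "K \<subseteq> \<Omega>" "\<And>x. x \<notin> K \<Longrightarrow> \<phi> x = 0" "smooth \<phi>" using Cc_inftyD[OF assms(2)] by metis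
  show ?thesis
    unfolding has_weak_grad_def
  proof (intro conjI ballI allI)
    show "locally_integrable \<Omega> \<phi>" "locally_integrable \<Omega> (mgrad \<phi>)"
      using continuous_locally_integrable[OF smooth_continuous[OF K(3)]]
        continuous_locally_integrable[OF mgrad_continuous[OF K(3)]] by auto
    fix \<psi> :: "real ^ 'a \<Rightarrow> real" and i j assume \<psi>: "\<psi> \<in> Cc_infty \<Omega>"
    let ?u = "\<lambda>x. \<phi> x $ i"
    have C: "C1c ?u (gr ?u)" "C1c \<psi> (gr \<psi>)" using Cc_infty_C1c \<psi> Cc_infty_component[OF assms(2)] by blast+
    note [measurable] = C1c_measurable[OF C(1)] C1c_measurable[OF C(2)]
    obtain K' where K': "K' \<subseteq> \<Omega>" "\<And>x. x \<notin> K' \<Longrightarrow> \<psi> x = 0" using Cc_inftyD[OF \<psi>] by metis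
    have out: "\<phi> x = 0" "\<psi> x = 0" if "x \<notin> \<Omega>" for x
      using mgrad_outside[OF assms(2) that] K' that by auto
    have e1: "\<phi> x $ i * frechet_derivative \<psi> (at x) (axis j 1) = (?u x *\<^sub>R gr \<psi> x) \<bullet> axis j 1" for x
      by (simp add: inner_axis gr_nth)
    have e2: "mgrad \<phi> x $ i $ j * \<psi> x = (\<psi> x *\<^sub>R gr ?u x) \<bullet> axis j 1" for x
      by (simp add: inner_axis mgrad_row[OF K(3)])
    have "(\<integral>x. (?u x *\<^sub>R gr \<psi> x + \<psi> x *\<^sub>R gr ?u x) \<bullet> axis j 1 \<partial>lborel) = 0"
      by (rule C1c_integral_deriv[OF C1c_mult[OF C]])
    moreover have "(\<integral>x. (?u x *\<^sub>R gr \<psi> x + \<psi> x *\<^sub>R gr ?u x) \<bullet> axis j 1 \<partial>lborel) =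
      (\<integral>x. (?u x *\<^sub>R gr \<psi> x) \<bullet> axis j 1 \<partial>lborel) + (\<integral>x. (\<psi> x *\<^sub>R gr ?u x) \<bullet> axis j 1 \<partial>lborel)"
    proof -
      obtain B where B: "\<And>x. \<bar>?u x\<bar> \<le> B" using C1c_bounded[OF C(1)] by metis
      obtain B' where B': "\<And>x. \<bar>\<psi> x\<bar> \<le> B'" using C1c_bounded[OF C(2)] by metis
      have "integrable lborel (\<lambda>x. ?u x *\<^sub>R gr \<psi> x)" "integrable lborel (\<lambda>x. \<psi> x *\<^sub>R gr ?u x)"
        using integrable_scaleR_bounded[OF C1c_integrable(2)[OF C(2)] _ B]
          integrable_scaleR_bounded[OF C1c_integrable(2)[OF C(1)] _ B'] by auto
      then show ?thesis unfolding inner_add_left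
        by (intro Bochner_Integration.integral_add integrable_inner_left) auto
    qed
    moreover have "(LINT x|lebesgue_on \<Omega>. \<phi> x $ i * frechet_derivative \<psi> (at x) (axis j 1)) =
       (\<integral>x. (?u x *\<^sub>R gr \<psi> x) \<bullet> axis j 1 \<partial>lborel)"
      unfolding e1 by (rule integral_lebesgue_on_borel[OF assms(1)]) (auto simp: out)
    moreover have "(LINT x|lebesgue_on \<Omega>. mgrad \<phi> x $ i $ j * \<psi> x) =
       (\<integral>x. (\<psi> x *\<^sub>R gr ?u x) \<bullet> axis j 1 \<partial>lborel)"
      unfolding e2 by (rule integral_lebesgue_on_borel[OF assms(1)]) (auto simp: out)
    ultimately show "(LINT x|lebesgue_on \<Omega>. \<phi> x $ i * frechet_derivative \<psi> (at x) (axis j 1)) =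
        - (LINT x|lebesgue_on \<Omega>. mgrad \<phi> x $ i $ j * \<psi> x)" by simp
  qed
qed

lemma test_integrable:
  assumes "open \<Omega>" "\<psi> \<in> Cc_infty \<Omega>"
  shows "locally_integrable \<Omega> u \<Longrightarrow>
      integrable (lebesgue_on \<Omega>) (\<lambda>x. u x $ i * frechet_derivative \<psi> (at x) (axis j 1))"
    and "locally_integrable \<Omega> (G :: real ^ 'n \<Rightarrow> real ^ 'n ^ 'd) \<Longrightarrow>
      integrable (lebesgue_on \<Omega>) (\<lambda>x. G x $ i $ j * (\<psi> x :: real))"
proof -
  obtain K where K: "compact K" "K \<subseteq> \<Omega>" "\<And>x. x \<notin> K \<Longrightarrow> \<psi> x = 0"
    "\<And>x h. x \<notin> K \<Longrightarrow> frechet_derivative \<psi> (at x) h = 0" "smooth \<psi>" using Cc_inftyD[OF assms(2)] by metis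
  have c: "continuous_on UNIV \<psi>" "continuous_on UNIV (\<lambda>x. frechet_derivative \<psi> (at x) (axis j 1))"
    using K(5) by (auto intro!: smooth_continuous smoothD simp: Basis_vec_def)
  {
    assume "locally_integrable \<Omega> u"
    from locally_integrable_inner[OF this, of "axis i 1"]
    show "integrable (lebesgue_on \<Omega>) (\<lambda>x. u x $ i * frechet_derivative \<psi> (at x) (axis j 1))"
      using integrable_test[OF assms(1) _ c(2) K(1,2) K(4), of "\<lambda>x. u x $ i"] by (simp add: inner_axis)
  next
    assume "locally_integrable \<Omega> G"
    from locally_integrable_inner[OF this, of "axis i (axis j 1)"]
    show "integrable (lebesgue_on \<Omega>) (\<lambda>x. G x $ i $ j * \<psi> x)"
      using integrable_test[OF assms(1) _ c(1) K(1,2) K(3), of "\<lambda>x. G x $ i $ j"] by (simp add: inner_axis)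
  }
qed

lemma has_weak_grad_add:
  assumes "open \<Omega>" "has_weak_grad \<Omega> u G" "has_weak_grad \<Omega> v H"
  shows "has_weak_grad \<Omega> (\<lambda>x. u x + v x) (\<lambda>x. G x + H x)"
  unfolding has_weak_grad_def
proof (intro conjI ballI allI)
  have l: "locally_integrable \<Omega> u" "locally_integrable \<Omega> G" "locally_integrable \<Omega> v" "locally_integrable \<Omega> H"
    using assms by (auto simp: has_weak_grad_def)
  then show "locally_integrable \<Omega> (\<lambda>x. u x + v x)" "locally_integrable \<Omega> (\<lambda>x. G x + H x)"
    by (auto simp: locally_integrable_def)
  fix \<psi> :: "real ^ 'a \<Rightarrow> real" and i j assume \<psi>: "\<psi> \<in> Cc_infty \<Omega>"
  note t = test_integrable[OF assms(1) \<psi>]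
  show "(LINT x|lebesgue_on \<Omega>. (u x + v x) $ i * frechet_derivative \<psi> (at x) (axis j 1)) =
      - (LINT x|lebesgue_on \<Omega>. (G x + H x) $ i $ j * \<psi> x)"
    using assms(2,3) \<psi> t(1)[OF l(1)] t(1)[OF l(3)] t(2)[OF l(2)] t(2)[OF l(4)]
    by (simp add: has_weak_grad_def distrib_right)
qed

lemma has_weak_grad_uminus:
  assumes "has_weak_grad \<Omega> u G"
  shows "has_weak_grad \<Omega> (\<lambda>x. - u x) (\<lambda>x. - G x)"
  using assms by (auto simp: has_weak_grad_def locally_integrable_def)

lemma has_weak_grad_diff:
  assumes "open \<Omega>" "has_weak_grad \<Omega> u G" "has_weak_grad \<Omega> v H"
  shows "has_weak_grad \<Omega> (\<lambda>x. u x - v x) (\<lambda>x. G x - H x)"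
  using has_weak_grad_add[OF assms(1,2) has_weak_grad_uminus[OF assms(3)]] by simp

lemma has_weak_grad_unique:
  assumes \<Omega>: "open \<Omega>" and G: "has_weak_grad \<Omega> u G" "has_weak_grad \<Omega> u H"
  shows "AE x in lebesgue_on \<Omega>. G x = H x"
proof -
  have d: "has_weak_grad \<Omega> (\<lambda>x. u x - u x) (\<lambda>x. G x - H x)" by (rule has_weak_grad_diff[OF \<Omega> G])
  have "AE x in lebesgue_on \<Omega>. (G x - H x) $ i $ j = 0" for i j
  proof (rule fundamental_lemma[OF \<Omega>])
    show "locally_integrable \<Omega> (\<lambda>x. (G x - H x) $ i $ j)"
      using locally_integrable_inner[of \<Omega> "\<lambda>x. G x - H x" "axis i (axis j 1)"] d
      by (simp add: has_weak_grad_def inner_axis)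
    fix \<psi> :: "real ^ 'a \<Rightarrow> real"
    show "(LINT x|lebesgue_on \<Omega>. (G x - H x) $ i $ j * \<psi> x) = 0" if "\<psi> \<in> Cc_infty \<Omega>"
      using that
    proof -
      assume "\<psi> \<in> Cc_infty \<Omega>"
      then have "(LINT x|lebesgue_on \<Omega>. (u x - u x) $ i * frechet_derivative \<psi> (at x) (axis j 1)) =
        - (LINT x|lebesgue_on \<Omega>. (G x - H x) $ i $ j * \<psi> x)"
        using d unfolding has_weak_grad_def by blast
      then show ?thesis by simp
    qed
  qed
  then have "AE x in lebesgue_on \<Omega>. \<forall>i j. (G x - H x) $ i $ j = 0"
    by (simp add: AE_all_countable)
  then show ?thesis by eventually_elim (simp add: vec_eq_iff)
qed

lemma weak_grad_works:
  assumes "has_weak_grad \<Omega> u G"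
  shows "has_weak_grad \<Omega> u (weak_grad \<Omega> u)"
  unfolding weak_grad_def using assms by (rule someI[of "has_weak_grad \<Omega> u"])

lemma weak_grad_AE:
  assumes "open \<Omega>" "has_weak_grad \<Omega> u G"
  shows "AE x in lebesgue_on \<Omega>. weak_grad \<Omega> u x = G x"
  by (rule has_weak_grad_unique[OF assms(1) weak_grad_works[OF assms(2)] assms(2)])

lemma locally_integrable_measurable:
  fixes f :: "'a::euclidean_space \<Rightarrow> 'b::euclidean_space"
  assumes "open \<Omega>" "locally_integrable \<Omega> f"
  shows "f \<in> borel_measurable (lebesgue_on \<Omega>)"
proof -
  obtain C where C: "\<And>n. compact (C n)" "\<And>n. C n \<subseteq> \<Omega>" "\<And>n. C n \<subseteq> interior (C (Suc n))" "\<Union>(range C) = \<Omega>"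
    using open_Union_compact_subsets[OF assms(1)] by metis
  have "C n \<subseteq> C (Suc n)" for n
    using C(3)[of n] interior_subset[of "C (Suc n)"] by (rule order_trans)
  then have mono: "C m \<subseteq> C n" if "m \<le> n" for m n
    using that by (rule lift_Suc_mono_le)
  have m: "(\<lambda>x. indicator (C n) x *\<^sub>R f x) \<in> borel_measurable lebesgue" for n
  proof -
    have "integrable (lebesgue_on (C n)) f" using assms C by (auto simp: locally_integrable_def)
    then have "integrable lebesgue (\<lambda>x. indicator (C n) x *\<^sub>R f x)"
      using C(1)[of n] by (simp add: integrable_restrict_space borel_closed compact_imp_closed)
    then show ?thesis by auto
  qed
  have "(\<lambda>x. indicator \<Omega> x *\<^sub>R f x) \<in> borel_measurable lebesgue"
  proof (rule borel_measurable_LIMSEQ_metric[OF m])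
    fix x
    show "(\<lambda>n. indicator (C n) x *\<^sub>R f x) \<longlonglongrightarrow> indicator \<Omega> x *\<^sub>R f x"
    proof (cases "x \<in> \<Omega>")
      case True
      then obtain m where "x \<in> C m" using C(4) by blast
      then have "\<forall>\<^sub>F n in sequentially. x \<in> C n"
        using mono by (auto simp: eventually_sequentially intro!: exI[of _ m])
      then show ?thesis using True by (intro tendsto_eventually) (auto elim!: eventually_mono)
    next
      case False
      then have "x \<notin> C n" for n using C(2) by blast
      then show ?thesis using False by simp
    qed
  qed
  then show ?thesis
    using assms(1) by (subst borel_measurable_restrict_space_iff) (auto simp: mult.commute)
qed

lemma W11D:
  assumes "open \<Omega>" "u \<in> W11 \<Omega>"
  shows "integrable (lebesgue_on \<Omega>) u" "has_weak_grad \<Omega> u (weak_grad \<Omega> u)"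
    "integrable (lebesgue_on \<Omega>) (weak_grad \<Omega> u)"
proof -
  obtain G where G: "has_weak_grad \<Omega> u G" "integrable (lebesgue_on \<Omega>) G" and u: "integrable (lebesgue_on \<Omega>) u"
    using assms(2) by (auto simp: W11_def)
  show "integrable (lebesgue_on \<Omega>) u" by (rule u)
  show w: "has_weak_grad \<Omega> u (weak_grad \<Omega> u)" by (rule weak_grad_works[OF G(1)])
  show "integrable (lebesgue_on \<Omega>) (weak_grad \<Omega> u)"
  proof (rule integrable_cong_AE_imp[OF G(2)])
    show "weak_grad \<Omega> u \<in> borel_measurable (lebesgue_on \<Omega>)"
      using w by (intro locally_integrable_measurable assms) (simp add: has_weak_grad_def)
    show "AE x in lebesgue_on \<Omega>. G x = weak_grad \<Omega> u x"
      using weak_grad_AE[OF assms(1) G(1)] by eventually_elim simp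
  qed
qed

lemma W11I: "has_weak_grad \<Omega> u G \<Longrightarrow> integrable (lebesgue_on \<Omega>) u \<Longrightarrow> integrable (lebesgue_on \<Omega>) G \<Longrightarrow> u \<in> W11 \<Omega>"
  by (auto simp: W11_def)

lemma integrable_lebesgue_on_borel:
  fixes f :: "'a::euclidean_space \<Rightarrow> 'b::euclidean_space"
  assumes "open \<Omega>" "integrable lborel f"
  shows "integrable (lebesgue_on \<Omega>) f"
proof -
  have "integrable lebesgue f" using assms(2) by (subst integrable_completion) auto
  then have "integrable lebesgue (\<lambda>x. indicator \<Omega> x *\<^sub>R f x)"
    using integrable_mult_indicator[of \<Omega> lebesgue f] assms(1) by simp
  then show ?thesis using assms(1) by (simp add: integrable_restrict_space)
qed

lemma Cc_infty_integrable:
  fixes \<phi> :: "real ^ 'n \<Rightarrow> real ^ 'd"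
  assumes "\<phi> \<in> Cc_infty \<Omega>"
  shows "integrable lborel \<phi>" "integrable lborel (mgrad \<phi>)"
    and "\<phi> \<in> borel_measurable borel" "mgrad \<phi> \<in> borel_measurable borel"
    and "\<exists>B>0. (\<forall>x. norm (\<phi> x) \<le> B) \<and> (\<forall>x. norm (mgrad \<phi> x) \<le> B)"
proof -
  obtain K where K: "compact K" "\<And>x. x \<notin> K \<Longrightarrow> \<phi> x = 0"
    "\<And>x h. x \<notin> K \<Longrightarrow> frechet_derivative \<phi> (at x) h = 0" "smooth \<phi>" using Cc_inftyD[OF assms] by metis
  obtain B where "\<forall>x\<in>K. norm x \<le> B" using compact_imp_bounded[OF K(1)] bounded_iff by blast
  then have R: "x \<notin> K" if "norm x \<ge> B + 1" for x using that by fastforce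
  have z: "\<phi> x = 0" "mgrad \<phi> x = 0" if "norm x \<ge> B + 1" for x
    using K(2,3) R[OF that] by (auto simp: mgrad_def vec_eq_iff)
  have c: "continuous_on UNIV \<phi>" "continuous_on UNIV (mgrad \<phi>)"
    using smooth_continuous[OF K(4)] mgrad_continuous[OF K(4)] by auto
  show "integrable lborel \<phi>" "integrable lborel (mgrad \<phi>)"
    using integrable_compact_support[OF c(1), of "B + 1"] integrable_compact_support[OF c(2), of "B + 1"] z by auto
  then show "\<phi> \<in> borel_measurable borel" "mgrad \<phi> \<in> borel_measurable borel" by auto
  obtain B1 where B1: "B1 > 0" "\<And>x. norm (\<phi> x) \<le> B1" using compact_support_bound[OF c(1), of "B + 1"] z by blast
  obtain B2 where B2: "B2 > 0" "\<And>x. norm (mgrad \<phi> x) \<le> B2" using compact_support_bound[OF c(2), of "B + 1"] z by blast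
  show "\<exists>B>0. (\<forall>x. norm (\<phi> x) \<le> B) \<and> (\<forall>x. norm (mgrad \<phi> x) \<le> B)"
    using B1 B2 by (intro exI[of _ "max B1 B2"]) (auto simp: le_max_iff_disj)
qed

lemma Cc_infty_W11_0:
  fixes \<phi> :: "real ^ 'n \<Rightarrow> real ^ 'd"
  assumes "open \<Omega>" "\<phi> \<in> Cc_infty \<Omega>"
  shows "\<phi> \<in> W11_0 \<Omega>"
proof -
  have w: "has_weak_grad \<Omega> \<phi> (mgrad \<phi>)" by (rule Cc_infty_has_weak_grad[OF assms])
  have "\<phi> \<in> W11 \<Omega>"
    using Cc_infty_integrable[OF assms(2)] by (intro W11I[OF w] integrable_lebesgue_on_borel assms(1))
  moreover have "W11_norm \<Omega> (\<lambda>x. \<phi> x - \<phi> x) = 0"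
  proof -
    have "has_weak_grad \<Omega> (\<lambda>x. \<phi> x - \<phi> x) (\<lambda>x. mgrad \<phi> x - mgrad \<phi> x)"
      by (rule has_weak_grad_diff[OF assms(1) w w])
    then have h: "has_weak_grad \<Omega> (\<lambda>x. 0) (\<lambda>x. 0 :: real ^ 'n ^ 'd)" by simp
    then have "AE x in lebesgue_on \<Omega>. weak_grad \<Omega> (\<lambda>x. 0 :: real ^ 'd) x = 0" by (rule weak_grad_AE[OF assms(1)])
    then have "(LINT x|lebesgue_on \<Omega>. norm (weak_grad \<Omega> (\<lambda>x. 0 :: real ^ 'd) x)) = 0"
      by (intro integral_eq_zero_AE) (auto elim!: eventually_mono)
    then show ?thesis by (simp add: W11_norm_def)
  qed
  ultimately show ?thesis
    using assms(2) by (auto simp: W11_0_def intro!: exI[of _ "\<lambda>_. \<phi>"])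
qed

text \<open>A zero trace enters here, and only as membership in the closure of the test functions:
  test functions on \<open>\<Omega>\<close> are test functions on the whole space, and outside of \<open>\<Omega>\<close> they coincide
  with the extension of \<open>v\<close> by zero.\<close>

lemma W11_0_sob:
  fixes v :: "real ^ 'n \<Rightarrow> real ^ 'd"
  assumes \<Omega>: "open \<Omega>" and v: "v \<in> W11_0 \<Omega>"
    and w: "integrable lborel w" "\<And>x. x \<notin> \<Omega> \<Longrightarrow> w x = 0" "AE x in lebesgue_on \<Omega>. w x = v x"
    and G: "integrable lborel G" "\<And>x. x \<notin> \<Omega> \<Longrightarrow> G x = 0" "AE x in lebesgue_on \<Omega>. G x = weak_grad \<Omega> v x"
  shows "sob (\<lambda>x. w x $ i) (\<lambda>x. G x $ i)"
  unfolding sob_def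
proof (intro conjI allI impI)
  show "integrable lborel (\<lambda>x. w x $ i)" "integrable lborel (\<lambda>x. G x $ i)"
    using w(1) G(1) by (auto intro: integrable_bounded_linear[OF bounded_linear_vec_nth])
  have [measurable]: "w \<in> borel_measurable borel" "G \<in> borel_measurable borel" using w(1) G(1) by auto
  have m[measurable]: "(\<lambda>x. w x $ i) \<in> borel_measurable borel" "(\<lambda>x. G x $ i) \<in> borel_measurable borel"
    using \<open>integrable lborel (\<lambda>x. w x $ i)\<close> \<open>integrable lborel (\<lambda>x. G x $ i)\<close> by auto
  fix e :: real assume "e > 0"
  obtain \<phi> where \<phi>: "\<And>k. \<phi> k \<in> Cc_infty \<Omega>" "(\<lambda>k. W11_norm \<Omega> (\<lambda>x. \<phi> k x - v x)) \<longlonglongrightarrow> 0"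
    and vW: "v \<in> W11 \<Omega>"
    using v by (auto simp: W11_0_def)
  have "\<forall>\<^sub>F k in sequentially. W11_norm \<Omega> (\<lambda>x. \<phi> k x - v x) < e"
    using order_tendstoD(2)[OF \<phi>(2) \<open>e > 0\<close>] .
  then obtain k where k: "W11_norm \<Omega> (\<lambda>x. \<phi> k x - v x) < e" by (auto simp: eventually_sequentially)
  let ?u = "\<lambda>x. \<phi> k x $ i"
  have C: "C1c ?u (gr ?u)" by (rule Cc_infty_C1c[OF Cc_infty_component[OF \<phi>(1)]])
  note [measurable] = C1c_measurable[OF C]
  obtain K where sm: "smooth (\<phi> k)" using Cc_inftyD[OF \<phi>(1)] by metis
  note wv = W11D[OF \<Omega> vW]
  have hd: "has_weak_grad \<Omega> (\<lambda>x. \<phi> k x - v x) (\<lambda>x. mgrad (\<phi> k) x - weak_grad \<Omega> v x)"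
    by (rule has_weak_grad_diff[OF \<Omega> Cc_infty_has_weak_grad[OF \<Omega> \<phi>(1)] wv(2)])
  have i1: "integrable (lebesgue_on \<Omega>) (\<lambda>x. \<phi> k x - v x)"
    "integrable (lebesgue_on \<Omega>) (\<lambda>x. mgrad (\<phi> k) x - weak_grad \<Omega> v x)"
    by (intro Bochner_Integration.integrable_diff wv integrable_lebesgue_on_borel[OF \<Omega>] Cc_infty_integrable[OF \<phi>(1)])+
  have "sdist ?u (gr ?u) (\<lambda>x. w x $ i) (\<lambda>x. G x $ i) =
     (\<integral>\<^sup>+x. ennreal (\<bar>?u x - w x $ i\<bar> + norm (gr ?u x - G x $ i)) \<partial>lebesgue_on \<Omega>)"
    unfolding sdist_def
  proof (rule nn_integral_lebesgue_on_borel[OF \<Omega>, symmetric])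
    fix x assume "x \<notin> \<Omega>"
    then show "ennreal (\<bar>?u x - w x $ i\<bar> + norm (gr ?u x - G x $ i)) = 0"
      using mgrad_outside[OF \<phi>(1), of x k] w(2) G(2) by (simp flip: mgrad_row[OF sm])
  qed measurable
  also have "\<dots> \<le> (\<integral>\<^sup>+x. ennreal (norm (\<phi> k x - v x) + norm (mgrad (\<phi> k) x - weak_grad \<Omega> v x)) \<partial>lebesgue_on \<Omega>)"
  proof (rule nn_integral_mono_AE)
    show "AE x in lebesgue_on \<Omega>. ennreal (\<bar>?u x - w x $ i\<bar> + norm (gr ?u x - G x $ i)) \<le>
      ennreal (norm (\<phi> k x - v x) + norm (mgrad (\<phi> k) x - weak_grad \<Omega> v x))"
      using w(3) G(3)
    proof eventually_elim
      case (elim x)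
      have "\<bar>?u x - w x $ i\<bar> \<le> norm (\<phi> k x - v x)"
        using component_le_norm_cart[of "\<phi> k x - v x" i] elim by simp
      moreover have "norm (gr ?u x - G x $ i) \<le> norm (mgrad (\<phi> k) x - weak_grad \<Omega> v x)"
        using Finite_Cartesian_Product.norm_nth_le[of "mgrad (\<phi> k) x - weak_grad \<Omega> v x" i] elim by (simp add: mgrad_row[OF sm])
      ultimately show ?case by (intro ennreal_leI add_mono)
    qed
  qed
  also have "\<dots> = ennreal (LINT x|lebesgue_on \<Omega>. norm (\<phi> k x - v x) + norm (mgrad (\<phi> k) x - weak_grad \<Omega> v x))"
    using i1 by (intro nn_integral_eq_integral) auto
  also have "(LINT x|lebesgue_on \<Omega>. norm (\<phi> k x - v x) + norm (mgrad (\<phi> k) x - weak_grad \<Omega> v x))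
     = W11_norm \<Omega> (\<lambda>x. \<phi> k x - v x)"
  proof -
    have wm: "weak_grad \<Omega> (\<lambda>x. \<phi> k x - v x) \<in> borel_measurable (lebesgue_on \<Omega>)"
      using weak_grad_works[OF hd] by (intro locally_integrable_measurable[OF \<Omega>]) (simp add: has_weak_grad_def)
    have "(LINT x|lebesgue_on \<Omega>. norm (mgrad (\<phi> k) x - weak_grad \<Omega> v x)) =
      (LINT x|lebesgue_on \<Omega>. norm (weak_grad \<Omega> (\<lambda>x. \<phi> k x - v x) x))"
    proof (rule Bochner_Integration.integral_cong_AE)
      show "(\<lambda>x. norm (mgrad (\<phi> k) x - weak_grad \<Omega> v x)) \<in> borel_measurable (lebesgue_on \<Omega>)"
        using i1(2) by auto
      show "(\<lambda>x. norm (weak_grad \<Omega> (\<lambda>x. \<phi> k x - v x) x)) \<in> borel_measurable (lebesgue_on \<Omega>)"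
        using wm by measurable
      show "AE x in lebesgue_on \<Omega>. norm (mgrad (\<phi> k) x - weak_grad \<Omega> v x) = norm (weak_grad \<Omega> (\<lambda>x. \<phi> k x - v x) x)"
        using weak_grad_AE[OF \<Omega> hd] by eventually_elim simp
    qed
    then show ?thesis using i1 by (simp add: W11_norm_def)
  qed
  also have "ennreal (W11_norm \<Omega> (\<lambda>x. \<phi> k x - v x)) < ennreal e" using k \<open>e > 0\<close> by (rule ennreal_lessI[rotated])
  finally show "\<exists>\<phi> d\<phi>. C1c \<phi> d\<phi> \<and> sdist \<phi> d\<phi> (\<lambda>x. w x $ i) (\<lambda>x. G x $ i) < ennreal e" using C by blast
qed

section \<open>Modulars\<close>

text \<open>The properties of \<open>M\<close> on which density rests.  All but the doubling condition hold at every point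
  of \<open>\<Omega>\<close>, and the two bounding functions of a weak \<open>N\<close>-function appear as uniform bounds on balls and on their
  complements.  In the doubling condition, small \<open>\<xi>\<close> are absorbed by \<open>h\<close>.\<close>

locale modular =
  fixes \<Omega> :: "(real ^ 'n) set" and M :: "real ^ 'n \<Rightarrow> real ^ 'n ^ 'd \<Rightarrow> real"
  assumes open_\<Omega>: "open \<Omega>" and bounded_\<Omega>: "bounded \<Omega>"
    and M_nonneg: "x \<in> \<Omega> \<Longrightarrow> 0 \<le> M x \<xi>"
    and M_cont: "continuous_on (\<Omega> \<times> UNIV) (\<lambda>(x, \<xi>). M x \<xi>)"
    and M_zero: "x \<in> \<Omega> \<Longrightarrow> M x 0 = 0"
    and M_convex: "x \<in> \<Omega> \<Longrightarrow> convex_on UNIV (M x)"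
    and M_even: "x \<in> \<Omega> \<Longrightarrow> M x (- \<xi>) = M x \<xi>"
    and M_lower: "r > 0 \<Longrightarrow> \<exists>\<mu>>0. \<forall>x\<in>\<Omega>. \<forall>\<xi>. norm \<xi> \<ge> r \<longrightarrow> M x \<xi> \<ge> \<mu>"
    and M_upper: "\<exists>B\<ge>0. \<forall>x\<in>\<Omega>. \<forall>\<xi>. norm \<xi> \<le> R \<longrightarrow> M x \<xi> \<le> B"
    and M_double: "\<exists>c\<ge>0. \<exists>h. integrable lborel h \<and> (\<forall>x. 0 \<le> h x) \<and>
        (AE x in lborel. x \<in> \<Omega> \<longrightarrow> (\<forall>\<xi>. M x (2 *\<^sub>R \<xi>) \<le> c * M x \<xi> + h x))"
begin

lemma \<Omega>_borel[measurable]: "\<Omega> \<in> sets borel" using open_\<Omega> by simp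

lemma \<Omega>_finite: "emeasure lborel \<Omega> < \<infinity>"
  by (rule emeasure_bounded_finite[OF bounded_\<Omega>])

lemma M_continuous: "x \<in> \<Omega> \<Longrightarrow> continuous_on UNIV (M x)"
proof -
  assume x: "x \<in> \<Omega>"
  have "continuous_on UNIV (\<lambda>\<xi>. (\<lambda>(x, \<xi>). M x \<xi>) (x, \<xi>))"
    by (rule continuous_on_compose2[OF M_cont]) (use x in \<open>auto intro!: continuous_intros\<close>)
  then show ?thesis by simp
qed

lemma M_continuous_space: "continuous_on \<Omega> (\<lambda>x. M x \<xi>)"
proof -
  have "continuous_on \<Omega> (\<lambda>x. (\<lambda>(x, \<xi>). M x \<xi>) (x, \<xi>))"
    by (rule continuous_on_compose2[OF M_cont]) (auto intro!: continuous_intros)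
  then show ?thesis by simp
qed

definition Mb :: "real ^ 'n \<Rightarrow> real ^ 'n ^ 'd \<Rightarrow> real" where
  "Mb x \<xi> = indicator \<Omega> x * M x \<xi>"

lemma Mb_in: "x \<in> \<Omega> \<Longrightarrow> Mb x \<xi> = M x \<xi>" and Mb_out: "x \<notin> \<Omega> \<Longrightarrow> Mb x \<xi> = 0"
  by (auto simp: Mb_def)

lemma Mb_nonneg: "0 \<le> Mb x \<xi>"
  using M_nonneg by (simp add: Mb_def indicator_def)

lemma Mb_measurable[measurable]:
  assumes [measurable]: "G \<in> borel_measurable borel"
  shows "(\<lambda>x. Mb x (G x)) \<in> borel_measurable borel"
proof -
  have "(\<lambda>p. indicator (\<Omega> \<times> UNIV) p *\<^sub>R (\<lambda>(x, \<xi>). M x \<xi>) p) \<in> borel_measurable borel"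
    by (rule borel_measurable_continuous_on_indicator[OF _ M_cont])
       (auto intro!: borel_open open_Times open_\<Omega>)
  moreover have "(\<lambda>x. (x, G x)) \<in> borel \<rightarrow>\<^sub>M borel" by (intro borel_measurable_Pair) auto
  ultimately have "(\<lambda>x. indicator (\<Omega> \<times> UNIV) (x, G x) *\<^sub>R (\<lambda>(x, \<xi>). M x \<xi>) (x, G x)) \<in> borel_measurable borel"
    by (rule measurable_compose[rotated])
  then show ?thesis by (simp add: Mb_def indicator_def)
qed

lemma Mb_ray: "0 \<le> t \<Longrightarrow> t \<le> 1 \<Longrightarrow> Mb x (t *\<^sub>R \<xi>) \<le> t * Mb x \<xi>"
proof (cases "x \<in> \<Omega>")
  case True
  assume "0 \<le> t" "t \<le> 1"
  then show ?thesis
    using convex_onD[OF M_convex[OF True], of t 0 \<xi>] True by (simp add: Mb_in M_zero)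
qed (simp add: Mb_out)

lemma Mb_ray': "0 \<le> t \<Longrightarrow> t \<le> 1 \<Longrightarrow> Mb x (t *\<^sub>R \<xi>) \<le> Mb x \<xi>"
  using Mb_ray[of t x \<xi>] mult_right_mono[of t 1 "Mb x \<xi>"] Mb_nonneg[of x \<xi>] by simp

lemma Mb_even: "Mb x (- \<xi>) = Mb x \<xi>"
  using M_even by (cases "x \<in> \<Omega>") (auto simp: Mb_in Mb_out)

lemma Mb_add: "Mb x (\<xi> + \<eta>) \<le> (Mb x (2 *\<^sub>R \<xi>) + Mb x (2 *\<^sub>R \<eta>)) / 2"
proof (cases "x \<in> \<Omega>")
  case True
  have "M x ((1 - 1/2) *\<^sub>R (2 *\<^sub>R \<xi>) + (1/2) *\<^sub>R (2 *\<^sub>R \<eta>)) \<le> (1 - 1/2) * M x (2 *\<^sub>R \<xi>) + (1/2) * M x (2 *\<^sub>R \<eta>)"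
    by (rule convex_onD[OF M_convex[OF True]]) auto
  then show ?thesis using True by (simp add: Mb_in)
qed (simp add: Mb_out)

lemma Mb_zero: "Mb x 0 = 0"
  using M_zero by (cases "x \<in> \<Omega>") (auto simp: Mb_in Mb_out)

lemma Mb_tendsto: "(H \<longlongrightarrow> \<xi>) F \<Longrightarrow> ((\<lambda>k. Mb x (H k)) \<longlongrightarrow> Mb x \<xi>) F"
proof (cases "x \<in> \<Omega>")
  case True
  assume "(H \<longlongrightarrow> \<xi>) F"
  moreover have "isCont (M x) \<xi>" using M_continuous[OF True] by (simp add: continuous_on_eq_continuous_at)
  ultimately show ?thesis using True by (simp add: Mb_in isCont_tendsto_compose)
qed (simp add: Mb_out)

definition doubles :: "real \<Rightarrow> (real ^ 'n \<Rightarrow> real) \<Rightarrow> bool" where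
  "doubles c h \<longleftrightarrow> c \<ge> 0 \<and> integrable lborel h \<and> (\<forall>x. 0 \<le> h x) \<and>
     (AE x in lborel. \<forall>\<xi>. Mb x (2 *\<^sub>R \<xi>) \<le> c * Mb x \<xi> + h x)"

lemma doubles_exists: obtains c h where "doubles c h"
proof -
  obtain c h where ch: "c \<ge> 0" "integrable lborel h" "\<And>x. 0 \<le> h x"
    "AE x in lborel. x \<in> \<Omega> \<longrightarrow> (\<forall>\<xi>. M x (2 *\<^sub>R \<xi>) \<le> c * M x \<xi> + h x)"
    using M_double by blast
  have "AE x in lborel. \<forall>\<xi>. Mb x (2 *\<^sub>R \<xi>) \<le> c * Mb x \<xi> + h x"
    using ch(4)
  proof eventually_elim
    case (elim x)
    then show ?case using ch(3)[of x] by (cases "x \<in> \<Omega>") (auto simp: Mb_in Mb_out)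
  qed
  then show ?thesis using ch that by (auto simp: doubles_def)
qed

text \<open>The modular of \<open>G\<close>, together with the \<open>L\<^sup>1\<close> norms; the latter give convergence almost everywhere along
  rapidly converging sequences.\<close>

definition E :: "(real ^ 'n \<Rightarrow> real ^ 'd) \<Rightarrow> (real ^ 'n \<Rightarrow> real ^ 'n ^ 'd) \<Rightarrow> ennreal" where
  "E w G = (\<integral>\<^sup>+x. ennreal (norm (w x) + norm (G x) + Mb x (G x)) \<partial>lborel)"

text \<open>Dominated convergence, where continuity of \<open>M x\<close> at zero takes care of the modular.\<close>

lemma E_dominated:
  assumes [measurable]: "\<And>k. w k \<in> borel_measurable borel" "\<And>k. H k \<in> borel_measurable borel"
    and S: "S \<in> borel_measurable borel" "(\<integral>\<^sup>+x. ennreal (S x) \<partial>lborel) < \<infinity>"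
    and dom: "\<And>k. AE x in lborel. norm (w k x) + norm (H k x) + Mb x (H k x) \<le> S x"
    and lim: "AE x in lborel. (\<lambda>k. w k x) \<longlonglongrightarrow> 0 \<and> (\<lambda>k. H k x) \<longlonglongrightarrow> 0"
  shows "(\<lambda>k. E (w k) (H k)) \<longlonglongrightarrow> 0"
proof -
  have "(\<lambda>k. E (w k) (H k)) \<longlonglongrightarrow> (\<integral>\<^sup>+x. ennreal 0 \<partial>(lborel :: (real ^ 'n) measure))"
    unfolding E_def
  proof (rule nn_integral_dominated_convergence[where w="\<lambda>x. ennreal (S x)"])
    show "AE x in lborel. (\<lambda>k. ennreal (norm (w k x) + norm (H k x) + Mb x (H k x))) \<longlonglongrightarrow> ennreal 0"
      using lim
    proof eventually_elim
      case (elim x)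
      then have "(\<lambda>k. norm (w k x) + norm (H k x) + Mb x (H k x)) \<longlonglongrightarrow> norm (0 :: real ^ 'd) + norm (0 :: real ^ 'n ^ 'd) + Mb x 0"
        by (intro tendsto_add tendsto_norm Mb_tendsto) auto
      then show ?case by (intro tendsto_ennrealI) (simp add: Mb_zero)
    qed
    show "AE x in lborel. ennreal (norm (w k x) + norm (H k x) + Mb x (H k x)) \<le> ennreal (S x)" for k
      using dom[of k] by eventually_elim (rule ennreal_leI)
  qed (use S in auto)
  then show ?thesis by simp
qed

lemma fast_E:
  assumes [measurable]: "\<And>k. w k \<in> borel_measurable borel" "\<And>k. H k \<in> borel_measurable borel"
    and small: "\<And>k. E (w k) (H k) \<le> ennreal ((1/2) ^ k)"
  obtains S where "S \<in> borel_measurable borel" "\<And>x. 0 \<le> S x" "(\<integral>\<^sup>+x. ennreal (S x) \<partial>lborel) < \<infinity>"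
    "AE x in lborel. (\<forall>k. norm (w k x) + norm (H k x) + Mb x (H k x) \<le> S x) \<and> (\<lambda>k. w k x) \<longlonglongrightarrow> 0 \<and> (\<lambda>k. H k x) \<longlonglongrightarrow> 0"
proof -
  define r where "r k x = norm (w k x) + norm (H k x) + Mb x (H k x)" for k x
  obtain S where S: "S \<in> borel_measurable lborel" "\<And>x. 0 \<le> S x" "(\<integral>\<^sup>+x. ennreal (S x) \<partial>lborel) < \<infinity>"
    "AE x in lborel. (\<forall>k. r k x \<le> S x) \<and> (\<lambda>k. r k x) \<longlonglongrightarrow> 0"
  proof (rule fast_convergence[of r lborel])
    show "r k \<in> borel_measurable lborel" for k unfolding r_def by measurable
    show "0 \<le> r k x" for k x using Mb_nonneg[of x "H k x"] by (simp add: r_def)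
    show "(\<integral>\<^sup>+x. ennreal (r k x) \<partial>lborel) \<le> ennreal ((1/2) ^ k)" for k
      using small[of k] by (simp add: r_def E_def)
  qed auto
  have "AE x in lborel. (\<forall>k. norm (w k x) + norm (H k x) + Mb x (H k x) \<le> S x) \<and> (\<lambda>k. w k x) \<longlonglongrightarrow> 0 \<and> (\<lambda>k. H k x) \<longlonglongrightarrow> 0"
    using S(4)
  proof eventually_elim
    case (elim x)
    have "norm (w k x) \<le> r k x" "norm (H k x) \<le> r k x" for k
      using Mb_nonneg[of x "H k x"] by (auto simp: r_def)
    then have "(\<lambda>k. w k x) \<longlonglongrightarrow> 0" "(\<lambda>k. H k x) \<longlonglongrightarrow> 0"
      using elim by (auto intro!: Lim_null_comparison[of _ "\<lambda>k. r k x"] always_eventually)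
    then show ?case using elim by (simp add: r_def)
  qed
  then show ?thesis using that[of S] S by simp
qed

text \<open>The doubling condition alone bounds the left-hand side only up to the integral of \<open>h\<close>, which is
  not small.  If the claim failed, there would be a sequence of counterexamples with geometrically
  decreasing \<open>E\<close>.  It has a majorant \<open>S\<close> by \<open>fast_E\<close>, so \<open>(2 + c) S + h\<close> is a majorant for the doubled sequence,
  which tends to zero by dominated convergence.\<close>

lemma E_double:
  assumes "e > 0"
  obtains d where "d > 0" "\<And>w H. w \<in> borel_measurable borel \<Longrightarrow> H \<in> borel_measurable borel \<Longrightarrow>
    E w H < ennreal d \<Longrightarrow> E (\<lambda>x. 2 *\<^sub>R w x) (\<lambda>x. 2 *\<^sub>R H x) < ennreal e"
proof (rule ccontr)
  assume neg: "\<not> thesis"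
  have "\<exists>w H. w \<in> borel_measurable borel \<and> H \<in> borel_measurable borel \<and> E w H < ennreal ((1/2) ^ k) \<and>
     \<not> E (\<lambda>x. 2 *\<^sub>R w x) (\<lambda>x. 2 *\<^sub>R H x) < ennreal e" for k
  proof (rule ccontr)
    assume c: "\<not> ?thesis"
    have "(1/2 :: real) ^ k > 0" by simp
    then show False by (rule neg[THEN notE, OF that]) (use c in blast)
  qed
  then obtain w H where wH: "\<And>k. w k \<in> borel_measurable borel" "\<And>k. H k \<in> borel_measurable borel"
    "\<And>k. E (w k) (H k) < ennreal ((1/2) ^ k)"
    "\<And>k. \<not> E (\<lambda>x. 2 *\<^sub>R w k x) (\<lambda>x. 2 *\<^sub>R H k x) < ennreal e" by metis
  note [measurable] = wH(1,2)
  obtain S where S[measurable]: "S \<in> borel_measurable borel" and S0: "\<And>x. 0 \<le> S x"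
    and Sfin: "(\<integral>\<^sup>+x. ennreal (S x) \<partial>lborel) < \<infinity>"
    and Sae: "AE x in lborel. (\<forall>k. norm (w k x) + norm (H k x) + Mb x (H k x) \<le> S x) \<and> (\<lambda>k. w k x) \<longlonglongrightarrow> 0 \<and> (\<lambda>k. H k x) \<longlonglongrightarrow> 0"
    using fast_E[OF wH(1,2) less_imp_le[OF wH(3)]] by blast
  obtain c h where ch: "doubles c h" by (rule doubles_exists)
  then have c0: "c \<ge> 0" and h: "integrable lborel h" "\<And>x. 0 \<le> h x"
    and dbl: "AE x in lborel. \<forall>\<xi>. Mb x (2 *\<^sub>R \<xi>) \<le> c * Mb x \<xi> + h x" by (auto simp: doubles_def)
  have [measurable]: "h \<in> borel_measurable borel" using h by auto
  have "(\<lambda>k. E (\<lambda>x. 2 *\<^sub>R w k x) (\<lambda>x. 2 *\<^sub>R H k x)) \<longlonglongrightarrow> 0"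
  proof (rule E_dominated[where S="\<lambda>x. (2 + c) * S x + h x"])
    have "(\<integral>\<^sup>+x. ennreal ((2 + c) * S x + h x) \<partial>lborel) = ennreal (2 + c) * (\<integral>\<^sup>+x. ennreal (S x) \<partial>lborel) + (\<integral>\<^sup>+x. ennreal (h x) \<partial>lborel)"
      using S0 h c0 by (simp add: ennreal_mult nn_integral_add nn_integral_cmult del: ennreal_plus flip: nn_integral_cmult)
        (simp add: nn_integral_add ennreal_mult)
    moreover have "(\<integral>\<^sup>+x. ennreal (h x) \<partial>lborel) < \<infinity>" using h by (simp add: integrable_iff_bounded)
    ultimately show "(\<integral>\<^sup>+x. ennreal ((2 + c) * S x + h x) \<partial>lborel) < \<infinity>"
      using Sfin by (simp add: ennreal_mult_less_top)
    show "AE x in lborel. norm (2 *\<^sub>R w k x) + norm (2 *\<^sub>R H k x) + Mb x (2 *\<^sub>R H k x) \<le> (2 + c) * S x + h x" for k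
      using Sae dbl
    proof eventually_elim
      case (elim x)
      have "norm (w k x) + norm (H k x) \<le> S x" "Mb x (H k x) \<le> S x"
        using elim(1) Mb_nonneg[of x "H k x"] norm_ge_zero[of "w k x"] norm_ge_zero[of "H k x"]
        by (smt (verit))+
      moreover have "c * Mb x (H k x) \<le> c * S x" using calculation(2) c0 by (rule mult_left_mono)
      moreover have "Mb x (2 *\<^sub>R H k x) \<le> c * Mb x (H k x) + h x" using elim(2) by blast
      ultimately show ?case by (simp add: distrib_right)
    qed
    show "AE x in lborel. (\<lambda>k. 2 *\<^sub>R w k x) \<longlonglongrightarrow> 0 \<and> (\<lambda>k. 2 *\<^sub>R H k x) \<longlonglongrightarrow> 0"
      using Sae
    proof eventually_elim
      case (elim x)
      then show ?case using tendsto_scaleR[OF tendsto_const, of "\<lambda>k. w k x" 0 sequentially 2]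
          tendsto_scaleR[OF tendsto_const, of "\<lambda>k. H k x" 0 sequentially 2] by simp
    qed
  qed measurable
  then have "\<forall>\<^sub>F k in sequentially. E (\<lambda>x. 2 *\<^sub>R w k x) (\<lambda>x. 2 *\<^sub>R H k x) < ennreal e"
    using assms by (intro order_tendstoD(2)) auto
  then show False using wH(4) by (auto simp: eventually_sequentially)
qed

lemma E_power2:
  assumes "e > 0"
  shows "\<exists>d>0. \<forall>w H. w \<in> borel_measurable borel \<longrightarrow> H \<in> borel_measurable borel \<longrightarrow>
    E w H < ennreal d \<longrightarrow> E (\<lambda>x. 2 ^ m *\<^sub>R w x) (\<lambda>x. 2 ^ m *\<^sub>R H x) < ennreal e"
  using assms
proof (induction m arbitrary: e)
  case 0
  then show ?case by (intro exI[of _ e]) auto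
next
  case (Suc m)
  obtain d where d: "d > 0" "\<And>w H. w \<in> borel_measurable borel \<Longrightarrow> H \<in> borel_measurable borel \<Longrightarrow>
    E w H < ennreal d \<Longrightarrow> E (\<lambda>x. 2 *\<^sub>R w x) (\<lambda>x. 2 *\<^sub>R H x) < ennreal e"
    using E_double[OF Suc.prems] by blast
  obtain d' where d': "d' > 0" "\<And>w H. w \<in> borel_measurable borel \<Longrightarrow> H \<in> borel_measurable borel \<Longrightarrow>
    E w H < ennreal d' \<Longrightarrow> E (\<lambda>x. 2 ^ m *\<^sub>R w x) (\<lambda>x. 2 ^ m *\<^sub>R H x) < ennreal d"
    using Suc.IH[OF d(1)] by blast
  show ?case
  proof (intro exI[of _ d'] conjI d'(1) allI impI)
    fix w H assume m[measurable]: "w \<in> borel_measurable borel" "H \<in> borel_measurable borel" and "E w H < ennreal d'"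
    then have "E (\<lambda>x. 2 ^ m *\<^sub>R w x) (\<lambda>x. 2 ^ m *\<^sub>R H x) < ennreal d" by (intro d')
    then have "E (\<lambda>x. 2 *\<^sub>R 2 ^ m *\<^sub>R w x) (\<lambda>x. 2 *\<^sub>R 2 ^ m *\<^sub>R H x) < ennreal e"
      by (intro d(2)) measurable
    then show "E (\<lambda>x. 2 ^ Suc m *\<^sub>R w x) (\<lambda>x. 2 ^ Suc m *\<^sub>R H x) < ennreal e" by simp
  qed
qed

lemma E_shrink:
  assumes [measurable]: "w \<in> borel_measurable borel" "H \<in> borel_measurable borel" and t: "0 \<le> t" "t \<le> 1"
  shows "E (\<lambda>x. t *\<^sub>R w x) (\<lambda>x. t *\<^sub>R H x) \<le> E w H"
  unfolding E_def
proof (intro nn_integral_mono ennreal_leI add_mono)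
  fix x
  show "norm (t *\<^sub>R w x) \<le> norm (w x)" "norm (t *\<^sub>R H x) \<le> norm (H x)"
    using t by (auto intro: mult_left_le_one_le)
  show "Mb x (t *\<^sub>R H x) \<le> Mb x (H x)" by (rule Mb_ray'[OF t])
qed

lemma E_scale:
  assumes "e > 0" "0 \<le> \<kappa>"
  obtains d where "d > 0" "\<And>w H. w \<in> borel_measurable borel \<Longrightarrow> H \<in> borel_measurable borel \<Longrightarrow>
    E w H < ennreal d \<Longrightarrow> E (\<lambda>x. \<kappa> *\<^sub>R w x) (\<lambda>x. \<kappa> *\<^sub>R H x) < ennreal e"
proof -
  obtain m where m: "\<kappa> < 2 ^ m" using real_arch_pow[of 2 \<kappa>] by auto
  obtain d where d: "d > 0" "\<And>w H. w \<in> borel_measurable borel \<Longrightarrow> H \<in> borel_measurable borel \<Longrightarrow>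
    E w H < ennreal d \<Longrightarrow> E (\<lambda>x. 2 ^ m *\<^sub>R w x) (\<lambda>x. 2 ^ m *\<^sub>R H x) < ennreal e"
    using E_power2[OF assms(1)] by blast
  have "E (\<lambda>x. \<kappa> *\<^sub>R w x) (\<lambda>x. \<kappa> *\<^sub>R H x) < ennreal e"
    if [measurable]: "w \<in> borel_measurable borel" "H \<in> borel_measurable borel" and "E w H < ennreal d" for w H
  proof -
    have "E (\<lambda>x. (\<kappa> / 2 ^ m) *\<^sub>R (2 ^ m *\<^sub>R w x)) (\<lambda>x. (\<kappa> / 2 ^ m) *\<^sub>R (2 ^ m *\<^sub>R H x)) \<le>
      E (\<lambda>x. 2 ^ m *\<^sub>R w x) (\<lambda>x. 2 ^ m *\<^sub>R H x)"
      by (rule E_shrink) (use m assms in auto)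
    also have "\<dots> < ennreal e" by (rule d(2)) (use that in auto)
    finally show ?thesis by simp
  qed
  then show ?thesis using that d(1) by blast
qed

text \<open>Convexity bounds \<open>M\<close> at a sum only by its values at the doubled summands; \<open>E_double\<close> compensates
  for this.\<close>

lemma E_add:
  assumes [measurable]: "a \<in> borel_measurable borel" "A \<in> borel_measurable borel"
    "b \<in> borel_measurable borel" "B \<in> borel_measurable borel"
  shows "E (\<lambda>x. a x + b x) (\<lambda>x. A x + B x) \<le>
    E (\<lambda>x. 2 *\<^sub>R a x) (\<lambda>x. 2 *\<^sub>R A x) + E (\<lambda>x. 2 *\<^sub>R b x) (\<lambda>x. 2 *\<^sub>R B x)"
proof -
  have "E (\<lambda>x. a x + b x) (\<lambda>x. A x + B x) \<le>
     (\<integral>\<^sup>+x. ennreal (norm (2 *\<^sub>R a x) + norm (2 *\<^sub>R A x) + Mb x (2 *\<^sub>R A x))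
       + ennreal (norm (2 *\<^sub>R b x) + norm (2 *\<^sub>R B x) + Mb x (2 *\<^sub>R B x)) \<partial>lborel)"
    unfolding E_def
  proof (intro nn_integral_mono)
    fix x
    have "norm (a x + b x) \<le> norm (2 *\<^sub>R a x) + norm (2 *\<^sub>R b x)"
      using norm_triangle_ineq[of "a x" "b x"] norm_ge_zero[of "a x"] norm_ge_zero[of "b x"]
      by (simp only: norm_scaleR)
    moreover have "norm (A x + B x) \<le> norm (2 *\<^sub>R A x) + norm (2 *\<^sub>R B x)"
      using norm_triangle_ineq[of "A x" "B x"] norm_ge_zero[of "A x"] norm_ge_zero[of "B x"]
      by (simp only: norm_scaleR)
    moreover have "Mb x (A x + B x) \<le> Mb x (2 *\<^sub>R A x) + Mb x (2 *\<^sub>R B x)"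
      using Mb_add[of x "A x" "B x"] Mb_nonneg[of x "2 *\<^sub>R A x"] Mb_nonneg[of x "2 *\<^sub>R B x"] by simp
    ultimately have "norm (a x + b x) + norm (A x + B x) + Mb x (A x + B x) \<le>
       (norm (2 *\<^sub>R a x) + norm (2 *\<^sub>R A x) + Mb x (2 *\<^sub>R A x)) + (norm (2 *\<^sub>R b x) + norm (2 *\<^sub>R B x) + Mb x (2 *\<^sub>R B x))"
      by linarith
    then show "ennreal (norm (a x + b x) + norm (A x + B x) + Mb x (A x + B x)) \<le>
       ennreal (norm (2 *\<^sub>R a x) + norm (2 *\<^sub>R A x) + Mb x (2 *\<^sub>R A x)) + ennreal (norm (2 *\<^sub>R b x) + norm (2 *\<^sub>R B x) + Mb x (2 *\<^sub>R B x))"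
      using Mb_nonneg by (subst ennreal_plus[symmetric]) (auto intro!: add_nonneg_nonneg ennreal_leI simp del: ennreal_plus)
  qed
  also have "\<dots> = E (\<lambda>x. 2 *\<^sub>R a x) (\<lambda>x. 2 *\<^sub>R A x) + E (\<lambda>x. 2 *\<^sub>R b x) (\<lambda>x. 2 *\<^sub>R B x)"
    unfolding E_def by (rule nn_integral_add) measurable
  finally show ?thesis .
qed

lemma E_small_sum:
  assumes "e > 0"
  obtains d where "d > 0" "\<And>a A b B. a \<in> borel_measurable borel \<Longrightarrow> A \<in> borel_measurable borel \<Longrightarrow>
    b \<in> borel_measurable borel \<Longrightarrow> B \<in> borel_measurable borel \<Longrightarrow>
    E a A < ennreal d \<Longrightarrow> E b B < ennreal d \<Longrightarrow> E (\<lambda>x. a x + b x) (\<lambda>x. A x + B x) < ennreal e"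
proof -
  have "e/2 > 0" using assms by simp
  obtain d where d: "d > 0" "\<And>w H. w \<in> borel_measurable borel \<Longrightarrow> H \<in> borel_measurable borel \<Longrightarrow>
    E w H < ennreal d \<Longrightarrow> E (\<lambda>x. 2 *\<^sub>R w x) (\<lambda>x. 2 *\<^sub>R H x) < ennreal (e/2)"
    using E_double[OF \<open>e/2 > 0\<close>] by blast
  show ?thesis
  proof (rule that[OF d(1)])
    fix a A b B assume m: "a \<in> borel_measurable borel" "A \<in> borel_measurable borel"
      "b \<in> borel_measurable borel" "B \<in> borel_measurable borel" and s: "E a A < ennreal d" "E b B < ennreal d"
    note E_add[OF m]
    also have "E (\<lambda>x. 2 *\<^sub>R a x) (\<lambda>x. 2 *\<^sub>R A x) + E (\<lambda>x. 2 *\<^sub>R b x) (\<lambda>x. 2 *\<^sub>R B x) < ennreal (e/2) + ennreal (e/2)"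
      by (intro ennreal_add_strict_mono d m s)
    also have "\<dots> = ennreal e" using assms by (simp flip: ennreal_plus)
    finally show "E (\<lambda>x. a x + b x) (\<lambda>x. A x + B x) < ennreal e" .
  qed
qed

definition approximable :: "(real ^ 'n \<Rightarrow> real ^ 'd) \<Rightarrow> (real ^ 'n \<Rightarrow> real ^ 'n ^ 'd) \<Rightarrow> bool" where
  "approximable w G \<longleftrightarrow> w \<in> borel_measurable borel \<and> G \<in> borel_measurable borel \<and>
     (\<forall>e>0. \<exists>\<phi>\<in>Cc_infty \<Omega>. E (\<lambda>x. \<phi> x - w x) (\<lambda>x. mgrad \<phi> x - G x) < ennreal e)"

lemma Cc_infty_add:
  assumes "\<phi> \<in> Cc_infty \<Omega>" "\<psi> \<in> Cc_infty \<Omega>"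
  shows "(\<lambda>x. \<phi> x + \<psi> x :: real ^ 'd) \<in> Cc_infty \<Omega>" "mgrad (\<lambda>x. \<phi> x + \<psi> x) x = mgrad \<phi> x + mgrad \<psi> x"
proof -
  obtain K where K: "compact K" "K \<subseteq> \<Omega>" "\<And>x. x \<notin> K \<Longrightarrow> \<phi> x = 0" "smooth \<phi>" using Cc_inftyD[OF assms(1)] by metis
  obtain L where L: "compact L" "L \<subseteq> \<Omega>" "\<And>x. x \<notin> L \<Longrightarrow> \<psi> x = 0" "smooth \<psi>" using Cc_inftyD[OF assms(2)] by metis
  show "(\<lambda>x. \<phi> x + \<psi> x) \<in> Cc_infty \<Omega>"
    by (rule Cc_inftyI[of _ "K \<union> L"]) (use K L in \<open>auto intro: smooth_add compact_Un\<close>)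
  have "frechet_derivative (\<lambda>x. \<phi> x + \<psi> x) (at x) = (\<lambda>h. frechet_derivative \<phi> (at x) h + frechet_derivative \<psi> (at x) h)"
    by (intro frechet_derivativeI has_derivative_add frechet_works smoothD K L)
  then show "mgrad (\<lambda>x. \<phi> x + \<psi> x) x = mgrad \<phi> x + mgrad \<psi> x" by (simp add: mgrad_def vec_eq_iff)
qed

lemma approximable_add:
  assumes "approximable w G" "approximable v H"
  shows "approximable (\<lambda>x. w x + v x) (\<lambda>x. G x + H x)"
  unfolding approximable_def
proof (intro conjI allI impI)
  have m[measurable]: "w \<in> borel_measurable borel" "G \<in> borel_measurable borel"
    "v \<in> borel_measurable borel" "H \<in> borel_measurable borel" using assms by (auto simp: approximable_def)
  show "(\<lambda>x. w x + v x) \<in> borel_measurable borel" "(\<lambda>x. G x + H x) \<in> borel_measurable borel" by measurable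
  fix e :: real assume "e > 0"
  obtain d where d: "d > 0" "\<And>a A b B. a \<in> borel_measurable borel \<Longrightarrow> A \<in> borel_measurable borel \<Longrightarrow>
    b \<in> borel_measurable borel \<Longrightarrow> B \<in> borel_measurable borel \<Longrightarrow>
    E a A < ennreal d \<Longrightarrow> E b B < ennreal d \<Longrightarrow> E (\<lambda>x. a x + b x) (\<lambda>x. A x + B x) < ennreal e"
    using E_small_sum[OF \<open>e > 0\<close>] by blast
  obtain \<phi> where \<phi>: "\<phi> \<in> Cc_infty \<Omega>" "E (\<lambda>x. \<phi> x - w x) (\<lambda>x. mgrad \<phi> x - G x) < ennreal d"
    using assms(1) d(1) by (auto simp: approximable_def)
  obtain \<psi> where \<psi>: "\<psi> \<in> Cc_infty \<Omega>" "E (\<lambda>x. \<psi> x - v x) (\<lambda>x. mgrad \<psi> x - H x) < ennreal d"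
    using assms(2) d(1) by (auto simp: approximable_def)
  note [measurable] = Cc_infty_integrable(3,4)[OF \<phi>(1)] Cc_infty_integrable(3,4)[OF \<psi>(1)]
  have "E (\<lambda>x. (\<phi> x - w x) + (\<psi> x - v x)) (\<lambda>x. (mgrad \<phi> x - G x) + (mgrad \<psi> x - H x)) < ennreal e"
    by (rule d(2)) (use \<phi>(2) \<psi>(2) in auto)
  also have "(\<lambda>x. (\<phi> x - w x) + (\<psi> x - v x)) = (\<lambda>x. (\<phi> x + \<psi> x) - (w x + v x))" by auto
  also have "(\<lambda>x. (mgrad \<phi> x - G x) + (mgrad \<psi> x - H x)) = (\<lambda>x. mgrad (\<lambda>x. \<phi> x + \<psi> x) x - (G x + H x))"
    by (auto simp: Cc_infty_add(2)[OF \<phi>(1) \<psi>(1)])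
  finally show "\<exists>\<phi>\<in>Cc_infty \<Omega>. E (\<lambda>x. \<phi> x - (w x + v x)) (\<lambda>x. mgrad \<phi> x - (G x + H x)) < ennreal e"
    using Cc_infty_add(1)[OF \<phi>(1) \<psi>(1)] by (intro bexI[of _ "\<lambda>x. \<phi> x + \<psi> x"])
qed

lemma approximable_limit:
  assumes m[measurable]: "w \<in> borel_measurable borel" "G \<in> borel_measurable borel"
    and appr: "\<And>e. e > 0 \<Longrightarrow> \<exists>v H. approximable v H \<and> E (\<lambda>x. v x - w x) (\<lambda>x. H x - G x) < ennreal e"
  shows "approximable w G"
  unfolding approximable_def
proof (intro conjI allI impI m)
  fix e :: real assume "e > 0"
  obtain d where d: "d > 0" "\<And>a A b B. a \<in> borel_measurable borel \<Longrightarrow> A \<in> borel_measurable borel \<Longrightarrow>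
    b \<in> borel_measurable borel \<Longrightarrow> B \<in> borel_measurable borel \<Longrightarrow>
    E a A < ennreal d \<Longrightarrow> E b B < ennreal d \<Longrightarrow> E (\<lambda>x. a x + b x) (\<lambda>x. A x + B x) < ennreal e"
    using E_small_sum[OF \<open>e > 0\<close>] by blast
  obtain v H where vH: "approximable v H" "E (\<lambda>x. v x - w x) (\<lambda>x. H x - G x) < ennreal d"
    using appr[OF d(1)] by blast
  then have [measurable]: "v \<in> borel_measurable borel" "H \<in> borel_measurable borel" by (auto simp: approximable_def)
  obtain \<phi> where \<phi>: "\<phi> \<in> Cc_infty \<Omega>" "E (\<lambda>x. \<phi> x - v x) (\<lambda>x. mgrad \<phi> x - H x) < ennreal d"
    using vH(1) d(1) by (auto simp: approximable_def)
  note [measurable] = Cc_infty_integrable(3,4)[OF \<phi>(1)]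
  have "E (\<lambda>x. (\<phi> x - v x) + (v x - w x)) (\<lambda>x. (mgrad \<phi> x - H x) + (H x - G x)) < ennreal e"
    by (rule d(2)) (use \<phi>(2) vH(2) in auto)
  then show "\<exists>\<phi>\<in>Cc_infty \<Omega>. E (\<lambda>x. \<phi> x - w x) (\<lambda>x. mgrad \<phi> x - G x) < ennreal e"
    using \<phi>(1) by auto
qed

definition Mfin :: "(real ^ 'n \<Rightarrow> real ^ 'n ^ 'd) \<Rightarrow> bool" where
  "Mfin G \<longleftrightarrow> G \<in> borel_measurable borel \<and> (\<integral>\<^sup>+x. ennreal (Mb x (G x)) \<partial>lborel) < \<infinity>"

lemma Mfin_double: "Mfin G \<Longrightarrow> Mfin (\<lambda>x. 2 *\<^sub>R G x)"
proof -
  assume G: "Mfin G"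
  then have [measurable]: "G \<in> borel_measurable borel" by (simp add: Mfin_def)
  obtain c h where ch: "doubles c h" by (rule doubles_exists)
  then have c0: "c \<ge> 0" and h: "integrable lborel h" "\<And>x. 0 \<le> h x"
    and dbl: "AE x in lborel. \<forall>\<xi>. Mb x (2 *\<^sub>R \<xi>) \<le> c * Mb x \<xi> + h x" by (auto simp: doubles_def)
  have [measurable]: "h \<in> borel_measurable borel" using h by auto
  have "(\<integral>\<^sup>+x. ennreal (Mb x (2 *\<^sub>R G x)) \<partial>lborel) \<le> (\<integral>\<^sup>+x. ennreal c * ennreal (Mb x (G x)) + ennreal (h x) \<partial>lborel)"
  proof (rule nn_integral_mono_AE)
    show "AE x in lborel. ennreal (Mb x (2 *\<^sub>R G x)) \<le> ennreal c * ennreal (Mb x (G x)) + ennreal (h x)"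
      using dbl
    proof eventually_elim
      case (elim x)
      then show ?case using c0 h(2)[of x] Mb_nonneg[of x "G x"]
        by (simp add: ennreal_leI del: ennreal_plus flip: ennreal_mult ennreal_plus)
    qed
  qed
  also have "\<dots> = ennreal c * (\<integral>\<^sup>+x. ennreal (Mb x (G x)) \<partial>lborel) + (\<integral>\<^sup>+x. ennreal (h x) \<partial>lborel)"
    by (simp add: nn_integral_add nn_integral_cmult)
  also have "\<dots> < \<infinity>"
    using G h by (simp add: Mfin_def integrable_iff_bounded ennreal_mult_less_top)
  finally show ?thesis by (simp add: Mfin_def)
qed

lemma Mfin_mono:
  assumes "Mfin G" "H \<in> borel_measurable borel" "AE x in lborel. Mb x (H x) \<le> Mb x (G x) + B"
  shows "Mfin H"
proof -
  have [measurable]: "G \<in> borel_measurable borel" "H \<in> borel_measurable borel" using assms by (auto simp: Mfin_def)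
  have "(\<integral>\<^sup>+x. ennreal (Mb x (H x)) \<partial>lborel) \<le> (\<integral>\<^sup>+x. ennreal (Mb x (G x)) + ennreal \<bar>B\<bar> * indicator \<Omega> x \<partial>lborel)"
  proof (rule nn_integral_mono_AE)
    show "AE x in lborel. ennreal (Mb x (H x)) \<le> ennreal (Mb x (G x)) + ennreal \<bar>B\<bar> * indicator \<Omega> x"
      using assms(3)
    proof eventually_elim
      case (elim x)
      show ?case
      proof (cases "x \<in> \<Omega>")
        case True
        have "Mb x (H x) \<le> Mb x (G x) + \<bar>B\<bar>" using elim by simp
        then show ?thesis using True Mb_nonneg[of x "G x"] by (simp add: ennreal_leI del: ennreal_plus flip: ennreal_plus)
      qed (simp add: Mb_out)
    qed
  qed
  also have "\<dots> = (\<integral>\<^sup>+x. ennreal (Mb x (G x)) \<partial>lborel) + ennreal \<bar>B\<bar> * emeasure lborel \<Omega>"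
    by (simp add: nn_integral_add nn_integral_cmult)
  also have "\<dots> < \<infinity>" using assms(1) \<Omega>_finite by (simp add: Mfin_def ennreal_mult_less_top)
  finally show ?thesis by (simp add: Mfin_def)
qed

lemma Mfin_scale:
  assumes "Mfin G"
  shows "Mfin (\<lambda>x. \<kappa> *\<^sub>R G x)"
proof -
  have [measurable]: "G \<in> borel_measurable borel" using assms by (auto simp: Mfin_def)
  have p: "Mfin (\<lambda>x. 2 ^ m *\<^sub>R G x)" for m
  proof (induction m)
    case (Suc m)
    then show ?case using Mfin_double[of "\<lambda>x. 2 ^ m *\<^sub>R G x"] by simp
  qed (simp add: assms)
  obtain m where m: "\<bar>\<kappa>\<bar> < 2 ^ m" using real_arch_pow[of 2 "\<bar>\<kappa>\<bar>"] by auto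
  show ?thesis
  proof (rule Mfin_mono[OF p[of m], of _ 0])
    show "AE x in lborel. Mb x (\<kappa> *\<^sub>R G x) \<le> Mb x (2 ^ m *\<^sub>R G x) + 0"
    proof (rule AE_I2)
      fix x
      have "Mb x (\<kappa> *\<^sub>R G x) = Mb x (\<bar>\<kappa>\<bar> *\<^sub>R G x)"
        using Mb_even[of x "\<kappa> *\<^sub>R G x"] by (cases "\<kappa> \<ge> 0") auto
      also have "\<dots> \<le> Mb x (2 ^ m *\<^sub>R G x)"
        using Mb_ray'[of "\<bar>\<kappa>\<bar> / 2 ^ m" x "2 ^ m *\<^sub>R G x"] m by simp
      finally show "Mb x (\<kappa> *\<^sub>R G x) \<le> Mb x (2 ^ m *\<^sub>R G x) + 0" by simp
    qed
  qed measurable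
qed

lemma Mfin_add:
  assumes "Mfin G" "Mfin H"
  shows "Mfin (\<lambda>x. G x + H x)"
proof -
  have [measurable]: "G \<in> borel_measurable borel" "H \<in> borel_measurable borel" using assms by (auto simp: Mfin_def)
  have "(\<integral>\<^sup>+x. ennreal (Mb x (G x + H x)) \<partial>lborel) \<le> (\<integral>\<^sup>+x. ennreal (Mb x (2 *\<^sub>R G x)) + ennreal (Mb x (2 *\<^sub>R H x)) \<partial>lborel)"
  proof (rule nn_integral_mono)
    fix x
    have "Mb x (G x + H x) \<le> Mb x (2 *\<^sub>R G x) + Mb x (2 *\<^sub>R H x)"
      using Mb_add[of x "G x" "H x"] Mb_nonneg[of x "2 *\<^sub>R G x"] Mb_nonneg[of x "2 *\<^sub>R H x"] by simp
    then show "ennreal (Mb x (G x + H x)) \<le> ennreal (Mb x (2 *\<^sub>R G x)) + ennreal (Mb x (2 *\<^sub>R H x))"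
      using Mb_nonneg by (simp add: ennreal_leI del: ennreal_plus flip: ennreal_plus)
  qed
  also have "\<dots> = (\<integral>\<^sup>+x. ennreal (Mb x (2 *\<^sub>R G x)) \<partial>lborel) + (\<integral>\<^sup>+x. ennreal (Mb x (2 *\<^sub>R H x)) \<partial>lborel)"
    by (rule nn_integral_add) measurable
  also have "\<dots> < \<infinity>" using Mfin_double[OF assms(1)] Mfin_double[OF assms(2)] by (simp add: Mfin_def)
  finally show ?thesis by (simp add: Mfin_def)
qed

lemma Mfin_bounded:
  assumes [measurable]: "G \<in> borel_measurable borel" and "\<And>x. norm (G x) \<le> R"
  shows "Mfin G"
proof -
  obtain B where B: "B \<ge> 0" "\<And>x \<xi>. x \<in> \<Omega> \<Longrightarrow> norm \<xi> \<le> R \<Longrightarrow> M x \<xi> \<le> B" using M_upper[of R] by blast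
  have "Mfin (\<lambda>x. 0)" by (simp add: Mfin_def Mb_zero)
  then show ?thesis
  proof (rule Mfin_mono)
    show "AE x in lborel. Mb x (G x) \<le> Mb x 0 + B"
      using B assms(2) by (intro AE_I2) (auto simp: Mb_def indicator_def M_zero)
  qed measurable
qed

end

text \<open>A hyperplane separates the point \<open>(x, f x)\<close> from the convex set strictly above the graph.  It is
  not vertical, since \<open>f\<close> is finite everywhere.\<close>

lemma subgradient_exists:
  fixes f :: "'a::euclidean_space \<Rightarrow> real"
  assumes f: "convex_on UNIV f"
  obtains p where "\<And>z. f x + p \<bullet> (z - x) \<le> f z"
proof -
  define T where "T = {(z, t). f z < t}"
  have "convex T"
  proof (rule convexI)
    fix a b :: "'a \<times> real" and u v :: real
    assume ab: "a \<in> T" "b \<in> T" and uv: "0 \<le> u" "0 \<le> v" "u + v = 1"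
    have "f (u *\<^sub>R fst a + v *\<^sub>R fst b) \<le> u * f (fst a) + v * f (fst b)"
      using f uv by (auto simp: convex_on_def)
    also have "\<dots> < u * snd a + v * snd b"
    proof (cases "u = 0")
      case True
      then show ?thesis using ab uv by (simp add: T_def split_beta)
    next
      case False
      then have "u * f (fst a) < u * snd a" using ab uv by (simp add: T_def split_beta)
      moreover have "v * f (fst b) \<le> v * snd b" using ab uv by (intro mult_left_mono) (auto simp: T_def)
      ultimately show ?thesis by simp
    qed
    finally show "u *\<^sub>R a + v *\<^sub>R b \<in> T" by (simp add: T_def split_beta)
  qed
  have "(x, f x + 1) \<in> T" by (simp add: T_def)
  then have ne: "T \<noteq> {}" by blast
  have disj: "{(x, f x)} \<inter> T = {}" by (simp add: T_def)
  obtain q b where q: "q \<noteq> 0" "\<forall>y\<in>{(x, f x)}. q \<bullet> y \<le> b" "\<forall>y\<in>T. b \<le> q \<bullet> y"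
    using separating_hyperplane_sets[OF convex_singleton \<open>convex T\<close> _ ne disj] by blast
  obtain \<alpha> \<beta> where qq: "q = (\<alpha>, \<beta>)" by (cases q)
  have 1: "\<alpha> \<bullet> x + \<beta> * f x \<le> \<alpha> \<bullet> z + \<beta> * t" if "f z < t" for z t
  proof -
    have "q \<bullet> (x, f x) \<le> b" "b \<le> q \<bullet> (z, t)" using q that by (auto simp: T_def)
    then show ?thesis by (simp add: qq)
  qed
  have "\<beta> \<ge> 0" using 1[of x "f x + 1"] by (simp add: distrib_left)
  moreover have "\<beta> \<noteq> 0"
  proof
    assume "\<beta> = 0"
    then have "\<alpha> \<bullet> x \<le> \<alpha> \<bullet> z" for z using 1[of z "f z + 1"] by simp
    from this[of "x - \<alpha>"] have "\<alpha> \<bullet> \<alpha> \<le> 0" by (simp add: inner_diff_right)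
    then have "\<alpha> \<bullet> \<alpha> = 0" using inner_ge_zero[of \<alpha>] by linarith
    then have "\<alpha> = 0" by simp
    then show False using q(1) qq \<open>\<beta> = 0\<close> by (simp add: zero_prod_def)
  qed
  ultimately have "\<beta> > 0" by simp
  have "f x + (- \<alpha> /\<^sub>R \<beta>) \<bullet> (z - x) \<le> f z" for z
  proof (rule field_le_epsilon)
    fix e :: real assume "e > 0"
    have "\<beta> * (f x + (- \<alpha> /\<^sub>R \<beta>) \<bullet> (z - x)) = \<beta> * f x - \<alpha> \<bullet> (z - x)"
      using \<open>\<beta> > 0\<close> by (simp add: right_diff_distrib flip: mult.assoc)
    also have "\<dots> \<le> \<beta> * (f z + e)" using 1[of z "f z + e"] \<open>e > 0\<close> by (simp add: inner_diff_right)
    finally show "f x + (- \<alpha> /\<^sub>R \<beta>) \<bullet> (z - x) \<le> f z + e" using \<open>\<beta> > 0\<close> by simp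
  qed
  then show ?thesis by (rule that)
qed

context modular
begin

text \<open>Shifted mollifications of \<open>w\<close>, \<open>G\<close> and \<open>g\<close> converge in the mean.  If they do so rapidly, the
  assumed bounds \<open>q * (1 + conv (rho \<epsilon>) g (x - a))\<close> have a common integrable majorant, hence so has the
  modular of the scaled difference \<open>(mgrad \<phi> x - G x) /\<^sub>R (2 * A)\<close>.  The scaling is undone by \<open>E_scale\<close>.\<close>

lemma moll_approximable:
  fixes w :: "real ^ 'n \<Rightarrow> real ^ 'd" and G :: "real ^ 'n \<Rightarrow> real ^ 'n ^ 'd" and g :: "real ^ 'n \<Rightarrow> real"
  assumes w: "integrable lborel w" and G: "integrable lborel G" and GM: "Mfin G"
    and g: "integrable lborel g" and A: "A > 0" and q: "q \<ge> 0"
    and step: "\<And>\<delta>. \<delta> > 0 \<Longrightarrow> \<exists>\<phi>\<in>Cc_infty \<Omega>. \<exists>\<epsilon> a. 0 < \<epsilon> \<and> \<epsilon> + norm a < \<delta> \<and>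
      (\<forall>x. \<phi> x = conv (rho \<epsilon>) w (x - a)) \<and> (\<forall>x. mgrad \<phi> x = conv (rho \<epsilon>) G (x - a)) \<and>
      (\<forall>x\<in>\<Omega>. M x (mgrad \<phi> x /\<^sub>R A) \<le> q * (1 + conv (rho \<epsilon>) g (x - a)))"
  shows "approximable w G"
  unfolding approximable_def
proof (intro conjI allI impI)
  show m[measurable]: "w \<in> borel_measurable borel" "G \<in> borel_measurable borel" using w G by auto
  have [measurable]: "g \<in> borel_measurable borel" using g by auto
  fix e :: real assume "e > 0"
  \<comment> \<open>the factor 2 compensates for the convexity inequality at a difference\<close>
  define \<kappa> where "\<kappa> = 2 * A"
  have \<kappa>: "\<kappa> > 0" using A by (simp add: \<kappa>_def)
  obtain d where d: "d > 0" "\<And>w H. w \<in> borel_measurable borel \<Longrightarrow> H \<in> borel_measurable borel \<Longrightarrow>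
    E w H < ennreal d \<Longrightarrow> E (\<lambda>x. \<kappa> *\<^sub>R w x) (\<lambda>x. \<kappa> *\<^sub>R H x) < ennreal e"
    using E_scale[OF \<open>e > 0\<close> less_imp_le[OF \<kappa>]] by blast
  define good where "good k \<phi> \<epsilon> a \<longleftrightarrow> \<phi> \<in> Cc_infty \<Omega> \<and> 0 < \<epsilon> \<and> (\<forall>x. \<phi> x = conv (rho \<epsilon>) w (x - a)) \<and> (\<forall>x. mgrad \<phi> x = conv (rho \<epsilon>) G (x - a)) \<and>
      (\<forall>x\<in>\<Omega>. M x (mgrad \<phi> x /\<^sub>R A) \<le> q * (1 + conv (rho \<epsilon>) g (x - a))) \<and>
      (\<integral>\<^sup>+x. ennreal (norm (conv (rho \<epsilon>) w (x - a) - w x)) \<partial>lborel) \<le> ennreal ((1/2) ^ k) \<and>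
      (\<integral>\<^sup>+x. ennreal (norm (conv (rho \<epsilon>) G (x - a) - G x)) \<partial>lborel) \<le> ennreal ((1/2) ^ k) \<and>
      (\<integral>\<^sup>+x. ennreal (norm (conv (rho \<epsilon>) g (x - a) - g x)) \<partial>lborel) \<le> ennreal ((1/2) ^ k)"
    for k \<phi> \<epsilon> a
  have "\<exists>\<phi> \<epsilon> a. good k \<phi> \<epsilon> a" for k
  proof -
    have e: "(1/2 :: real) ^ k > 0" by simp
    obtain d1 where d1: "d1 > 0" "\<And>\<epsilon> a. 0 < \<epsilon> \<Longrightarrow> \<epsilon> + norm a < d1 \<Longrightarrow>
      (\<integral>\<^sup>+x. ennreal (norm (conv (rho \<epsilon>) w (x - a) - w x)) \<partial>lborel) \<le> ennreal ((1/2) ^ k)"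
      using conv_converges[OF w e] by blast
    obtain d2 where d2: "d2 > 0" "\<And>\<epsilon> a. 0 < \<epsilon> \<Longrightarrow> \<epsilon> + norm a < d2 \<Longrightarrow>
      (\<integral>\<^sup>+x. ennreal (norm (conv (rho \<epsilon>) G (x - a) - G x)) \<partial>lborel) \<le> ennreal ((1/2) ^ k)"
      using conv_converges[OF G e] by blast
    obtain d3 where d3: "d3 > 0" "\<And>\<epsilon> a. 0 < \<epsilon> \<Longrightarrow> \<epsilon> + norm a < d3 \<Longrightarrow>
      (\<integral>\<^sup>+x. ennreal (norm (conv (rho \<epsilon>) g (x - a) - g x)) \<partial>lborel) \<le> ennreal ((1/2) ^ k)"
      using conv_converges[OF g e] by blast
    have "min d1 (min d2 d3) > 0" using d1(1) d2(1) d3(1) by simp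
    from step[OF this] obtain \<phi> \<epsilon> a where "\<phi> \<in> Cc_infty \<Omega>" "0 < \<epsilon>" "\<epsilon> + norm a < min d1 (min d2 d3)"
      "\<forall>x. \<phi> x = conv (rho \<epsilon>) w (x - a)" "\<forall>x. mgrad \<phi> x = conv (rho \<epsilon>) G (x - a)"
      "\<forall>x\<in>\<Omega>. M x (mgrad \<phi> x /\<^sub>R A) \<le> q * (1 + conv (rho \<epsilon>) g (x - a))" by blast
    then show ?thesis using d1(2)[of \<epsilon> a] d2(2)[of \<epsilon> a] d3(2)[of \<epsilon> a]
      unfolding good_def by (intro exI[of _ \<phi>] exI[of _ \<epsilon>] exI[of _ a]) auto
  qed
  then obtain \<phi> \<epsilon> a where goods: "\<And>k. good k (\<phi> k) (\<epsilon> k) (a k)" by metis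
  then have \<phi>: "\<And>k. \<phi> k \<in> Cc_infty \<Omega>" and \<epsilon>: "\<And>k::nat. 0 < \<epsilon> k"
    and eq: "\<And>k x. \<phi> k x = conv (rho (\<epsilon> k)) w (x - a k)" "\<And>k x. mgrad (\<phi> k) x = conv (rho (\<epsilon> k)) G (x - a k)"
    and bd: "\<And>k x. x \<in> \<Omega> \<Longrightarrow> M x (mgrad (\<phi> k) x /\<^sub>R A) \<le> q * (1 + conv (rho (\<epsilon> k)) g (x - a k))"
    and sm: "\<And>k. (\<integral>\<^sup>+x. ennreal (norm (conv (rho (\<epsilon> k)) w (x - a k) - w x)) \<partial>lborel) \<le> ennreal ((1/2) ^ k)"
      "\<And>k. (\<integral>\<^sup>+x. ennreal (norm (conv (rho (\<epsilon> k)) G (x - a k) - G x)) \<partial>lborel) \<le> ennreal ((1/2) ^ k)"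
      "\<And>k. (\<integral>\<^sup>+x. ennreal (norm (conv (rho (\<epsilon> k)) g (x - a k) - g x)) \<partial>lborel) \<le> ennreal ((1/2) ^ k)"
    unfolding good_def by blast+
  have rm: "(rho (\<epsilon> k) :: real ^ 'n \<Rightarrow> real) \<in> borel_measurable borel" for k
    by (rule C1c_measurable(1)[OF rho_C1c[OF \<epsilon>]])
  note [measurable] = conv_measurable[OF m(1) rm] conv_measurable[OF m(2) rm]
    conv_measurable[of g, OF _ rm] Cc_infty_integrable(3,4)[OF \<phi>]
  obtain Sw where Sw[measurable]: "Sw \<in> borel_measurable lborel" "\<And>x. 0 \<le> Sw x" "(\<integral>\<^sup>+x. ennreal (Sw x) \<partial>lborel) < \<infinity>"
    "AE x in lborel. (\<forall>k. norm (conv (rho (\<epsilon> k)) w (x - a k) - w x) \<le> Sw x) \<and> (\<lambda>k. norm (conv (rho (\<epsilon> k)) w (x - a k) - w x)) \<longlonglongrightarrow> 0"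
    by (rule fast_convergence[of "\<lambda>k x. norm (conv (rho (\<epsilon> k)) w (x - a k) - w x)" lborel]) (use sm in auto)
  obtain SG where SG[measurable]: "SG \<in> borel_measurable lborel" "\<And>x. 0 \<le> SG x" "(\<integral>\<^sup>+x. ennreal (SG x) \<partial>lborel) < \<infinity>"
    "AE x in lborel. (\<forall>k. norm (conv (rho (\<epsilon> k)) G (x - a k) - G x) \<le> SG x) \<and> (\<lambda>k. norm (conv (rho (\<epsilon> k)) G (x - a k) - G x)) \<longlonglongrightarrow> 0"
    by (rule fast_convergence[of "\<lambda>k x. norm (conv (rho (\<epsilon> k)) G (x - a k) - G x)" lborel]) (use sm in auto)
  obtain Sg where Sg[measurable]: "Sg \<in> borel_measurable lborel" "\<And>x. 0 \<le> Sg x" "(\<integral>\<^sup>+x. ennreal (Sg x) \<partial>lborel) < \<infinity>"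
    "AE x in lborel. (\<forall>k. norm (conv (rho (\<epsilon> k)) g (x - a k) - g x) \<le> Sg x) \<and> (\<lambda>k. norm (conv (rho (\<epsilon> k)) g (x - a k) - g x)) \<longlonglongrightarrow> 0"
    by (rule fast_convergence[of "\<lambda>k x. norm (conv (rho (\<epsilon> k)) g (x - a k) - g x)" lborel]) (use sm in auto)
  define u where "u k x = (\<phi> k x - w x) /\<^sub>R \<kappa>" for k x
  define H where "H k x = (mgrad (\<phi> k) x - G x) /\<^sub>R \<kappa>" for k x
  have [measurable]: "u k \<in> borel_measurable borel" "H k \<in> borel_measurable borel" for k
    unfolding u_def H_def by measurable
  have Mbd: "Mb x (H k x) \<le> indicator \<Omega> x * (q * (1 + \<bar>g x\<bar> + Sg x)) + Mb x (G x /\<^sub>R A)"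
    if "norm (conv (rho (\<epsilon> k)) g (x - a k) - g x) \<le> Sg x" for k x
  proof -
    have "H k x = mgrad (\<phi> k) x /\<^sub>R \<kappa> + - (G x /\<^sub>R \<kappa>)" by (simp add: H_def scaleR_diff_right)
    then have "Mb x (H k x) \<le> (Mb x (2 *\<^sub>R (mgrad (\<phi> k) x /\<^sub>R \<kappa>)) + Mb x (2 *\<^sub>R - (G x /\<^sub>R \<kappa>))) / 2"
      using Mb_add[of x "mgrad (\<phi> k) x /\<^sub>R \<kappa>" "- (G x /\<^sub>R \<kappa>)"] by simp
    also have "2 *\<^sub>R (mgrad (\<phi> k) x /\<^sub>R \<kappa>) = mgrad (\<phi> k) x /\<^sub>R A" using A by (simp add: \<kappa>_def)
    also have "2 *\<^sub>R - (G x /\<^sub>R \<kappa>) = - (G x /\<^sub>R A)" using A by (simp add: \<kappa>_def)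
    also have "Mb x (- (G x /\<^sub>R A)) = Mb x (G x /\<^sub>R A)" by (rule Mb_even)
    finally have 1: "Mb x (H k x) \<le> (Mb x (mgrad (\<phi> k) x /\<^sub>R A) + Mb x (G x /\<^sub>R A)) / 2" .
    have "Mb x (mgrad (\<phi> k) x /\<^sub>R A) \<le> indicator \<Omega> x * (q * (1 + \<bar>g x\<bar> + Sg x))"
    proof (cases "x \<in> \<Omega>")
      case True
      have "conv (rho (\<epsilon> k)) g (x - a k) \<le> \<bar>g x\<bar> + Sg x" using that by simp
      then have "q * (1 + conv (rho (\<epsilon> k)) g (x - a k)) \<le> q * (1 + \<bar>g x\<bar> + Sg x)"
        using q by (intro mult_left_mono) auto
      then show ?thesis using bd[OF True, of k] True by (simp add: Mb_in)
    qed (simp add: Mb_out)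
    moreover have "h \<le> j + g'" if "h \<le> (m + g') / 2" "m \<le> j" "0 \<le> m" "0 \<le> g'" for h j m g' :: real
      using that by simp
    ultimately show ?thesis using 1 Mb_nonneg[of x "G x /\<^sub>R A"] Mb_nonneg[of x "mgrad (\<phi> k) x /\<^sub>R A"] by blast
  qed
  have "(\<lambda>k. E (u k) (H k)) \<longlonglongrightarrow> 0"
  proof (rule E_dominated[where S="\<lambda>x. (Sw x + SG x) / \<kappa> + (indicator \<Omega> x * (q * (1 + \<bar>g x\<bar> + Sg x)) + Mb x (G x /\<^sub>R A))"])
    have i: "integrable lborel Sw" "integrable lborel SG" "integrable lborel Sg"
      using Sw SG Sg by (auto simp: integrable_iff_bounded)
    have "integrable lborel (\<lambda>x. indicator \<Omega> x *\<^sub>R (q * (1 :: real)))"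
      using \<Omega>_finite by (intro integrable_scaleR_left integrable_real_indicator) auto
    moreover have "integrable lborel (\<lambda>x. indicator \<Omega> x *\<^sub>R (q * (\<bar>g x\<bar> + Sg x)))"
      using g i(3) by (intro integrable_mult_indicator integrable_mult_right) auto
    ultimately have "integrable lborel (\<lambda>x. indicator \<Omega> x *\<^sub>R (q * (1 :: real)) + indicator \<Omega> x *\<^sub>R (q * (\<bar>g x\<bar> + Sg x)))"
      by (rule Bochner_Integration.integrable_add)
    then have i2: "integrable lborel (\<lambda>x. indicator \<Omega> x * (q * (1 + \<bar>g x\<bar> + Sg x)))"
      by (rule back_subst[of "integrable lborel"]) (auto simp: fun_eq_iff algebra_simps)
    have i3: "integrable lborel (\<lambda>x. Mb x (G x /\<^sub>R A))"
      using Mfin_scale[OF GM, of "inverse A"] Mb_nonneg by (simp add: Mfin_def integrable_iff_bounded)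
    have i4: "integrable lborel (\<lambda>x. (Sw x + SG x) / \<kappa> + (indicator \<Omega> x * (q * (1 + \<bar>g x\<bar> + Sg x)) + Mb x (G x /\<^sub>R A)))"
      using i i2 i3 by auto
    then show "(\<lambda>x. (Sw x + SG x) / \<kappa> + (indicator \<Omega> x * (q * (1 + \<bar>g x\<bar> + Sg x)) + Mb x (G x /\<^sub>R A))) \<in> borel_measurable borel"
      by auto
    have "(\<integral>\<^sup>+x. ennreal ((Sw x + SG x) / \<kappa> + (indicator \<Omega> x * (q * (1 + \<bar>g x\<bar> + Sg x)) + Mb x (G x /\<^sub>R A))) \<partial>lborel) \<le>
       (\<integral>\<^sup>+x. ennreal (norm ((Sw x + SG x) / \<kappa> + (indicator \<Omega> x * (q * (1 + \<bar>g x\<bar> + Sg x)) + Mb x (G x /\<^sub>R A)))) \<partial>lborel)"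
      by (intro nn_integral_mono ennreal_leI) simp
    also have "\<dots> < \<infinity>" using i4 by (simp only: integrable_iff_bounded)
    finally show "(\<integral>\<^sup>+x. ennreal ((Sw x + SG x) / \<kappa> + (indicator \<Omega> x * (q * (1 + \<bar>g x\<bar> + Sg x)) + Mb x (G x /\<^sub>R A))) \<partial>lborel) < \<infinity>" .
    show "AE x in lborel. norm (u k x) + norm (H k x) + Mb x (H k x) \<le> (Sw x + SG x) / \<kappa> + (indicator \<Omega> x * (q * (1 + \<bar>g x\<bar> + Sg x)) + Mb x (G x /\<^sub>R A))" for k
      using Sw(4) SG(4) Sg(4)
    proof eventually_elim
      case (elim x)
      have "norm (u k x) \<le> Sw x / \<kappa>" "norm (H k x) \<le> SG x / \<kappa>"
        unfolding u_def H_def norm_scaleR using elim \<kappa>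
        by (auto simp: eq divide_inverse mult.commute[of "inverse \<kappa>"] intro!: mult_right_mono)
      then show ?case using Mbd[of k x] elim by (simp add: add_divide_distrib)
    qed
    show "AE x in lborel. (\<lambda>k. u k x) \<longlonglongrightarrow> 0 \<and> (\<lambda>k. H k x) \<longlonglongrightarrow> 0"
      using Sw(4) SG(4)
    proof eventually_elim
      case (elim x)
      then have "(\<lambda>k. \<phi> k x - w x) \<longlonglongrightarrow> 0" "(\<lambda>k. mgrad (\<phi> k) x - G x) \<longlonglongrightarrow> 0"
        by (auto simp: eq tendsto_norm_zero_iff)
      then show ?case
        using tendsto_scaleR[OF tendsto_const, of "\<lambda>k. \<phi> k x - w x" 0 sequentially "inverse \<kappa>"]
          tendsto_scaleR[OF tendsto_const, of "\<lambda>k. mgrad (\<phi> k) x - G x" 0 sequentially "inverse \<kappa>"]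
        by (simp add: u_def H_def)
    qed
  qed measurable
  then have "\<forall>\<^sub>F k in sequentially. E (u k) (H k) < ennreal d"
    using d(1) by (intro order_tendstoD(2)) auto
  then obtain k where "E (u k) (H k) < ennreal d" by (auto simp: eventually_sequentially)
  then have "E (\<lambda>x. \<kappa> *\<^sub>R u k x) (\<lambda>x. \<kappa> *\<^sub>R H k x) < ennreal e" by (intro d(2)) auto
  also have "(\<lambda>x. \<kappa> *\<^sub>R u k x) = (\<lambda>x. \<phi> k x - w x)" using \<kappa> by (auto simp: u_def)
  also have "(\<lambda>x. \<kappa> *\<^sub>R H k x) = (\<lambda>x. mgrad (\<phi> k) x - G x)" using \<kappa> by (auto simp: H_def)
  finally show "\<exists>\<phi>\<in>Cc_infty \<Omega>. E (\<lambda>x. \<phi> x - w x) (\<lambda>x. mgrad \<phi> x - G x) < ennreal e" using \<phi> by blast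
qed

definition Minf :: "(real ^ 'n) set \<Rightarrow> real ^ 'n ^ 'd \<Rightarrow> real" where
  "Minf S \<xi> = (INF z\<in>S. M z \<xi>)"

lemma Minf_le: "S \<subseteq> \<Omega> \<Longrightarrow> z \<in> S \<Longrightarrow> Minf S \<xi> \<le> M z \<xi>"
  unfolding Minf_def using M_nonneg by (intro cINF_lower bdd_belowI2[of _ 0]) auto

lemma le_Minf: "S \<noteq> {} \<Longrightarrow> (\<And>z. z \<in> S \<Longrightarrow> t \<le> M z \<xi>) \<Longrightarrow> t \<le> Minf S \<xi>"
  unfolding Minf_def by (rule cINF_greatest)

lemma M_ray: "x \<in> \<Omega> \<Longrightarrow> 0 \<le> t \<Longrightarrow> t \<le> 1 \<Longrightarrow> M x (t *\<^sub>R \<xi>) \<le> t * M x \<xi>"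
  using Mb_ray[of t x \<xi>] by (simp add: Mb_in)

text \<open>This takes the place of Jensen's inequality for \<open>Minf S\<close>, which need not be convex.  The affine
  function is the tangent plane of \<open>M x\<close> at \<open>X /\<^sub>R 2\<close>, within \<open>V\<close>.  In the sublevel set of assumption \<open>B\<close> it is
  compared with \<open>M z\<close> by that assumption.  Any other \<open>\<xi>\<close> is halved until it enters the sublevel set:
  then the plane is at most \<open>2 * T + 2\<close>, while one step before \<open>M z\<close> still exceeded \<open>T\<close> at \<open>C *\<^sub>R \<xi>\<close>.  Undoing
  the \<open>m\<close> halvings multiplies the former bound by \<open>2 ^ m\<close> and, by convexity of \<open>M z\<close>, the latter at least
  by \<open>2 ^ (m - 1)\<close>, so their quotient stays bounded.

  Touching at \<open>X /\<^sub>R 2\<close> rather than at \<open>X\<close> bounds the constant term: \<open>a\<close> is at most the value of the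
  plane at \<open>X\<close>, hence at most \<open>M x X \<le> T + 1\<close>.\<close>

lemma affine_minorant:
  fixes P :: "real ^ 'n ^ 'd \<Rightarrow> real ^ 'n ^ 'd"
  assumes S: "S \<subseteq> \<Omega>" "x \<in> S"
    and V: "subspace V" "linear P" "\<And>\<xi>. P \<xi> \<in> V" "\<And>\<xi>. \<xi> \<in> V \<Longrightarrow> P \<xi> = \<xi>"
    and C: "C \<ge> 1" and s: "s > 0" and T: "T \<ge> \<mu>0" "\<mu>0 > 0"
    and B: "\<And>\<xi> y z. \<xi> \<in> V \<Longrightarrow> Minf S (C *\<^sub>R \<xi>) \<le> T \<Longrightarrow> y \<in> S \<Longrightarrow> z \<in> S \<Longrightarrow> M y \<xi> \<le> M z (C *\<^sub>R \<xi>) + 1"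
    and small: "\<And>\<xi>. \<xi> \<in> V \<Longrightarrow> norm \<xi> \<le> s \<Longrightarrow> Minf S \<xi> \<le> T"
    and X: "X \<in> V" "C * norm X \<le> s"
  obtains p a where "a \<ge> 0" "2 * M x (X /\<^sub>R 2) \<le> p \<bullet> X - a"
    "\<And>\<xi> z. \<xi> \<in> V \<Longrightarrow> z \<in> S \<Longrightarrow> p \<bullet> \<xi> - a - 1 \<le> (4 * (1 + 1 / \<mu>0)) * M z (C *\<^sub>R \<xi>)"
proof -
  define k where "k = 4 * (1 + 1 / \<mu>0)"
  have k1: "k \<ge> 1" using T by (simp add: k_def)
  have xO: "x \<in> \<Omega>" using S by blast
  have near: "M y \<xi> \<le> T + 1" if "\<xi> \<in> V" "Minf S (C *\<^sub>R \<xi>) \<le> T" "y \<in> S" for \<xi> y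
  proof -
    have "M y \<xi> - 1 \<le> Minf S (C *\<^sub>R \<xi>)"
      using S(2) B[OF that(1,2,3)] by (intro le_Minf) (auto simp: algebra_simps)
    then show ?thesis using that(2) by simp
  qed
  have "Minf S (C *\<^sub>R X) \<le> T" using X C V(1) by (intro small) (auto simp: subspace_scale)
  then have fX: "M x X \<le> T + 1" using X S by (intro near)
  have "convex_on UNIV (\<lambda>\<xi>. M x (P \<xi>))"
    unfolding convex_on_def
  proof (intro conjI convex_UNIV ballI allI impI)
    fix \<xi> \<eta> and u v :: real assume uv: "0 \<le> u" "0 \<le> v" "u + v = 1"
    show "M x (P (u *\<^sub>R \<xi> + v *\<^sub>R \<eta>)) \<le> u * M x (P \<xi>) + v * M x (P \<eta>)"
      using M_convex[OF xO] uv by (auto simp: linear_add[OF V(2)] linear_scale[OF V(2)] convex_on_def)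
  qed
  then obtain p where p: "\<And>z. M x (P (X /\<^sub>R 2)) + p \<bullet> (z - X /\<^sub>R 2) \<le> M x (P z)"
    using subgradient_exists by blast
  have PX: "P (X /\<^sub>R 2) = X /\<^sub>R 2" "P X = X" "P 0 = 0"
    using V X by (auto simp: subspace_scale subspace_0)
  define a where "a = p \<bullet> X / 2 - M x (X /\<^sub>R 2)"
  have sub: "p \<bullet> \<xi> - a \<le> M x \<xi>" if "\<xi> \<in> V" for \<xi>
    using p[of \<xi>, unfolded PX(1)] V(4)[OF that] by (simp add: a_def inner_diff_right)
  have a0: "a \<ge> 0" using sub[of 0] V(1) by (simp add: subspace_0 M_zero[OF xO])
  have hX: "0 \<le> M x (X /\<^sub>R 2)" by (rule M_nonneg[OF xO])
  have aT: "a \<le> T + 1" using sub[OF X(1)] fX hX by (simp add: a_def)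
  have "p \<bullet> \<xi> - a - 1 \<le> k * M z (C *\<^sub>R \<xi>)" if \<xi>: "\<xi> \<in> V" and z: "z \<in> S" for \<xi> z
  proof (cases "Minf S (C *\<^sub>R \<xi>) \<le> T")
    case True
    have "p \<bullet> \<xi> - a - 1 \<le> M x \<xi> - 1" using sub[OF \<xi>] by simp
    also have "\<dots> \<le> 1 * M z (C *\<^sub>R \<xi>)" using B[OF \<xi> True S(2) z] by simp
    also have "\<dots> \<le> k * M z (C *\<^sub>R \<xi>)" using k1 M_nonneg z S by (intro mult_right_mono) auto
    finally show ?thesis .
  next
    case False
    \<comment> \<open>the sublevel set is reached after \<open>m\<close> halvings; the least such \<open>m\<close> is positive\<close>
    define Q where "Q m \<longleftrightarrow> Minf S (C *\<^sub>R ((1/2) ^ m *\<^sub>R \<xi>)) \<le> T" for m :: nat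
    have "\<exists>m. Q m"
    proof -
      obtain m where "C * norm \<xi> / s < 2 ^ m" using real_arch_pow[of 2] by auto
      then have "C * norm \<xi> \<le> s * 2 ^ m" using s by (simp add: field_simps)
      then have "norm (C *\<^sub>R ((1/2) ^ m *\<^sub>R \<xi>)) \<le> s" using C by (simp add: power_divide field_simps)
      then have "Q m" unfolding Q_def using V(1) \<xi> by (intro small) (auto simp: subspace_scale)
      then show ?thesis ..
    qed
    define m where "m = (LEAST m. Q m)"
    have Qm: "Q m" unfolding m_def using \<open>\<exists>m. Q m\<close> by (metis LeastI)
    have "\<not> Q 0" using False by (simp add: Q_def)
    then obtain m' where m': "m = Suc m'" using Qm by (cases m) auto
    have nQ: "\<not> Q m'" using m' not_less_Least[of m' Q] by (simp add: m_def)
    define \<zeta> where "\<zeta> = (1/2) ^ m *\<^sub>R \<xi>"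
    have \<zeta>: "\<zeta> \<in> V" using V(1) \<xi> by (simp add: \<zeta>_def subspace_scale)
    have "p \<bullet> \<zeta> \<le> M x \<zeta> + a" using sub[OF \<zeta>] by simp
    also have "\<dots> \<le> 2 * T + 2" using near[OF \<zeta> _ S(2)] Qm aT by (simp add: Q_def \<zeta>_def)
    finally have "(1/2) ^ m * (p \<bullet> \<xi>) \<le> 2 * T + 2" by (simp add: \<zeta>_def)
    then have 1: "p \<bullet> \<xi> \<le> 2 ^ m' * (4 * (T + 1))" by (simp add: m' power_divide field_simps)
    have "T < Minf S (C *\<^sub>R ((1/2) ^ m' *\<^sub>R \<xi>))" using nQ by (simp add: Q_def)
    also have "\<dots> \<le> M z ((1/2) ^ m' *\<^sub>R (C *\<^sub>R \<xi>))" using Minf_le[OF S(1) z] by (simp add: mult.commute)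
    also have "\<dots> \<le> (1/2) ^ m' * M z (C *\<^sub>R \<xi>)" using z S by (intro M_ray) (auto simp: power_le_one)
    finally have 2: "2 ^ m' * T \<le> M z (C *\<^sub>R \<xi>)" by (simp add: power_divide field_simps)
    have "T > 0" using T by simp
    have "4 * (T + 1) = (4 * (1 + 1 / T)) * T" using \<open>T > 0\<close> by (simp add: field_simps)
    also have "\<dots> \<le> k * T" unfolding k_def using T \<open>T > 0\<close> by (intro mult_right_mono mult_left_mono add_left_mono) (auto intro: divide_left_mono)
    finally have "2 ^ m' * (4 * (T + 1)) \<le> k * (2 ^ m' * T)" by simp
    also have "\<dots> \<le> k * M z (C *\<^sub>R \<xi>)" using 2 k1 by (intro mult_left_mono) auto
    finally show ?thesis using 1 a0 by linarith
  qed
  moreover have "2 * M x (X /\<^sub>R 2) \<le> p \<bullet> X - a" using a0 by (simp add: a_def)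
  ultimately show ?thesis using that[OF a0] by (simp add: k_def)
qed

end

lemma linear_block_part: "linear (block_part b j)"
  by (rule linearI) (auto simp: block_part_def vec_eq_iff)

lemma block_part_in: "block_part b j \<xi> \<in> block_space b j"
  by (simp add: block_part_def block_space_def)

lemma block_part_id: "\<xi> \<in> block_space b j \<Longrightarrow> block_part b j \<xi> = \<xi>"
  by (simp add: block_part_def block_space_def vec_eq_iff)

lemma subspace_block_space: "subspace (block_space b j)"
  by (simp add: subspace_def block_space_def)

lemma norm_block_part: "norm (block_part b j \<xi>) \<le> norm \<xi>"
  unfolding norm_vec_def
  by (intro L2_set_mono) (auto simp: block_part_def intro!: L2_set_mono)

lemma block_unit:
  fixes b :: "'d::finite \<Rightarrow> 'n::finite \<Rightarrow> nat"
  assumes "b i k = j"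
  shows "axis i (axis k 1) \<in> block_space b j" "norm (axis i (axis k 1) :: real ^ 'n ^ 'd) = 1"
proof -
  show "axis i (axis k 1) \<in> block_space b j" using assms by (auto simp: block_space_def axis_def)
  show "norm (axis i (axis k 1) :: real ^ 'n ^ 'd) = 1" by (simp add: norm_eq_sqrt_inner inner_axis_axis)
qed

lemma norm_matrix_le_sum: "norm (A :: real ^ 'n ^ 'd) \<le> (\<Sum>i\<in>UNIV. \<Sum>j\<in>UNIV. \<bar>A $ i $ j\<bar>)"
proof -
  have "norm A \<le> (\<Sum>i\<in>UNIV. norm (A $ i))" unfolding norm_vec_def[of A] by (rule L2_set_le_sum) simp
  also have "\<dots> \<le> (\<Sum>i\<in>UNIV. \<Sum>j\<in>UNIV. \<bar>A $ i $ j\<bar>)" by (intro sum_mono norm_le_l1_cart)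
  finally show ?thesis .
qed

lemma conv_bounded_linear:
  fixes f :: "'a::euclidean_space \<Rightarrow> 'b::euclidean_space" and T :: "'b \<Rightarrow> 'c::euclidean_space"
  assumes "bounded_linear T" "integrable lborel f" "C1c \<rho> d\<rho>"
  shows "T (conv \<rho> f x) = conv \<rho> (\<lambda>y. T (f y)) x"
proof -
  obtain B where B: "\<And>x. \<bar>\<rho> x\<bar> \<le> B" using C1c_bounded[OF assms(3)] by metis
  have "integrable lborel (\<lambda>y. \<rho> (x - y) *\<^sub>R f y)"
    by (rule conv_integrable[OF assms(2) C1c_measurable(1)[OF assms(3)] B])
  from integral_bounded_linear[OF assms(1) this] show ?thesis
    by (simp add: conv_def linear_scale[OF bounded_linear.linear[OF assms(1)]])
qed

text \<open>By \<open>sob_conv\<close> the derivative may be moved from the kernel to the function.\<close>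

lemma mollification:
  fixes w :: "real ^ 'n \<Rightarrow> real ^ 'd" and G :: "real ^ 'n \<Rightarrow> real ^ 'n ^ 'd"
  assumes w: "integrable lborel w" and G: "integrable lborel G"
    and s: "\<And>i. sob (\<lambda>x. w x $ i) (\<lambda>x. G x $ i)" and \<epsilon>: "\<epsilon> > 0"
  shows "smooth (\<lambda>x. conv (rho \<epsilon>) w (x - a))"
    and "mgrad (\<lambda>x. conv (rho \<epsilon>) w (x - a)) x = conv (rho \<epsilon>) G (x - a)"
    and "conv (rho \<epsilon>) G x $ i $ j = conv (\<lambda>z. gr (rho \<epsilon>) z \<bullet> axis j 1) (\<lambda>y. w y $ i) x"
proof -
  note C = rho_C1c[OF \<epsilon>, where 'a="real ^ 'n"]
  have sm: "smooth (conv (rho \<epsilon>) w)" by (rule conv_smooth[OF smooth_rho[OF \<epsilon>] rho_outside[OF \<epsilon>] w])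
  then show "smooth (\<lambda>x. conv (rho \<epsilon>) w (x - a))"
    using smooth_affine[of "conv (rho \<epsilon>) w" "- a" 1] by simp
  have comp: "conv (rho \<epsilon>) G x $ i $ j = conv (\<lambda>z. gr (rho \<epsilon>) z \<bullet> axis j 1) (\<lambda>y. w y $ i) x" for x i j
  proof -
    have "conv (rho \<epsilon>) G x $ i = conv (rho \<epsilon>) (\<lambda>y. G y $ i) x"
      by (rule conv_bounded_linear[OF bounded_linear_vec_nth G C])
    then have "conv (rho \<epsilon>) G x $ i $ j = conv (rho \<epsilon>) (\<lambda>y. G y $ i) x \<bullet> axis j 1" by (simp add: inner_axis)
    also have "\<dots> = conv (\<lambda>z. gr (rho \<epsilon>) z \<bullet> axis j 1) (\<lambda>y. w y $ i) x"
      by (rule sob_conv[OF s C, symmetric])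
    finally show ?thesis .
  qed
  then show "conv (rho \<epsilon>) G x $ i $ j = conv (\<lambda>z. gr (rho \<epsilon>) z \<bullet> axis j 1) (\<lambda>y. w y $ i) x" .
  have "((\<lambda>x. conv (rho \<epsilon>) w (x - a)) has_derivative (\<lambda>h. conv (\<lambda>z. gr (rho \<epsilon>) z \<bullet> h) w (x - a))) (at x)"
  proof -
    have "((\<lambda>x. x - a) has_derivative (\<lambda>h. h)) (at x)" by (auto intro!: derivative_eq_intros)
    from has_derivative_compose[OF this conv_has_derivative[OF C w]] show ?thesis .
  qed
  then have fd: "frechet_derivative (\<lambda>x. conv (rho \<epsilon>) w (x - a)) (at x) = (\<lambda>h. conv (\<lambda>z. gr (rho \<epsilon>) z \<bullet> h) w (x - a))"
    by (rule frechet_derivativeI)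
  have "conv (\<lambda>z. gr (rho \<epsilon>) z \<bullet> axis j 1) w (x - a) $ i = conv (\<lambda>z. gr (rho \<epsilon>) z \<bullet> axis j 1) (\<lambda>y. w y $ i) (x - a)" for i j
  proof -
    obtain B where B: "\<And>x. norm (gr (rho \<epsilon>) (x :: real ^ 'n)) \<le> B" using C1c_bounded[OF C] by metis
    have bd: "\<bar>gr (rho \<epsilon>) z \<bullet> axis j 1\<bar> \<le> B" for z :: "real ^ 'n"
      using B[of z] component_le_norm_cart[of "gr (rho \<epsilon>) z" j] by (simp add: inner_axis)
    have "(\<lambda>z :: real ^ 'n. gr (rho \<epsilon>) z \<bullet> axis j 1) \<in> borel_measurable borel"
      by (rule borel_measurable_inner[OF C1c_measurable(2)[OF C] borel_measurable_const])
    from integral_bounded_linear[OF bounded_linear_vec_nth conv_integrable[OF w this bd, of "x - a"], of i]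
    show ?thesis by (simp add: conv_def)
  qed
  then show "mgrad (\<lambda>x. conv (rho \<epsilon>) w (x - a)) x = conv (rho \<epsilon>) G (x - a)"
    by (simp add: mgrad_def vec_eq_iff fd comp)
qed

lemma mollification_grad_bound:
  obtains D where "D \<ge> 0"
    "\<And>(w :: real ^ 'n \<Rightarrow> real ^ 'd) G \<epsilon> x c \<delta>. integrable lborel w \<Longrightarrow> integrable lborel G \<Longrightarrow>
      (\<And>i. sob (\<lambda>x. w x $ i) (\<lambda>x. G x $ i)) \<Longrightarrow> \<epsilon> > 0 \<Longrightarrow>
      (\<And>y. norm (x - y) < \<epsilon> \<Longrightarrow> norm (w y - c) \<le> \<delta>) \<Longrightarrow> norm (conv (rho \<epsilon>) G x) \<le> D * \<delta> / \<epsilon>"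
proof -
  define D1 where "D1 = (\<integral>x. norm (gr (rho 1) x) \<partial>(lborel :: (real ^ 'n) measure))"
  define D where "D = real CARD('d) * real CARD('n) * D1"
  have "norm (conv (rho \<epsilon>) G x) \<le> D * \<delta> / \<epsilon>"
    if w: "integrable lborel w" "integrable lborel G" "\<And>i. sob (\<lambda>x. w x $ i) (\<lambda>x. G x $ i)" and \<epsilon>: "\<epsilon> > 0"
      and osc: "\<And>y. norm (x - y) < \<epsilon> \<Longrightarrow> norm (w y - c) \<le> \<delta>"
    for w :: "real ^ 'n \<Rightarrow> real ^ 'd" and G \<epsilon> x c \<delta>
  proof -
    have "\<bar>conv (rho \<epsilon>) G x $ i $ j\<bar> \<le> D1 * \<delta> / \<epsilon>" for i j
      unfolding mollification(3)[OF w \<epsilon>] D1_def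
    proof (rule conv_grad_bound[OF sobD(1)[OF w(3)] \<epsilon>])
      show "norm (axis j 1 :: real ^ 'n) \<le> 1" by simp
      fix y assume "norm (x - y) < \<epsilon>"
      then show "\<bar>w y $ i - c $ i\<bar> \<le> \<delta>"
        using component_le_norm_cart[of "w y - c" i] osc[of y] by simp
    qed
    then have "(\<Sum>i\<in>UNIV. \<Sum>j\<in>UNIV. \<bar>conv (rho \<epsilon>) G x $ i $ j\<bar>) \<le> (\<Sum>i\<in>(UNIV :: 'd set). \<Sum>j\<in>(UNIV :: 'n set). D1 * \<delta> / \<epsilon>)"
      by (intro sum_mono)
    also have "\<dots> = D * \<delta> / \<epsilon>" by (simp add: D_def)
    finally show ?thesis using norm_matrix_le_sum[of "conv (rho \<epsilon>) G x"] by linarith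
  qed
  moreover have "D \<ge> 0" by (simp add: D_def D1_def)
  ultimately show ?thesis using that by blast
qed

context modular
begin

text \<open>The balance condition in terms of \<open>M\<close> alone.  The summand with index \<open>j\<close> is the restriction of \<open>M\<close> to the
  \<open>j\<close>-th block space, as all other summands vanish there, and the two extrema over the ball in the
  conclusion become a comparison of arbitrary points \<open>y\<close> and \<open>z\<close>.\<close>

definition bgen_with :: "real \<Rightarrow> nat \<Rightarrow> ('d \<Rightarrow> 'n \<Rightarrow> nat) \<Rightarrow> real \<Rightarrow> real \<Rightarrow> bool" where
  "bgen_with \<gamma> K b c C \<longleftrightarrow> {b i k | i k. True} = {..<K} \<and>
     (\<forall>x\<in>\<Omega>. \<forall>\<xi>. M x \<xi> = (\<Sum>j<K. M x (block_part b j \<xi>))) \<and> c > 1 \<and> C > 1 \<and>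
     (\<forall>p r. 0 < r \<and> r \<le> 1 \<and> ball p r \<inter> \<Omega> \<noteq> {} \<longrightarrow> (\<forall>j<K. \<forall>\<xi>\<in>block_space b j.
        Minf (ball p r \<inter> \<Omega>) (C *\<^sub>R \<xi>) \<le>
          (SUP \<eta>\<in>{\<eta> \<in> block_space b j. norm \<eta> = 1}. Minf (ball p r \<inter> \<Omega>) ((c * r powr (\<gamma> - 1)) *\<^sub>R \<eta>))
        \<longrightarrow> (\<forall>y\<in>ball p r \<inter> \<Omega>. \<forall>z\<in>ball p r \<inter> \<Omega>. M y \<xi> \<le> M z (C *\<^sub>R \<xi>) + 1)))"

definition bgen :: "real \<Rightarrow> bool" where
  "bgen \<gamma> \<longleftrightarrow> (\<exists>K b c C. bgen_with \<gamma> K b c C)"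

text \<open>Integrate the assumption \<open>min\<close> for \<open>\<xi> = P (G y) /\<^sub>R A\<close> against the kernel.  As the kernel has integral
  one, the left-hand side becomes the affine function at the average.  Points \<open>y\<close> outside of \<open>\<Omega>\<close> do no harm: there \<open>G y = 0\<close> and the
  affine function is negative.\<close>

lemma averaged_minorant:
  fixes P :: "real ^ 'n ^ 'd \<Rightarrow> real ^ 'n ^ 'd"
  assumes G: "integrable lborel G" "\<And>y. y \<notin> \<Omega> \<Longrightarrow> G y = 0"
    and g: "integrable lborel (\<lambda>y. Mb y ((C / A) *\<^sub>R P (G y)))"
    and P: "linear P" "\<And>\<xi>. P \<xi> \<in> V" "subspace V" and a: "a \<ge> 0" and k: "k \<ge> 0" and \<epsilon>: "\<epsilon> > 0"
    and S: "\<And>y. y \<in> \<Omega> \<Longrightarrow> norm (x - y) < \<epsilon> \<Longrightarrow> y \<in> S"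
    and min: "\<And>\<xi> z. \<xi> \<in> V \<Longrightarrow> z \<in> S \<Longrightarrow> p \<bullet> \<xi> - a - 1 \<le> k * M z (C *\<^sub>R \<xi>)"
  shows "p \<bullet> (P (conv (rho \<epsilon>) G x) /\<^sub>R A) - a - 1 \<le> k * conv (rho \<epsilon>) (\<lambda>y. Mb y ((C / A) *\<^sub>R P (G y))) x"
proof -
  define l where "l \<xi> = p \<bullet> (P \<xi> /\<^sub>R A)" for \<xi>
  have bl: "bounded_linear l"
    unfolding l_def using P(1)
    by (intro bounded_linear_inner_right_comp bounded_linear_const_scaleR) (simp add: linear_conv_bounded_linear)
  note C = rho_C1c[OF \<epsilon>, where 'a="real ^ 'n"]
  obtain B where B: "\<And>x. \<bar>rho \<epsilon> (x :: real ^ 'n)\<bar> \<le> B" using C1c_bounded[OF C] by metis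
  have i1: "integrable lborel (\<lambda>y. rho \<epsilon> (x - y) *\<^sub>R l (G y))"
    by (rule conv_integrable[OF integrable_bounded_linear[OF bl G(1)] C1c_measurable(1)[OF C] B])
  have i2: "integrable lborel (\<lambda>y. rho \<epsilon> (x - y) *\<^sub>R Mb y ((C / A) *\<^sub>R P (G y)))"
    by (rule conv_integrable[OF g C1c_measurable(1)[OF C] B])
  have i3: "integrable lborel (\<lambda>y. rho \<epsilon> (x - y))"
    by (rule integrable_reflect[OF C1c_integrable(1)[OF C]])
  have one: "(\<integral>y. rho \<epsilon> (x - y) \<partial>lborel) = 1"
    using integral_reflect[OF C1c_measurable(1)[OF C], of x] rho_integral[OF \<epsilon>, where 'a="real ^ 'n"] by simp
  have "p \<bullet> (P (conv (rho \<epsilon>) G x) /\<^sub>R A) - a - 1 = (\<integral>y. rho \<epsilon> (x - y) *\<^sub>R l (G y) \<partial>lborel) - (a + 1) * (\<integral>y. rho \<epsilon> (x - y) \<partial>lborel)"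
    using conv_bounded_linear[OF bl G(1) C, of x] by (simp add: l_def conv_def one)
  also have "\<dots> = (\<integral>y. rho \<epsilon> (x - y) *\<^sub>R l (G y) - (a + 1) * rho \<epsilon> (x - y) \<partial>lborel)"
    using i1 i3 by simp
  also have "\<dots> \<le> (\<integral>y. k * (rho \<epsilon> (x - y) *\<^sub>R Mb y ((C / A) *\<^sub>R P (G y))) \<partial>lborel)"
  proof (rule Bochner_Integration.integral_mono)
    fix y
    have "rho \<epsilon> (x - y) * (l (G y) - a - 1) \<le> rho \<epsilon> (x - y) * (k * Mb y ((C / A) *\<^sub>R P (G y)))"
    proof (cases "norm (x - y) < \<epsilon>")
      case True
      have "l (G y) - a - 1 \<le> k * Mb y ((C / A) *\<^sub>R P (G y))"
      proof (cases "y \<in> \<Omega>")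
        case yO: True
        have "P (G y) /\<^sub>R A \<in> V" using P by (simp add: subspace_scale)
        from min[OF this S[OF yO True]] show ?thesis
          using yO by (simp add: l_def Mb_in divide_inverse)
      next
        case False
        then have "l (G y) = 0" using G(2) linear_0[OF bounded_linear.linear[OF bl]] by simp
        then show ?thesis using a False by (simp add: Mb_out)
      qed
      then show ?thesis using rho_nonneg[OF \<epsilon>] by (rule mult_left_mono)
    qed (simp add: rho_outside[OF \<epsilon>])
    then show "rho \<epsilon> (x - y) *\<^sub>R l (G y) - (a + 1) * rho \<epsilon> (x - y) \<le> k * (rho \<epsilon> (x - y) *\<^sub>R Mb y ((C / A) *\<^sub>R P (G y)))"
      by (simp add: algebra_simps)
  qed (use i1 i2 i3 in auto)
  also have "\<dots> = k * conv (rho \<epsilon>) (\<lambda>y. Mb y ((C / A) *\<^sub>R P (G y))) x" using i2 by (simp add: conv_def)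
  finally show ?thesis .
qed

text \<open>The radius \<open>\<kappa> * \<epsilon>\<close> is so large that the ball around \<open>x\<close> contains the ball around \<open>x'\<close> over which
  \<open>G\<close> is averaged.  For each block, \<open>affine_minorant\<close> gives a plane that bounds \<open>M x\<close> at the averaged gradient from
  above and \<open>M y\<close> at the gradients \<open>G y\<close> from below; \<open>averaged_minorant\<close> connects the two.\<close>

lemma mollified_bound:
  assumes bg: "bgen \<gamma>" and \<gamma>: "\<gamma> \<le> 1"
    and G: "integrable lborel G" "\<And>y. y \<notin> \<Omega> \<Longrightarrow> G y = 0" and GM: "Mfin G" and D: "D \<ge> 0" and \<kappa>: "\<kappa> > 0"
  obtains A q g where "A > 0" "q \<ge> 0" "integrable lborel g"
    "\<And>\<epsilon> x x'. \<epsilon> > 0 \<Longrightarrow> \<kappa> * \<epsilon> \<le> 1 \<Longrightarrow> x \<in> \<Omega> \<Longrightarrow> norm (x - x') + \<epsilon> \<le> \<kappa> * \<epsilon> \<Longrightarrow>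
      norm (conv (rho \<epsilon>) G x') \<le> D * \<epsilon> powr (\<gamma> - 1) \<Longrightarrow>
      M x (conv (rho \<epsilon>) G x' /\<^sub>R A) \<le> q * (1 + conv (rho \<epsilon>) g x')"
proof -
  obtain K b c C where raw: "bgen_with \<gamma> K b c C" using bg by (auto simp: bgen_def)
  then have K: "{b i k | i k. True} = {..<K::nat}"
    and Msum: "\<And>x \<xi>. x \<in> \<Omega> \<Longrightarrow> M x \<xi> = (\<Sum>j<K. M x (block_part b j \<xi>))"
    and c: "c > 1" and C: "C > 1"
  proof -
    note r = raw[unfolded bgen_with_def]
    show "{b i k | i k. True} = {..<K}" using r by (rule conjunct1)
    note r2 = r[THEN conjunct2]
    show "M x \<xi> = (\<Sum>j<K. M x (block_part b j \<xi>))" if "x \<in> \<Omega>" for x \<xi>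
      using r2[THEN conjunct1] that by blast
    show "c > 1" "C > 1"
      using r2[THEN conjunct2, THEN conjunct1] r2[THEN conjunct2, THEN conjunct2, THEN conjunct1] .
  qed
  have bg: "M y \<xi> \<le> M z (C *\<^sub>R \<xi>) + 1"
    if "0 < r" "r \<le> 1" "ball p r \<inter> \<Omega> \<noteq> {}" "j < K" "\<xi> \<in> block_space b j"
      "Minf (ball p r \<inter> \<Omega>) (C *\<^sub>R \<xi>) \<le>
          (SUP \<eta>\<in>{\<eta> \<in> block_space b j. norm \<eta> = 1}. Minf (ball p r \<inter> \<Omega>) ((c * r powr (\<gamma> - 1)) *\<^sub>R \<eta>))"
      "y \<in> ball p r \<inter> \<Omega>" "z \<in> ball p r \<inter> \<Omega>" for p r j \<xi> y z
    using raw[unfolded bgen_with_def, THEN conjunct2, THEN conjunct2, THEN conjunct2, THEN conjunct2,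
      rule_format, OF conjI[OF that(1) conjI[OF that(2,3)]] that(4-8)] .
  have [measurable]: "G \<in> borel_measurable borel" using G by auto
  \<comment> \<open>a lower bound for the sublevel \<open>T\<close> below that does not depend on the ball, since \<open>s \<ge> c\<close>\<close>
  obtain \<mu>0 where \<mu>0: "\<mu>0 > 0" "\<And>x \<xi>. x \<in> \<Omega> \<Longrightarrow> norm \<xi> \<ge> c \<Longrightarrow> M x \<xi> \<ge> \<mu>0"
    using M_lower[of c] c by auto
  \<comment> \<open>dividing by \<open>A\<close> brings the averaged gradient, of norm at most \<open>D * \<epsilon> powr (\<gamma> - 1)\<close>, into the range \<open>C * norm X \<le> s\<close>\<close>
  define A where "A = max 1 (D * C / (c * \<kappa> powr (\<gamma> - 1)))"
  have A: "A \<ge> 1" "D * C / (c * \<kappa> powr (\<gamma> - 1)) \<le> A" by (auto simp: A_def)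
  define k where "k = 4 * (1 + 1 / \<mu>0)"
  have k0: "k \<ge> 0" using \<mu>0 by (simp add: k_def)
  define gj where "gj j y = Mb y ((C / A) *\<^sub>R block_part b j (G y))" for j y
  have Mj: "M x (block_part b j \<xi>) \<le> M x \<xi>" if "x \<in> \<Omega>" "j < K" for x j \<xi>
  proof -
    have "M x (block_part b j \<xi>) = (\<Sum>i\<in>{j}. M x (block_part b i \<xi>))" by simp
    also have "\<dots> \<le> (\<Sum>i<K. M x (block_part b i \<xi>))"
      using that M_nonneg by (intro sum_mono2) auto
    also have "\<dots> = M x \<xi>" by (rule Msum[OF that(1), symmetric])
    finally show ?thesis .
  qed
  have gji: "integrable lborel (gj j)" if "j < K" for j
  proof -
    have bl: "bounded_linear (block_part b j)" using linear_block_part by (simp add: linear_conv_bounded_linear)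
    have [measurable]: "(\<lambda>y. block_part b j (G y)) \<in> borel_measurable borel"
      using integrable_bounded_linear[OF bl G(1)] by auto
    have "Mfin (\<lambda>y. (C / A) *\<^sub>R block_part b j (G y))"
    proof (rule Mfin_mono[OF Mfin_scale[OF GM, of "C / A"], of _ 0])
      show "AE y in lborel. Mb y ((C / A) *\<^sub>R block_part b j (G y)) \<le> Mb y ((C / A) *\<^sub>R G y) + 0"
        using Mj[OF _ that, of _ "(C / A) *\<^sub>R G _"]
        by (intro AE_I2) (auto simp: Mb_def indicator_def linear_scale[OF linear_block_part])
    qed measurable
    then show ?thesis using Mb_nonneg by (simp add: Mfin_def integrable_iff_bounded gj_def[abs_def])
  qed
  define g where "g y = (\<Sum>j<K. gj j y)" for y
  have gi: "integrable lborel g" unfolding g_def using gji by (intro Bochner_Integration.integrable_sum) auto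
  define q where "q = max (real K) k"
  show ?thesis
  proof (rule that[of "2 * A" q g])
    show "0 < 2 * A" "0 \<le> q" using A k0 by (auto simp: q_def)
    show "integrable lborel g" by (rule gi)
    fix \<epsilon> x x'
    assume \<epsilon>: "\<epsilon> > 0" and \<kappa>\<epsilon>: "\<kappa> * \<epsilon> \<le> 1" and x: "x \<in> \<Omega>" and xx: "norm (x - x') + \<epsilon> \<le> \<kappa> * \<epsilon>"
      and bd: "norm (conv (rho \<epsilon>) G x') \<le> D * \<epsilon> powr (\<gamma> - 1)"
    note C1 = rho_C1c[OF \<epsilon>, where 'a="real ^ 'n"]
    obtain Br where Br: "\<And>x. \<bar>rho \<epsilon> (x :: real ^ 'n)\<bar> \<le> Br" using C1c_bounded[OF C1] by metis
    define r where "r = \<kappa> * \<epsilon>"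
    have r: "0 < r" "r \<le> 1" using \<kappa> \<epsilon> \<kappa>\<epsilon> by (auto simp: r_def)
    define S where "S = ball x r \<inter> \<Omega>"
    have S: "S \<subseteq> \<Omega>" "x \<in> S" using x r by (auto simp: S_def)
    define s where "s = c * r powr (\<gamma> - 1)"
    have "0 \<le> (\<gamma> - 1) * ln r" using r \<gamma> by (intro mult_nonpos_nonpos) (auto simp: ln_le_zero_iff)
    then have "r powr (\<gamma> - 1) \<ge> 1" using r by (simp add: powr_def)
    then have s: "s \<ge> c" using c by (simp add: s_def)
    define Y where "Y = conv (rho \<epsilon>) G x'"
    have part: "2 * M x (block_part b j (Y /\<^sub>R (2 * A))) \<le> 1 + k * conv (rho \<epsilon>) (gj j) x'" if j: "j < K" for j
    proof -
      define V where "V = block_space b j"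
      define T where "T = (SUP \<eta>\<in>{\<eta> \<in> V. norm \<eta> = 1}. Minf S (s *\<^sub>R \<eta>))"
      have "j \<in> {b i k | i k. True}" using K j by simp
      then obtain i0 k0 where ik: "b i0 k0 = j" by blast
      define \<eta>0 where "\<eta>0 = (axis i0 (axis k0 1) :: real ^ 'n ^ 'd)"
      have \<eta>0: "\<eta>0 \<in> V" "norm \<eta>0 = 1" using block_unit[of b, OF ik] by (auto simp: V_def \<eta>0_def)
      obtain B where B: "B \<ge> 0" "\<And>x \<xi>. x \<in> \<Omega> \<Longrightarrow> norm \<xi> \<le> s \<Longrightarrow> M x \<xi> \<le> B" using M_upper[of s] by blast
      have bdd: "bdd_above ((\<lambda>\<eta>. Minf S (s *\<^sub>R \<eta>)) ` {\<eta> \<in> V. norm \<eta> = 1})"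
      proof (rule bdd_aboveI2)
        fix \<eta> assume "\<eta> \<in> {\<eta> \<in> V. norm \<eta> = 1}"
        then have "M x (s *\<^sub>R \<eta>) \<le> B" using s c by (intro B x) auto
        then show "Minf S (s *\<^sub>R \<eta>) \<le> B" using Minf_le[OF S, of "s *\<^sub>R \<eta>"] by simp
      qed
      have Tup: "Minf S (s *\<^sub>R \<eta>) \<le> T" if "\<eta> \<in> V" "norm \<eta> = 1" for \<eta>
        unfolding T_def by (rule cSUP_upper[OF _ bdd]) (use that in auto)
      have "\<mu>0 \<le> Minf S (s *\<^sub>R \<eta>0)"
        using S s c \<eta>0 by (intro le_Minf \<mu>0) auto
      then have T: "T \<ge> \<mu>0" using Tup[OF \<eta>0] by simp
      have small: "Minf S \<xi> \<le> T" if "\<xi> \<in> V" "norm \<xi> \<le> s" for \<xi>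
      proof (cases "\<xi> = 0")
        case True
        then show ?thesis using Minf_le[OF S, of 0] M_zero[OF x] T \<mu>0 by simp
      next
        case False
        define \<eta> where "\<eta> = \<xi> /\<^sub>R norm \<xi>"
        have \<eta>: "\<eta> \<in> V" "norm \<eta> = 1" using that False by (auto simp: \<eta>_def V_def subspace_scale[OF subspace_block_space])
        have eq: "\<xi> = (norm \<xi> / s) *\<^sub>R (s *\<^sub>R \<eta>)" using False s c by (simp add: \<eta>_def)
        have "Minf S \<xi> \<le> M z (s *\<^sub>R \<eta>)" if "z \<in> S" for z
        proof -
          have z: "z \<in> \<Omega>" using that S by blast
          have "Minf S \<xi> \<le> M z \<xi>" by (rule Minf_le[OF S(1) that])
          also have "\<dots> = M z ((norm \<xi> / s) *\<^sub>R (s *\<^sub>R \<eta>))" using eq by simp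
          also have "\<dots> \<le> (norm \<xi> / s) * M z (s *\<^sub>R \<eta>)"
            using \<open>norm \<xi> \<le> s\<close> s c by (intro M_ray z) auto
          also have "\<dots> \<le> 1 * M z (s *\<^sub>R \<eta>)"
            using \<open>norm \<xi> \<le> s\<close> s c M_nonneg[OF z] by (intro mult_right_mono) auto
          finally show ?thesis by simp
        qed
        then have "Minf S \<xi> \<le> Minf S (s *\<^sub>R \<eta>)" using S by (intro le_Minf) auto
        then show ?thesis using Tup[OF \<eta>] by simp
      qed
      have BB: "M y \<xi> \<le> M z (C *\<^sub>R \<xi>) + 1" if "\<xi> \<in> V" "Minf S (C *\<^sub>R \<xi>) \<le> T" "y \<in> S" "z \<in> S" for \<xi> y z
      proof -
        have ne: "ball x r \<inter> \<Omega> \<noteq> {}" using S(2) unfolding S_def by blast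
        show ?thesis
          using bg[OF r ne j, of \<xi> y z] that unfolding S_def T_def V_def s_def by blast
      qed
      define X where "X = block_part b j Y /\<^sub>R A"
      have X: "X \<in> V" by (simp add: X_def V_def subspace_scale[OF subspace_block_space] block_part_in)
      have "C * norm X \<le> C * (D * \<epsilon> powr (\<gamma> - 1) / A)"
      proof (intro mult_left_mono)
        have "norm X = norm (block_part b j Y) / A" using A by (simp add: X_def divide_inverse mult.commute)
        also have "\<dots> \<le> D * \<epsilon> powr (\<gamma> - 1) / A"
          using A norm_block_part[of b j Y] bd by (intro divide_right_mono) (auto simp: Y_def)
        finally show "norm X \<le> D * \<epsilon> powr (\<gamma> - 1) / A" .
      qed (use C in simp)
      also have "\<dots> \<le> s"
      proof -
        have "s = c * (\<kappa> powr (\<gamma> - 1) * \<epsilon> powr (\<gamma> - 1))" using \<kappa> \<epsilon> by (simp add: s_def r_def powr_mult)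
        moreover have "D * C \<le> A * (c * \<kappa> powr (\<gamma> - 1))" using A(2) c \<kappa> by (simp add: divide_le_eq)
        then have "(D * C) * \<epsilon> powr (\<gamma> - 1) \<le> (A * (c * \<kappa> powr (\<gamma> - 1))) * \<epsilon> powr (\<gamma> - 1)"
          by (rule mult_right_mono) simp
        ultimately show ?thesis using A by (simp add: divide_le_eq mult_ac)
      qed
      finally have Xs: "C * norm X \<le> s" .
      have s0: "s > 0" using s c by simp
      have V: "subspace V" "\<And>\<xi>. block_part b j \<xi> \<in> V" "\<And>\<xi>. \<xi> \<in> V \<Longrightarrow> block_part b j \<xi> = \<xi>"
        by (simp_all add: V_def subspace_block_space block_part_in block_part_id)
      obtain p a where pa: "a \<ge> 0" "2 * M x (X /\<^sub>R 2) \<le> p \<bullet> X - a"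
        "\<And>\<xi> z. \<xi> \<in> V \<Longrightarrow> z \<in> S \<Longrightarrow> p \<bullet> \<xi> - a - 1 \<le> k * M z (C *\<^sub>R \<xi>)"
      proof (rule affine_minorant[OF S V(1) linear_block_part V(2,3) less_imp_le[OF C] s0 T \<mu>0(1) BB small X Xs, folded k_def])
        fix p a
        assume "0 \<le> a" "2 * M x (X /\<^sub>R 2) \<le> p \<bullet> X - a"
          "\<And>\<xi> z. \<xi> \<in> V \<Longrightarrow> z \<in> S \<Longrightarrow> p \<bullet> \<xi> - a - 1 \<le> k * M z (C *\<^sub>R \<xi>)"
        then show thesis by (rule that)
      qed assumption+
      have "p \<bullet> X - a - 1 \<le> k * conv (rho \<epsilon>) (gj j) x'"
        unfolding X_def Y_def gj_def[abs_def]
      proof (rule averaged_minorant[OF G _ linear_block_part _ _ pa(1) k0 \<epsilon> _ pa(3)])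
        show "integrable lborel (\<lambda>y. Mb y ((C / A) *\<^sub>R block_part b j (G y)))" using gji[OF j] by (simp add: gj_def[abs_def])
        show "block_part b j \<xi> \<in> V" for \<xi> by (simp add: V_def block_part_in)
        show "subspace V" by (simp add: V_def subspace_block_space)
        fix y assume y: "y \<in> \<Omega>" "norm (x' - y) < \<epsilon>"
        have "norm (x - y) \<le> norm (x - x') + norm (x' - y)" by norm
        then show "y \<in> S" using y xx by (simp add: S_def r_def dist_norm)
      qed
      moreover have "block_part b j (Y /\<^sub>R (2 * A)) = X /\<^sub>R 2"
        by (simp add: X_def linear_scale[OF linear_block_part])
      ultimately show ?thesis using pa(2) by simp
    qed
    have cj: "conv (rho \<epsilon>) (gj j) x' \<ge> 0" for j
      unfolding conv_def gj_def
      by (intro Bochner_Integration.integral_nonneg) (simp add: rho_nonneg[OF \<epsilon>] Mb_nonneg)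
    have cg: "conv (rho \<epsilon>) g x' = (\<Sum>j<K. conv (rho \<epsilon>) (gj j) x')"
      unfolding conv_def g_def scaleR_sum_right
      by (rule Bochner_Integration.integral_sum)
        (use conv_integrable[OF gji C1c_measurable(1)[OF C1] Br] in auto)
    have "M x (Y /\<^sub>R (2 * A)) = (\<Sum>j<K. M x (block_part b j (Y /\<^sub>R (2 * A))))" by (rule Msum[OF x])
    also have "\<dots> \<le> (\<Sum>j<K. 1 + k * conv (rho \<epsilon>) (gj j) x')"
    proof (rule sum_mono)
      fix j assume "j \<in> {..<K}"
      then show "M x (block_part b j (Y /\<^sub>R (2 * A))) \<le> 1 + k * conv (rho \<epsilon>) (gj j) x'"
        using part[of j] M_nonneg[OF x, of "block_part b j (Y /\<^sub>R (2 * A))"] by simp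
    qed
    also have "\<dots> = real K + k * conv (rho \<epsilon>) g x'" by (simp add: sum.distrib cg sum_distrib_left)
    also have "\<dots> \<le> q * 1 + q * conv (rho \<epsilon>) g x'"
      using cj by (intro add_mono mult_right_mono) (auto simp: q_def cg intro: sum_nonneg)
    also have "\<dots> = q * (1 + conv (rho \<epsilon>) g x')" by (simp add: distrib_left)
    finally show "M x (conv (rho \<epsilon>) G x' /\<^sub>R (2 * A)) \<le> q * (1 + conv (rho \<epsilon>) g x')" by (simp add: Y_def)
  qed
qed

end

section \<open>Lipschitz boundaries\<close>

text \<open>\<open>h\<close> is the height above the graph in direction \<open>e\<close>.  Moving by \<open>t *\<^sub>R e\<close> gains height \<open>t\<close>, and a perturbation \<open>z\<close>
  loses at most a fixed multiple of \<open>norm z\<close>.\<close>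

lemma lipschitz_chart:
  fixes \<Omega> :: "'a::euclidean_space set"
  assumes \<Omega>: "bounded_lipschitz_domain \<Omega>" and p: "p \<in> frontier \<Omega>"
  obtains e r K h where "norm e = 1" "r > 0" "K \<ge> 0" "continuous_on UNIV h"
    "\<And>x. x \<in> ball p r \<Longrightarrow> x \<in> \<Omega> \<longleftrightarrow> 0 < h x" "\<And>x t z. h (x + t *\<^sub>R e + z) \<ge> h x + t - (1 + 2 * K) * norm z"
    "\<And>x t. h (x + t *\<^sub>R e) = h x + t"
proof -
  from \<Omega> p obtain e r K and g :: "'a \<Rightarrow> real" where chart: "norm e = 1 \<and> r > 0 \<and>
      K-lipschitz_on {y. y \<bullet> e = 0} g \<and> (\<forall>x\<in>ball p r. x \<in> \<Omega> \<longleftrightarrow> g (x - (x \<bullet> e) *\<^sub>R e) < x \<bullet> e)"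
    unfolding bounded_lipschitz_domain_def lipschitz_boundary_def by blast
  then have e: "norm e = 1" and r: "r > 0" and g: "K-lipschitz_on {y. y \<bullet> e = 0} g"
    and ch: "\<And>x. x \<in> ball p r \<Longrightarrow> x \<in> \<Omega> \<longleftrightarrow> g (x - (x \<bullet> e) *\<^sub>R e) < x \<bullet> e"
    by blast+
  define \<pi> where "\<pi> x = x - (x \<bullet> e) *\<^sub>R e" for x
  have ee: "e \<bullet> e = 1" using e by (simp add: norm_eq_1)
  have \<pi>0: "\<pi> x \<in> {y. y \<bullet> e = 0}" for x by (simp add: \<pi>_def inner_diff_left ee)
  define h where "h x = x \<bullet> e - g (\<pi> x)" for x
  have K: "K \<ge> 0" using g by (rule lipschitz_on_nonneg)
  have lip: "\<bar>g (\<pi> x) - g (\<pi> y)\<bar> \<le> K * norm (\<pi> x - \<pi> y)" for x y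
    using lipschitz_onD[OF g \<pi>0 \<pi>0, of x y] by (simp add: dist_norm)
  have \<pi>le: "norm (\<pi> z) \<le> 2 * norm z" for z
  proof -
    have "norm (\<pi> z) \<le> norm z + norm ((z \<bullet> e) *\<^sub>R e)" unfolding \<pi>_def by (rule norm_triangle_ineq4)
    also have "norm ((z \<bullet> e) *\<^sub>R e) \<le> norm z" using Cauchy_Schwarz_ineq2[of z e] e by simp
    finally show ?thesis by simp
  qed
  have \<pi>add: "\<pi> (x + t *\<^sub>R e + z) = \<pi> x + \<pi> z" for x t z
    by (simp add: \<pi>_def inner_add_left ee algebra_simps)
  have low: "h (x + t *\<^sub>R e + z) \<ge> h x + t - (1 + 2 * K) * norm z" for x t z
  proof -
    have "\<bar>g (\<pi> x + \<pi> z) - g (\<pi> x)\<bar> \<le> K * norm (\<pi> z)"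
      using lip[of "x + 0 *\<^sub>R e + z" x] \<pi>add[of x 0 z] by simp
    also have "\<dots> \<le> K * (2 * norm z)" by (rule mult_left_mono[OF \<pi>le K])
    finally have 1: "\<bar>g (\<pi> x + \<pi> z) - g (\<pi> x)\<bar> \<le> K * (2 * norm z)" .
    have "\<bar>z \<bullet> e\<bar> \<le> norm z" using Cauchy_Schwarz_ineq2[of z e] e by simp
    then show ?thesis using 1 unfolding h_def \<pi>add by (simp add: inner_add_left ee algebra_simps)
  qed
  have shift: "h (x + t *\<^sub>R e) = h x + t" for x t
    using \<pi>add[of x t 0] by (simp add: h_def inner_add_left ee) (simp add: \<pi>_def)
  have cont: "continuous_on UNIV h"
    unfolding h_def
    by (intro continuous_intros continuous_on_compose2[OF lipschitz_on_continuous_on[OF g]])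
       (use \<pi>0 in \<open>auto simp: \<pi>_def intro!: continuous_intros\<close>)
  show ?thesis
    by (rule that[OF e r K cont _ low shift]) (simp add: ch h_def \<pi>_def)
qed

text \<open>A cone condition: points of the closure of \<open>\<Omega>\<close> near \<open>p\<close> enter \<open>\<Omega>\<close> when they move in direction \<open>e\<close>,
  together with balls of radius proportional to the distance travelled.  The step size \<open>t0\<close> may depend
  on \<open>Q\<close>, since a point must not leave the ball in which \<open>\<Omega>\<close> is an epigraph.\<close>

definition inward_chart :: "'a::euclidean_space set \<Rightarrow> 'a \<Rightarrow> real \<Rightarrow> bool" where
  "inward_chart \<Omega> p r \<longleftrightarrow> r > 0 \<and> (\<exists>e. \<exists>a>0. \<forall>Q. compact Q \<longrightarrow> Q \<subseteq> ball p r \<inter> closure \<Omega> \<longrightarrow>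
    (\<exists>t0>0. \<forall>t y z. 0 < t \<longrightarrow> t < t0 \<longrightarrow> y \<in> Q \<longrightarrow> norm z \<le> a * t \<longrightarrow> y + t *\<^sub>R e + z \<in> \<Omega>))"

lemma inward_shift:
  fixes \<Omega> :: "'a::euclidean_space set"
  assumes \<Omega>: "bounded_lipschitz_domain \<Omega>" and p: "p \<in> closure \<Omega>"
  shows "\<exists>r. inward_chart \<Omega> p r"
proof (cases "p \<in> \<Omega>")
  case True
  have o: "open \<Omega>" using \<Omega> by (simp add: bounded_lipschitz_domain_def)
  then obtain r where r: "r > 0" "ball p r \<subseteq> \<Omega>" using True open_contains_ball by blast
  show ?thesis
    unfolding inward_chart_def
  proof (rule exI[of _ r], intro conjI r(1), rule exI[of _ 0], rule exI[of _ 1], intro conjI allI impI)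
    fix Q assume Q: "compact Q" "Q \<subseteq> ball p r \<inter> closure \<Omega>"
    then obtain e0 where e0: "e0 > 0" "(\<Union>x\<in>Q. ball x e0) \<subseteq> \<Omega>"
      using compact_subset_open_imp_ball_epsilon_subset[of Q \<Omega>] o r by blast
    show "\<exists>t0>0. \<forall>t y z. 0 < t \<longrightarrow> t < t0 \<longrightarrow> y \<in> Q \<longrightarrow> norm z \<le> 1 * t \<longrightarrow> y + t *\<^sub>R 0 + z \<in> \<Omega>"
    proof (intro exI[of _ e0] conjI e0(1) allI impI)
      fix t :: real and y z :: 'a assume "0 < t" "t < e0" "y \<in> Q" "norm z \<le> 1 * t"
      then have "y + t *\<^sub>R 0 + z \<in> ball y e0" by (simp add: dist_norm)
      then show "y + t *\<^sub>R 0 + z \<in> \<Omega>" using e0(2) \<open>y \<in> Q\<close> by blast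
    qed
  qed simp
next
  case False
  have o: "open \<Omega>" using \<Omega> by (simp add: bounded_lipschitz_domain_def)
  then have "p \<in> frontier \<Omega>" using p False by (simp add: frontier_def interior_open)
  then obtain e r K h where e: "norm e = 1" and r: "r > 0" and K: "K \<ge> 0" and hc: "continuous_on UNIV h"
    and ch: "\<And>x. x \<in> ball p r \<Longrightarrow> x \<in> \<Omega> \<longleftrightarrow> 0 < h x"
    and low: "\<And>x t z. h (x + t *\<^sub>R e + z) \<ge> h x + t - (1 + 2 * K) * norm z"
    using lipschitz_chart[OF \<Omega>] by metis
  have cl: "0 \<le> h y" if y: "y \<in> ball p r" "y \<in> closure \<Omega>" for y
  proof (rule ccontr)
    assume "\<not> 0 \<le> h y"
    moreover have "open {x. h x < 0}" using open_Collect_less[OF hc continuous_on_const] .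
    ultimately have "open ({x. h x < 0} \<inter> ball p r)" "y \<in> {x. h x < 0} \<inter> ball p r" using that by auto
    then have "({x. h x < 0} \<inter> ball p r) \<inter> \<Omega> \<noteq> {}"
      using y(2) open_Int_closure_eq_empty[of "{x. h x < 0} \<inter> ball p r" \<Omega>] by blast
    then show False using ch by fastforce
  qed
  define a where "a = 1 / (2 * (1 + 2 * K))"
  have a: "a > 0" "(1 + 2 * K) * a = 1 / 2" using K by (auto simp: a_def field_simps)
  show ?thesis
    unfolding inward_chart_def
  proof (rule exI[of _ r], intro conjI r, rule exI[of _ e], rule exI[of _ a], intro conjI allI impI a(1))
    fix Q assume Q: "compact Q" "Q \<subseteq> ball p r \<inter> closure \<Omega>"
    then obtain e0 where e0: "e0 > 0" "(\<Union>x\<in>Q. ball x e0) \<subseteq> ball p r"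
      using compact_subset_open_imp_ball_epsilon_subset[of Q "ball p r"] by auto
    show "\<exists>t0>0. \<forall>t y z. 0 < t \<longrightarrow> t < t0 \<longrightarrow> y \<in> Q \<longrightarrow> norm z \<le> a * t \<longrightarrow> y + t *\<^sub>R e + z \<in> \<Omega>"
    proof (intro exI[of _ "e0 / (1 + a)"] conjI allI impI)
      show "0 < e0 / (1 + a)" using e0 a by simp
      fix t :: real and y z :: 'a
      assume t: "0 < t" "t < e0 / (1 + a)" and y: "y \<in> Q" and z: "norm z \<le> a * t"
      have "norm (t *\<^sub>R e + z) \<le> t + a * t" using norm_triangle_ineq[of "t *\<^sub>R e" z] e t z by simp
      also have "\<dots> < e0" using t a by (simp add: field_simps)
      finally have "y + t *\<^sub>R e + z \<in> ball y e0"
        using norm_minus_cancel[of "t *\<^sub>R e + z"] by (simp add: dist_norm algebra_simps)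
      then have b: "y + t *\<^sub>R e + z \<in> ball p r" using e0(2) y by blast
      have "(1 + 2 * K) * norm z \<le> (1 + 2 * K) * (a * t)" using z K by (intro mult_left_mono) auto
      also have "\<dots> = t / 2" using a(2) by (simp flip: mult.assoc)
      finally have "0 < h (y + t *\<^sub>R e + z)" using low[of y t z] cl[of y] Q y t by fastforce
      then show "y + t *\<^sub>R e + z \<in> \<Omega>" using ch[OF b] by simp
    qed
  qed
qed

text \<open>Moving from \<open>p\<close> against the direction \<open>e\<close> leads strictly below the graph.\<close>

lemma exterior_ball:
  fixes \<Omega> :: "'a::euclidean_space set"
  assumes \<Omega>: "bounded_lipschitz_domain \<Omega>" and p: "p \<in> frontier \<Omega>" and R: "R > 0"
  obtains x \<delta> where "\<delta> > 0" "ball x \<delta> \<subseteq> ball p R" "ball x \<delta> \<inter> \<Omega> = {}"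
proof -
  obtain e r K h where e: "norm e = 1" and r: "r > 0" and hc: "continuous_on UNIV h"
    and ch: "\<And>x. x \<in> ball p r \<Longrightarrow> x \<in> \<Omega> \<longleftrightarrow> 0 < h x"
    and sh: "\<And>x t. h (x + t *\<^sub>R e) = h x + t"
    using lipschitz_chart[OF \<Omega> p] by metis
  have "open \<Omega>" using \<Omega> by (simp add: bounded_lipschitz_domain_def)
  then have "p \<notin> \<Omega>" using p by (simp add: frontier_def interior_open)
  then have "h p \<le> 0" using ch[of p] r by auto
  define s where "s = min r R / 2"
  have s: "s > 0" "s < r" "s < R" using r R by (auto simp: s_def min_def)
  define x where "x = p + (- s) *\<^sub>R e"
  have hx: "h x < 0" using sh[of p "- s"] \<open>h p \<le> 0\<close> s by (simp add: x_def)
  have "dist p x = s" using e s by (simp add: x_def dist_norm)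
  then have "x \<in> {x. h x < 0} \<inter> (ball p r \<inter> ball p R)" using hx s by simp
  moreover have "open ({x. h x < 0} \<inter> (ball p r \<inter> ball p R))"
    using open_Collect_less[OF hc continuous_on_const] by auto
  ultimately obtain \<delta> where \<delta>: "\<delta> > 0" "ball x \<delta> \<subseteq> {x. h x < 0} \<inter> (ball p r \<inter> ball p R)"
    using open_contains_ball by blast
  have "ball x \<delta> \<inter> \<Omega> = {}" using \<delta>(2) ch by force
  then show ?thesis using that[of \<delta> x] \<delta> by blast
qed

text \<open>If \<open>f\<close> exceeded \<open>b\<close> at a point of \<open>\<Omega>\<close> close to \<open>p\<close>, then by Hoelder continuity it would exceed \<open>b / 2\<close>
  in all of \<open>\<Omega>\<close> near \<open>p\<close>.  Truncating \<open>f\<close> between \<open>0\<close> and \<open>b / 2\<close> would yield a Sobolev function that has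
  zero gradient near \<open>p\<close>, but equals \<open>b / 2\<close> inside and \<open>0\<close> outside of \<open>\<Omega>\<close>, and both sides contain balls.\<close>

lemma small_at_boundary_pos:
  fixes f :: "'a::euclidean_space \<Rightarrow> real"
  assumes \<Omega>: "bounded_lipschitz_domain \<Omega>" and fg: "sob f g" and out: "\<And>x. x \<notin> \<Omega> \<Longrightarrow> f x = 0"
    and H: "\<And>x y. x \<in> \<Omega> \<Longrightarrow> y \<in> \<Omega> \<Longrightarrow> \<bar>f x - f y\<bar> \<le> H * norm (x - y) powr \<gamma>" "H \<ge> 0" "\<gamma> > 0"
    and p: "p \<in> frontier \<Omega>" and b: "b > 0"
  shows "\<exists>r>0. \<forall>x\<in>ball p r \<inter> \<Omega>. f x \<le> b"
proof -
  \<comment> \<open>within the ball of radius \<open>r\<close> the Hoelder bound stays below \<open>b / 2\<close>\<close>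
  define r where "r = (b / (2 * (H + 1))) powr (1 / \<gamma>) / 2"
  have pos: "b / (2 * (H + 1)) > 0" using b H(2) by simp
  have r: "r > 0" using b H(2) by (simp add: r_def)
  have "(2 * r) powr \<gamma> = b / (2 * (H + 1))"
  proof -
    define k where "k = b / (2 * (H + 1))"
    have "2 * r = k powr (1 / \<gamma>)" by (simp add: r_def k_def)
    moreover have "k > 0" using pos by (simp add: k_def)
    ultimately show ?thesis using H(3) unfolding k_def[symmetric] by (simp add: powr_powr)
  qed
  then have "H * (2 * r) powr \<gamma> = (b / 2) * (H / (H + 1))" by simp
  also have "\<dots> < (b / 2) * 1" using H(2) b by (intro mult_strict_left_mono) auto
  finally have small: "H * (2 * r) powr \<gamma> < b / 2" by simp
  have "f x \<le> b" if x: "x \<in> ball p r" "x \<in> \<Omega>" for x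
  proof (rule ccontr)
    assume "\<not> f x \<le> b"
    have big: "f y > b / 2" if y: "y \<in> ball p r" "y \<in> \<Omega>" for y
    proof -
      have "norm (x - y) \<le> 2 * r" using x(1) y(1) dist_triangle[of x y p] by (simp add: dist_norm norm_minus_commute)
      then have "norm (x - y) powr \<gamma> \<le> (2 * r) powr \<gamma>" using H(3) by (intro powr_mono2) auto
      then have "H * norm (x - y) powr \<gamma> \<le> H * (2 * r) powr \<gamma>" using H(2) by (rule mult_left_mono)
      then show ?thesis using H(1)[OF x(2) y(2)] small \<open>\<not> f x \<le> b\<close> by linarith
    qed
    define u where "u x = max 0 (f x - 0) - max 0 (f x - b / 2)" for x
    define G where "G x = (if f x > 0 then g x else 0) - (if f x > b / 2 then g x else 0)" for x
    have uG: "sob u G" unfolding u_def G_def using b by (intro sob_diff sob_pos_part[OF fg]) auto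
    have "open \<Omega>" using \<Omega> by (simp add: bounded_lipschitz_domain_def)
    then have "open (\<Omega> \<inter> ball p r)" "x \<in> \<Omega> \<inter> ball p r" using x by auto
    then obtain \<delta>1 where \<delta>1: "\<delta>1 > 0" "ball x \<delta>1 \<subseteq> \<Omega> \<inter> ball p r" using open_contains_ball by blast
    obtain x2 \<delta>2 where \<delta>2: "\<delta>2 > 0" "ball x2 \<delta>2 \<subseteq> ball p r" "ball x2 \<delta>2 \<inter> \<Omega> = {}"
      by (rule exterior_ball[OF \<Omega> p r])
    have "b / 2 = 0"
    proof (rule sob_locally_constant[OF uG, of p r x "min \<delta>1 \<delta>2" _ x2])
      show "G y = 0" if "y \<in> ball p r" for y
        using big[of y] out[of y] b that by (cases "y \<in> \<Omega>") (auto simp: G_def)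
      show "u y = b / 2" if "y \<in> ball x (min \<delta>1 \<delta>2)" for y
      proof -
        have "y \<in> ball x \<delta>1" using that by simp
        then have "f y > b / 2" using \<delta>1(2) big by blast
        then show ?thesis using b by (simp add: u_def)
      qed
      show "u y = 0" if "y \<in> ball x2 (min \<delta>1 \<delta>2)" for y
      proof -
        have "y \<in> ball x2 \<delta>2" using that by simp
        then have "y \<notin> \<Omega>" using \<delta>2(3) by blast
        then show ?thesis using b out by (simp add: u_def)
      qed
      show "ball x (min \<delta>1 \<delta>2) \<subseteq> ball p r" using \<delta>1(2) by fastforce
      show "ball x2 (min \<delta>1 \<delta>2) \<subseteq> ball p r" using \<delta>2(2) by fastforce
      show "min \<delta>1 \<delta>2 > 0" using \<delta>1(1) \<delta>2(1) by simp
    qed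
    then show False using b by simp
  qed
  then show ?thesis using r by blast
qed

text \<open>Apply \<open>small_at_boundary_pos\<close> to \<open>f\<close> and to \<open>- f\<close>.\<close>

lemma compact_superlevel:
  fixes f :: "'a::euclidean_space \<Rightarrow> real"
  assumes \<Omega>: "bounded_lipschitz_domain \<Omega>" and fg: "sob f g" and out: "\<And>x. x \<notin> \<Omega> \<Longrightarrow> f x = 0"
    and H: "\<And>x y. x \<in> \<Omega> \<Longrightarrow> y \<in> \<Omega> \<Longrightarrow> \<bar>f x - f y\<bar> \<le> H * norm (x - y) powr \<gamma>" "H \<ge> 0" "\<gamma> > 0"
    and b: "b > 0"
  shows "compact (closure {x. \<bar>f x\<bar> > b})" "closure {x. \<bar>f x\<bar> > b} \<subseteq> \<Omega>"
proof -
  have o: "open \<Omega>" "bounded \<Omega>" using \<Omega> by (auto simp: bounded_lipschitz_domain_def)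
  have sub: "{x. \<bar>f x\<bar> > b} \<subseteq> \<Omega>" using out b by force
  show "compact (closure {x. \<bar>f x\<bar> > b})"
    using bounded_subset[OF o(2) sub] by (simp add: compact_closure)
  show "closure {x. \<bar>f x\<bar> > b} \<subseteq> \<Omega>"
  proof
    fix p assume pc: "p \<in> closure {x. \<bar>f x\<bar> > b}"
    show "p \<in> \<Omega>"
    proof (rule ccontr)
      assume "p \<notin> \<Omega>"
      then have p: "p \<in> frontier \<Omega>" using pc closure_mono[OF sub] o by (auto simp: frontier_def interior_open)
      obtain r1 where r1: "r1 > 0" "\<forall>x\<in>ball p r1 \<inter> \<Omega>. f x \<le> b"
        using small_at_boundary_pos[OF \<Omega> fg out H p b] by blast
      have H': "\<bar>- f x - - f y\<bar> \<le> H * norm (x - y) powr \<gamma>" if "x \<in> \<Omega>" "y \<in> \<Omega>" for x y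
        using H(1)[OF that] by simp
      obtain r2 where r2: "r2 > 0" "\<forall>x\<in>ball p r2 \<inter> \<Omega>. - f x \<le> b"
        using small_at_boundary_pos[OF \<Omega> sob_uminus[OF fg] _ H' H(2,3) p b] out by auto
      have "open (ball p (min r1 r2))" "p \<in> ball p (min r1 r2)" using r1 r2 by auto
      then have "ball p (min r1 r2) \<inter> {x. \<bar>f x\<bar> > b} \<noteq> {}"
        using pc open_Int_closure_eq_empty[of "ball p (min r1 r2)" "{x. \<bar>f x\<bar> > b}"] by blast
      then obtain x where "x \<in> ball p (min r1 r2)" "\<bar>f x\<bar> > b" by blast
      moreover from this have "x \<in> \<Omega>" using sub by blast
      ultimately show False using r1(2) r2(2) by (auto simp: abs_le_iff not_le[symmetric])
    qed
  qed
qed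

section \<open>Modular density of smooth functions\<close>

lemma cutoff_exists:
  fixes p :: "'a::euclidean_space"
  assumes r: "r > 0"
  obtains \<psi> d\<psi> where "C1c \<psi> d\<psi>" "\<And>x. x \<in> ball p (r/2) \<Longrightarrow> \<psi> x = 1"
    "\<And>x. x \<notin> cball p (3 * r / 4) \<Longrightarrow> \<psi> x = 0"
proof -
  define \<epsilon> where "\<epsilon> = r / 8"
  have \<epsilon>: "\<epsilon> > 0" using r by (simp add: \<epsilon>_def)
  define \<eta> :: "'a \<Rightarrow> real" where "\<eta> = indicator (cball p (5 * r / 8))"
  have i: "integrable lborel \<eta>"
    unfolding \<eta>_def using emeasure_bounded_finite[OF bounded_cball, of p "5 * r / 8"]
    by (intro integrable_real_indicator) auto
  define \<psi> where "\<psi> = conv (rho \<epsilon>) \<eta>"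
  have sm: "smooth \<psi>" unfolding \<psi>_def by (rule conv_smooth[OF smooth_rho[OF \<epsilon>] rho_outside[OF \<epsilon>] i])
  have zero: "\<psi> x = 0" if "x \<notin> cball p (3 * r / 4)" for x
  proof -
    have "rho \<epsilon> (x - y) *\<^sub>R \<eta> y = 0" for y
    proof (cases "norm (x - y) < \<epsilon>")
      case True
      then have "y \<notin> cball p (5 * r / 8)" using that dist_triangle[of p x y] by (auto simp: \<epsilon>_def dist_norm norm_minus_commute)
      then show ?thesis by (simp add: \<eta>_def)
    qed (simp add: rho_outside[OF \<epsilon>])
    then have "(\<lambda>y. rho \<epsilon> (x - y) *\<^sub>R \<eta> y) = (\<lambda>y. 0)" by (rule ext)
    then show ?thesis unfolding \<psi>_def conv_def by (simp only:) simp
  qed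
  have one: "\<psi> x = 1" if "x \<in> ball p (r/2)" for x
  proof -
    have "rho \<epsilon> (x - y) *\<^sub>R \<eta> y = rho \<epsilon> (x - y)" for y
    proof (cases "norm (x - y) < \<epsilon>")
      case True
      then have "y \<in> cball p (5 * r / 8)" using that dist_triangle[of p y x] by (auto simp: \<epsilon>_def dist_norm)
      then show ?thesis by (simp add: \<eta>_def)
    qed (simp add: rho_outside[OF \<epsilon>])
    then have "(\<lambda>y. rho \<epsilon> (x - y) *\<^sub>R \<eta> y) = (\<lambda>y. rho \<epsilon> (x - y))" by (rule ext)
    then have "\<psi> x = (\<integral>y. rho \<epsilon> (x - y) \<partial>lborel)" unfolding \<psi>_def conv_def by (simp only:)
    then show ?thesis
      using integral_reflect[OF C1c_measurable(1)[OF rho_C1c[OF \<epsilon>]], of x] rho_integral[OF \<epsilon>, where 'a='a] by simp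
  qed
  have "C1c \<psi> (gr \<psi>)"
  proof (rule smooth_C1c[OF sm])
    fix x :: 'a assume "norm x \<ge> norm p + r"
    then have "x \<notin> cball p (3 * r / 4)" using norm_triangle_ineq[of p "x - p"] r by (auto simp: dist_norm norm_minus_commute)
    then show "\<psi> x = 0" by (rule zero)
  qed
  then show ?thesis using that one zero by blast
qed

context modular
begin

text \<open>What remains of a competitor of zero trace: its extension by zero, paired with the gradient, of which
  the modular is finite.\<close>

definition admissible :: "(real ^ 'n \<Rightarrow> real ^ 'd) \<Rightarrow> (real ^ 'n \<Rightarrow> real ^ 'n ^ 'd) \<Rightarrow> bool" where
  "admissible w G \<longleftrightarrow> integrable lborel w \<and> integrable lborel G \<and> (\<forall>i. sob (\<lambda>x. w x $ i) (\<lambda>x. G x $ i)) \<and>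
     (\<forall>x. x \<notin> \<Omega> \<longrightarrow> w x = 0 \<and> G x = 0) \<and> Mfin G"

text \<open>A shift by \<open>t *\<^sub>R e\<close>, followed by mollification on the scale \<open>a * t\<close>, keeps the support inside of \<open>\<Omega>\<close>.
  The assumed order of the mollified gradients is the range of \<open>mollified_bound\<close>; for \<open>\<gamma> = 1\<close> these
  gradients are bounded, and so is \<open>M\<close> along them.\<close>

lemma shift_approximable:
  assumes adm: "admissible w G" and Q: "compact Q" "\<And>y. w y \<noteq> 0 \<Longrightarrow> y \<in> Q"
    and a: "a > 0" and t0: "t0 > 0"
    and inward: "\<And>t y z. 0 < t \<Longrightarrow> t < t0 \<Longrightarrow> y \<in> Q \<Longrightarrow> norm z \<le> a * t \<Longrightarrow> y + t *\<^sub>R e + z \<in> \<Omega>"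
    and D: "D \<ge> 0" "\<And>t x. 0 < t \<Longrightarrow> t < t0 \<Longrightarrow> norm (conv (rho (a * t)) G x) \<le> D * (a * t) powr (\<gamma> - 1)"
    and \<gamma>: "\<gamma> = 1 \<or> bgen \<gamma> \<and> \<gamma> \<le> 1"
  shows "approximable w G"
proof -
  have w: "integrable lborel w" and G: "integrable lborel G" and s: "\<And>i. sob (\<lambda>x. w x $ i) (\<lambda>x. G x $ i)"
    and out: "\<And>x. x \<notin> \<Omega> \<Longrightarrow> w x = 0" "\<And>x. x \<notin> \<Omega> \<Longrightarrow> G x = 0" and GM: "Mfin G"
    using adm by (auto simp: admissible_def)
  \<comment> \<open>in units of the scale \<open>a * t\<close>: the length of the shift plus the radius of the kernel\<close>
  define \<kappa> where "\<kappa> = norm e / a + 1"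
  have \<kappa>: "\<kappa> > 0" using a by (simp add: \<kappa>_def add_nonneg_pos)
  have "\<exists>A>0. \<exists>q\<ge>0. \<exists>g. integrable lborel g \<and> (\<forall>t x. 0 < t \<longrightarrow> t < t0 \<longrightarrow> \<kappa> * (a * t) \<le> 1 \<longrightarrow> x \<in> \<Omega> \<longrightarrow>
      M x (conv (rho (a * t)) G (x - t *\<^sub>R e) /\<^sub>R A) \<le> q * (1 + conv (rho (a * t)) g (x - t *\<^sub>R e)))"
    using \<gamma>
  proof
    assume "\<gamma> = 1"
    obtain B where B: "B \<ge> 0" "\<And>x \<xi>. x \<in> \<Omega> \<Longrightarrow> norm \<xi> \<le> D \<Longrightarrow> M x \<xi> \<le> B" using M_upper[of D] by blast
    show ?thesis
    proof (rule exI[of _ 1], intro conjI, simp, rule exI[of _ B], intro conjI B(1), rule exI[of _ "\<lambda>x. 0"], intro conjI allI impI)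
      fix t x assume t: "0 < t" "t < t0" and x: "x \<in> \<Omega>"
      have "norm (conv (rho (a * t)) G (x - t *\<^sub>R e)) \<le> D" using D(2)[OF t, of "x - t *\<^sub>R e"] \<open>\<gamma> = 1\<close> a t by simp
      from B(2)[OF x this] show "M x (conv (rho (a * t)) G (x - t *\<^sub>R e) /\<^sub>R 1) \<le> B * (1 + conv (rho (a * t)) (\<lambda>x. 0) (x - t *\<^sub>R e))"
        by (simp add: conv_def)
    qed simp
  next
    assume "bgen \<gamma> \<and> \<gamma> \<le> 1"
    then obtain A q g where A: "A > 0" "q \<ge> 0" "integrable lborel g"
      "\<And>\<epsilon> x x'. \<epsilon> > 0 \<Longrightarrow> \<kappa> * \<epsilon> \<le> 1 \<Longrightarrow> x \<in> \<Omega> \<Longrightarrow> norm (x - x') + \<epsilon> \<le> \<kappa> * \<epsilon> \<Longrightarrow>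
        norm (conv (rho \<epsilon>) G x') \<le> D * \<epsilon> powr (\<gamma> - 1) \<Longrightarrow>
        M x (conv (rho \<epsilon>) G x' /\<^sub>R A) \<le> q * (1 + conv (rho \<epsilon>) g x')"
      using mollified_bound[OF _ _ G out(2) GM D(1) \<kappa>, of \<gamma>] by blast
    show ?thesis
    proof (rule exI[of _ A], intro conjI A(1), rule exI[of _ q], intro conjI A(2), rule exI[of _ g], intro conjI A(3) allI impI)
      fix t x assume t: "0 < t" "t < t0" and k: "\<kappa> * (a * t) \<le> 1" and x: "x \<in> \<Omega>"
      have "norm (x - (x - t *\<^sub>R e)) + a * t \<le> \<kappa> * (a * t)" using a t by (simp add: \<kappa>_def field_simps)
      then show "M x (conv (rho (a * t)) G (x - t *\<^sub>R e) /\<^sub>R A) \<le> q * (1 + conv (rho (a * t)) g (x - t *\<^sub>R e))"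
        using a t x k D(2)[OF t] by (intro A(4)) auto
    qed
  qed
  then obtain A q g where A: "A > 0" "q \<ge> 0" "integrable lborel g"
    and bd: "\<And>t x. 0 < t \<Longrightarrow> t < t0 \<Longrightarrow> \<kappa> * (a * t) \<le> 1 \<Longrightarrow> x \<in> \<Omega> \<Longrightarrow>
      M x (conv (rho (a * t)) G (x - t *\<^sub>R e) /\<^sub>R A) \<le> q * (1 + conv (rho (a * t)) g (x - t *\<^sub>R e))"
    by blast
  show ?thesis
  proof (rule moll_approximable[OF w G GM A(3,1,2)])
    fix \<delta> :: real assume "\<delta> > 0"
    define m where "m = min (t0 / 2) (min (1 / (\<kappa> * a)) (\<delta> / (2 * (a + norm e))))"
    have an: "a + norm e > 0" using a by (simp add: add_pos_nonneg)
    have m: "m > 0" using t0 \<kappa> a an \<open>\<delta> > 0\<close> by (simp add: m_def)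
    have m1: "m < t0" using t0 by (simp add: m_def min_less_iff_disj)
    have "m \<le> 1 / (\<kappa> * a)" by (simp add: m_def)
    then have m2: "\<kappa> * (a * m) \<le> 1" using \<kappa> a by (simp add: field_simps)
    have "m \<le> \<delta> / (2 * (a + norm e))" by (simp add: m_def)
    then have "m * (a + norm e) \<le> \<delta> / 2" using an by (simp add: field_simps)
    then have m3: "a * m + norm (m *\<^sub>R e) < \<delta>" using m \<open>\<delta> > 0\<close> by (simp add: algebra_simps)
    have \<epsilon>: "a * m > 0" using a m by simp
    define \<phi> where "\<phi> x = conv (rho (a * m)) w (x - m *\<^sub>R e)" for x
    have sm: "smooth \<phi>" unfolding \<phi>_def by (rule mollification(1)[OF w G s \<epsilon>])
    have mg: "mgrad \<phi> x = conv (rho (a * m)) G (x - m *\<^sub>R e)" for x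
      unfolding \<phi>_def by (rule mollification(2)[OF w G s \<epsilon>])
    define L where "L = (\<lambda>(y, z). y + m *\<^sub>R e + z) ` (Q \<times> cball 0 (a * m))"
    have "compact L" unfolding L_def
      by (intro compact_continuous_image compact_Times Q compact_cball) (auto simp: split_beta intro!: continuous_intros)
    moreover have "L \<subseteq> \<Omega>" using inward[OF m m1] by (auto simp: L_def)
    moreover have "\<phi> x = 0" if "x \<notin> L" for x
    proof -
      have "rho (a * m) (x - m *\<^sub>R e - y) *\<^sub>R w y = 0" for y
      proof (cases "w y = 0 \<or> a * m \<le> norm (x - m *\<^sub>R e - y)")
        case True
        then show ?thesis using rho_outside[OF \<epsilon>] by auto
      next
        case False
        then have "(y, x - m *\<^sub>R e - y) \<in> Q \<times> cball 0 (a * m)" using Q(2) by auto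
        then have "x \<in> L" unfolding L_def by (rule image_eqI[rotated]) simp
        then show ?thesis using that by simp
      qed
      then have "(\<lambda>y. rho (a * m) (x - m *\<^sub>R e - y) *\<^sub>R w y) = (\<lambda>y. 0)" by (rule ext)
      then show ?thesis unfolding \<phi>_def conv_def by (simp only:) simp
    qed
    ultimately have "\<phi> \<in> Cc_infty \<Omega>" using sm by (intro Cc_inftyI[of _ L]) auto
    then show "\<exists>\<phi>\<in>Cc_infty \<Omega>. \<exists>\<epsilon> a. 0 < \<epsilon> \<and> \<epsilon> + norm a < \<delta> \<and>
      (\<forall>x. \<phi> x = conv (rho \<epsilon>) w (x - a)) \<and> (\<forall>x. mgrad \<phi> x = conv (rho \<epsilon>) G (x - a)) \<and>
      (\<forall>x\<in>\<Omega>. M x (mgrad \<phi> x /\<^sub>R A) \<le> q * (1 + conv (rho \<epsilon>) g (x - a)))"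
      using \<epsilon> m3 mg bd[OF m m1 m2]
      by (intro bexI[of _ \<phi>] exI[of _ "a * m"] exI[of _ "m *\<^sub>R e"]) (auto simp: \<phi>_def)
  qed
qed

text \<open>A support that is compact in \<open>\<Omega>\<close> needs no shift.  On a ball of radius \<open>t\<close> the function oscillates by a
  multiple of \<open>t powr \<gamma>\<close>, so by \<open>mollification_grad_bound\<close> the mollified gradient is of order \<open>t powr (\<gamma> - 1)\<close>.\<close>

lemma hoelder_compact_approximable:
  assumes adm: "admissible w G" and Q: "compact Q" "Q \<subseteq> \<Omega>" "\<And>y. w y \<noteq> 0 \<Longrightarrow> y \<in> Q"
    and H: "\<And>x y. x \<in> \<Omega> \<Longrightarrow> y \<in> \<Omega> \<Longrightarrow> norm (w x - w y) \<le> H * norm (x - y) powr \<gamma>" "H \<ge> 0" "\<gamma> > 0"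
    and \<gamma>: "\<gamma> = 1 \<or> bgen \<gamma> \<and> \<gamma> \<le> 1"
  shows "approximable w G"
proof -
  have w: "integrable lborel w" and G: "integrable lborel G" and s: "\<And>i. sob (\<lambda>x. w x $ i) (\<lambda>x. G x $ i)"
    using adm by (auto simp: admissible_def)
  obtain e0 where e0: "e0 > 0" "(\<Union>x\<in>Q. ball x e0) \<subseteq> \<Omega>"
    using compact_subset_open_imp_ball_epsilon_subset[OF Q(1) open_\<Omega> Q(2)] by blast
  obtain D where D: "D \<ge> 0"
    "\<And>(w :: real ^ 'n \<Rightarrow> real ^ 'd) G \<epsilon> x c \<delta>. integrable lborel w \<Longrightarrow> integrable lborel G \<Longrightarrow>
      (\<And>i. sob (\<lambda>x. w x $ i) (\<lambda>x. G x $ i)) \<Longrightarrow> \<epsilon> > 0 \<Longrightarrow>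
      (\<And>y. norm (x - y) < \<epsilon> \<Longrightarrow> norm (w y - c) \<le> \<delta>) \<Longrightarrow> norm (conv (rho \<epsilon>) G x) \<le> D * \<delta> / \<epsilon>"
    by (rule mollification_grad_bound) blast
  show ?thesis
  proof (rule shift_approximable[OF adm Q(1,3), of 1 e0 0 "D * H" \<gamma>])
    show "y + t *\<^sub>R 0 + z \<in> \<Omega>" if "0 < t" "t < e0" "y \<in> Q" "norm z \<le> 1 * t" for t y z
    proof -
      have "y + z \<in> ball y e0" using that by (simp add: dist_norm)
      then have "y + z \<in> (\<Union>x\<in>Q. ball x e0)" using that(3) by blast
      with e0(2) have "y + z \<in> \<Omega>" by (rule subsetD)
      then show ?thesis by simp
    qed
    fix t x assume t: "0 < t" "t < e0"
    have "norm (w y - w x) \<le> H * t powr \<gamma>" if "norm (x - y) < t" for y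
    proof (cases "w x = 0 \<and> w y = 0")
      case True
      then show ?thesis using H(2) by simp
    next
      case False
      then have "x \<in> Q \<or> y \<in> Q" using Q(3) by blast
      have near: "v' \<in> \<Omega>" if "u' \<in> Q" "norm (u' - v') < e0" for u' v'
      proof -
        have "v' \<in> ball u' e0" using that(2) by (simp add: dist_norm)
        then have "v' \<in> (\<Union>x\<in>Q. ball x e0)" using that(1) by blast
        with e0(2) show ?thesis by (rule subsetD)
      qed
      have "norm (x - y) < e0" "norm (y - x) < e0" using that t by (auto simp: norm_minus_commute)
      then have "x \<in> \<Omega>" "y \<in> \<Omega>" using \<open>x \<in> Q \<or> y \<in> Q\<close> near[of x y] near[of y x] Q(2) by blast+
      then have "norm (w y - w x) \<le> H * norm (y - x) powr \<gamma>" by (intro H)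
      also have "\<dots> \<le> H * t powr \<gamma>"
        using H(2,3) that by (intro mult_left_mono powr_mono2) (auto simp: norm_minus_commute)
      finally show ?thesis .
    qed
    then have "norm (conv (rho (1 * t)) G x) \<le> D * (H * t powr \<gamma>) / t"
      using D(2)[OF w G s, of t x "w x"] t by simp
    also have "\<dots> = D * H * (1 * t) powr (\<gamma> - 1)" using t by (simp add: powr_diff)
    finally show "norm (conv (rho (1 * t)) G x) \<le> D * H * (1 * t) powr (\<gamma> - 1)" .
  qed (use e0 D(1) H(2) \<gamma> in auto)
qed

text \<open>Near a boundary point the support can be shifted into \<open>\<Omega>\<close>.  The oscillation of a bounded function
  is of order one, which is the case \<open>\<gamma> = 0\<close> of the gradient estimate.\<close>

lemma local_approximable:
  assumes adm: "admissible w G" and W: "\<And>x. norm (w x) \<le> W" and bg: "bgen 0"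
    and Q: "compact Q" "\<And>y. w y \<noteq> 0 \<Longrightarrow> y \<in> Q" and a: "a > 0" and t0: "t0 > 0"
    and inward: "\<And>t y z. 0 < t \<Longrightarrow> t < t0 \<Longrightarrow> y \<in> Q \<Longrightarrow> norm z \<le> a * t \<Longrightarrow> y + t *\<^sub>R e + z \<in> \<Omega>"
  shows "approximable w G"
proof -
  have w: "integrable lborel w" and G: "integrable lborel G" and s: "\<And>i. sob (\<lambda>x. w x $ i) (\<lambda>x. G x $ i)"
    using adm by (auto simp: admissible_def)
  obtain D where D: "D \<ge> 0"
    "\<And>(w :: real ^ 'n \<Rightarrow> real ^ 'd) G \<epsilon> x c \<delta>. integrable lborel w \<Longrightarrow> integrable lborel G \<Longrightarrow>
      (\<And>i. sob (\<lambda>x. w x $ i) (\<lambda>x. G x $ i)) \<Longrightarrow> \<epsilon> > 0 \<Longrightarrow>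
      (\<And>y. norm (x - y) < \<epsilon> \<Longrightarrow> norm (w y - c) \<le> \<delta>) \<Longrightarrow> norm (conv (rho \<epsilon>) G x) \<le> D * \<delta> / \<epsilon>"
    by (rule mollification_grad_bound) blast
  have "W \<ge> 0" using W[of undefined] norm_ge_zero order_trans by blast
  show ?thesis
  proof (rule shift_approximable[OF adm Q a t0 inward, of "D * W" 0])
    fix t x assume t: "0 < t" "t < t0"
    then have "a * t > 0" using a by simp
    then have "norm (conv (rho (a * t)) G x) \<le> D * W / (a * t)"
      using D(2)[OF w G s, of "a * t" x 0 W] W by simp
    also have "\<dots> = D * W * (a * t) powr (0 - 1)"
      using \<open>a * t > 0\<close> by (simp add: powr_minus divide_inverse)
    finally show "norm (conv (rho (a * t)) G x) \<le> D * W * (a * t) powr (0 - 1)" .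
  qed (use D(1) \<open>W \<ge> 0\<close> bg in auto)
qed

text \<open>The product rule adds the term \<open>(w x $ i) *\<^sub>R d\<psi> x\<close> to the gradient; it is bounded because \<open>w\<close> is, and
  bounded fields have finite modular.\<close>

lemma admissible_cutoff:
  assumes adm: "admissible w G" and W: "\<And>x. norm (w x) \<le> W" and \<psi>: "C1c \<psi> d\<psi>"
  shows "admissible (\<lambda>x. \<psi> x *\<^sub>R w x) (\<lambda>x. \<psi> x *\<^sub>R G x + (\<chi> i. (w x $ i) *\<^sub>R d\<psi> x))"
    and "\<exists>W'. \<forall>x. norm (\<psi> x *\<^sub>R w x) \<le> W'"
proof -
  have w: "integrable lborel w" and G: "integrable lborel G" and s: "\<And>i. sob (\<lambda>x. w x $ i) (\<lambda>x. G x $ i)"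
    and out: "\<And>x. x \<notin> \<Omega> \<Longrightarrow> w x = 0" "\<And>x. x \<notin> \<Omega> \<Longrightarrow> G x = 0" and GM: "Mfin G"
    using adm by (auto simp: admissible_def)
  note m[measurable] = C1c_measurable[OF \<psi>]
  have [measurable]: "w \<in> borel_measurable borel" "G \<in> borel_measurable borel" using w G by auto
  obtain B where B: "B > 0" "\<And>x. \<bar>\<psi> x\<bar> \<le> B" "\<And>x. norm (d\<psi> x) \<le> B" using C1c_bounded[OF \<psi>] by blast
  define T where "T x = (\<chi> i. (w x $ i) *\<^sub>R d\<psi> x)" for x
  have Tm[measurable]: "T \<in> borel_measurable borel"
  proof -
    have "continuous_on UNIV (\<lambda>(a :: real ^ 'd, b :: real ^ 'n). (\<chi> i. (a $ i) *\<^sub>R b) :: real ^ 'n ^ 'd)"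
      by (auto simp: split_beta intro!: continuous_intros)
    from borel_measurable_continuous_onI[OF this]
    have "(\<lambda>x. (\<lambda>(a, b). (\<chi> i. (a $ i) *\<^sub>R b)) (w x, d\<psi> x)) \<in> borel_measurable borel"
      by (rule measurable_compose[rotated]) (intro borel_measurable_Pair; measurable)
    then show ?thesis by (simp add: T_def[abs_def])
  qed
  have "W \<ge> 0" using W[of undefined] norm_ge_zero order_trans by blast
  have Tb: "norm (T x) \<le> real CARD('d) * (norm (w x) * B)" for x
  proof -
    have "norm (T x) \<le> (\<Sum>i\<in>UNIV. norm (T x $ i))" unfolding norm_vec_def[of "T x"] by (rule L2_set_le_sum) simp
    also have "\<dots> \<le> (\<Sum>i\<in>(UNIV :: 'd set). norm (w x) * B)"
      unfolding T_def using component_le_norm_cart[of "w x"] B by (intro sum_mono) (auto intro!: mult_mono)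
    finally show ?thesis by simp
  qed
  have Ti: "integrable lborel T"
    by (rule Bochner_Integration.integrable_bound[of _ "\<lambda>x. real CARD('d) * (norm (w x) * B)"])
      (use w Tb B in auto)
  have "norm (T x) \<le> real CARD('d) * (W * B)" for x
    using Tb[of x] W[of x] B by (meson mult_left_mono mult_right_mono of_nat_0_le_iff order_trans less_imp_le)
  then have TM: "Mfin T" by (rule Mfin_bounded[OF Tm])
  have \<psi>G: "Mfin (\<lambda>x. \<psi> x *\<^sub>R G x)"
  proof (rule Mfin_mono[OF Mfin_scale[OF GM, of B], of _ 0])
    show "AE x in lborel. Mb x (\<psi> x *\<^sub>R G x) \<le> Mb x (B *\<^sub>R G x) + 0"
    proof (rule AE_I2)
      fix x
      have "Mb x (\<psi> x *\<^sub>R G x) = Mb x (\<bar>\<psi> x\<bar> *\<^sub>R G x)"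
        using Mb_even[of x "\<psi> x *\<^sub>R G x"] by (cases "\<psi> x \<ge> 0") auto
      also have "\<dots> \<le> Mb x (B *\<^sub>R G x)"
        using Mb_ray'[of "\<bar>\<psi> x\<bar> / B" x "B *\<^sub>R G x"] B by simp
      finally show "Mb x (\<psi> x *\<^sub>R G x) \<le> Mb x (B *\<^sub>R G x) + 0" by simp
    qed
  qed measurable
  have "sob (\<lambda>x. (\<psi> x *\<^sub>R w x) $ i) (\<lambda>x. (\<psi> x *\<^sub>R G x + T x) $ i)" for i
    using sob_mult[OF s \<psi>, of i] by (simp add: T_def)
  moreover have "integrable lborel (\<lambda>x. \<psi> x *\<^sub>R w x)" "integrable lborel (\<lambda>x. \<psi> x *\<^sub>R G x)"
    using integrable_scaleR_bounded[OF w _ B(2)] integrable_scaleR_bounded[OF G _ B(2)] by auto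
  moreover have "T x = 0" if "x \<notin> \<Omega>" for x using out(1)[OF that] by (simp add: T_def vec_eq_iff)
  ultimately have "admissible (\<lambda>x. \<psi> x *\<^sub>R w x) (\<lambda>x. \<psi> x *\<^sub>R G x + T x)"
    using Ti Mfin_add[OF \<psi>G TM] out by (auto simp: admissible_def)
  then show "admissible (\<lambda>x. \<psi> x *\<^sub>R w x) (\<lambda>x. \<psi> x *\<^sub>R G x + (\<chi> i. (w x $ i) *\<^sub>R d\<psi> x))"
    by (simp add: T_def)
  show "\<exists>W'. \<forall>x. norm (\<psi> x *\<^sub>R w x) \<le> W'"
    using mult_mono[OF B(2) W less_imp_le[OF B(1)] norm_ge_zero] by (intro exI[of _ "B * W"]) auto
qed

lemma admissible_diff:
  assumes "admissible w G" "admissible v H"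
  shows "admissible (\<lambda>x. w x - v x) (\<lambda>x. G x - H x)"
proof -
  have "Mfin (\<lambda>x. G x + (- 1) *\<^sub>R H x)" using assms by (intro Mfin_add Mfin_scale) (auto simp: admissible_def)
  then show ?thesis using assms by (auto simp: admissible_def intro: sob_diff)
qed

text \<open>The balls are removed one after the other, in place of a partition of unity: \<open>\<psi> x *\<^sub>R w x\<close> lives in one
  chart, and the remainder vanishes on the ball of half radius, where \<open>\<psi> = 1\<close>.\<close>

lemma covered_approximable:
  assumes \<Omega>: "bounded_lipschitz_domain \<Omega>" and bg: "bgen 0" and I: "finite I"
    and chart: "\<And>p. p \<in> I \<Longrightarrow> inward_chart \<Omega> p (r p)"
    and adm: "admissible w G" and W: "\<And>x. norm (w x) \<le> W"
    and cover: "\<And>x. w x \<noteq> 0 \<Longrightarrow> \<exists>p\<in>I. x \<in> ball p (r p / 2)"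
  shows "approximable w G"
  using I chart adm W cover
proof (induction I arbitrary: w G W rule: finite_induct)
  case empty
  have w0: "w x = 0" for x using empty.prems(4)[of x] by auto
  have s: "sob (\<lambda>x. w x $ i) (\<lambda>x. G x $ i)" and m: "w \<in> borel_measurable borel" "G \<in> borel_measurable borel" for i
    using empty.prems(2) by (auto simp: admissible_def)
  have "AE x in lborel. \<forall>i. G x $ i = 0"
    using sob_zero_set[OF s] by (simp add: AE_all_countable w0)
  then have G0: "AE x in lborel. G x = 0" by eventually_elim (simp add: vec_eq_iff)
  show ?case
    unfolding approximable_def
  proof (intro conjI m allI impI)
    fix e :: real assume "e > 0"
    have z: "(\<lambda>x. 0) \<in> Cc_infty \<Omega>"
      by (rule Cc_inftyI[of _ "{}"]) (use smooth_zero in auto)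
    have "mgrad (\<lambda>x. 0 :: real ^ 'd) x = 0" for x :: "real ^ 'n"
      by (simp add: mgrad_def vec_eq_iff frechet_derivative_const)
    then have "E (\<lambda>x. 0 - w x) (\<lambda>x. mgrad (\<lambda>x. 0) x - G x) = (\<integral>\<^sup>+x. 0 \<partial>(lborel :: (real ^ 'n) measure))"
      unfolding E_def using G0 by (intro nn_integral_cong_AE) (auto simp: w0 Mb_zero)
    then show "\<exists>\<phi>\<in>Cc_infty \<Omega>. E (\<lambda>x. \<phi> x - w x) (\<lambda>x. mgrad \<phi> x - G x) < ennreal e"
      using z \<open>e > 0\<close> by (intro bexI[of _ "\<lambda>x. 0"]) auto
  qed
next
  case (insert p I)
  have rp: "r p > 0" and ex: "\<exists>e a. a > 0 \<and> (\<forall>Q. compact Q \<longrightarrow> Q \<subseteq> ball p (r p) \<inter> closure \<Omega> \<longrightarrow>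
      (\<exists>t0>0. \<forall>t y z. 0 < t \<longrightarrow> t < t0 \<longrightarrow> y \<in> Q \<longrightarrow> norm z \<le> a * t \<longrightarrow> y + t *\<^sub>R e + z \<in> \<Omega>))"
    using insert.prems(1)[OF insertI1] unfolding inward_chart_def by simp_all
  from ex obtain e a where ea: "a > 0 \<and> (\<forall>Q. compact Q \<longrightarrow> Q \<subseteq> ball p (r p) \<inter> closure \<Omega> \<longrightarrow>
      (\<exists>t0>0. \<forall>t y z. 0 < t \<longrightarrow> t < t0 \<longrightarrow> y \<in> Q \<longrightarrow> norm z \<le> a * t \<longrightarrow> y + t *\<^sub>R e + z \<in> \<Omega>))"
    by (elim exE)
  then have a: "a > 0" and inw: "\<forall>Q. compact Q \<longrightarrow> Q \<subseteq> ball p (r p) \<inter> closure \<Omega> \<longrightarrow>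
      (\<exists>t0>0. \<forall>t y z. 0 < t \<longrightarrow> t < t0 \<longrightarrow> y \<in> Q \<longrightarrow> norm z \<le> a * t \<longrightarrow> y + t *\<^sub>R e + z \<in> \<Omega>)"
    by (rule conjunct1, rule conjunct2)
  obtain \<psi> d\<psi> where \<psi>: "C1c \<psi> d\<psi>" "\<And>x. x \<in> ball p (r p / 2) \<Longrightarrow> \<psi> x = 1"
    "\<And>x. x \<notin> cball p (3 * r p / 4) \<Longrightarrow> \<psi> x = 0"
    by (rule cutoff_exists[OF rp, of p]) blast
  define v where "v x = \<psi> x *\<^sub>R w x" for x
  define H where "H x = \<psi> x *\<^sub>R G x + (\<chi> i. (w x $ i) *\<^sub>R d\<psi> x)" for x
  have vH: "admissible v H" unfolding v_def H_def by (rule admissible_cutoff(1)[OF insert.prems(2,3) \<psi>(1)])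
  obtain W' where W': "\<And>x. norm (v x) \<le> W'"
    using admissible_cutoff(2)[OF insert.prems(2,3) \<psi>(1)] unfolding v_def by blast
  have out: "w x = 0" if "x \<notin> \<Omega>" for x using insert.prems(2) that by (auto simp: admissible_def)
  define Q where "Q = cball p (3 * r p / 4) \<inter> closure \<Omega>"
  have Q: "compact Q" "Q \<subseteq> ball p (r p) \<inter> closure \<Omega>" using rp by (auto simp: Q_def compact_Int_closed)
  obtain t0 where t0: "t0 > 0" "\<And>t y z. 0 < t \<Longrightarrow> t < t0 \<Longrightarrow> y \<in> Q \<Longrightarrow> norm z \<le> a * t \<Longrightarrow> y + t *\<^sub>R e + z \<in> \<Omega>"
    using inw[rule_format, OF Q] by blast
  have "approximable v H"
  proof (rule local_approximable[OF vH W' bg Q(1) _ a t0])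
    fix y assume "v y \<noteq> 0"
    then have "y \<in> \<Omega>" "y \<in> cball p (3 * r p / 4)" using out \<psi>(3) by (auto simp: v_def)
    then show "y \<in> Q" using closure_subset by (auto simp: Q_def)
  qed
  moreover have "approximable (\<lambda>x. w x - v x) (\<lambda>x. G x - H x)"
  proof (rule insert.IH)
    show "inward_chart \<Omega> q (r q)" if "q \<in> I" for q
      using insert.prems(1)[of q] that by simp
    show "admissible (\<lambda>x. w x - v x) (\<lambda>x. G x - H x)" by (rule admissible_diff[OF insert.prems(2) vH])
    show "norm (w x - v x) \<le> W + W'" for x
      using norm_triangle_ineq4[of "w x" "v x"] insert.prems(3)[of x] W'[of x] by linarith
    fix x assume x: "w x - v x \<noteq> 0"
    then have "w x \<noteq> 0" by (auto simp: v_def)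
    moreover have "x \<notin> ball p (r p / 2)" using x \<psi>(2)[of x] by (auto simp: v_def)
    ultimately show "\<exists>p\<in>I. x \<in> ball p (r p / 2)" using insert.prems(4)[of x] by blast
  qed
  ultimately have "approximable (\<lambda>x. v x + (w x - v x)) (\<lambda>x. H x + (G x - H x))" by (rule approximable_add)
  then show ?case by simp
qed

lemma bounded_approximable:
  assumes \<Omega>: "bounded_lipschitz_domain \<Omega>" and bg: "bgen 0"
    and adm: "admissible w G" and W: "\<And>x. norm (w x) \<le> W"
  shows "approximable w G"
proof -
  obtain r where r: "\<And>p. p \<in> closure \<Omega> \<Longrightarrow> inward_chart \<Omega> p (r p)"
    using inward_shift[OF \<Omega>] by metis
  have "compact (closure \<Omega>)" using bounded_\<Omega> by (simp add: compact_closure)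
  moreover have "closure \<Omega> \<subseteq> (\<Union>p\<in>closure \<Omega>. ball p (r p / 2))"
  proof
    fix p assume "p \<in> closure \<Omega>"
    moreover from this have "p \<in> ball p (r p / 2)" using r[of p] by (simp add: inward_chart_def)
    ultimately show "p \<in> (\<Union>p\<in>closure \<Omega>. ball p (r p / 2))" by blast
  qed
  ultimately obtain I where I: "I \<subseteq> closure \<Omega>" "finite I" "closure \<Omega> \<subseteq> (\<Union>p\<in>I. ball p (r p / 2))"
    using compactE_image[of "closure \<Omega>" "closure \<Omega>" "\<lambda>p. ball p (r p / 2)"] by (metis open_ball)
  show ?thesis
  proof (rule covered_approximable[OF \<Omega> bg I(2) _ adm W])
    show "inward_chart \<Omega> p (r p)" if "p \<in> I" for p
      using r[of p] I(1) that by blast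
    fix x assume "w x \<noteq> 0"
    then have "x \<in> \<Omega>" using adm by (auto simp: admissible_def)
    then show "\<exists>p\<in>I. x \<in> ball p (r p / 2)" using I(3) closure_subset by blast
  qed
qed

end

section \<open>Approximation of Sobolev functions of zero trace\<close>

lemma measurable_vec_components:
  fixes f :: "'a \<Rightarrow> ('b::euclidean_space) ^ 'k"
  assumes "\<And>i. (\<lambda>x. f x $ i) \<in> borel_measurable M"
  shows "f \<in> borel_measurable M"
proof -
  have "(\<lambda>x. \<Sum>i\<in>UNIV. axis i (f x $ i)) \<in> borel_measurable M"
  proof (rule borel_measurable_sum)
    fix i
    have "continuous_on UNIV (axis i :: 'b \<Rightarrow> 'b ^ 'k)"
      unfolding axis_def
    proof (rule continuous_on_vec_lambda)
      fix j show "continuous_on UNIV (\<lambda>x :: 'b. if j = i then x else 0)" by (cases "j = i") auto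
    qed
    from borel_measurable_continuous_onI[OF this] assms[of i]
    show "(\<lambda>x. axis i (f x $ i)) \<in> borel_measurable M" by (rule measurable_compose[rotated])
  qed
  moreover have "(\<Sum>i\<in>UNIV. axis i (f x $ i)) = f x" for x
    by (simp add: vec_eq_iff axis_def if_distrib cong: if_cong)
  ultimately show ?thesis by simp
qed

lemma norm_vec_mono:
  fixes x y :: "('b::real_normed_vector) ^ 'k"
  assumes "\<And>i. norm (x $ i) \<le> norm (y $ i)"
  shows "norm x \<le> norm y"
  unfolding norm_vec_def using assms by (intro L2_set_mono) auto



text \<open>The decomposition of \<open>M\<close> into functions of the rows enters in this form: deleting rows of a matrix
  does not increase \<open>M\<close>.\<close>

locale row_modular = modular \<Omega> M for \<Omega> :: "(real ^ 'n) set" and M :: "real ^ 'n \<Rightarrow> real ^ 'n ^ 'd \<Rightarrow> real" +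
  assumes M_rows: "x \<in> \<Omega> \<Longrightarrow> (\<And>i. \<eta> $ i = \<xi> $ i \<or> \<eta> $ i = 0) \<Longrightarrow> M x \<eta> \<le> M x \<xi>"
begin

lemma Mb_rows: "(\<And>i. \<eta> $ i = \<xi> $ i \<or> \<eta> $ i = 0) \<Longrightarrow> Mb x \<eta> \<le> Mb x \<xi>"
  using M_rows[of x \<eta> \<xi>] by (cases "x \<in> \<Omega>") (auto simp: Mb_in Mb_out)

lemma admissible_rows:
  assumes adm: "admissible w G" and s: "\<And>i. sob (\<lambda>x. v x $ i) (\<lambda>x. H x $ i)"
    and v: "\<And>x i. \<bar>v x $ i\<bar> \<le> \<bar>w x $ i\<bar>" and H: "\<And>x i. H x $ i = G x $ i \<or> H x $ i = 0"
  shows "admissible v H"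
proof -
  have w: "integrable lborel w" and G: "integrable lborel G"
    and out: "\<And>x. x \<notin> \<Omega> \<Longrightarrow> w x = 0" "\<And>x. x \<notin> \<Omega> \<Longrightarrow> G x = 0" and GM: "Mfin G"
    using adm by (auto simp: admissible_def)
  have m: "v \<in> borel_measurable borel" "H \<in> borel_measurable borel"
    by (rule measurable_vec_components[OF sobD(3)[OF s]] measurable_vec_components[OF sobD(4)[OF s]])+
  have nv: "norm (v x) \<le> norm (w x)" for x using v by (intro norm_vec_mono) simp
  have "norm (H x $ i) \<le> norm (G x $ i)" for x i using H[of x i] by auto
  then have nH: "norm (H x) \<le> norm (G x)" for x by (rule norm_vec_mono)
  have "Mfin H"
    by (rule Mfin_mono[OF GM m(2), of 0]) (use Mb_rows[OF H] in auto)
  moreover have "integrable lborel v" "integrable lborel H"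
    using Bochner_Integration.integrable_bound[OF w, of v] Bochner_Integration.integrable_bound[OF G, of H] m nv nH by auto
  moreover have "v x = 0 \<and> H x = 0" if "x \<notin> \<Omega>" for x
    using nv[of x] nH[of x] out[OF that] by simp
  ultimately show ?thesis using s by (auto simp: admissible_def)
qed

text \<open>Each row of \<open>G x - H n x\<close> is either zero or a row of \<open>G x\<close>, so \<open>Mb x (G x)\<close> is a majorant for the
  modulars.\<close>

lemma approximable_rows:
  assumes adm: "admissible w G" and appr: "\<And>n. approximable (v n) (H n)"
    and v: "\<And>n x i. \<bar>v n x $ i - w x $ i\<bar> \<le> \<bar>w x $ i\<bar>" and H: "\<And>n x i. H n x $ i = G x $ i \<or> H n x $ i = 0"
    and lim: "AE x in lborel. \<forall>i. (\<lambda>n. v n x $ i) \<longlonglongrightarrow> w x $ i \<and> (\<lambda>n. H n x $ i) \<longlonglongrightarrow> G x $ i"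
  shows "approximable w G"
proof (rule approximable_limit)
  have w: "integrable lborel w" and G: "integrable lborel G" and GM: "Mfin G"
    using adm by (auto simp: admissible_def)
  show m[measurable]: "w \<in> borel_measurable borel" "G \<in> borel_measurable borel" using w G by auto
  have [measurable]: "v n \<in> borel_measurable borel" "H n \<in> borel_measurable borel" for n
    using appr[of n] by (auto simp: approximable_def)
  fix e :: real assume "e > 0"
  have "(\<lambda>n. E (\<lambda>x. v n x - w x) (\<lambda>x. H n x - G x)) \<longlonglongrightarrow> 0"
  proof (rule E_dominated[where S="\<lambda>x. norm (w x) + norm (G x) + Mb x (G x)"])
    have "(\<integral>\<^sup>+x. ennreal (norm (w x) + norm (G x) + Mb x (G x)) \<partial>lborel) =
      (\<integral>\<^sup>+x. ennreal (norm (w x)) \<partial>lborel) + (\<integral>\<^sup>+x. ennreal (norm (G x)) \<partial>lborel) + (\<integral>\<^sup>+x. ennreal (Mb x (G x)) \<partial>lborel)"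
      by (simp add: Mb_nonneg nn_integral_add)
    then show "(\<integral>\<^sup>+x. ennreal (norm (w x) + norm (G x) + Mb x (G x)) \<partial>lborel) < \<infinity>"
      using w G GM by (simp add: integrable_iff_bounded Mfin_def)
    show "AE x in lborel. norm (v n x - w x) + norm (H n x - G x) + Mb x (H n x - G x) \<le> norm (w x) + norm (G x) + Mb x (G x)" for n
    proof (intro AE_I2 add_mono)
      fix x
      show "norm (v n x - w x) \<le> norm (w x)" using v by (intro norm_vec_mono) simp
      have "norm ((H n x - G x) $ i) \<le> norm (G x $ i)" for i using H[of n x i] by auto
      then show "norm (H n x - G x) \<le> norm (G x)" by (rule norm_vec_mono)
      have "Mb x (H n x - G x) = Mb x (G x - H n x)" using Mb_even[of x "G x - H n x"] by simp
      also have "\<dots> \<le> Mb x (G x)"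
      proof (rule Mb_rows)
        fix i show "(G x - H n x) $ i = G x $ i \<or> (G x - H n x) $ i = 0" using H[of n x i] by auto
      qed
      finally show "Mb x (H n x - G x) \<le> Mb x (G x)" .
    qed
    show "AE x in lborel. (\<lambda>n. v n x - w x) \<longlonglongrightarrow> 0 \<and> (\<lambda>n. H n x - G x) \<longlonglongrightarrow> 0"
      using lim
    proof eventually_elim
      case (elim x)
      have "(\<lambda>n. v n x) \<longlonglongrightarrow> w x" by (rule vec_tendstoI) (use elim in auto)
      moreover have "(\<lambda>n. H n x) \<longlonglongrightarrow> G x" by (rule vec_tendstoI) (use elim in auto)
      ultimately show ?case by (simp add: LIM_zero_iff)
    qed
  qed measurable
  then have "\<forall>\<^sub>F n in sequentially. E (\<lambda>x. v n x - w x) (\<lambda>x. H n x - G x) < ennreal e"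
    using \<open>e > 0\<close> by (intro order_tendstoD(2)) auto
  then show "\<exists>v H. approximable v H \<and> E (\<lambda>x. v x - w x) (\<lambda>x. H x - G x) < ennreal e"
    using appr by (auto simp: eventually_sequentially)
qed

text \<open>Truncate the components at height \<open>n\<close> and let \<open>n\<close> tend to infinity.\<close>

lemma admissible_approximable:
  assumes \<Omega>: "bounded_lipschitz_domain \<Omega>" and bg: "bgen 0" and adm: "admissible w G"
  shows "approximable w G"
proof -
  have s: "\<And>i. sob (\<lambda>x. w x $ i) (\<lambda>x. G x $ i)" using adm by (auto simp: admissible_def)
  define v where "v n x = (\<chi> i. w x $ i - soft (real n) (w x $ i))" for n x
  define H where "H n x = (\<chi> i. if \<bar>w x $ i\<bar> > real n then 0 else G x $ i)" for n x
  have sv: "sob (\<lambda>x. v n x $ i) (\<lambda>x. H n x $ i)" for n i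
  proof -
    have "sob (\<lambda>x. w x $ i - soft (real n) (w x $ i)) (\<lambda>x. G x $ i - (if \<bar>w x $ i\<bar> > real n then G x $ i else 0))"
      by (intro sob_diff s sob_soft) simp
    moreover have "(\<lambda>x. G x $ i - (if \<bar>w x $ i\<bar> > real n then G x $ i else 0)) = (\<lambda>x. H n x $ i)"
      by (auto simp: H_def)
    ultimately show ?thesis by (simp add: v_def)
  qed
  have "approximable (v n) (H n)" for n
  proof (rule bounded_approximable[OF \<Omega> bg])
    show "admissible (v n) (H n)"
    proof (rule admissible_rows[OF adm sv])
      show "\<bar>v n x $ i\<bar> \<le> \<bar>w x $ i\<bar>" for x i
        using soft_le[of "real n" "w x $ i"] by (simp add: v_def abs_minus_commute)
    qed (simp add: H_def)
    show "norm (v n x) \<le> (\<Sum>i\<in>(UNIV :: 'd set). real n)" for x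
    proof -
      have "norm (v n x) \<le> (\<Sum>i\<in>UNIV. \<bar>v n x $ i\<bar>)" by (rule norm_le_l1_cart)
      also have "\<dots> \<le> (\<Sum>i\<in>(UNIV :: 'd set). real n)"
        using soft_close[of "real n"] by (intro sum_mono) (simp add: v_def abs_minus_commute)
      finally show ?thesis .
    qed
  qed
  then show ?thesis
  proof (rule approximable_rows[OF adm])
    have "\<bar>soft (real n) s\<bar> \<le> \<bar>s\<bar>" for n s using soft_lipschitz[of "real n" s 0] soft_zero[of 0 "real n"] by simp
    then show "\<bar>v n x $ i - w x $ i\<bar> \<le> \<bar>w x $ i\<bar>" for n x i by (simp add: v_def)
    show "H n x $ i = G x $ i \<or> H n x $ i = 0" for n x i by (simp add: H_def)
    show "AE x in lborel. \<forall>i. (\<lambda>n. v n x $ i) \<longlonglongrightarrow> w x $ i \<and> (\<lambda>n. H n x $ i) \<longlonglongrightarrow> G x $ i"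
    proof (intro AE_I2 allI)
      fix x i
      obtain N where N: "\<bar>w x $ i\<bar> < real N" using reals_Archimedean2 by blast
      have ev: "\<forall>\<^sub>F n in sequentially. \<bar>w x $ i\<bar> \<le> real n"
        using N by (auto simp: eventually_sequentially intro!: exI[of _ N])
      then have "\<forall>\<^sub>F n in sequentially. v n x $ i = w x $ i"
        by eventually_elim (simp add: v_def soft_zero)
      moreover from ev have "\<forall>\<^sub>F n in sequentially. H n x $ i = G x $ i"
        by eventually_elim (simp add: H_def)
      ultimately show "(\<lambda>n. v n x $ i) \<longlonglongrightarrow> w x $ i \<and> (\<lambda>n. H n x $ i) \<longlonglongrightarrow> G x $ i"
        by (simp add: tendsto_eventually)
    qed
  qed
qed

text \<open>Soft thresholding of the components makes the support compact, by \<open>compact_superlevel\<close>.  As the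
  threshold tends to zero, the gradients converge off the zero sets of the components, and on these
  the gradient vanishes by \<open>sob_zero_set\<close>.\<close>

lemma hoelder_approximable:
  assumes \<Omega>: "bounded_lipschitz_domain \<Omega>" and adm: "admissible w G"
    and H: "\<And>x y. x \<in> \<Omega> \<Longrightarrow> y \<in> \<Omega> \<Longrightarrow> norm (w x - w y) \<le> H * norm (x - y) powr \<gamma>" "H \<ge> 0" "\<gamma> > 0"
    and \<gamma>: "\<gamma> = 1 \<or> bgen \<gamma> \<and> \<gamma> \<le> 1"
  shows "approximable w G"
proof -
  have s: "\<And>i. sob (\<lambda>x. w x $ i) (\<lambda>x. G x $ i)" and out: "\<And>x. x \<notin> \<Omega> \<Longrightarrow> w x = 0"
    using adm by (auto simp: admissible_def)
  define b where "b n = 1 / real (Suc n)" for n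
  have b: "b n > 0" for n by (simp add: b_def)
  have b0: "b \<longlonglongrightarrow> 0" unfolding b_def by (rule LIMSEQ_Suc[OF lim_1_over_n])
  define v where "v n x = (\<chi> i. soft (b n) (w x $ i))" for n x
  define K where "K n x = (\<chi> i. if \<bar>w x $ i\<bar> > b n then G x $ i else 0)" for n x
  have Hi: "\<bar>w x $ i - w y $ i\<bar> \<le> H * norm (x - y) powr \<gamma>" if "x \<in> \<Omega>" "y \<in> \<Omega>" for x y i
    using component_le_norm_cart[of "w x - w y" i] H(1)[OF that] by simp
  have sv: "sob (\<lambda>x. v n x $ i) (\<lambda>x. K n x $ i)" for n i
    using sob_soft[OF s[of i] less_imp_le[OF b], of n] by (simp add: v_def K_def)
  have sle: "\<bar>soft (b n) t\<bar> \<le> \<bar>t\<bar>" for n t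
    using soft_lipschitz[OF less_imp_le[OF b], of n t 0] soft_zero[of 0 "b n"] less_imp_le[OF b[of n]] by simp
  have "approximable (v n) (K n)" for n
  proof -
    define Q where "Q = (\<Union>i\<in>UNIV. closure {x. \<bar>w x $ i\<bar> > b n})"
    have cs: "compact (closure {x. \<bar>w x $ i\<bar> > b n})" "closure {x. \<bar>w x $ i\<bar> > b n} \<subseteq> \<Omega>" for i
      using compact_superlevel[OF \<Omega> s[of i] _ Hi H(2,3) b[of n]] out by auto
    have Q: "compact Q" "Q \<subseteq> \<Omega>" using cs by (auto simp: Q_def)
    show ?thesis
    proof (rule hoelder_compact_approximable[OF _ Q _ _ _ H(3) \<gamma>])
      show "admissible (v n) (K n)"
        by (rule admissible_rows[OF adm sv]) (auto simp: v_def K_def sle)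
      show "y \<in> Q" if vy: "v n y \<noteq> 0" for y
      proof -
        obtain i where "v n y $ i \<noteq> 0" using vy by (auto simp: vec_eq_iff)
        then have "\<bar>w y $ i\<bar> > b n" using soft_zero[of "w y $ i" "b n"] by (force simp: v_def)
        then show ?thesis using closure_subset[of "{x. \<bar>w x $ i\<bar> > b n}"] by (auto simp: Q_def)
      qed
      show "norm (v n x - v n y) \<le> (real CARD('d) * H) * norm (x - y) powr \<gamma>" if "x \<in> \<Omega>" "y \<in> \<Omega>" for x y
      proof -
        have "norm (v n x - v n y) \<le> (\<Sum>i\<in>UNIV. \<bar>(v n x - v n y) $ i\<bar>)" by (rule norm_le_l1_cart)
        also have "\<dots> \<le> (\<Sum>i\<in>(UNIV :: 'd set). H * norm (x - y) powr \<gamma>)"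
        proof (rule sum_mono)
          fix i
          have "\<bar>(v n x - v n y) $ i\<bar> \<le> \<bar>w x $ i - w y $ i\<bar>"
            using soft_lipschitz[OF less_imp_le[OF b], of n] by (simp add: v_def)
          then show "\<bar>(v n x - v n y) $ i\<bar> \<le> H * norm (x - y) powr \<gamma>" using Hi[OF that, of i] by linarith
        qed
        finally show ?thesis by simp
      qed
      show "0 \<le> real CARD('d) * H" using H(2) by simp
    qed
  qed
  then show ?thesis
  proof (rule approximable_rows[OF adm])
    show "\<bar>v n x $ i - w x $ i\<bar> \<le> \<bar>w x $ i\<bar>" for n x i
      using soft_le[OF less_imp_le[OF b]] by (simp add: v_def)
    show "K n x $ i = G x $ i \<or> K n x $ i = 0" for n x i by (simp add: K_def)
    have "AE x in lborel. \<forall>i. w x $ i = 0 \<longrightarrow> G x $ i = 0"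
      using sob_zero_set[OF s] by (simp add: AE_all_countable)
    then show "AE x in lborel. \<forall>i. (\<lambda>n. v n x $ i) \<longlonglongrightarrow> w x $ i \<and> (\<lambda>n. K n x $ i) \<longlonglongrightarrow> G x $ i"
    proof eventually_elim
      case (elim x)
      show ?case
      proof (intro allI conjI)
        fix i
        have "(\<lambda>n. v n x $ i - w x $ i) \<longlonglongrightarrow> 0"
          by (rule Lim_null_comparison[OF _ b0]) (use soft_close[OF less_imp_le[OF b]] in \<open>auto simp: v_def\<close>)
        then show "(\<lambda>n. v n x $ i) \<longlonglongrightarrow> w x $ i" by (simp add: LIM_zero_iff)
        show "(\<lambda>n. K n x $ i) \<longlonglongrightarrow> G x $ i"
        proof (cases "w x $ i = 0")
          case True
          then have "G x $ i = 0" using elim by blast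
          moreover from this have "K n x $ i = 0" for n by (simp add: K_def)
          ultimately show ?thesis by simp
        next
          case False
          then have "\<forall>\<^sub>F n in sequentially. b n < \<bar>w x $ i\<bar>" using order_tendstoD(2)[OF b0, of "\<bar>w x $ i\<bar>"] by simp
          then have "\<forall>\<^sub>F n in sequentially. K n x $ i = G x $ i" by eventually_elim (simp add: K_def)
          then show ?thesis by (rule tendsto_eventually)
        qed
      qed
    qed
  qed
qed

end

section \<open>Continuity of the energy\<close>

text \<open>For a simple function \<open>f\<close> the composition is a finite sum; in general, \<open>f\<close> is a pointwise limit of simple
  functions.\<close>

lemma caratheodory_measurable:
  fixes F :: "'a \<Rightarrow> 'b::{metric_space, second_countable_topology} \<Rightarrow> real"
  assumes F: "\<And>\<xi>. (\<lambda>x. F x \<xi>) \<in> borel_measurable M" and c: "\<And>x. x \<in> space M \<Longrightarrow> continuous_on UNIV (F x)"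
    and f: "f \<in> borel_measurable M"
  shows "(\<lambda>x. F x (f x)) \<in> borel_measurable M"
proof -
  obtain s where s: "\<And>i::nat. simple_function M (s i)" "\<And>x. x \<in> space M \<Longrightarrow> (\<lambda>i. s i x) \<longlonglongrightarrow> f x"
    using borel_measurable_implies_sequence_metric[OF f, of undefined] by blast
  have m: "(\<lambda>x. F x (s i x)) \<in> borel_measurable M" for i
  proof -
    note sD = simple_functionD[OF s(1)[of i]]
    have "(\<lambda>x. \<Sum>\<xi>\<in>s i ` space M. F x \<xi> * indicator (s i -` {\<xi>} \<inter> space M) x) \<in> borel_measurable M"
      using F sD(2) by (intro borel_measurable_sum borel_measurable_times borel_measurable_indicator) auto
    moreover have "(\<Sum>\<xi>\<in>s i ` space M. F x \<xi> * indicator (s i -` {\<xi>} \<inter> space M) x) = F x (s i x)" if "x \<in> space M" for x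
    proof -
      have "(\<Sum>\<xi>\<in>s i ` space M. F x \<xi> * indicator (s i -` {\<xi>} \<inter> space M) x) =
        (\<Sum>\<xi>\<in>s i ` space M. if \<xi> = s i x then F x \<xi> else 0)"
        using that by (intro sum.cong) (auto simp: indicator_def)
      also have "\<dots> = F x (s i x)" using that sD(1) by (simp add: sum.delta)
      finally show ?thesis .
    qed
    ultimately show ?thesis by (subst (asm) measurable_cong) auto
  qed
  show ?thesis
  proof (rule borel_measurable_LIMSEQ_real[OF _ m])
    fix x assume x: "x \<in> space M"
    have "isCont (F x) (f x)" using c[OF x] by (simp add: continuous_on_eq_continuous_at)
    then show "(\<lambda>i. F x (s i x)) \<longlonglongrightarrow> F x (f x)" using s(2)[OF x] by (rule isCont_tendsto_compose)
  qed
qed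

lemma AE_lebesgue_on_of_lborel:
  assumes "open \<Omega>" "AE x in lborel. P x"
  shows "AE x in lebesgue_on \<Omega>. P x"
  using AE_completion[OF assms(2)] assms(1) by (auto simp: AE_restrict_space_iff elim!: eventually_mono)

lemma borel_measurable_lebesgue_on:
  assumes "f \<in> borel_measurable borel"
  shows "f \<in> borel_measurable (lebesgue_on \<Omega>)"
  using assms by (intro measurable_restrict_space1 measurable_completion) simp

context modular
begin

text \<open>Choose test functions \<open>\<phi> k\<close> that approximate \<open>w\<close> at a geometric rate.  By convexity, \<open>M x (U x + mgrad (\<phi> k) x)\<close> is at most
  the mean of \<open>M x (2 *\<^sub>R (U x + G x))\<close> and \<open>M x (2 *\<^sub>R (mgrad (\<phi> k) x - G x))\<close>.  The first is integrable, and
  the doubling condition bounds the second by \<open>c * S x + h x\<close>, where \<open>S\<close> is the majorant from \<open>fast_E\<close>.  With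
  the growth of \<open>F\<close> this dominates the energies.\<close>

lemma energy_infimum_le:
  fixes F :: "real ^ 'n \<Rightarrow> real ^ 'd \<Rightarrow> real ^ 'n ^ 'd \<Rightarrow> real"
  assumes F_meas: "\<And>z \<xi>. (\<lambda>x. F x z \<xi>) \<in> borel_measurable (lebesgue_on \<Omega>)"
    and F_cont: "\<And>x. x \<in> \<Omega> \<Longrightarrow> continuous_on UNIV (\<lambda>(z, \<xi>). F x z \<xi>)"
    and L: "L \<ge> 0" and growth: "\<And>x z \<xi>. x \<in> \<Omega> \<Longrightarrow> F x z \<xi> \<le> L * (M x \<xi> + 1)"
    and u0: "u0 \<in> W11 \<Omega>" and U: "Mfin U" "AE x in lebesgue_on \<Omega>. U x = weak_grad \<Omega> u0 x"
    and v: "v \<in> W11 \<Omega>" and w: "AE x in lebesgue_on \<Omega>. w x = v x"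
    and G: "Mfin G" "AE x in lebesgue_on \<Omega>. G x = weak_grad \<Omega> v x"
    and appr: "approximable w G"
  shows "(INF u\<in>translate u0 (Cc_infty \<Omega>). energy \<Omega> F u) \<le> energy \<Omega> F (\<lambda>x. u0 x + v x)"
proof -
  obtain u1 where u1: "integrable lborel u1" "\<And>x. x \<notin> \<Omega> \<Longrightarrow> u1 x = 0" "AE x in lebesgue_on \<Omega>. u1 x = u0 x"
    using integrable_borel_representative[OF \<Omega>_borel W11D(1)[OF open_\<Omega> u0]] by blast
  have m[measurable]: "u1 \<in> borel_measurable borel" "U \<in> borel_measurable borel"
    "w \<in> borel_measurable borel" "G \<in> borel_measurable borel"
    using u1 U G appr by (auto simp: Mfin_def approximable_def)
  have "\<exists>\<phi>\<in>Cc_infty \<Omega>. E (\<lambda>x. \<phi> x - w x) (\<lambda>x. mgrad \<phi> x - G x) < ennreal ((1/2) ^ k)" for k :: nat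
    using appr by (simp add: approximable_def)
  then have "\<forall>k::nat. \<exists>\<phi>. \<phi> \<in> Cc_infty \<Omega> \<and> E (\<lambda>x. \<phi> x - w x) (\<lambda>x. mgrad \<phi> x - G x) < ennreal ((1/2) ^ k)"
    unfolding Bex_def by (rule allI)
  from choice[OF this] obtain \<phi> where \<phi>': "\<forall>k::nat. \<phi> k \<in> Cc_infty \<Omega> \<and>
      E (\<lambda>x. \<phi> k x - w x) (\<lambda>x. mgrad (\<phi> k) x - G x) < ennreal ((1/2) ^ k)" ..
  then have \<phi>: "\<And>k. \<phi> k \<in> Cc_infty \<Omega>"
    "\<And>k. E (\<lambda>x. \<phi> k x - w x) (\<lambda>x. mgrad (\<phi> k) x - G x) < ennreal ((1/2) ^ k)" by simp_all
  note m2[measurable] = Cc_infty_integrable(3,4)[OF \<phi>(1)]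
  obtain S where S[measurable]: "S \<in> borel_measurable borel" and S0: "\<And>x. 0 \<le> S x"
    and Sfin: "(\<integral>\<^sup>+x. ennreal (S x) \<partial>lborel) < \<infinity>"
    and Sae: "AE x in lborel. (\<forall>k. norm (\<phi> k x - w x) + norm (mgrad (\<phi> k) x - G x) + Mb x (mgrad (\<phi> k) x - G x) \<le> S x)
      \<and> (\<lambda>k. \<phi> k x - w x) \<longlonglongrightarrow> 0 \<and> (\<lambda>k. mgrad (\<phi> k) x - G x) \<longlonglongrightarrow> 0"
  proof (rule fast_E[of "\<lambda>k x. \<phi> k x - w x" "\<lambda>k x. mgrad (\<phi> k) x - G x"])
    show "(\<lambda>x. \<phi> k x - w x) \<in> borel_measurable borel" for k by measurable
    show "(\<lambda>x. mgrad (\<phi> k) x - G x) \<in> borel_measurable borel" for k by measurable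
    show "E (\<lambda>x. \<phi> k x - w x) (\<lambda>x. mgrad (\<phi> k) x - G x) \<le> ennreal ((1/2) ^ k)" for k
      using \<phi>(2)[of k] by (rule less_imp_le)
  qed auto
  obtain c h where ch: "doubles c h" by (rule doubles_exists)
  then have c0: "c \<ge> 0" and h: "integrable lborel h" "\<And>x. 0 \<le> h x"
    and dbl: "AE x in lborel. \<forall>\<xi>. Mb x (2 *\<^sub>R \<xi>) \<le> c * Mb x \<xi> + h x" by (auto simp: doubles_def)
  have hm[measurable]: "h \<in> borel_measurable borel" using h by auto
  define D where "D x = indicator \<Omega> x * (L * (Mb x (2 *\<^sub>R (U x + G x)) + (c * S x + h x) + 1))" for x
  have Dm[measurable]: "D \<in> borel_measurable borel" unfolding D_def by measurable
  have UG: "Mfin (\<lambda>x. 2 *\<^sub>R (U x + G x))" by (intro Mfin_scale Mfin_add U G)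
  have Dfin: "(\<integral>\<^sup>+x. ennreal (D x) \<partial>lebesgue_on \<Omega>) < \<infinity>"
  proof -
    have i: "integrable lborel S" using S S0 Sfin by (simp add: integrable_iff_bounded)
    have i1: "integrable lborel (\<lambda>x. Mb x (2 *\<^sub>R (U x + G x)))"
      using UG Mb_nonneg by (simp add: Mfin_def integrable_iff_bounded)
    have i2: "integrable lborel (\<lambda>x. indicator \<Omega> x :: real)"
      using \<Omega>_finite by (intro integrable_real_indicator) auto
    have "integrable lborel (\<lambda>x. indicator \<Omega> x *\<^sub>R (L * (Mb x (2 *\<^sub>R (U x + G x)) + (c * S x + h x))) + L * indicator \<Omega> x)"
      using i i1 i2 h by (intro Bochner_Integration.integrable_add integrable_mult_indicator integrable_mult_right) auto
    then have "integrable lborel D"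
      by (rule back_subst[of "integrable lborel"]) (auto simp: D_def fun_eq_iff algebra_simps)
    moreover have D0: "D x \<ge> 0" for x
      unfolding D_def using L c0 S0 h(2) Mb_nonneg by (intro mult_nonneg_nonneg add_nonneg_nonneg) auto
    ultimately have "(\<integral>\<^sup>+x. ennreal (D x) \<partial>lborel) < \<infinity>" by (simp add: integrable_iff_bounded)
    then show ?thesis
      by (subst nn_integral_lebesgue_on_borel[OF open_\<Omega>]) (auto simp: D_def)
  qed
  have Fm: "(\<lambda>x. ennreal (F x (a x) (A x))) \<in> borel_measurable (lebesgue_on \<Omega>)"
    if "a \<in> borel_measurable borel" "A \<in> borel_measurable borel" for a A
  proof -
    have "(\<lambda>x. (a x, A x)) \<in> borel_measurable borel" using that by (intro borel_measurable_Pair)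
    then have aA: "(\<lambda>x. (a x, A x)) \<in> borel_measurable (lebesgue_on \<Omega>)" by (rule borel_measurable_lebesgue_on)
    have "(\<lambda>x. (\<lambda>p. F x (fst p) (snd p)) (a x, A x)) \<in> borel_measurable (lebesgue_on \<Omega>)"
    proof (rule caratheodory_measurable[OF _ _ aA])
      show "(\<lambda>x. F x (fst p) (snd p)) \<in> borel_measurable (lebesgue_on \<Omega>)" for p by (rule F_meas)
      show "continuous_on UNIV (\<lambda>p. F x (fst p) (snd p))" if "x \<in> space (lebesgue_on \<Omega>)" for x
        using F_cont[of x] that by (simp add: split_beta)
    qed
    then show ?thesis by simp
  qed
  have "(\<lambda>k. \<integral>\<^sup>+x. ennreal (F x (u1 x + \<phi> k x) (U x + mgrad (\<phi> k) x)) \<partial>lebesgue_on \<Omega>)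
     \<longlonglongrightarrow> (\<integral>\<^sup>+x. ennreal (F x (u1 x + w x) (U x + G x)) \<partial>lebesgue_on \<Omega>)"
  proof (rule nn_integral_dominated_convergence[where w="\<lambda>x. ennreal (D x)"])
    show "(\<lambda>x. ennreal (F x (u1 x + \<phi> k x) (U x + mgrad (\<phi> k) x))) \<in> borel_measurable (lebesgue_on \<Omega>)" for k
      by (rule Fm) measurable
    show "(\<lambda>x. ennreal (F x (u1 x + w x) (U x + G x))) \<in> borel_measurable (lebesgue_on \<Omega>)"
      by (rule Fm) measurable
    show "(\<lambda>x. ennreal (D x)) \<in> borel_measurable (lebesgue_on \<Omega>)"
      by (rule borel_measurable_lebesgue_on) measurable
    show "(\<integral>\<^sup>+x. ennreal (D x) \<partial>lebesgue_on \<Omega>) < \<infinity>" by (rule Dfin)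
    have sp: "AE x in lebesgue_on \<Omega>. x \<in> \<Omega>" by (rule AE_I2) simp
    show "AE x in lebesgue_on \<Omega>. ennreal (F x (u1 x + \<phi> k x) (U x + mgrad (\<phi> k) x)) \<le> ennreal (D x)" for k
      using sp AE_lebesgue_on_of_lborel[OF open_\<Omega> Sae] AE_lebesgue_on_of_lborel[OF open_\<Omega> dbl]
    proof eventually_elim
      case (elim x)
      have "Mb x (mgrad (\<phi> k) x - G x) \<le> S x"
        using elim(2) norm_ge_zero[of "\<phi> k x - w x"] norm_ge_zero[of "mgrad (\<phi> k) x - G x"] by (smt (verit))
      then have "c * Mb x (mgrad (\<phi> k) x - G x) \<le> c * S x" using c0 by (rule mult_left_mono)
      moreover have "Mb x (2 *\<^sub>R (mgrad (\<phi> k) x - G x)) \<le> c * Mb x (mgrad (\<phi> k) x - G x) + h x" using elim(3) by blast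
      moreover have "Mb x (U x + mgrad (\<phi> k) x) \<le> (Mb x (2 *\<^sub>R (U x + G x)) + Mb x (2 *\<^sub>R (mgrad (\<phi> k) x - G x))) / 2"
        using Mb_add[of x "U x + G x" "mgrad (\<phi> k) x - G x"] by simp
      moreover have "a \<le> p + (s + h)" if "t \<le> s" "q \<le> t + h" "a \<le> (p + q) / 2" "0 \<le> p" "0 \<le> q" for a p q s t h :: real
        using that by simp
      ultimately have "Mb x (U x + mgrad (\<phi> k) x) \<le> Mb x (2 *\<^sub>R (U x + G x)) + (c * S x + h x)"
        using Mb_nonneg by blast
      then have "L * (M x (U x + mgrad (\<phi> k) x) + 1) \<le> D x"
        using elim(1) L by (simp add: D_def Mb_in mult_left_mono)
      then show ?case using growth[OF elim(1), of "u1 x + \<phi> k x" "U x + mgrad (\<phi> k) x"]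
        by (intro ennreal_leI) linarith
    qed
    show "AE x in lebesgue_on \<Omega>. (\<lambda>k. ennreal (F x (u1 x + \<phi> k x) (U x + mgrad (\<phi> k) x)))
        \<longlonglongrightarrow> ennreal (F x (u1 x + w x) (U x + G x))"
      using sp AE_lebesgue_on_of_lborel[OF open_\<Omega> Sae]
    proof eventually_elim
      case (elim x)
      have "(\<lambda>k. \<phi> k x) \<longlonglongrightarrow> w x" "(\<lambda>k. mgrad (\<phi> k) x) \<longlonglongrightarrow> G x" using elim(2) by (auto simp: LIM_zero_iff)
      then have "(\<lambda>k. (u1 x + \<phi> k x, U x + mgrad (\<phi> k) x)) \<longlonglongrightarrow> (u1 x + w x, U x + G x)"
        by (intro tendsto_intros)
      moreover have "isCont (\<lambda>(z, \<xi>). F x z \<xi>) (u1 x + w x, U x + G x)"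
        using F_cont[OF elim(1)] by (simp add: continuous_on_eq_continuous_at)
      ultimately have "(\<lambda>k. (\<lambda>(z, \<xi>). F x z \<xi>) (u1 x + \<phi> k x, U x + mgrad (\<phi> k) x)) \<longlonglongrightarrow> (\<lambda>(z, \<xi>). F x z \<xi>) (u1 x + w x, U x + G x)"
        by (rule isCont_tendsto_compose[rotated])
      then show ?case by (intro tendsto_ennrealI) simp
    qed
  qed
  moreover have "energy \<Omega> F (\<lambda>x. u0 x + \<phi> k x) = (\<integral>\<^sup>+x. ennreal (F x (u1 x + \<phi> k x) (U x + mgrad (\<phi> k) x)) \<partial>lebesgue_on \<Omega>)" for k
    unfolding energy_def
  proof (rule nn_integral_cong_AE)
    have "has_weak_grad \<Omega> (\<lambda>x. u0 x + \<phi> k x) (\<lambda>x. weak_grad \<Omega> u0 x + mgrad (\<phi> k) x)"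
      by (rule has_weak_grad_add[OF open_\<Omega> W11D(2)[OF open_\<Omega> u0] Cc_infty_has_weak_grad[OF open_\<Omega> \<phi>(1)]])
    from weak_grad_AE[OF open_\<Omega> this] u1(3) U(2)
    show "AE x in lebesgue_on \<Omega>. ennreal (F x (u0 x + \<phi> k x) (weak_grad \<Omega> (\<lambda>x. u0 x + \<phi> k x) x)) =
      ennreal (F x (u1 x + \<phi> k x) (U x + mgrad (\<phi> k) x))"
      by eventually_elim simp
  qed
  moreover have "energy \<Omega> F (\<lambda>x. u0 x + v x) = (\<integral>\<^sup>+x. ennreal (F x (u1 x + w x) (U x + G x)) \<partial>lebesgue_on \<Omega>)"
    unfolding energy_def
  proof (rule nn_integral_cong_AE)
    have "has_weak_grad \<Omega> (\<lambda>x. u0 x + v x) (\<lambda>x. weak_grad \<Omega> u0 x + weak_grad \<Omega> v x)"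
      by (rule has_weak_grad_add[OF open_\<Omega> W11D(2)[OF open_\<Omega> u0] W11D(2)[OF open_\<Omega> v]])
    from weak_grad_AE[OF open_\<Omega> this] u1(3) U(2) w G(2)
    show "AE x in lebesgue_on \<Omega>. ennreal (F x (u0 x + v x) (weak_grad \<Omega> (\<lambda>x. u0 x + v x) x)) =
      ennreal (F x (u1 x + w x) (U x + G x))"
      by eventually_elim simp
  qed
  ultimately have lim: "(\<lambda>k. energy \<Omega> F (\<lambda>x. u0 x + \<phi> k x)) \<longlonglongrightarrow> energy \<Omega> F (\<lambda>x. u0 x + v x)" by simp
  show ?thesis
  proof (rule LIMSEQ_le_const[OF lim], intro exI allI impI)
    fix k
    show "(INF u\<in>translate u0 (Cc_infty \<Omega>). energy \<Omega> F u) \<le> energy \<Omega> F (\<lambda>x. u0 x + \<phi> k x)"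
      by (rule INF_lower) (use \<phi>(1) in \<open>auto simp: translate_def\<close>)
  qed
qed

end

section \<open>Weak N-functions and competitors\<close>

text \<open>The inequality fails on an open set, which is not a null set unless it is empty.\<close>

lemma AE_le_everywhere:
  fixes f g :: "'a::euclidean_space \<Rightarrow> real"
  assumes S: "open S" and c: "continuous_on S f" "continuous_on S g"
    and ae: "AE x in lebesgue_on S. f x \<le> g x" and x: "x \<in> S"
  shows "f x \<le> g x"
proof (rule ccontr)
  assume neg: "\<not> f x \<le> g x"
  define A where "A = S \<inter> (\<lambda>x. f x - g x) -` {0<..}"
  have "open A" unfolding A_def
    by (intro continuous_open_preimage continuous_on_diff c S open_greaterThan)
  have "AE x in lebesgue. x \<in> S \<longrightarrow> f x \<le> g x" using ae S by (simp add: AE_restrict_space_iff)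
  then have "AE x in lebesgue. x \<notin> A" by eventually_elim (auto simp: A_def)
  moreover have "A \<in> sets lebesgue" using \<open>open A\<close> by simp
  ultimately have "A \<in> null_sets lebesgue" using AE_iff_null_sets by blast
  then have "negligible A" by (simp add: negligible_iff_null_sets)
  moreover have "x \<in> A" using neg x by (simp add: A_def)
  ultimately show False using open_not_negligible[OF \<open>open A\<close>] by blast
qed

lemma AE_eq_everywhere:
  fixes f g :: "'a::euclidean_space \<Rightarrow> real"
  assumes "open S" "continuous_on S f" "continuous_on S g"
    and ae: "AE x in lebesgue_on S. f x = g x" and x: "x \<in> S"
  shows "f x = g x"
proof (rule antisym)
  show "f x \<le> g x" by (rule AE_le_everywhere[OF assms(1-3) _ x]) (use ae in \<open>auto elim!: eventually_mono\<close>)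
  show "g x \<le> f x" by (rule AE_le_everywhere[OF assms(1,3,2) _ x]) (use ae in \<open>auto elim!: eventually_mono\<close>)
qed

lemma esssup_continuous:
  fixes f :: "'a::euclidean_space \<Rightarrow> real"
  assumes S: "open S" and c: "continuous_on S f"
  shows "y \<in> S \<Longrightarrow> ereal (f y) \<le> esssup (lebesgue_on S) (\<lambda>y. ereal (f y))"
    and "(\<And>y. y \<in> S \<Longrightarrow> f y \<le> b) \<Longrightarrow> esssup (lebesgue_on S) (\<lambda>y. ereal (f y)) \<le> ereal b"
proof -
  have m: "f \<in> borel_measurable (lebesgue_on S)"
    using c S by (intro continuous_imp_measurable_on_sets_lebesgue) auto
  show "esssup (lebesgue_on S) (\<lambda>y. ereal (f y)) \<le> ereal b" if "\<And>y. y \<in> S \<Longrightarrow> f y \<le> b"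
    using m that by (intro esssup_I) auto
  assume y: "y \<in> S"
  define e where "e = esssup (lebesgue_on S) (\<lambda>y. ereal (f y))"
  have ae: "AE y in lebesgue_on S. ereal (f y) \<le> e" unfolding e_def by (rule esssup_AE)
  have "ereal (f y) \<le> e"
  proof (cases e)
    case (real r)
    then have "AE y in lebesgue_on S. f y \<le> r" using ae by simp
    from AE_le_everywhere[OF S c continuous_on_const this y] show ?thesis using real by simp
  next
    case MInf
    then have "AE y in lebesgue_on S. f y \<le> f y - 1" using ae by (auto elim!: eventually_mono)
    moreover have "continuous_on S (\<lambda>y. f y - 1)" by (intro continuous_intros c)
    ultimately have "f y \<le> f y - 1" using AE_le_everywhere[OF S c _ _ y] by blast
    then show ?thesis by simp
  qed simp
  then show "ereal (f y) \<le> esssup (lebesgue_on S) (\<lambda>y. ereal (f y))" by (simp add: e_def)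
qed

lemma weak_N_functionD:
  assumes "weak_N_function \<Omega> V N"
  shows "\<And>\<xi>. \<xi> \<in> V \<Longrightarrow> (\<lambda>x. N x \<xi>) \<in> borel_measurable (lebesgue_on \<Omega>)"
    "AE x in lebesgue_on \<Omega>. N x 0 = 0" "\<And>x \<xi>. x \<in> \<Omega> \<Longrightarrow> \<xi> \<in> V \<Longrightarrow> 0 \<le> N x \<xi>"
    "AE x in lebesgue_on \<Omega>. convex_on V (N x)"
    "AE x in lebesgue_on \<Omega>. \<forall>\<xi>\<in>V. N x \<xi> = N x (- \<xi>)"
    "\<exists>m1 m2 :: real \<Rightarrow> real. convex_on {0..} m1 \<and> (\<forall>s\<ge>0. 0 \<le> m1 s \<and> 0 \<le> m2 s) \<and> m1 0 = 0 \<and> (\<forall>s>0. 0 < m1 s) \<and>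
        (AE x in lebesgue_on \<Omega>. \<forall>\<xi>\<in>V. m1 (norm \<xi>) \<le> N x \<xi> \<and> N x \<xi> \<le> m2 (norm \<xi>))"
proof -
  note D = assms[unfolded weak_N_function_def]
  show "(\<lambda>x. N x \<xi>) \<in> borel_measurable (lebesgue_on \<Omega>)" if "\<xi> \<in> V" for \<xi>
    using D that by (elim conjE) blast
  show "AE x in lebesgue_on \<Omega>. N x 0 = 0" using D by (elim conjE) (auto elim!: eventually_mono)
  show "0 \<le> N x \<xi>" if "x \<in> \<Omega>" "\<xi> \<in> V" for x \<xi> using D that by (elim conjE) blast
  show "AE x in lebesgue_on \<Omega>. convex_on V (N x)" using D by (elim conjE) (auto elim!: eventually_mono)
  show "AE x in lebesgue_on \<Omega>. \<forall>\<xi>\<in>V. N x \<xi> = N x (- \<xi>)" using D by (elim conjE)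
  show "\<exists>m1 m2 :: real \<Rightarrow> real. convex_on {0..} m1 \<and> (\<forall>s\<ge>0. 0 \<le> m1 s \<and> 0 \<le> m2 s) \<and> m1 0 = 0 \<and> (\<forall>s>0. 0 < m1 s) \<and>
        (AE x in lebesgue_on \<Omega>. \<forall>\<xi>\<in>V. m1 (norm \<xi>) \<le> N x \<xi> \<and> N x \<xi> \<le> m2 (norm \<xi>))"
    using D by (elim conjE exE) (intro exI conjI; assumption)
qed

text \<open>Continuity in \<open>x\<close> extends the defining properties from almost every to every point.  The minorant
  \<open>m1\<close> is increasing, being convex with minimum at zero.  The majorant \<open>m2\<close> need not be; its value on
  a sphere bounds \<open>M\<close> on the ball inside by convexity along rays.\<close>

lemma modular_of_weak_N_function:
  fixes \<Omega> :: "(real ^ 'n) set" and M :: "real ^ 'n \<Rightarrow> real ^ 'n ^ 'd \<Rightarrow> real"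
  assumes \<Omega>: "open \<Omega>" "bounded \<Omega>" and N: "weak_N_function \<Omega> UNIV M"
    and cont: "continuous_on (\<Omega> \<times> UNIV) (\<lambda>(x, \<xi>). M x \<xi>)" and D2: "Delta2 \<Omega> M"
  shows "modular \<Omega> M"
proof -
  note ND = weak_N_functionD[OF N]
  have cx: "continuous_on \<Omega> (\<lambda>x. M x \<xi>)" for \<xi>
  proof -
    have "continuous_on \<Omega> (\<lambda>x. (\<lambda>(x, \<xi>). M x \<xi>) (x, \<xi>))"
      by (rule continuous_on_compose2[OF cont]) (auto intro!: continuous_intros)
    then show ?thesis by simp
  qed
  note le = AE_le_everywhere[OF \<Omega>(1)] and eq = AE_eq_everywhere[OF \<Omega>(1)]
  obtain m1 m2 :: "real \<Rightarrow> real" where m1: "convex_on {0..} m1" "\<And>s. s \<ge> 0 \<Longrightarrow> 0 \<le> m1 s" "m1 0 = 0" "\<And>s. s > 0 \<Longrightarrow> 0 < m1 s"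
    and m2: "\<And>s. s \<ge> 0 \<Longrightarrow> 0 \<le> m2 s"
    and ae: "AE x in lebesgue_on \<Omega>. \<forall>\<xi>\<in>UNIV. m1 (norm \<xi>) \<le> M x \<xi> \<and> M x \<xi> \<le> m2 (norm \<xi>)"
    using ND(6) by blast
  have zero: "M x 0 = 0" if "x \<in> \<Omega>" for x
    by (rule eq[OF cx continuous_on_const ND(2) that])
  have conv: "M x (u *\<^sub>R \<xi> + v *\<^sub>R \<eta>) \<le> u * M x \<xi> + v * M x \<eta>"
    if "x \<in> \<Omega>" "0 \<le> u" "0 \<le> v" "u + v = 1" for x u v \<xi> \<eta>
  proof (rule le[OF cx _ _ that(1)])
    show "continuous_on \<Omega> (\<lambda>x. u * M x \<xi> + v * M x \<eta>)" by (intro continuous_intros cx)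
    show "AE x in lebesgue_on \<Omega>. M x (u *\<^sub>R \<xi> + v *\<^sub>R \<eta>) \<le> u * M x \<xi> + v * M x \<eta>"
      using ND(4) by eventually_elim (use that in \<open>auto simp: convex_on_def\<close>)
  qed
  have lo: "m1 (norm \<xi>) \<le> M x \<xi>" if "x \<in> \<Omega>" for x \<xi>
    by (rule le[OF continuous_on_const cx _ that]) (use ae in \<open>auto elim!: eventually_mono\<close>)
  have up: "M x \<xi> \<le> m2 (norm \<xi>)" if "x \<in> \<Omega>" for x \<xi>
    by (rule le[OF cx continuous_on_const _ that]) (use ae in \<open>auto elim!: eventually_mono\<close>)
  have ray: "M x (t *\<^sub>R \<xi>) \<le> M x \<xi>" if "x \<in> \<Omega>" "0 \<le> t" "t \<le> 1" for x t \<xi>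
  proof -
    have "M x (t *\<^sub>R \<xi> + (1 - t) *\<^sub>R 0) \<le> t * M x \<xi> + (1 - t) * M x 0" using that by (intro conv) auto
    also have "\<dots> \<le> 1 * M x \<xi>" using that ND(3)[of x \<xi>] by (simp add: zero mult_left_le_one_le)
    finally show ?thesis by simp
  qed
  have upper: "\<exists>B\<ge>0. \<forall>x\<in>\<Omega>. \<forall>\<xi>. norm \<xi> \<le> R \<longrightarrow> M x \<xi> \<le> B" for R
  proof (intro exI conjI ballI allI impI)
    define R' where "R' = max R 1"
    show "0 \<le> m2 R'" by (intro m2) (simp add: R'_def)
    fix x and \<xi> :: "real ^ 'n ^ 'd" assume x: "x \<in> \<Omega>" and \<xi>: "norm \<xi> \<le> R"
    show "M x \<xi> \<le> m2 R'"
    proof (cases "\<xi> = 0")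
      case True
      then show ?thesis using zero[OF x] \<open>0 \<le> m2 R'\<close> by simp
    next
      case False
      define \<zeta> where "\<zeta> = (R' / norm \<xi>) *\<^sub>R \<xi>"
      have "norm \<zeta> = R'" using False by (simp add: \<zeta>_def R'_def)
      have "\<xi> = (norm \<xi> / R') *\<^sub>R \<zeta>" using False by (simp add: \<zeta>_def R'_def)
      then have "M x \<xi> = M x ((norm \<xi> / R') *\<^sub>R \<zeta>)" by simp
      also have "\<dots> \<le> M x \<zeta>"
      proof (rule ray[OF x])
        show "0 \<le> norm \<xi> / R'" "norm \<xi> / R' \<le> 1" using \<xi> by (auto simp: R'_def divide_le_eq_1)
      qed
      also have "\<dots> \<le> m2 R'" using up[OF x, of \<zeta>] \<open>norm \<zeta> = R'\<close> by simp
      finally show ?thesis .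
    qed
  qed
  show ?thesis
  proof
    show "0 \<le> M x \<xi>" if "x \<in> \<Omega>" for x \<xi> using ND(3)[OF that] by simp
    show "convex_on UNIV (M x)" if "x \<in> \<Omega>" for x using conv[OF that] by (auto simp: convex_on_def)
    show "M x (- \<xi>) = M x \<xi>" if "x \<in> \<Omega>" for x \<xi>
    proof (rule eq[OF cx cx _ that])
      show "AE x in lebesgue_on \<Omega>. M x (- \<xi>) = M x \<xi>" using ND(5) by eventually_elim simp
    qed
    show "\<exists>\<mu>>0. \<forall>x\<in>\<Omega>. \<forall>\<xi>. norm \<xi> \<ge> r \<longrightarrow> M x \<xi> \<ge> \<mu>" if "r > 0" for r
    proof (rule exI[of _ "m1 r"], intro conjI ballI allI impI m1(4)[OF that])
      fix x and \<xi> :: "real ^ 'n ^ 'd" assume x: "x \<in> \<Omega>" and \<xi>: "r \<le> norm \<xi>"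
      define t where "t = r / norm \<xi>"
      have t: "0 \<le> t" "t \<le> 1" "r = t * norm \<xi>" using \<xi> that by (auto simp: t_def divide_le_eq_1)
      have "m1 ((1 - t) *\<^sub>R 0 + t *\<^sub>R norm \<xi>) \<le> (1 - t) * m1 0 + t * m1 (norm \<xi>)"
        using t by (intro convex_onD[OF m1(1)]) auto
      then have "m1 r \<le> t * m1 (norm \<xi>)" using t(3) m1(3) by simp
      also have "\<dots> \<le> 1 * m1 (norm \<xi>)" using t m1(2)[of "norm \<xi>"] by (intro mult_right_mono) auto
      finally show "m1 r \<le> M x \<xi>" using lo[OF x, of \<xi>] by simp
    qed
    show "\<exists>c\<ge>0. \<exists>h. integrable lborel h \<and> (\<forall>x. 0 \<le> h x) \<and>
        (AE x in lborel. x \<in> \<Omega> \<longrightarrow> (\<forall>\<xi>. M x (2 *\<^sub>R \<xi>) \<le> c * M x \<xi> + h x))"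
    proof -
      obtain c C h where c: "c > 0" and C: "C > 0" and h: "integrable (lebesgue_on \<Omega>) h"
        and dbl: "AE x in lebesgue_on \<Omega>. \<forall>\<xi>. norm \<xi> > C \<longrightarrow> M x (2 *\<^sub>R \<xi>) \<le> c * M x \<xi> + h x"
        using D2 by (auto simp: Delta2_def)
      obtain h' where h': "integrable lborel h'" "AE x in lebesgue_on \<Omega>. h' x = h x"
        using integrable_borel_representative[OF _ h] \<Omega> by (metis borel_open)
      obtain B where B: "B \<ge> 0" "\<And>x \<xi>. x \<in> \<Omega> \<Longrightarrow> norm \<xi> \<le> 2 * C \<Longrightarrow> M x \<xi> \<le> B" using upper[of "2 * C"] by blast
      define k where "k x = \<bar>h' x\<bar> + B * indicator \<Omega> x" for x
      have "emeasure lborel \<Omega> < \<infinity>" by (rule emeasure_bounded_finite[OF \<Omega>(2)])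
      then have "integrable lborel (indicator \<Omega> :: _ \<Rightarrow> real)" using \<Omega> by (intro integrable_real_indicator) auto
      then have "integrable lborel k" unfolding k_def using h'(1) by auto
      moreover have "\<forall>x. 0 \<le> k x" using B by (simp add: k_def)
      moreover have "AE x in lborel. x \<in> \<Omega> \<longrightarrow> (\<forall>\<xi>. M x (2 *\<^sub>R \<xi>) \<le> c * M x \<xi> + k x)"
      proof -
        have "AE x in lebesgue_on \<Omega>. x \<in> \<Omega>" by (rule AE_I2) simp
        with dbl h'(2) have "AE x in lebesgue_on \<Omega>. \<forall>\<xi>. M x (2 *\<^sub>R \<xi>) \<le> c * M x \<xi> + k x"
        proof eventually_elim
          case (elim x)
          show ?case
          proof
            fix \<xi>
            show "M x (2 *\<^sub>R \<xi>) \<le> c * M x \<xi> + k x"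
            proof (cases "norm \<xi> > C")
              case True
              then have "M x (2 *\<^sub>R \<xi>) \<le> c * M x \<xi> + h' x" using elim by simp
              then show ?thesis using elim(3) B by (simp add: k_def)
            next
              case False
              then have "M x (2 *\<^sub>R \<xi>) \<le> B" using elim(3) by (intro B) auto
              moreover have "0 \<le> c * M x \<xi>" using c ND(3)[OF elim(3), of \<xi>] by simp
              ultimately show ?thesis using elim(3) by (simp add: k_def)
            qed
          qed
        qed
        then have "AE x in lebesgue. x \<in> \<Omega> \<longrightarrow> (\<forall>\<xi>. M x (2 *\<^sub>R \<xi>) \<le> c * M x \<xi> + k x)"
          using \<Omega> by (simp add: AE_restrict_space_iff)
        then show ?thesis by (simp add: AE_completion_iff)
      qed
      ultimately show ?thesis using c less_imp_le by blast
    qed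
  qed (use \<Omega> cont zero upper in auto)
qed

context modular
begin

text \<open>Continuous functions on an open set attain no value outside of their essential range.\<close>

lemma N_inf_eq_Minf:
  assumes B: "open B" "B \<inter> \<Omega> \<noteq> {}" and m: "(\<lambda>y. N y \<xi>) \<in> borel_measurable (lebesgue_on \<Omega>)"
    and ae: "AE y in lebesgue_on \<Omega>. N y \<xi> = M y \<xi>"
  shows "N_inf \<Omega> N B \<xi> = ereal (Minf (B \<inter> \<Omega>) \<xi>)"
    and "y \<in> B \<inter> \<Omega> \<Longrightarrow> ereal (M y \<xi>) \<le> N_sup \<Omega> N B \<xi>"
proof -
  define S where "S = B \<inter> \<Omega>"
  have S: "open S" "S \<subseteq> \<Omega>" "S \<noteq> {}" using B open_\<Omega> by (auto simp: S_def)
  have c: "continuous_on S (\<lambda>y. M y \<xi>)" using M_continuous_space continuous_on_subset S(2) by blast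
  then have c': "continuous_on S (\<lambda>y. - M y \<xi>)" by (intro continuous_intros)
  have mS: "(\<lambda>y. N y \<xi>) \<in> borel_measurable (lebesgue_on S)" using m S(2) by (rule measurable_restrict_mono)
  have cm: "(\<lambda>y. M y \<xi>) \<in> borel_measurable (lebesgue_on S)"
    using c S by (intro continuous_imp_measurable_on_sets_lebesgue) auto
  have aeS: "AE y in lebesgue_on S. N y \<xi> = M y \<xi>"
    using ae S open_\<Omega> by (auto simp: AE_restrict_space_iff elim!: eventually_mono)
  have "esssup (lebesgue_on S) (\<lambda>y. ereal (N y \<xi>)) = esssup (lebesgue_on S) (\<lambda>y. ereal (M y \<xi>))"
    by (rule esssup_AE_cong) (use mS cm aeS in \<open>auto elim!: eventually_mono\<close>)
  then show "ereal (M y \<xi>) \<le> N_sup \<Omega> N B \<xi>" if "y \<in> B \<inter> \<Omega>"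
    using esssup_continuous(1)[OF S(1) c, of y] that by (simp add: N_sup_def S_def)
  define e where "e = esssup (lebesgue_on S) (\<lambda>y. ereal (- M y \<xi>))"
  have eq: "esssup (lebesgue_on S) (\<lambda>y. - ereal (N y \<xi>)) = e"
    unfolding e_def by (rule esssup_AE_cong) (use mS cm aeS in \<open>auto elim!: eventually_mono\<close>)
  have "e = ereal (- Minf S \<xi>)"
  proof (rule antisym)
    show "e \<le> ereal (- Minf S \<xi>)"
      unfolding e_def using Minf_le[OF S(2)] by (intro esssup_continuous(2)[OF S(1) c']) simp
    have up: "ereal (- M y \<xi>) \<le> e" if "y \<in> S" for y
      unfolding e_def by (rule esssup_continuous(1)[OF S(1) c' that])
    show "ereal (- Minf S \<xi>) \<le> e"
    proof (cases e)
      case (real r)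
      then have "- r \<le> M y \<xi>" if "y \<in> S" for y using up[OF that] by simp
      then have "- r \<le> Minf S \<xi>" by (rule le_Minf[OF S(3)])
      then show ?thesis using real by simp
    next
      case MInf
      then show ?thesis using up S(3) by auto
    qed simp
  qed
  then show "N_inf \<Omega> N B \<xi> = ereal (Minf (B \<inter> \<Omega>) \<xi>)" using eq by (simp add: N_inf_def S_def)
qed

text \<open>On the \<open>j\<close>-th block space all summands but \<open>N j\<close> vanish for almost every \<open>x\<close>, so \<open>N j\<close> agrees with
  \<open>M\<close> there.\<close>

lemma bgen_of_B_gen:
  assumes "B_gen \<gamma> \<Omega> M"
  shows "bgen \<gamma>"
proof -
  from assms[unfolded B_gen_def] obtain K b N c C where K: "{b i k | i k. True} = {..<K::nat}"
    and N': "\<forall>j<K. weak_N_function \<Omega> (block_space b j) (N j)"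
    and Msum': "\<forall>x\<in>\<Omega>. \<forall>\<xi>. M x \<xi> = (\<Sum>j<K. N j x (block_part b j \<xi>))"
    and c: "c > 1" and C: "C > 1"
    and bg0: "\<forall>p r. 0 < r \<and> r \<le> 1 \<longrightarrow>
           (\<forall>j<K. \<forall>\<xi>\<in>block_space b j.
              N_inf \<Omega> (N j) (ball p r) (C *\<^sub>R \<xi>)
                \<le> (SUP \<eta>\<in>{\<eta> \<in> block_space b j. norm \<eta> = 1}.
                     N_inf \<Omega> (N j) (ball p r) ((c * r powr (\<gamma> - 1)) *\<^sub>R \<eta>))
              \<longrightarrow> N_sup \<Omega> (N j) (ball p r) \<xi> \<le> N_inf \<Omega> (N j) (ball p r) (C *\<^sub>R \<xi>) + 1)"
    by (elim exE conjE) (rule that; assumption)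
  have N: "weak_N_function \<Omega> (block_space b j) (N j)" if "j < K" for j using N' that by (elim allE impE)
  have Msum: "M x \<xi> = (\<Sum>j<K. N j x (block_part b j \<xi>))" if "x \<in> \<Omega>" for x \<xi>
    using bspec[OF Msum' that] by (rule spec)
  have "AE x in lebesgue_on \<Omega>. \<forall>j\<in>{..<K}. N j x 0 = 0"
    using weak_N_functionD(2)[OF N] by (intro AE_finite_allI) auto
  moreover have "AE x in lebesgue_on \<Omega>. x \<in> \<Omega>" by (rule AE_I2) simp
  ultimately have ae: "AE x in lebesgue_on \<Omega>. \<forall>j<K. \<forall>\<xi>\<in>block_space b j. N j x \<xi> = M x \<xi>"
  proof eventually_elim
    case (elim x)
    show ?case
    proof (intro allI impI ballI)
      fix j \<xi> assume j: "j < K" and \<xi>: "\<xi> \<in> block_space b j"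
      have bp: "block_part b i \<xi> = (if i = j then \<xi> else 0)" for i
        using \<xi> by (auto simp: block_part_def block_space_def vec_eq_iff)
      have "M x \<xi> = (\<Sum>i<K. N i x (block_part b i \<xi>))" by (rule Msum[OF elim(2)])
      also have "\<dots> = (\<Sum>i<K. if i = j then N j x \<xi> else 0)"
        using elim(1) by (intro sum.cong) (auto simp: bp)
      also have "\<dots> = N j x \<xi>" using j by simp
      finally show "N j x \<xi> = M x \<xi>" by simp
    qed
  qed
  have aej: "AE x in lebesgue_on \<Omega>. N j x \<xi> = M x \<xi>" if "j < K" "\<xi> \<in> block_space b j" for j \<xi>
    using ae by eventually_elim (use that in blast)
  have sum_all: "M x \<xi> = (\<Sum>j<K. M x (block_part b j \<xi>))" if "x \<in> \<Omega>" for x \<xi>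
  proof (rule AE_eq_everywhere[OF open_\<Omega> M_continuous_space _ _ that])
    show "continuous_on \<Omega> (\<lambda>x. \<Sum>j<K. M x (block_part b j \<xi>))" by (intro continuous_intros M_continuous_space)
    have "AE x in lebesgue_on \<Omega>. x \<in> \<Omega>" by (rule AE_I2) simp
    with ae show "AE x in lebesgue_on \<Omega>. M x \<xi> = (\<Sum>j<K. M x (block_part b j \<xi>))"
    proof eventually_elim
      case (elim x)
      have "M x \<xi> = (\<Sum>j<K. N j x (block_part b j \<xi>))" by (rule Msum[OF elim(2)])
      also have "\<dots> = (\<Sum>j<K. M x (block_part b j \<xi>))"
      proof (rule sum.cong[OF refl])
        fix j assume "j \<in> {..<K}"
        then show "N j x (block_part b j \<xi>) = M x (block_part b j \<xi>)"
          using elim(1)[rule_format, OF _ block_part_in] by simp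
      qed
      finally show ?case .
    qed
  qed
  have "bgen_with \<gamma> K b c C"
    unfolding bgen_with_def
  proof (intro conjI K c C ballI allI impI sum_all)
    fix p :: "real ^ 'n" and r :: real and j \<xi> y z
    assume r: "0 < r \<and> r \<le> 1 \<and> ball p r \<inter> \<Omega> \<noteq> {}" and j: "j < K" and \<xi>: "\<xi> \<in> block_space b j"
      and prem: "Minf (ball p r \<inter> \<Omega>) (C *\<^sub>R \<xi>) \<le>
          (SUP \<eta>\<in>{\<eta> \<in> block_space b j. norm \<eta> = 1}. Minf (ball p r \<inter> \<Omega>) ((c * r powr (\<gamma> - 1)) *\<^sub>R \<eta>))"
      and y: "y \<in> ball p r \<inter> \<Omega>" and z: "z \<in> ball p r \<inter> \<Omega>"
    have sc: "t *\<^sub>R \<eta> \<in> block_space b j" if "\<eta> \<in> block_space b j" for t \<eta>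
      using subspace_scale[OF subspace_block_space that] .
    have ni: "N_inf \<Omega> (N j) (ball p r) \<eta> = ereal (Minf (ball p r \<inter> \<Omega>) \<eta>)" if "\<eta> \<in> block_space b j" for \<eta>
      by (rule N_inf_eq_Minf(1)[of "ball p r" "N j" \<eta>, OF open_ball _ weak_N_functionD(1)[OF N[OF j] that] aej[OF j that]])
        (use r in blast)
    define U where "U = {\<eta> \<in> block_space b j. norm \<eta> = 1}"
    define f where "f \<eta> = Minf (ball p r \<inter> \<Omega>) ((c * r powr (\<gamma> - 1)) *\<^sub>R \<eta>)" for \<eta>
    have "j \<in> {b i k | i k. True}" using K j by simp
    then obtain i0 k0 where ik: "b i0 k0 = j" by blast
    have Une: "U \<noteq> {}" using block_unit[of b, OF ik] by (auto simp: U_def)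
    have eqU: "(SUP \<eta>\<in>U. N_inf \<Omega> (N j) (ball p r) ((c * r powr (\<gamma> - 1)) *\<^sub>R \<eta>)) = (SUP \<eta>\<in>U. ereal (f \<eta>))"
      by (intro SUP_cong refl) (simp add: U_def f_def ni sc)
    have leU: "ereal (SUP \<eta>\<in>U. f \<eta>) \<le> (SUP \<eta>\<in>U. ereal (f \<eta>))"
    proof (cases "SUP \<eta>\<in>U. ereal (f \<eta>)")
      case (real t)
      have "f \<eta> \<le> t" if "\<eta> \<in> U" for \<eta> using SUP_upper[OF that, of "\<lambda>\<eta>. ereal (f \<eta>)"] real by simp
      then have "(SUP \<eta>\<in>U. f \<eta>) \<le> t" by (intro cSUP_least Une)
      then show ?thesis using real by simp
    next
      case MInf
      obtain \<eta> where "\<eta> \<in> U" using Une by blast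
      from SUP_upper[OF this, of "\<lambda>\<eta>. ereal (f \<eta>)"] MInf show ?thesis by simp
    qed simp
    have leN: "N_inf \<Omega> (N j) (ball p r) (C *\<^sub>R \<xi>) \<le> ereal (SUP \<eta>\<in>U. f \<eta>)"
      using prem by (simp add: ni[OF sc[OF \<xi>]] U_def f_def)
    have le: "N_inf \<Omega> (N j) (ball p r) (C *\<^sub>R \<xi>)
        \<le> (SUP \<eta>\<in>U. N_inf \<Omega> (N j) (ball p r) ((c * r powr (\<gamma> - 1)) *\<^sub>R \<eta>))"
      unfolding eqU by (rule order_trans[OF leN leU])
    have r01: "0 < r \<and> r \<le> 1" using r by blast
    have concl: "N_sup \<Omega> (N j) (ball p r) \<xi> \<le> N_inf \<Omega> (N j) (ball p r) (C *\<^sub>R \<xi>) + 1"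
      by (rule bg0[rule_format, OF r01 j \<xi> le[unfolded U_def]])
    have "ereal (M y \<xi>) \<le> N_sup \<Omega> (N j) (ball p r) \<xi>"
      by (rule N_inf_eq_Minf(2)[of "ball p r" "N j" \<xi>, OF open_ball _ weak_N_functionD(1)[OF N[OF j] \<xi>] aej[OF j \<xi>] y]) (use r in blast)
    also note concl
    also have "N_inf \<Omega> (N j) (ball p r) (C *\<^sub>R \<xi>) + 1 = ereal (Minf (ball p r \<inter> \<Omega>) (C *\<^sub>R \<xi>) + 1)"
      by (simp add: ni[OF sc[OF \<xi>]] one_ereal_def)
    finally have "M y \<xi> \<le> Minf (ball p r \<inter> \<Omega>) (C *\<^sub>R \<xi>) + 1" by simp
    then show "M y \<xi> \<le> M z (C *\<^sub>R \<xi>) + 1" using Minf_le[of "ball p r \<inter> \<Omega>" z "C *\<^sub>R \<xi>"] z by simp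
  qed
  then show ?thesis unfolding bgen_def by blast
qed

text \<open>By the doubling condition the functions of finite modular form a linear space, so the linear
  hull in the definition of \<open>L_M\<close> adds nothing but changes on null sets.\<close>

lemma L_M_representative:
  assumes "f \<in> L_M \<Omega> M"
  obtains f' where "Mfin f'" "\<And>x. x \<notin> \<Omega> \<Longrightarrow> f' x = 0" "AE x in lebesgue_on \<Omega>. f' x = f x"
proof -
  define T where "T = {f. \<exists>f'. Mfin f' \<and> (\<forall>x. x \<notin> \<Omega> \<longrightarrow> f' x = 0) \<and> (AE x in lebesgue_on \<Omega>. f' x = f x)}"
  have "L_M \<Omega> M \<subseteq> T"
    unfolding L_M_def
  proof (rule hull_minimal)
    show "{f \<in> borel_measurable (lebesgue_on \<Omega>). (\<integral>\<^sup>+x. ennreal (M x (f x)) \<partial>lebesgue_on \<Omega>) < \<infinity>} \<subseteq> T"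
    proof
      fix f assume "f \<in> {f \<in> borel_measurable (lebesgue_on \<Omega>). (\<integral>\<^sup>+x. ennreal (M x (f x)) \<partial>lebesgue_on \<Omega>) < \<infinity>}"
      then have f: "f \<in> borel_measurable (lebesgue_on \<Omega>)" "(\<integral>\<^sup>+x. ennreal (M x (f x)) \<partial>lebesgue_on \<Omega>) < \<infinity>" by auto
      obtain f' where f': "f' \<in> borel_measurable borel" "\<And>x. x \<notin> \<Omega> \<Longrightarrow> f' x = 0" "AE x in lebesgue_on \<Omega>. f' x = f x"
        using borel_representative[OF \<Omega>_borel f(1)] by blast
      note [measurable] = f'(1)
      have "(\<integral>\<^sup>+x. ennreal (Mb x (f' x)) \<partial>lborel) = (\<integral>\<^sup>+x. ennreal (Mb x (f' x)) \<partial>lebesgue_on \<Omega>)"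
        by (rule nn_integral_lebesgue_on_borel[OF open_\<Omega>, symmetric]) (auto simp: Mb_out)
      also have "\<dots> = (\<integral>\<^sup>+x. ennreal (M x (f x)) \<partial>lebesgue_on \<Omega>)"
      proof (rule nn_integral_cong_AE)
        have "AE x in lebesgue_on \<Omega>. x \<in> \<Omega>" by (rule AE_I2) simp
        with f'(3) show "AE x in lebesgue_on \<Omega>. ennreal (Mb x (f' x)) = ennreal (M x (f x))"
          by eventually_elim (simp add: Mb_in)
      qed
      finally have "Mfin f'" using f(2) by (simp add: Mfin_def)
      then show "f \<in> T" using f' by (auto simp: T_def)
    qed
    show "linear_fun_space T"
      unfolding linear_fun_space_def
    proof (intro conjI ballI allI)
      show "(\<lambda>x. 0) \<in> T"
        unfolding T_def by (intro CollectI exI[of _ "\<lambda>x. 0"]) (simp add: Mfin_def Mb_zero)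
      show "(\<lambda>x. f x + g x) \<in> T" if "f \<in> T" "g \<in> T" for f g
      proof -
        from that(1) obtain f' where f': "Mfin f'" "\<forall>x. x \<notin> \<Omega> \<longrightarrow> f' x = 0" "AE x in lebesgue_on \<Omega>. f' x = f x"
          unfolding T_def by blast
        from that(2) obtain g' where g': "Mfin g'" "\<forall>x. x \<notin> \<Omega> \<longrightarrow> g' x = 0" "AE x in lebesgue_on \<Omega>. g' x = g x"
          unfolding T_def by blast
        from f'(3) g'(3) have "AE x in lebesgue_on \<Omega>. f' x + g' x = f x + g x" by eventually_elim simp
        then show ?thesis unfolding T_def using f' g' Mfin_add[OF f'(1) g'(1)]
          by (intro CollectI exI[of _ "\<lambda>x. f' x + g' x"]) auto
      qed
      show "(\<lambda>x. c *\<^sub>R f x) \<in> T" if "f \<in> T" for c f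
      proof -
        from that obtain f' where f': "Mfin f'" "\<forall>x. x \<notin> \<Omega> \<longrightarrow> f' x = 0" "AE x in lebesgue_on \<Omega>. f' x = f x"
          unfolding T_def by blast
        from f'(3) have "AE x in lebesgue_on \<Omega>. c *\<^sub>R f' x = c *\<^sub>R f x" by eventually_elim simp
        then show ?thesis unfolding T_def using f' Mfin_scale[OF f'(1), of c]
          by (intro CollectI exI[of _ "\<lambda>x. c *\<^sub>R f' x"]) auto
      qed
    qed
  qed
  then have "f \<in> T" using assms by blast
  then show ?thesis using that unfolding T_def by blast
qed

lemma V1L_0_admissible:
  assumes v: "v \<in> V1L_0 \<Omega> M" and w: "integrable lborel w" "\<And>x. x \<notin> \<Omega> \<Longrightarrow> w x = 0" "AE x in lebesgue_on \<Omega>. w x = v x"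
  obtains G where "admissible w G" "AE x in lebesgue_on \<Omega>. G x = weak_grad \<Omega> v x"
proof -
  have v0: "v \<in> W11_0 \<Omega>" "weak_grad \<Omega> v \<in> L_M \<Omega> M" using v by (auto simp: V1L_0_def)
  then have "v \<in> W11 \<Omega>" by (simp add: W11_0_def)
  obtain G where G: "integrable lborel G" "\<And>x. x \<notin> \<Omega> \<Longrightarrow> G x = 0" "AE x in lebesgue_on \<Omega>. G x = weak_grad \<Omega> v x"
    using integrable_borel_representative[OF \<Omega>_borel W11D(3)[OF open_\<Omega> \<open>v \<in> W11 \<Omega>\<close>]] by blast
  obtain H where H: "Mfin H" "AE x in lebesgue_on \<Omega>. H x = weak_grad \<Omega> v x"
    using L_M_representative[OF v0(2)] by blast
  have "AE x in lebesgue_on \<Omega>. G x = H x" using G(3) H(2) by eventually_elim simp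
  then have "AE x in lebesgue. x \<in> \<Omega> \<longrightarrow> G x = H x" using open_\<Omega> by (simp add: AE_restrict_space_iff)
  then have "AE x in lborel. x \<in> \<Omega> \<longrightarrow> G x = H x" by (simp add: AE_completion_iff)
  then have "AE x in lborel. Mb x (G x) \<le> Mb x (H x) + 0"
    by eventually_elim (auto simp: Mb_def indicator_def)
  then have "Mfin G" using G(1) by (intro Mfin_mono[OF H(1), of G 0]) auto
  moreover have "sob (\<lambda>x. w x $ i) (\<lambda>x. G x $ i)" for i
    by (rule W11_0_sob[OF open_\<Omega> v0(1) w G])
  ultimately have "admissible w G" using w G by (auto simp: admissible_def)
  then show ?thesis using that G(3) by blast
qed

lemma Cc_infty_V1L_0: "Cc_infty \<Omega> \<subseteq> V1L_0 \<Omega> M"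
proof
  fix \<phi> :: "real ^ 'n \<Rightarrow> real ^ 'd" assume \<phi>: "\<phi> \<in> Cc_infty \<Omega>"
  have hw: "has_weak_grad \<Omega> \<phi> (mgrad \<phi>)" by (rule Cc_infty_has_weak_grad[OF open_\<Omega> \<phi>])
  have m: "weak_grad \<Omega> \<phi> \<in> borel_measurable (lebesgue_on \<Omega>)"
    using weak_grad_works[OF hw] by (intro locally_integrable_measurable[OF open_\<Omega>]) (simp add: has_weak_grad_def)
  obtain B where B: "\<And>x. norm (mgrad \<phi> x) \<le> B" using Cc_infty_integrable(5)[OF \<phi>] by blast
  note [measurable] = Cc_infty_integrable(4)[OF \<phi>]
  have fin: "Mfin (mgrad \<phi>)" by (rule Mfin_bounded[OF _ B]) measurable
  have "(\<integral>\<^sup>+x. ennreal (M x (weak_grad \<Omega> \<phi> x)) \<partial>lebesgue_on \<Omega>) = (\<integral>\<^sup>+x. ennreal (Mb x (mgrad \<phi> x)) \<partial>lebesgue_on \<Omega>)"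
  proof (rule nn_integral_cong_AE)
    have "AE x in lebesgue_on \<Omega>. x \<in> \<Omega>" by (rule AE_I2) simp
    with weak_grad_AE[OF open_\<Omega> hw] show "AE x in lebesgue_on \<Omega>. ennreal (M x (weak_grad \<Omega> \<phi> x)) = ennreal (Mb x (mgrad \<phi> x))"
      by eventually_elim (simp add: Mb_in)
  qed
  also have "\<dots> = (\<integral>\<^sup>+x. ennreal (Mb x (mgrad \<phi> x)) \<partial>lborel)"
    by (rule nn_integral_lebesgue_on_borel[OF open_\<Omega>]) (auto simp: Mb_out)
  also have "\<dots> < \<infinity>" using fin by (simp add: Mfin_def)
  finally have "weak_grad \<Omega> \<phi> \<in> L_M \<Omega> M" unfolding L_M_def using m by (intro hull_inc) auto
  then show "\<phi> \<in> V1L_0 \<Omega> M" using Cc_infty_W11_0[OF open_\<Omega> \<phi>] by (simp add: V1L_0_def)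
qed

end

text \<open>Test functions are Lipschitz continuous, and on a bounded set the distance of two points is at most a
  multiple of its power with exponent \<open>\<gamma> \<le> 1\<close>.\<close>

lemma Cc_infty_Hoelder:
  fixes \<Omega> :: "(real ^ 'n) set"
  assumes \<Omega>: "bounded \<Omega>" and \<gamma>: "\<gamma> \<le> 1"
  shows "(Cc_infty \<Omega> :: (real ^ 'n \<Rightarrow> real ^ 'd) set) \<subseteq> Hoelder \<Omega> \<gamma>"
proof
  fix \<phi> :: "real ^ 'n \<Rightarrow> real ^ 'd" assume \<phi>: "\<phi> \<in> Cc_infty \<Omega>"
  have "\<exists>B\<ge>0. \<forall>x y. \<bar>\<phi> x $ i - \<phi> y $ i\<bar> \<le> B * norm (x - y)" for i
  proof -
    have C: "C1c (\<lambda>x. \<phi> x $ i) (gr (\<lambda>x. \<phi> x $ i))" by (rule Cc_infty_C1c[OF Cc_infty_component[OF \<phi>]])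
    obtain B where B: "B > 0" "\<And>x. norm (gr (\<lambda>x. \<phi> x $ i) x) \<le> B" using C1c_bounded[OF C] by metis
    have "norm (\<phi> x $ i - \<phi> y $ i) \<le> B * norm (x - y)" for x y
    proof (rule differentiable_bound[of UNIV "\<lambda>x. \<phi> x $ i" "\<lambda>x h. gr (\<lambda>x. \<phi> x $ i) x \<bullet> h"])
      show "((\<lambda>x. \<phi> x $ i) has_derivative (\<lambda>h. gr (\<lambda>x. \<phi> x $ i) x \<bullet> h)) (at x within UNIV)" for x
        using C1c_derivD[OF C] by simp
      show "onorm (\<lambda>h. gr (\<lambda>x. \<phi> x $ i) x \<bullet> h) \<le> B" for x
      proof (rule onorm_le)
        fix h
        have "\<bar>gr (\<lambda>x. \<phi> x $ i) x \<bullet> h\<bar> \<le> norm (gr (\<lambda>x. \<phi> x $ i) x) * norm h" by (rule Cauchy_Schwarz_ineq2)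
        also have "\<dots> \<le> B * norm h" by (intro mult_right_mono B) simp
        finally show "norm (gr (\<lambda>x. \<phi> x $ i) x \<bullet> h) \<le> B * norm h" by simp
      qed
    qed auto
    then show ?thesis using B(1) by (intro exI[of _ B]) auto
  qed
  then obtain B where B: "\<And>i. B i \<ge> 0" "\<And>i x y. \<bar>\<phi> x $ i - \<phi> y $ i\<bar> \<le> B i * norm (x - y)" by metis
  define L where "L = (\<Sum>i\<in>UNIV. B i)"
  have L0: "L \<ge> 0" unfolding L_def using B(1) by (intro sum_nonneg) auto
  have lip: "norm (\<phi> x - \<phi> y) \<le> L * norm (x - y)" for x y
  proof -
    have "norm (\<phi> x - \<phi> y) \<le> (\<Sum>i\<in>UNIV. \<bar>(\<phi> x - \<phi> y) $ i\<bar>)" by (rule norm_le_l1_cart)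
    also have "\<dots> \<le> (\<Sum>i\<in>UNIV. B i * norm (x - y))" using B(2) by (intro sum_mono) simp
    finally show ?thesis by (simp add: L_def sum_distrib_right)
  qed
  obtain R where R: "\<And>x. x \<in> \<Omega> \<Longrightarrow> norm x \<le> R" using \<Omega> bounded_iff by blast
  have "norm (\<phi> x - \<phi> y) / norm (x - y) powr \<gamma> \<le> L * (2 * R) powr (1 - \<gamma>)" if xy: "x \<in> \<Omega>" "y \<in> \<Omega>" "x \<noteq> y" for x y
  proof -
    have d: "norm (x - y) > 0" using xy by simp
    have "norm (x - y) \<le> 2 * R" using norm_triangle_ineq4[of x y] R[OF xy(1)] R[OF xy(2)] by linarith
    then have p: "norm (x - y) powr (1 - \<gamma>) \<le> (2 * R) powr (1 - \<gamma>)" using \<gamma> by (intro powr_mono2) auto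
    have "norm (\<phi> x - \<phi> y) / norm (x - y) powr \<gamma> \<le> L * norm (x - y) / norm (x - y) powr \<gamma>"
      using lip by (intro divide_right_mono) auto
    also have "\<dots> = L * norm (x - y) powr (1 - \<gamma>)" using d by (simp add: powr_diff)
    also have "\<dots> \<le> L * (2 * R) powr (1 - \<gamma>)" by (rule mult_left_mono[OF p L0])
    finally show ?thesis .
  qed
  then show "\<phi> \<in> Hoelder \<Omega> \<gamma>" unfolding Hoelder_def by blast
qed

lemma HoelderE:
  assumes "h \<in> Hoelder \<Omega> \<gamma>"
  obtains H where "H \<ge> 0" "\<And>x y. x \<in> \<Omega> \<Longrightarrow> y \<in> \<Omega> \<Longrightarrow> norm (h x - h y) \<le> H * norm (x - y) powr \<gamma>"
proof -
  obtain H where H: "\<And>x y. x \<in> \<Omega> \<Longrightarrow> y \<in> \<Omega> \<Longrightarrow> x \<noteq> y \<Longrightarrow> norm (h x - h y) / norm (x - y) powr \<gamma> \<le> H"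
    using assms by (auto simp: Hoelder_def)
  have "norm (h x - h y) \<le> max 0 H * norm (x - y) powr \<gamma>" if "x \<in> \<Omega>" "y \<in> \<Omega>" for x y
  proof (cases "x = y")
    case False
    have p: "norm (x - y) powr \<gamma> > 0" using False by simp
    have "norm (h x - h y) / norm (x - y) powr \<gamma> \<le> max 0 H" using H[OF that False] by simp
    then show ?thesis using p by (simp add: pos_divide_le_eq)
  qed simp
  then show ?thesis using that[of "max 0 H"] by simp
qed

lemma Hoelder_continuous:
  assumes h: "h \<in> Hoelder \<Omega> \<gamma>" and \<gamma>: "\<gamma> > 0"
  shows "continuous_on \<Omega> h"
proof -
  obtain H where H: "H \<ge> 0" "\<And>x y. x \<in> \<Omega> \<Longrightarrow> y \<in> \<Omega> \<Longrightarrow> norm (h x - h y) \<le> H * norm (x - y) powr \<gamma>"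
    by (rule HoelderE[OF h]) blast
  show ?thesis
    unfolding continuous_on_def
  proof
    fix x assume x: "x \<in> \<Omega>"
    have "((\<lambda>y. norm (y - x)) \<longlongrightarrow> 0) (at x within \<Omega>)"
      by (rule tendsto_norm_zero) (simp add: LIM_zero_iff tendsto_ident_at)
    then have "((\<lambda>y. norm (y - x) powr \<gamma>) \<longlongrightarrow> 0 powr \<gamma>) (at x within \<Omega>)"
      using \<gamma> by (intro tendsto_powr2 tendsto_const) auto
    then have lim: "((\<lambda>y. H * norm (y - x) powr \<gamma>) \<longlongrightarrow> 0) (at x within \<Omega>)"
      using tendsto_mult_right_zero by force
    have "((\<lambda>y. h y - h x) \<longlongrightarrow> 0) (at x within \<Omega>)"
    proof (rule Lim_null_comparison[OF _ lim])
      show "\<forall>\<^sub>F y in at x within \<Omega>. norm (h y - h x) \<le> H * norm (y - x) powr \<gamma>"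
        unfolding eventually_at_filter using H(2)[OF _ x] by (auto intro!: always_eventually)
    qed
    then show "(h \<longlongrightarrow> h x) (at x within \<Omega>)" by (simp add: LIM_zero_iff)
  qed
qed

theorem theorem5:
  fixes \<Omega> :: "(real ^ 'n) set"
    and F :: "real ^ 'n \<Rightarrow> real ^ 'd \<Rightarrow> real ^ 'n ^ 'd \<Rightarrow> real"
    and M :: "real ^ 'n \<Rightarrow> real ^ 'n ^ 'd \<Rightarrow> real"
    and Mi :: "'d \<Rightarrow> real ^ 'n \<Rightarrow> real ^ 'n \<Rightarrow> real"
    and \<nu> \<beta> L :: real
  assumes domain: "bounded_lipschitz_domain \<Omega>"
    and F_nonneg: "\<And>x z \<xi>. x \<in> \<Omega> \<Longrightarrow> 0 \<le> F x z \<xi>"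
    and F_meas: "\<And>z \<xi>. (\<lambda>x. F x z \<xi>) \<in> borel_measurable (lebesgue_on \<Omega>)"
    and F_cont: "\<And>x. x \<in> \<Omega> \<Longrightarrow> continuous_on UNIV (\<lambda>(z, \<xi>). F x z \<xi>)"
    and M_weak_N: "weak_N_function \<Omega> UNIV M"
    and M_cont: "continuous_on (\<Omega> \<times> UNIV) (\<lambda>(x, \<xi>). M x \<xi>)"
    and M_Delta2: "Delta2 \<Omega> M"
    and Mi_weak_N: "\<And>i. weak_N_function \<Omega> UNIV (Mi i)"
    and M_sum: "\<And>x \<xi>. x \<in> \<Omega> \<Longrightarrow> M x \<xi> = (\<Sum>i\<in>UNIV. Mi i x (\<xi> $ i))"
    and constants: "0 < \<nu>" "\<nu> < 1" "0 < \<beta>" "\<beta> < 1" "1 < L"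
    and growth: "\<And>x z \<xi>. x \<in> \<Omega> \<Longrightarrow>
      \<nu> * M x (\<beta> *\<^sub>R \<xi>) \<le> F x z \<xi> \<and> F x z \<xi> \<le> L * (M x \<xi> + 1)"
  shows "(\<forall>u0. u0 \<in> V1L \<Omega> M \<and> B_gen 0 \<Omega> M \<longrightarrow>
            (INF u\<in>translate u0 (V1L_0 \<Omega> M). energy \<Omega> F u) =
            (INF u\<in>translate u0 (Cc_infty \<Omega>). energy \<Omega> F u)) \<and>
         (\<forall>\<gamma> u0. 0 < \<gamma> \<and> \<gamma> < 1 \<and> u0 \<in> V1L \<Omega> M \<inter> Hoelder \<Omega> \<gamma> \<and> B_gen \<gamma> \<Omega> M \<longrightarrow>
            (INF u\<in>translate u0 (V1L_0 \<Omega> M \<inter> Hoelder \<Omega> \<gamma>). energy \<Omega> F u) =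
            (INF u\<in>translate u0 (Cc_infty \<Omega>). energy \<Omega> F u)) \<and>
         (\<forall>u0. u0 \<in> V1L \<Omega> M \<inter> Hoelder \<Omega> 1 \<longrightarrow>
            (INF u\<in>translate u0 (V1L_0 \<Omega> M \<inter> Hoelder \<Omega> 1). energy \<Omega> F u) =
            (INF u\<in>translate u0 (Cc_infty \<Omega>). energy \<Omega> F u))"
proof -
  have \<Omega>: "open \<Omega>" "bounded \<Omega>" using domain by (auto simp: bounded_lipschitz_domain_def)
  interpret modular \<Omega> M by (rule modular_of_weak_N_function[OF \<Omega> M_weak_N M_cont M_Delta2])
  interpret row_modular \<Omega> M
  proof
    fix x and \<eta> \<xi> :: "real ^ 'n ^ 'd" assume x: "x \<in> \<Omega>" and rows: "\<And>i. \<eta> $ i = \<xi> $ i \<or> \<eta> $ i = 0"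
    show "M x \<eta> \<le> M x \<xi>"
    proof (rule AE_le_everywhere[OF \<Omega>(1) M_continuous_space M_continuous_space _ x])
      have "AE x in lebesgue_on \<Omega>. \<forall>i. Mi i x 0 = 0"
        using weak_N_functionD(2)[OF Mi_weak_N] by (simp add: AE_all_countable)
      moreover have "AE x in lebesgue_on \<Omega>. x \<in> \<Omega>" by (rule AE_I2) simp
      ultimately show "AE x in lebesgue_on \<Omega>. M x \<eta> \<le> M x \<xi>"
      proof eventually_elim
        case (elim x)
        have "(\<Sum>i\<in>UNIV. Mi i x (\<eta> $ i)) \<le> (\<Sum>i\<in>UNIV. Mi i x (\<xi> $ i))"
        proof (rule sum_mono)
          fix i
          show "Mi i x (\<eta> $ i) \<le> Mi i x (\<xi> $ i)"
            using rows[of i] elim weak_N_functionD(3)[OF Mi_weak_N elim(2), of "\<xi> $ i" i] by auto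
        qed
        then show ?case using M_sum[OF elim(2)] by simp
      qed
    qed
  qed
  have L: "L \<ge> 0" and growth': "\<And>x z \<xi>. x \<in> \<Omega> \<Longrightarrow> F x z \<xi> \<le> L * (M x \<xi> + 1)" using constants growth by auto
  \<comment> \<open>the three parts differ only in how competitors are approximated\<close>
  have main: "(INF u\<in>translate u0 A. energy \<Omega> F u) = (INF u\<in>translate u0 (Cc_infty \<Omega>). energy \<Omega> F u)"
    if u0: "u0 \<in> V1L \<Omega> M" and A: "Cc_infty \<Omega> \<subseteq> A" "A \<subseteq> V1L_0 \<Omega> M"
      and appr: "\<And>v. v \<in> A \<Longrightarrow> \<exists>w G. admissible w G \<and> approximable w G \<and>
        (AE x in lebesgue_on \<Omega>. w x = v x) \<and> (AE x in lebesgue_on \<Omega>. G x = weak_grad \<Omega> v x)" for u0 A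
  proof (rule antisym)
    show "(INF u\<in>translate u0 A. energy \<Omega> F u) \<le> (INF u\<in>translate u0 (Cc_infty \<Omega>). energy \<Omega> F u)"
      using A(1) by (intro INF_superset_mono) (auto simp: translate_def)
    show "(INF u\<in>translate u0 (Cc_infty \<Omega>). energy \<Omega> F u) \<le> (INF u\<in>translate u0 A. energy \<Omega> F u)"
    proof (rule INF_greatest)
      fix u assume "u \<in> translate u0 A"
      then obtain v where v: "v \<in> A" "u = (\<lambda>x. u0 x + v x)" by (auto simp: translate_def)
      obtain w G where wG: "admissible w G" "approximable w G" "AE x in lebesgue_on \<Omega>. w x = v x"
        "AE x in lebesgue_on \<Omega>. G x = weak_grad \<Omega> v x" using appr[OF v(1)] by blast
      obtain U where U: "Mfin U" "AE x in lebesgue_on \<Omega>. U x = weak_grad \<Omega> u0 x"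
        using L_M_representative[of "weak_grad \<Omega> u0"] u0 by (auto simp: V1L_def)
      have "v \<in> W11 \<Omega>" using v A(2) by (auto simp: V1L_0_def W11_0_def)
      then show "(INF u\<in>translate u0 (Cc_infty \<Omega>). energy \<Omega> F u) \<le> energy \<Omega> F u"
        unfolding v(2) using u0 wG U
        by (intro energy_infimum_le[OF F_meas F_cont L growth']) (auto simp: V1L_def admissible_def)
    qed
  qed
  have hoelder: "(INF u\<in>translate u0 (V1L_0 \<Omega> M \<inter> Hoelder \<Omega> \<gamma>). energy \<Omega> F u) =
      (INF u\<in>translate u0 (Cc_infty \<Omega>). energy \<Omega> F u)"
    if u0: "u0 \<in> V1L \<Omega> M" and \<gamma>: "0 < \<gamma>" "\<gamma> \<le> 1" "\<gamma> = 1 \<or> bgen \<gamma>" for u0 \<gamma>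
  proof (rule main[OF u0])
    show "Cc_infty \<Omega> \<subseteq> V1L_0 \<Omega> M \<inter> Hoelder \<Omega> \<gamma>"
      using Cc_infty_V1L_0 Cc_infty_Hoelder[OF \<Omega>(2) \<gamma>(2)] by blast
    fix v assume "v \<in> V1L_0 \<Omega> M \<inter> Hoelder \<Omega> \<gamma>"
    then have v: "v \<in> V1L_0 \<Omega> M" "v \<in> Hoelder \<Omega> \<gamma>" by auto
    define w where "w x = indicator \<Omega> x *\<^sub>R v x" for x
    have "v \<in> W11 \<Omega>" using v by (simp add: V1L_0_def W11_0_def)
    have "w \<in> borel_measurable borel"
      unfolding w_def using Hoelder_continuous[OF v(2) \<gamma>(1)] \<Omega>(1)
      by (intro borel_measurable_continuous_on_indicator) auto
    moreover have "integrable lebesgue w"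
      using W11D(1)[OF \<Omega>(1) \<open>v \<in> W11 \<Omega>\<close>] \<Omega>(1) unfolding w_def by (simp add: integrable_restrict_space)
    ultimately have w: "integrable lborel w" by (simp add: integrable_completion)
    have w0: "w x = 0" if "x \<notin> \<Omega>" for x using that by (simp add: w_def)
    have wv: "AE x in lebesgue_on \<Omega>. w x = v x" by (rule AE_I2) (simp add: w_def)
    obtain G where G: "admissible w G" "AE x in lebesgue_on \<Omega>. G x = weak_grad \<Omega> v x"
      by (rule V1L_0_admissible[OF v(1) w w0 wv])
    obtain H where H: "H \<ge> 0" "\<And>x y. x \<in> \<Omega> \<Longrightarrow> y \<in> \<Omega> \<Longrightarrow> norm (v x - v y) \<le> H * norm (x - y) powr \<gamma>"
      by (rule HoelderE[OF v(2)]) blast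
    have "norm (w x - w y) \<le> H * norm (x - y) powr \<gamma>" if "x \<in> \<Omega>" "y \<in> \<Omega>" for x y
      using H(2)[OF that] that by (simp add: w_def)
    then have "approximable w G"
      using \<gamma> by (intro hoelder_approximable[OF domain G(1) _ H(1) \<gamma>(1)]) auto
    then show "\<exists>w G. admissible w G \<and> approximable w G \<and>
        (AE x in lebesgue_on \<Omega>. w x = v x) \<and> (AE x in lebesgue_on \<Omega>. G x = weak_grad \<Omega> v x)"
      using G wv by blast
  qed simp
  show ?thesis
  proof (intro conjI allI impI)
    fix u0 assume a: "u0 \<in> V1L \<Omega> M \<and> B_gen 0 \<Omega> M"
    show "(INF u\<in>translate u0 (V1L_0 \<Omega> M). energy \<Omega> F u) = (INF u\<in>translate u0 (Cc_infty \<Omega>). energy \<Omega> F u)"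
    proof (rule main[OF _ Cc_infty_V1L_0])
      fix v assume v: "v \<in> V1L_0 \<Omega> M"
      then have "v \<in> W11 \<Omega>" by (simp add: V1L_0_def W11_0_def)
      obtain w where w: "integrable lborel w" "\<And>x. x \<notin> \<Omega> \<Longrightarrow> w x = 0" "AE x in lebesgue_on \<Omega>. w x = v x"
        using integrable_borel_representative[OF \<Omega>_borel W11D(1)[OF \<Omega>(1) \<open>v \<in> W11 \<Omega>\<close>]] by blast
      obtain G where G: "admissible w G" "AE x in lebesgue_on \<Omega>. G x = weak_grad \<Omega> v x"
        by (rule V1L_0_admissible[OF v w])
      have "approximable w G"
        by (rule admissible_approximable[OF domain bgen_of_B_gen G(1)]) (use a in blast)
      then show "\<exists>w G. admissible w G \<and> approximable w G \<and>
        (AE x in lebesgue_on \<Omega>. w x = v x) \<and> (AE x in lebesgue_on \<Omega>. G x = weak_grad \<Omega> v x)"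
        using G w(3) by blast
    qed (use a in auto)
  next
    fix \<gamma> u0 assume "0 < \<gamma> \<and> \<gamma> < 1 \<and> u0 \<in> V1L \<Omega> M \<inter> Hoelder \<Omega> \<gamma> \<and> B_gen \<gamma> \<Omega> M"
    then show "(INF u\<in>translate u0 (V1L_0 \<Omega> M \<inter> Hoelder \<Omega> \<gamma>). energy \<Omega> F u) =
            (INF u\<in>translate u0 (Cc_infty \<Omega>). energy \<Omega> F u)"
      using bgen_of_B_gen[of \<gamma>] by (intro hoelder) auto
  next
    fix u0 assume "u0 \<in> V1L \<Omega> M \<inter> Hoelder \<Omega> 1"
    then show "(INF u\<in>translate u0 (V1L_0 \<Omega> M \<inter> Hoelder \<Omega> 1). energy \<Omega> F u) =
            (INF u\<in>translate u0 (Cc_infty \<Omega>). energy \<Omega> F u)"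
      by (intro hoelder) auto
  qed
qed

end
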